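(* Let $n\ge2$ and $p>\frac{2n}{n-1}$. Suppose that for every Hörmander type operator $T^\lambda$ satisfying the convex and straight conditions (i.e. with phase satisfying (H1)–(H4) of the context) the estimate $$\|T^\lambda f\|_{L^p(\mathbb{R}^n)}\lesssim\|f\|_{L^p(B^{n-1}_1(0))}$$ holds uniformly in $\lambda\ge1$ (with a constant depending on $\phi$, $a$, $p$, $n$). Then $$\|(-\Delta-z)^{-1}\|_{L^p(\mathbb{R}^n)\to L^p(\mathbb{R}^n)}\lesssim_{p,n}|z|^{-1+\gamma_{p,p}}\,\mathrm{dist}(z,[0,\infty))^{-\gamma_{p,p}}$$ for all $z\in\mathbb{C}\setminus[0,\infty)$, where $$\gamma_{p,q}:=\max\Big\{0,\ 1-\frac{n+1}{2}\Big(\frac1p-\frac1q\Big),\ \frac{n+1}{2}-\frac np,\ \frac nq-\frac{n-1}{2}\Big\}.$$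
   Context: $B^d_r(x)$ is the ball in $\mathbb{R}^d$ of center $x$ and radius $r$. Let $a\in C_c^\infty(\mathbb{R}^n\times\mathbb{R}^{n-1})$ be non-negative and supported in $B^n_1(0)\times B^{n-1}_1(0)$, and let $\phi:B^n_1(0)\times B^{n-1}_1(0)\to\mathbb{R}$ be smooth. Put $a^\lambda(x,\xi):=a(x/\lambda,\xi)$, $\phi^\lambda(x,\xi):=\lambda\phi(x/\lambda,\xi)$ and $$T^\lambda f(x):=\int_{B^{n-1}_1(0)}e^{2\pi i\phi^\lambda(x,\xi)}a^\lambda(x,\xi)f(\xi)\,d\xi .$$ Define $G_0(x,\xi):=\bigwedge_{j=1}^{n-1}\partial_{\xi_j}\partial_x\phi(x,\xi)$ (identified with a vector in $\mathbb{R}^n$) and $G(x,\xi):=G_0(x,\xi)/|G_0(x,\xi)|\in S^{n-1}$. Conditions: (H1) $\mathrm{rank}\,\partial^2_{\xi x}\phi(x,\xi)=n-1$ for all $(x,\xi)\in B^n_1(0)\times B^{n-1}_1(0)$. (H2) $\det\partial^2_{\xi\xi}\langle\partial_x\phi(x,\xi),G(x,\xi_0)\rangle|_{\xi=\xi_0}\ne 0$ for all $(x,\xi_0)\in\mathrm{supp}\,a$. (H3) (convex condition) all eigenvalues of $\partial^2_{\xi\xi}\langle\partial_x\phi(x,\xi),G(x,\xi_0)\rangle|_{\xi=\xi_0}$ are positive for all $(x,\xi_0)\in\mathrm{supp}\,a$. (H4) (straight condition) for each given $\xi$, $G(x,\xi)$ does not depend on $x$. $T^\lambda$ is called a Hörmander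 type operator if $\phi$ satisfies (H1) and (H2). *)

theory Defs
  imports "HOL-Analysis.Analysis"
begin

text \<open>Euclidean \<open>(n - 1)\<close>-space is \<open>real ^ 'm\<close> and Euclidean \<open>n\<close>-space is \<open>real ^ ('m option)\<close>,
  so \<open>n = CARD('m option) = CARD('m) + 1\<close>. With this indexing the vectors
  \<open>v, w\<^sub>1, \<dots>, w\<^bsub>n-1\<^esub>\<close> of \<open>n\<close>-space are the rows of a square matrix, \<open>v\<close> being the row \<open>None\<close>
  and \<open>w\<^sub>j\<close> the row \<open>Some j\<close>.\<close>

section \<open>Smooth functions\<close>

primrec Ck_on :: "nat \<Rightarrow> ('a::real_normed_vector \<Rightarrow> 'b::real_normed_vector) \<Rightarrow> 'a set \<Rightarrow> bool" where
  "Ck_on 0 f S \<longleftrightarrow> continuous_on S f"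
| "Ck_on (Suc k) f S \<longleftrightarrow>
     (\<forall>x\<in>S. f differentiable (at x)) \<and> (\<forall>v. Ck_on k (\<lambda>x. frechet_derivative f (at x) v) S)"

text \<open>To be used for open \<open>S\<close> only.\<close>
definition smooth_on :: "('a::real_normed_vector \<Rightarrow> 'b::real_normed_vector) \<Rightarrow> 'a set \<Rightarrow> bool" where
  "smooth_on f S \<longleftrightarrow> (\<forall>k. Ck_on k f S)"

definition supp :: "('a::topological_space \<Rightarrow> 'b::zero) \<Rightarrow> 'a set" where
  "supp f = closure {x. f x \<noteq> 0}"

definition test_function :: "('a::real_normed_vector \<Rightarrow> 'b::real_normed_vector) \<Rightarrow> bool" where
  "test_function f \<longleftrightarrow> smooth_on f UNIV \<and> compact (supp f)"

definition partial_deriv :: "'k::finite \<Rightarrow> (real ^ 'k \<Rightarrow> 'b::real_normed_vector) \<Rightarrow> real ^ 'k \<Rightarrow> 'b" where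
  "partial_deriv i f x = frechet_derivative f (at x) (axis i 1)"

definition gradient :: "(real ^ 'k \<Rightarrow> real) \<Rightarrow> real ^ 'k \<Rightarrow> real ^ ('k::finite)" where
  "gradient f x = (\<chi> i. partial_deriv i f x)"

definition hessian :: "(real ^ 'k \<Rightarrow> real) \<Rightarrow> real ^ 'k \<Rightarrow> real ^ 'k ^ ('k::finite)" where
  "hessian f x = (\<chi> i j. partial_deriv i (partial_deriv j f) x)"

definition laplacian :: "(real ^ 'k \<Rightarrow> complex) \<Rightarrow> real ^ ('k::finite) \<Rightarrow> complex" where
  "laplacian f x = (\<Sum>i\<in>UNIV. partial_deriv i (partial_deriv i f) x)"

text \<open>Only applied to Hessians of smooth functions. These are symmetric, so every eigenvalue is real.\<close>
definition eigenvalue :: "real ^ 'k ^ 'k \<Rightarrow> real \<Rightarrow> bool" where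
  "eigenvalue A c \<longleftrightarrow> (\<exists>v. v \<noteq> 0 \<and> A *v v = c *\<^sub>R v)"

section \<open>Lebesgue spaces\<close>

text \<open>Elements of \<open>L\<^sup>p(S)\<close>, \<open>0 < p < \<infinity>\<close>, are represented by functions rather than by classes of
  almost everywhere equal functions.\<close>
definition Lp :: "real \<Rightarrow> 'a::euclidean_space set \<Rightarrow> ('a \<Rightarrow> complex) set" where
  "Lp p S = {f. set_borel_measurable lebesgue S f \<and> set_integrable lebesgue S (\<lambda>x. cmod (f x) powr p)}"

definition Lp_norm :: "real \<Rightarrow> 'a::euclidean_space set \<Rightarrow> ('a \<Rightarrow> complex) \<Rightarrow> real" where
  "Lp_norm p S f = (LINT x:S|lebesgue. cmod (f x) powr p) powr (1 / p)"

definition Lp_operator_norm ::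
    "real \<Rightarrow> (('a::euclidean_space \<Rightarrow> complex) \<Rightarrow> 'a \<Rightarrow> complex) \<Rightarrow> ennreal" where
  "Lp_operator_norm p T =
     (SUP f \<in> {f \<in> Lp p UNIV. Lp_norm p UNIV f \<le> 1}. ennreal (Lp_norm p UNIV (T f)))"

section \<open>Hoermander type operators\<close>

type_synonym 'm phase_space = "(real ^ ('m option)) \<times> (real ^ 'm)"

definition unit_balls :: "('m::finite) phase_space set" where
  "unit_balls = ball 0 1 \<times> ball 0 1"

definition amplitude :: "(('m::finite) phase_space \<Rightarrow> real) \<Rightarrow> bool" where
  "amplitude a \<longleftrightarrow> test_function a \<and> (\<forall>w. 0 \<le> a w) \<and> supp a \<subseteq> unit_balls"

definition grad_x :: "(('m::finite) phase_space \<Rightarrow> real) \<Rightarrow> real ^ ('m option) \<Rightarrow> real ^ 'm \<Rightarrow> real ^ ('m option)"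
  where "grad_x \<phi> x \<xi> = gradient (\<lambda>y. \<phi> (y, \<xi>)) x"

definition mixed_hessian ::
    "(('m::finite) phase_space \<Rightarrow> real) \<Rightarrow> real ^ ('m option) \<Rightarrow> real ^ 'm \<Rightarrow> real ^ ('m option) ^ 'm"
  where "mixed_hessian \<phi> x \<xi> = (\<chi> j. partial_deriv j (\<lambda>\<eta>. grad_x \<phi> x \<eta>) \<xi>)"

text \<open>The exterior product of \<open>n - 1\<close> vectors \<open>w\<^sub>j\<close> (the rows of \<open>W\<close>), identified with the vector
  whose inner product with any \<open>v\<close> is \<open>det (v, w\<^sub>1, \<dots>, w\<^bsub>n-1\<^esub>)\<close>; its \<open>i\<close>-th component is the value
  at \<open>v = axis i 1\<close>. The opposite orientation would change the sign. This does not affect statements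
  about all phases, because a reflection of one \<open>\<xi>\<close>-coordinate also changes the sign.\<close>
definition wedge :: "real ^ ('m option) ^ ('m::finite) \<Rightarrow> real ^ ('m option)" where
  "wedge W = (\<chi> i. det (\<chi> k. case k of None \<Rightarrow> axis i 1 | Some j \<Rightarrow> W $ j))"

definition G0 :: "(('m::finite) phase_space \<Rightarrow> real) \<Rightarrow> real ^ ('m option) \<Rightarrow> real ^ 'm \<Rightarrow> real ^ ('m option)"
  where "G0 \<phi> x \<xi> = wedge (mixed_hessian \<phi> x \<xi>)"

definition G :: "(('m::finite) phase_space \<Rightarrow> real) \<Rightarrow> real ^ ('m option) \<Rightarrow> real ^ 'm \<Rightarrow> real ^ ('m option)"
  where "G \<phi> x \<xi> = G0 \<phi> x \<xi> /\<^sub>R norm (G0 \<phi> x \<xi>)"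

definition curvature_matrix ::
    "(('m::finite) phase_space \<Rightarrow> real) \<Rightarrow> real ^ ('m option) \<Rightarrow> real ^ 'm \<Rightarrow> real ^ 'm ^ 'm"
  where "curvature_matrix \<phi> x \<xi>\<^sub>0 = hessian (\<lambda>\<xi>. grad_x \<phi> x \<xi> \<bullet> G \<phi> x \<xi>\<^sub>0) \<xi>\<^sub>0"

definition rank_condition :: "(('m::finite) phase_space \<Rightarrow> real) \<Rightarrow> bool" where
  "rank_condition \<phi> \<longleftrightarrow> (\<forall>(x, \<xi>) \<in> unit_balls. rank (mixed_hessian \<phi> x \<xi>) = CARD('m))"

definition nondegeneracy_condition :: "(('m::finite) phase_space \<Rightarrow> real) \<Rightarrow> ('m phase_space \<Rightarrow> real) \<Rightarrow> bool" where
  "nondegeneracy_condition a \<phi> \<longleftrightarrow> (\<forall>(x, \<xi>) \<in> supp a. det (curvature_matrix \<phi> x \<xi>) \<noteq> 0)"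

definition hormander_type :: "(('m::finite) phase_space \<Rightarrow> real) \<Rightarrow> ('m phase_space \<Rightarrow> real) \<Rightarrow> bool" where
  "hormander_type a \<phi> \<longleftrightarrow> amplitude a \<and> smooth_on \<phi> unit_balls \<and> rank_condition \<phi> \<and> nondegeneracy_condition a \<phi>"

definition convex_condition :: "(('m::finite) phase_space \<Rightarrow> real) \<Rightarrow> ('m phase_space \<Rightarrow> real) \<Rightarrow> bool" where
  "convex_condition a \<phi> \<longleftrightarrow>
     (\<forall>(x, \<xi>) \<in> supp a. \<forall>c. eigenvalue (curvature_matrix \<phi> x \<xi>) c \<longrightarrow> 0 < c)"

definition straight_condition :: "(('m::finite) phase_space \<Rightarrow> real) \<Rightarrow> bool" where
  "straight_condition \<phi> \<longleftrightarrow>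
     (\<forall>\<xi> \<in> ball 0 1. \<forall>x \<in> ball 0 1. \<forall>y \<in> ball 0 1. G \<phi> x \<xi> = G \<phi> y \<xi>)"

text \<open>For \<open>x\<close> outside the ball of radius \<open>l\<close> the phase is evaluated outside its domain, but the
  amplitude vanishes there.\<close>
definition T_op :: "(('m::finite) phase_space \<Rightarrow> real) \<Rightarrow> ('m phase_space \<Rightarrow> real) \<Rightarrow> real \<Rightarrow>
    (real ^ 'm \<Rightarrow> complex) \<Rightarrow> real ^ ('m option) \<Rightarrow> complex" where
  "T_op a \<phi> l f x = (LINT \<xi>:ball 0 1|lebesgue.
     exp (2 * of_real pi * \<i> * of_real (l * \<phi> (x /\<^sub>R l, \<xi>))) * of_real (a (x /\<^sub>R l, \<xi>)) * f \<xi>)"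

section \<open>The resolvent of the Laplacian\<close>

text \<open>\<open>(- \<Delta> - z) u = f\<close> in the sense of distributions.\<close>
definition helmholtz_solution ::
    "complex \<Rightarrow> (real ^ 'k \<Rightarrow> complex) \<Rightarrow> (real ^ ('k::finite) \<Rightarrow> complex) \<Rightarrow> bool" where
  "helmholtz_solution z f u \<longleftrightarrow> (\<forall>\<psi>. test_function \<psi> \<longrightarrow>
     (LINT x|lebesgue. u x * (- laplacian \<psi> x - z * \<psi> x)) = (LINT x|lebesgue. f x * \<psi> x))"

text \<open>\<open>- \<Delta> - z\<close>, as an operator in \<open>L\<^sup>p\<close> with domain \<open>{u \<in> L\<^sup>p. \<Delta> u \<in> L\<^sup>p}\<close>, is a bijection
  onto \<open>L\<^sup>p\<close>.\<close>
definition resolvent_exists :: "'k::finite itself \<Rightarrow> real \<Rightarrow> complex \<Rightarrow> bool" where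
  "resolvent_exists _ p z \<longleftrightarrow> (\<forall>f \<in> Lp p (UNIV :: (real ^ 'k) set).
     (\<exists>u \<in> Lp p UNIV. helmholtz_solution z f u) \<and>
     (\<forall>u \<in> Lp p UNIV. \<forall>v \<in> Lp p UNIV. helmholtz_solution z f u \<longrightarrow> helmholtz_solution z f v \<longrightarrow>
        (AE x in lebesgue. u x = v x)))"

text \<open>The choice is unique up to null sets if \<open>resolvent_exists\<close> holds, and only meaningful then.\<close>
definition resolvent :: "real \<Rightarrow> complex \<Rightarrow> (real ^ 'k \<Rightarrow> complex) \<Rightarrow> real ^ ('k::finite) \<Rightarrow> complex" where
  "resolvent p z f = (SOME u. u \<in> Lp p UNIV \<and> helmholtz_solution z f u)"

definition nonneg_axis :: "complex set" where
  "nonneg_axis = complex_of_real ` {0..}"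

definition resolvent_exponent :: "nat \<Rightarrow> real \<Rightarrow> real \<Rightarrow> real" where
  "resolvent_exponent n p q = Max {0, 1 - (real n + 1) / 2 * (1 / p - 1 / q),
     (real n + 1) / 2 - real n / p, real n / q - (real n - 1) / 2}"

end

theory Submission
 imports Defs "HOL-Probability.Probability" "HOL-Real_Asymp.Real_Asymp"
begin

text \<open>Write \<open>z = - \<kappa>\<^sup>2\<close> with \<open>Re \<kappa> > 0\<close>. The resolvent is convolution with a Bessel kernel, which is
 a superposition of pure exponentials,
 \<open>K h = c \<integral>\<^sub>0\<^sup>\<infinity> (s (2 \<kappa> + s))\<^bsup>(n - 3)/2\<^esup> exp (- (\<kappa> + s) |h|) ds\<close>.
 By duality it suffices to bound the form \<open>\<integral> K h (\<integral> f (x - h) g x dx) dh\<close> by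
 \<open>C |\<kappa>|\<^bsup>-2\<^esup> (|\<kappa>| / Re \<kappa>)\<^bsup>\<gamma>\<^esup> \<parallel>f\<parallel>\<^sub>p \<parallel>g\<parallel>\<^sub>q\<close> with \<open>\<gamma> = (n + 1)/2 - n/p\<close>, since \<open>|z| = |\<kappa>|\<^sup>2\<close> and the distance
 of \<open>z\<close> to the half line is at most \<open>3 |\<kappa>| Re \<kappa>\<close>. The bound is built up from one oscillation at a time.

 Unit scale. For \<open>h\<close> in a thick plate \<open>1 < h\<^sub>1 < 2\<close>, \<open>|h\<^sub>j| < 2\<close>, the kernel \<open>exp (i \<omega> |h|)\<close> gains
 \<open>(1 + |\<omega>|)\<^bsup>-n/p\<^esup>\<close> (\<open>osc_kernel_bound\<close>). Averaging over translations tangential to the plate writes the form as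
 an integral over \<open>Z\<close> of pairings of \<open>g (Z + \<cdot>)\<close> with the operator with kernel
 \<open>exp (i \<omega> |x + (0, \<xi>)|)\<close> acting on the slice \<open>\<xi> \<mapsto> f (Z - (0, \<xi>))\<close> (\<open>slab_identity\<close>). The phase is the
 distance from \<open>x\<close> to \<open>(0, - \<xi>)\<close>. Its \<open>\<xi>\<close>-gradient is constant along the rays issuing from \<open>(0, - \<xi>)\<close>, so \<open>G\<close>
 is the direction of the ray through \<open>x\<close>, which varies with \<open>x\<close>. The projective map
 \<open>x = (e, w') / (1 + w\<^sub>1)\<close> sends the parallel lines of direction \<open>(1, - \<xi>)\<close> to these rays. In the coordinates
 \<open>w\<close> the phase is therefore straight; it is convex because the regularised norm is; and so the
 hypothesis applies to it (\<open>hormander_phase\<close>, \<open>straight_condition_phase\<close>).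

 All scales. Exponential damping \<open>exp (- \<sigma> |h|)\<close> is a superposition of oscillations with an integrable
 weight, so it can be added (\<open>damped_kernel_bound\<close>). Dilations, permutations and reflections of the plate
 give a continuous partition of unity of space minus the origin (\<open>shells_integral\<close>), hence a bound
 for \<open>exp (- (\<sigma> + i \<omega>) |h|)\<close> (\<open>decay_form_bound\<close>). Integrating it against the density in \<open>s\<close> gives
 the stated power (\<open>double_integral_bound\<close>, \<open>helmholtz_form_bound\<close>); here \<open>\<gamma> > 1\<close>, which is
 \<open>p > 2n/(n - 1)\<close>, makes the damping at scale \<open>1 / Re \<kappa>\<close> the dominant one.

 The resolvent. The Laplacian of \<open>exp (- \<mu> |x|)\<close> is explicit (\<open>yukawa_green\<close>), and with the above density
 the superposition truncated at \<open>s = S\<close> satisfies the equation up to a Yukawa kernel that concentrates at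
 the origin as \<open>S\<close> grows, so \<open>K\<close> is a fundamental solution (\<open>helmholtz_kernel_fundamental\<close>). Convolution
 with \<open>K\<close> then solves the equation, and pairing with \<open>K\<close> also shows that a homogeneous solution in \<open>L\<^sup>p\<close>
 is orthogonal to every test function, hence zero (\<open>resolvent_bound\<close>).\<close>

lemmas lint_cong = Bochner_Integration.integral_cong
 and lint_nonneg = Bochner_Integration.integral_nonneg
 and integrable_dominated = Bochner_Integration.integrable_bound

abbreviation pos_ind :: "real => 'a::zero_neq_one" where "pos_ind == indicator {0<..}"

abbreviation lborel2 :: "('a::euclidean_space \<times> 'b::euclidean_space) measure" where
 "lborel2 == lborel \<Otimes>\<^sub>M lborel"

section \<open>Calculus of smooth functions\<close>

declare Ck_on.simps(2) [simp del]

lemma Ck_on_cong: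
 assumes "open S" "!!x. x \<in> S ==> f x = g x" "Ck_on k f S"
 shows "Ck_on k g S"
 using assms(2,3)
proof (induction k arbitrary: f g)
 case 0
 then show ?case by (simp cong: continuous_on_cong)
next
 case (Suc k)
 have d: "(g has_derivative frechet_derivative f (at x)) (at x)" if "x \<in> S" for x
 proof (rule has_derivative_transform_within_open[of f _ x UNIV S])
  show "(f has_derivative frechet_derivative f (at x)) (at x)"
   using Suc.prems(2) that unfolding Ck_on.simps(2) frechet_derivative_works by blast
 qed (use that assms(1) Suc.prems(1) in blast)+
 have e: "frechet_derivative g (at x) = frechet_derivative f (at x)" if "x \<in> S" for x
  using frechet_derivative_at[OF d[OF that]] by simp
 have "Ck_on k (%x. frechet_derivative g (at x) v) S" for v
  by (rule Suc.IH[of "%x. frechet_derivative f (at x) v"])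
    (use Suc.prems(2) e in \<open>simp_all add: Ck_on.simps(2)\<close>)
 then show ?case using d unfolding Ck_on.simps(2) differentiable_def by blast
qed

lemma Ck_on_SucI:
 assumes "open S" "!!x. x \<in> S ==> (f has_derivative f' x) (at x)"
  and "!!v. Ck_on k (%x. f' x v) S"
 shows "Ck_on (Suc k) f S"
proof -
 have "Ck_on k (%x. frechet_derivative f (at x) v) S" for v
  by (rule Ck_on_cong[OF assms(1) _ assms(3)[of v]])
    (use frechet_derivative_at[OF assms(2)] in auto)
 then show ?thesis using assms(2) by (auto simp: differentiable_def Ck_on.simps(2))
qed

lemma Ck_on_Suc_has_derivative:
 assumes "Ck_on (Suc k) f S" "x \<in> S"
 shows "(f has_derivative frechet_derivative f (at x)) (at x)"
 using assms frechet_derivative_works by (auto simp: Ck_on.simps(2))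

lemma Ck_on_frechet_derivative:
 "Ck_on (Suc k) f S ==> Ck_on k (%x. frechet_derivative f (at x) v) S"
 by (simp add: Ck_on.simps(2))

lemma Ck_on_SucD: "Ck_on (Suc k) f S ==> Ck_on k f S"
proof (induction k arbitrary: f)
 case 0
 then show ?case
  by (auto intro!: continuous_at_imp_continuous_on differentiable_imp_continuous_within simp: Ck_on.simps(2))
next
 case (Suc k)
 then show ?case by (metis Ck_on.simps(2))
qed

lemma Ck_on_Un:
 assumes "open S" "open T" "Ck_on k f S" "Ck_on k f T"
 shows "Ck_on k f (S \<union> T)"
 using assms(3,4) by (induction k arbitrary: f) (auto intro: continuous_on_open_Un assms(1,2) simp: Ck_on.simps(2))

lemma Ck_on_const: "open S ==> Ck_on k (%x. c) S"
proof (induction k arbitrary: c)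
 case (Suc k)
 then show ?case by (intro Ck_on_SucI[where f'="%x v. 0"] has_derivative_const)
qed simp

lemma Ck_on_bounded_linear_comp:
 assumes "open S" "bounded_linear h" "Ck_on k f S"
 shows "Ck_on k (%x. h (f x)) S"
 using assms(3)
proof (induction k arbitrary: f)
 case 0
 then show ?case using assms(2) by (auto intro: bounded_linear.continuous_on)
next
 case (Suc k)
 show ?case
  by (rule Ck_on_SucI[OF assms(1) bounded_linear.has_derivative[OF assms(2)
     Ck_on_Suc_has_derivative[OF Suc.prems]]])
    (intro Suc.IH Ck_on_frechet_derivative[OF Suc.prems] | assumption)+
qed

lemma Ck_on_bounded_linear:
 assumes "open S" "bounded_linear h"
 shows "Ck_on k h S"
proof (cases k)
 case 0
 then show ?thesis using assms(2) by (auto intro: linear_continuous_on)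
next
 case (Suc j)
 show ?thesis
  unfolding Suc by (intro Ck_on_SucI[where f'="%x. h"] Ck_on_const bounded_linear_imp_has_derivative assms)
qed

lemma Ck_on_add:
 assumes "open S" "Ck_on k f S" "Ck_on k g S"
 shows "Ck_on k (%x. f x + g x) S"
 using assms(2,3)
proof (induction k arbitrary: f g)
 case 0
 then show ?case by (auto intro: continuous_on_add)
next
 case (Suc k)
 show ?case
  by (rule Ck_on_SucI[OF assms(1) has_derivative_add[OF Ck_on_Suc_has_derivative[OF Suc.prems(1)]
     Ck_on_Suc_has_derivative[OF Suc.prems(2)]]])
    (intro Suc.IH Ck_on_frechet_derivative[OF Suc.prems(1)] Ck_on_frechet_derivative[OF Suc.prems(2)]
    | assumption)+
qed

lemma Ck_on_mult:
 fixes f g :: "'a::real_normed_vector => 'b::real_normed_algebra"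
 assumes "open S" "Ck_on k f S" "Ck_on k g S"
 shows "Ck_on k (%x. f x * g x) S"
 using assms(2,3)
proof (induction k arbitrary: f g)
 case 0
 then show ?case by (auto intro: continuous_on_mult)
next
 case (Suc k)
 have 1: "Ck_on k (%x. f x * frechet_derivative g (at x) v + frechet_derivative f (at x) v * g x) S" for v
  by (intro Ck_on_add Suc.IH assms(1) Ck_on_SucD[OF Suc.prems(1)] Ck_on_SucD[OF Suc.prems(2)]
    Ck_on_frechet_derivative[OF Suc.prems(1)] Ck_on_frechet_derivative[OF Suc.prems(2)])
 show ?case
  by (rule Ck_on_SucI[OF assms(1) has_derivative_mult[OF Ck_on_Suc_has_derivative[OF Suc.prems(1)]
     Ck_on_Suc_has_derivative[OF Suc.prems(2)]] 1])
qed

lemma Ck_on_compose_real: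
 fixes g :: "real => real" and f :: "'a::real_normed_vector => real"
 assumes "open S" "Ck_on k g T" "Ck_on k f S" "f ` S \<subseteq> T"
 shows "Ck_on k (%x. g (f x)) S"
 using assms(2,3,4)
proof (induction k arbitrary: g)
 case 0
 then show ?case using continuous_on_compose2 by auto
next
 case (Suc k)
 have 1: "Ck_on k (%x. frechet_derivative f (at x) v * frechet_derivative g (at (f x)) 1) S" for v
  by (rule Ck_on_mult[OF assms(1) Ck_on_frechet_derivative[OF Suc.prems(2)]
     Suc.IH[OF Ck_on_frechet_derivative[OF Suc.prems(1)] Ck_on_SucD[OF Suc.prems(2)] Suc.prems(3)]])
 show ?case
 proof (rule Ck_on_SucI[OF assms(1) _ 1])
  fix x assume x: "x \<in> S"
  have g: "(g has_derivative frechet_derivative g (at (f x))) (at (f x))"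
   using Suc.prems x by (intro Ck_on_Suc_has_derivative[of k g T]) auto
  have f: "(f has_derivative frechet_derivative f (at x)) (at x)"
   using Suc.prems x by (intro Ck_on_Suc_has_derivative[of k f S]) auto
  have l: "(%v. frechet_derivative g (at (f x)) (frechet_derivative f (at x) v)) =
    (%v. frechet_derivative f (at x) v * frechet_derivative g (at (f x)) 1)"
   by (rule ext) (metis linear_scale[OF has_derivative_linear[OF g]] real_scaleR_def mult.right_neutral)
  show "((%x. g (f x)) has_derivative
    (%v. frechet_derivative f (at x) v * frechet_derivative g (at (f x)) 1)) (at x)"
   using has_derivative_compose[OF f g] unfolding l .
 qed
qed

lemma smooth_on_cong:
 assumes "open S" "!!x. x \<in> S ==> f x = g x" "smooth_on f S"
 shows "smooth_on g S"
 using Ck_on_cong[OF assms(1,2)] assms(3) by (auto simp: smooth_on_def)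

lemma smooth_on_Un: "open S ==> open T ==> smooth_on f S ==> smooth_on f T ==> smooth_on f (S \<union> T)"
 by (simp add: smooth_on_def Ck_on_Un)

lemma smooth_on_const: "open S ==> smooth_on (%x. c) S"
 by (simp add: smooth_on_def Ck_on_const)

lemma smooth_on_bounded_linear: "open S ==> bounded_linear h ==> smooth_on h S"
 by (simp add: smooth_on_def Ck_on_bounded_linear)

lemma smooth_on_bounded_linear_comp:
 "open S ==> bounded_linear h ==> smooth_on f S ==> smooth_on (%x. h (f x)) S"
 by (simp add: smooth_on_def Ck_on_bounded_linear_comp)

lemma smooth_on_add: "open S ==> smooth_on f S ==> smooth_on g S ==> smooth_on (%x. f x + g x) S"
 by (simp add: smooth_on_def Ck_on_add)

lemma smooth_on_minus:
 assumes "open S" "smooth_on f S" shows "smooth_on (%x. - f x) S"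
 using smooth_on_bounded_linear_comp[OF assms(1) bounded_linear_minus[OF bounded_linear_ident] assms(2)] .

lemma smooth_on_diff: "open S ==> smooth_on f S ==> smooth_on g S ==> smooth_on (%x. f x - g x) S"
 using smooth_on_add[OF _ _ smooth_on_minus, of S f g] by simp

lemma smooth_on_mult:
 fixes f g :: "'a::real_normed_vector => 'b::real_normed_algebra"
 shows "open S ==> smooth_on f S ==> smooth_on g S ==> smooth_on (%x. f x * g x) S"
 by (simp add: smooth_on_def Ck_on_mult)

lemma smooth_on_power:
 fixes f :: "'a::real_normed_vector => 'b::real_normed_algebra_1"
 shows "open S ==> smooth_on f S ==> smooth_on (%x. f x ^ m) S"
 by (induction m) (auto intro: smooth_on_mult smooth_on_const)

lemma smooth_on_sum:
 "open S ==> (!!i. i \<in> I ==> smooth_on (f i) S) ==> smooth_on (%x. \<Sum>i\<in>I. f i x) S"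
 by (induction I rule: infinite_finite_induct) (auto intro: smooth_on_add smooth_on_const)

lemma smooth_on_prod:
 fixes f :: "'i => 'a::real_normed_vector => 'b::{real_normed_algebra,comm_ring_1}"
 shows "open S ==> (!!i. i \<in> I ==> smooth_on (f i) S) ==> smooth_on (%x. \<Prod>i\<in>I. f i x) S"
 by (induction I rule: infinite_finite_induct) (auto intro: smooth_on_mult smooth_on_const)

lemma smooth_on_compose_real:
 fixes g :: "real => real" and f :: "'a::real_normed_vector => real"
 shows "open S ==> smooth_on g T ==> smooth_on f S ==> f ` S \<subseteq> T ==> smooth_on (%x. g (f x)) S"
 unfolding smooth_on_def using Ck_on_compose_real by blast

lemma Ck_on_Suc_real:
 fixes g :: "real => real"
 assumes "open T" "!!t. t \<in> T ==> (g has_real_derivative g' t) (at t)" "Ck_on k g' T"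
 shows "Ck_on (Suc k) g T"
proof (rule Ck_on_SucI[OF assms(1)])
 show "(g has_derivative (%v. g' t * v)) (at t)" if "t \<in> T" for t
  using assms(2)[OF that] by (simp add: has_field_derivative_def)
 show "Ck_on k (%t. g' t * v) T" for v
  by (intro Ck_on_mult Ck_on_const assms)
qed

lemma smooth_on_real_derivative:
 fixes g :: "real => real"
 assumes "open T" "!!t. t \<in> T ==> (g has_real_derivative g' t) (at t)" "smooth_on g' T"
 shows "smooth_on g T"
 using Ck_on_SucD[OF Ck_on_Suc_real[OF assms(1,2)]] assms(3) unfolding smooth_on_def by blast

lemma smooth_on_exp: "open T ==> smooth_on (exp :: real => real) T"
 unfolding smooth_on_def
proof
 fix k assume "open T" then show "Ck_on k (exp :: real => real) T"
 proof (induction k)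
  case (Suc k)
  then show ?case by (intro Ck_on_Suc_real[where g'=exp] DERIV_exp)
 qed (simp add: continuous_on_exp)
qed

lemma smooth_on_inverse: "open T ==> 0 \<notin> T ==> smooth_on (inverse :: real => real) T"
 unfolding smooth_on_def
proof
 fix k assume T: "open T" "0 \<notin> T"
 show "Ck_on k (inverse :: real => real) T"
 proof (induction k)
  case 0 then show ?case using T by (auto intro!: continuous_intros)
 next
  case (Suc k)
  show ?case
  proof (rule Ck_on_Suc_real[OF T(1)])
   show "(inverse has_real_derivative (- 1) * (inverse t * inverse t)) (at t)" if "t \<in> T" for t
    using DERIV_inverse[of t UNIV] that T by (auto simp: power2_eq_square power_Suc)
   show "Ck_on k (%t::real. (- 1) * (inverse t * inverse t)) T"
    using Suc T by (intro Ck_on_mult Ck_on_const)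
  qed
 qed
qed

lemma smooth_on_sqrt: "open T ==> T \<subseteq> {0<..} ==> smooth_on sqrt T"
 unfolding smooth_on_def
proof
 fix k assume T: "open T" "T \<subseteq> {0<..}"
 show "Ck_on k sqrt T"
 proof (induction k)
  case 0 then show ?case by (auto intro!: continuous_intros)
 next
  case (Suc k)
  show ?case
  proof (rule Ck_on_Suc_real[OF T(1)])
   show "(sqrt has_real_derivative (1/2) * inverse (sqrt t)) (at t)" if "t \<in> T" for t
    using DERIV_real_sqrt[of t] that T by (auto simp: field_simps)
   have "Ck_on k inverse {0::real<..}"
    using smooth_on_inverse[of "{0::real<..}"] by (auto simp: smooth_on_def)
   from Ck_on_compose_real[OF T(1) this Suc]
   show "Ck_on k (%t. (1/2) * inverse (sqrt t)) T"
    using T by (intro Ck_on_mult Ck_on_const) (auto simp: image_subset_iff)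
  qed
 qed
qed

lemma smooth_on_inverse_comp:
 fixes f :: "'a::real_normed_vector => real"
 assumes "open S" "smooth_on f S" "!!x. x \<in> S ==> f x \<noteq> 0"
 shows "smooth_on (%x. inverse (f x)) S"
 by (rule smooth_on_compose_real[OF assms(1) smooth_on_inverse[of "- {0}"] assms(2)]) (use assms in auto)

lemma smooth_on_divide:
 fixes f g :: "'a::real_normed_vector => real"
 assumes "open S" "smooth_on f S" "smooth_on g S" "!!x. x \<in> S ==> g x \<noteq> 0"
 shows "smooth_on (%x. f x / g x) S"
 unfolding divide_inverse by (intro smooth_on_mult smooth_on_inverse_comp assms)

lemma smooth_on_continuous_on: "smooth_on f S ==> continuous_on S f"
 unfolding smooth_on_def by (metis Ck_on.simps(1))

section \<open>Smooth cutoffs and scale decomposition\<close>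

text \<open>The functions that the derivatives of \<open>exp (- 1/t)\<close> are made of: they are closed under differentiation
 up to linear combinations, so smoothness follows by induction on the order.\<close>
definition flat_exp :: "nat => real => real" where
 "flat_exp m t = (if t <= 0 then 0 else inverse t ^ m * exp (- inverse t))"

lemma flat_exp_nonneg: "0 <= flat_exp m t"
 by (simp add: flat_exp_def)

lemma tendsto_flat_exp_0: "(flat_exp m \<longlongrightarrow> 0) (at 0)"
proof -
 have "((%t. inverse t ^ m / exp (inverse t)) \<longlongrightarrow> 0) (at_right (0::real))"
  by (rule filterlim_compose[OF tendsto_power_div_exp_0 filterlim_inverse_at_top_right])
 then have "((flat_exp m) \<longlongrightarrow> 0) (at_right 0)"
  by (rule Lim_transform_eventually)
    (auto simp: flat_exp_def eventually_at_filter exp_minus field_simps)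
 moreover have "((flat_exp m) \<longlongrightarrow> 0) (at_left 0)"
  by (rule Lim_transform_eventually[OF tendsto_const])
    (auto simp: flat_exp_def eventually_at_filter)
 ultimately show ?thesis by (simp add: filterlim_split_at)
qed

lemma flat_exp_has_derivative:
 "(flat_exp m has_real_derivative (- real m * flat_exp (m + 1) t + flat_exp (m + 2) t)) (at t)"
proof -
 consider "t < 0" | "t = 0" | "t > 0" by linarith
 then show ?thesis
 proof cases
  case 1
  have "((%t. 0) has_real_derivative 0) (at t)" by simp
  then have "(flat_exp m has_real_derivative 0) (at t)"
   by (rule has_field_derivative_transform_within_open[where S="{..<0}"]) (use 1 in \<open>auto simp: flat_exp_def\<close>)
  then show ?thesis using 1 by (simp add: flat_exp_def)
 next
  case 2
  have "((%h. (flat_exp m (0 + h) - flat_exp m 0) / h) \<longlongrightarrow> 0) (at 0)"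
   by (rule Lim_transform_eventually[OF tendsto_flat_exp_0[of "Suc m"]])
     (auto simp: flat_exp_def eventually_at_filter field_simps)
  then show ?thesis using 2 by (simp add: DERIV_def flat_exp_def)
 next
  case 3
  have "((%t. inverse t ^ m * exp (- inverse t)) has_real_derivative
    (- real m * flat_exp (m + 1) t + flat_exp (m + 2) t)) (at t)"
  proof -
   have i: "(inverse has_real_derivative - (inverse t ^ 2)) (at t)"
    using DERIV_inverse[of t UNIV] 3 by (simp add: power2_eq_square)
   have "((%t. inverse t ^ m) has_real_derivative (- real m * inverse t ^ (m + 1))) (at t)"
    using DERIV_power[OF i, of m] by (cases m) (simp_all add: power2_eq_square algebra_simps)
   from DERIV_mult[OF this DERIV_chain2[OF DERIV_exp DERIV_minus[OF i]]]
   show ?thesis using 3 by (simp add: flat_exp_def power2_eq_square algebra_simps)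
  qed
  then show ?thesis
   by (rule has_field_derivative_transform_within_open[where S="{0<..}"]) (use 3 in \<open>auto simp: flat_exp_def\<close>)
 qed
qed

lemma smooth_on_flat_exp: "smooth_on (flat_exp m) UNIV"
proof -
 have "Ck_on k (flat_exp m) UNIV" for k
 proof (induction k arbitrary: m)
  case 0
  have "isCont (flat_exp m) t" for t
   using DERIV_isCont flat_exp_has_derivative by blast
  then show ?case by (simp add: continuous_at_imp_continuous_on)
 next
  case (Suc k)
  show ?case
   by (rule Ck_on_Suc_real[OF open_UNIV flat_exp_has_derivative])
     (intro Ck_on_add Ck_on_mult Ck_on_const open_UNIV Suc)
 qed
 then show ?thesis by (simp add: smooth_on_def)
qed

definition raw_bump :: "real => real" where
 "raw_bump t = flat_exp 0 (t - 1) * flat_exp 0 (2 - t)"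

definition bump :: "real => real" where
 "bump t = raw_bump t / integral {1..2} raw_bump"

definition step :: "real => real" where
 "step t = integral {0..t} bump"

definition plateau :: "real => real" where
 "plateau t = 1 - step t - step (- t)"

text \<open>The factor \<open>t\<close> makes \<open>shell (h/l) / l\<close>, up to its sign, the derivative of \<open>step (h/l)\<close> in \<open>l\<close>.\<close>
definition shell :: "real => real" where
 "shell t = t * bump t"

lemma smooth_on_raw_bump: "smooth_on raw_bump UNIV"
 unfolding raw_bump_def
 by (intro smooth_on_mult open_UNIV smooth_on_compose_real[OF open_UNIV smooth_on_flat_exp]
   smooth_on_diff smooth_on_const smooth_on_bounded_linear bounded_linear_ident) auto

lemma raw_bump_nonneg: "0 <= raw_bump t"
 by (simp add: raw_bump_def flat_exp_nonneg)

lemma integral_raw_bump_pos: "0 < integral {1..2} raw_bump"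
proof -
 have c: "continuous_on {1..2} raw_bump"
  using smooth_on_continuous_on[OF smooth_on_raw_bump] continuous_on_subset by blast
 have "integral {1..2} raw_bump \<noteq> 0"
 proof
  assume "integral {1..2} raw_bump = 0"
  then have "\<forall>t\<in>cbox 1 2. raw_bump t = 0"
   using integral_eq_0_iff[OF c] raw_bump_nonneg by auto
  then have "raw_bump (3/2) = 0" by (auto simp: cbox_interval)
  then show False by (simp add: raw_bump_def flat_exp_def)
 qed
 moreover have "0 <= integral {1..2} raw_bump"
  by (intro integral_nonneg integrable_continuous_real c) (simp add: raw_bump_nonneg)
 ultimately show ?thesis by simp
qed

lemma smooth_on_bump: "smooth_on bump UNIV"
 unfolding bump_def divide_inverse
 by (intro smooth_on_mult open_UNIV smooth_on_raw_bump smooth_on_const)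

lemma bump_nonneg: "0 <= bump t"
 using integral_raw_bump_pos by (simp add: bump_def raw_bump_nonneg)

lemma bump_eq_0: "t <= 1 \<or> 2 <= t ==> bump t = 0"
 by (auto simp: bump_def raw_bump_def flat_exp_def)

lemma bump_integrable: "bump integrable_on {a..b}"
 using smooth_on_continuous_on[OF smooth_on_bump]
 by (intro integrable_continuous_real) (rule continuous_on_subset, auto)

lemma step_eq_0: "t <= 1 ==> step t = 0"
 unfolding step_def by (rule trans[OF integral_cong[of _ _ "%x. 0"]]) (auto simp: bump_eq_0)

lemma step_eq_1: "2 <= t ==> step t = 1"
proof -
 assume t: "2 <= t"
 have "integral {1..2} bump = 1"
  using integral_raw_bump_pos integral_mult_left[of "{1..2}" raw_bump "inverse (integral {1..2} raw_bump)"]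
  by (simp add: bump_def[abs_def] divide_inverse)
 moreover have "integral {0..1} bump = 0"
  using step_eq_0[of 1] by (simp add: step_def)
 moreover have "integral {2..t} bump = 0"
  by (rule trans[OF integral_cong[of _ _ "%x. 0"]]) (auto simp: bump_eq_0)
 moreover have "integral {0..2} bump = integral {0..1} bump + integral {1..2} bump"
  using Henstock_Kurzweil_Integration.integral_combine[of 0 1 2 bump] bump_integrable by simp
 moreover have "integral {0..t} bump = integral {0..2} bump + integral {2..t} bump"
  using Henstock_Kurzweil_Integration.integral_combine[of 0 2 t bump] bump_integrable t by simp
 ultimately show ?thesis by (simp add: step_def)
qed

lemma step_nonneg: "0 <= step t"
 unfolding step_def by (intro integral_nonneg bump_integrable) (simp add: bump_nonneg)

lemma step_le_1: "step t <= 1"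
proof (cases "t <= 2")
 case True
 have "step t <= step 2"
  unfolding step_def
  by (rule integral_subset_le) (use True bump_integrable bump_nonneg in auto)
 then show ?thesis using step_eq_1[of 2] by simp
qed (simp add: step_eq_1)

lemma step_has_derivative: "(step has_real_derivative bump t) (at t)"
proof (cases "t < 1")
 case True
 have "((%t. 0) has_real_derivative 0) (at t)" by simp
 then have "(step has_real_derivative 0) (at t)"
  by (rule has_field_derivative_transform_within_open[where S="{..<1}"]) (use True in \<open>auto simp: step_eq_0\<close>)
 then show ?thesis using True by (simp add: bump_eq_0)
next
 case False
 have "((%u. integral {0..u} bump) has_real_derivative bump t) (at t within {0..t+1})"
  using smooth_on_continuous_on[OF smooth_on_bump] False
  by (intro integral_has_real_derivative) (auto intro: continuous_on_subset)
 then show ?thesis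
  unfolding step_def using False by (subst (asm) at_within_interior) auto
qed

lemma smooth_on_step: "smooth_on step UNIV"
 by (rule smooth_on_real_derivative[OF open_UNIV step_has_derivative smooth_on_bump])

lemma plateau_has_derivative: "(plateau has_real_derivative (bump (- t) - bump t)) (at t)"
 unfolding plateau_def
 by (auto intro!: derivative_eq_intros DERIV_chain2[OF step_has_derivative] step_has_derivative)

lemma smooth_on_plateau: "smooth_on plateau UNIV"
 unfolding plateau_def
 by (intro smooth_on_diff smooth_on_const open_UNIV smooth_on_step
   smooth_on_compose_real[OF open_UNIV smooth_on_step] smooth_on_minus
   smooth_on_bounded_linear bounded_linear_ident) auto

lemma smooth_on_shell: "smooth_on shell UNIV"
 unfolding shell_def
 by (intro smooth_on_mult open_UNIV smooth_on_bump smooth_on_bounded_linear bounded_linear_ident)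

lemma plateau_minus: "plateau (- t) = plateau t"
 by (simp add: plateau_def)

lemma plateau_eq_1: "\<bar>t\<bar> <= 1 ==> plateau t = 1"
 by (simp add: plateau_def step_eq_0)

lemma plateau_eq_0: "2 <= \<bar>t\<bar> ==> plateau t = 0"
 by (cases "t \<ge> 0") (auto simp: plateau_def step_eq_0 step_eq_1)

lemma plateau_nonneg: "0 <= plateau t"
 using step_le_1[of t] step_le_1[of "- t"]
 by (cases "t \<ge> 0") (auto simp: plateau_def step_eq_0)

lemma shell_nonneg: "0 <= shell t"
 by (cases "t <= 1") (auto simp: shell_def bump_nonneg bump_eq_0)

lemma shell_eq_0: "t <= 1 \<or> 2 <= t ==> shell t = 0"
 by (auto simp: shell_def bump_eq_0)

definition box_shell :: "'k => real ^ ('k::finite) => real" where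
 "box_shell i h = shell (h $ i) * (\<Prod>j\<in>UNIV - {i}. plateau (h $ j))"

lemma continuous_on_plateau: "continuous_on S plateau"
 using smooth_on_continuous_on[OF smooth_on_plateau] continuous_on_subset by blast

lemma continuous_on_shell: "continuous_on S shell"
 using smooth_on_continuous_on[OF smooth_on_shell] continuous_on_subset by blast

lemma continuous_on_box_shell: "continuous_on S (box_shell i)"
 unfolding box_shell_def
 by (intro continuous_intros continuous_on_compose2[OF continuous_on_shell[of UNIV]]
   continuous_on_compose2[OF continuous_on_plateau[of UNIV]]) auto

lemma borel_measurable_box_shell [measurable]: "box_shell i \<in> borel_measurable borel"
 using continuous_on_box_shell borel_measurable_continuous_onI by blast

lemma box_shell_nonneg: "0 <= box_shell i h"
 by (simp add: box_shell_def shell_nonneg plateau_nonneg prod_nonneg)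

text \<open>Each face of the cube \<open>|h\<^sub>j| < l\<close> contributes one localised term when the cube grows. These terms form the
 scale decomposition.\<close>
lemma box_shell_scale_derivative:
 fixes h :: "real ^ 'k::finite"
 assumes "0 < l"
 shows "((%l. \<Prod>j\<in>UNIV. plateau (h $ j / l)) has_real_derivative
  (\<Sum>i\<in>UNIV. box_shell i (h /\<^sub>R l) + box_shell i (- (h /\<^sub>R l))) / l) (at l)"
proof -
 have 1: "((%l. plateau (h $ j / l)) has_real_derivative
   (shell (h $ j / l) + shell (- (h $ j / l))) / l) (at l)" for j
 proof -
  have "((%l. plateau (h $ j / l)) has_real_derivative
   (bump (- (h $ j / l)) - bump (h $ j / l)) * (- h $ j / l^2)) (at l)"
   using assms
   by (intro DERIV_chain2[OF plateau_has_derivative])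
     (auto intro!: derivative_eq_intros simp: power2_eq_square)
  moreover have "(bump (- (h $ j / l)) - bump (h $ j / l)) * (- h $ j / l^2)
    = (shell (h $ j / l) + shell (- (h $ j / l))) / l"
   using assms by (simp add: shell_def field_simps power2_eq_square)
  ultimately show ?thesis by simp
 qed
 have "((%l. \<Prod>j\<in>UNIV. plateau (h $ j / l)) has_real_derivative
  (\<Sum>i\<in>UNIV. ((shell (h $ i / l) + shell (- (h $ i / l))) / l) * (\<Prod>j\<in>UNIV - {i}. plateau (h $ j / l)))) (at l)"
  by (rule has_field_derivative_prod) (rule 1)
 moreover have "(\<Sum>i\<in>UNIV. ((shell (h $ i / l) + shell (- (h $ i / l))) / l) * (\<Prod>j\<in>UNIV - {i}. plateau (h $ j / l)))
   = (\<Sum>i\<in>UNIV. box_shell i (h /\<^sub>R l) + box_shell i (- (h /\<^sub>R l))) / l"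
  unfolding sum_divide_distrib
  by (intro sum.cong refl) (simp add: box_shell_def plateau_minus field_simps)
 ultimately show ?thesis by simp
qed

text \<open>Fundamental theorem of calculus: the dilated cutoff increases from 0 to 1.\<close>
lemma nn_integral_box_shell_scale:
 fixes h :: "real ^ 'k::finite"
 assumes "h \<noteq> 0"
 shows "(\<integral>\<^sup>+ l. ennreal ((\<Sum>i\<in>UNIV. box_shell i (h /\<^sub>R l) + box_shell i (- (h /\<^sub>R l))) / l)
   * pos_ind l \<partial>lborel) = 1"
proof -
 let ?F = "%l. \<Prod>j\<in>UNIV. plateau (h $ j / l)"
 let ?f = "%l. (\<Sum>i\<in>UNIV. box_shell i (h /\<^sub>R l) + box_shell i (- (h /\<^sub>R l))) / l"
 obtain i where i: "h $ i \<noteq> 0" using assms by (auto simp: vec_eq_iff)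
 define a where "a = \<bar>h $ i\<bar> / 2"
 have a: "a > 0" using i by (simp add: a_def)
 have F0: "?F l = 0" if "0 < l" "l <= a" for l
 proof -
  have "plateau (h $ i / l) = 0" using that i
   by (intro plateau_eq_0) (auto simp: a_def abs_divide field_simps)
  then show ?thesis by (intro prod_zero) auto
 qed
 have f0: "?f l = 0" if "0 < l" "l < a" for l
 proof -
  have "((%l. 0) has_real_derivative 0) (at l)" by simp
  then have "(?F has_real_derivative 0) (at l)"
   by (rule has_field_derivative_transform_within_open[where S="{0<..<a}"]) (use that F0 in auto)
  then show ?thesis
   using box_shell_scale_derivative[OF that(1), of h] DERIV_unique by blast
 qed
 have F1: "eventually (%l. ?F l = 1) at_top"
  using eventually_ge_at_top[of "norm h + 1"]
 proof eventually_elim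
  case (elim l)
  have l0: "0 < l" using elim norm_ge_zero[of h] by linarith
  have "\<bar>h $ j\<bar> <= l" for j
   using component_le_norm_cart[of h j] elim by linarith
  then have "plateau (h $ j / l) = 1" for j
   using l0 by (intro plateau_eq_1) (simp add: abs_divide)
  then show ?case by simp
 qed
 have "(\<integral>\<^sup>+ l. ennreal (?f l) * pos_ind l \<partial>lborel) = (\<integral>\<^sup>+ l. ennreal (?f l) * indicator {a..} l \<partial>lborel)"
 proof (intro nn_integral_cong)
  fix l
  show "ennreal (?f l) * pos_ind l = ennreal (?f l) * indicator {a..} l"
  proof (cases "l < a")
   case True
   then show ?thesis using f0[of l] by (cases "l > 0") (auto simp: indicator_def)
  qed (use a in \<open>auto simp: indicator_def\<close>)
 qed
 also have "... = ennreal (1 - ?F a)"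
 proof (rule nn_integral_FTC_atLeast)
  show "?f \<in> borel_measurable borel" by measurable
  show "(?F has_real_derivative ?f l) (at l)" if "a <= l" for l
   using that a by (intro box_shell_scale_derivative) auto
  show "0 <= ?f l" if "a <= l" for l
   using that a by (intro divide_nonneg_nonneg sum_nonneg add_nonneg_nonneg box_shell_nonneg) auto
  show "(?F \<longlongrightarrow> 1) at_top" using F1 by (simp add: tendsto_eventually)
 qed
 also have "... = 1" using F0[of a] a by simp
 finally show ?thesis .
qed

section \<open>The straightened distance phase\<close>

lemma partial_deriv_eq: "(f has_derivative f') (at x) ==> partial_deriv i f x = f' (axis i 1)"
 unfolding partial_deriv_def using frechet_derivative_at by metis

definition emb :: "real ^ 'm => real ^ ('m::finite option)" where
 "emb v = (\<chi> i. case i of None => 0 | Some k => v $ k)"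

lemma emb_nth [simp]: "emb v $ None = 0" "emb v $ Some k = v $ k"
 by (simp_all add: emb_def)

lemma option_vec_eq_iff: "x = y \<longleftrightarrow> x $ None = y $ None \<and> (\<forall>k. x $ Some k = y $ Some k)"
 for x y :: "'a ^ ('m::finite option)"
 by (metis option.exhaust vec_eq_iff)

lemma sum_option_UNIV: "(\<Sum>i\<in>UNIV. f i) = f None + (\<Sum>k\<in>UNIV. f (Some k))"
 for f :: "'m::finite option => 'a::comm_monoid_add"
 by (simp add: UNIV_option_conv sum.reindex)

lemma prod_option_UNIV: "(\<Prod>i\<in>UNIV. f i) = f None * (\<Prod>k\<in>UNIV. f (Some k))"
 for f :: "'m::finite option => 'a::comm_monoid_mult"
 by (simp add: UNIV_option_conv prod.reindex)

lemma inner_option: "x \<bullet> y = x $ None * y $ None + (\<Sum>k\<in>UNIV. x $ Some k * y $ Some k)"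
 for x y :: "real ^ ('m::finite option)"
 by (simp add: inner_vec_def sum_option_UNIV)

lemma linear_emb: "linear emb"
 by (rule linearI) (auto simp: option_vec_eq_iff)

lemma bounded_linear_emb: "bounded_linear emb"
 using linear_conv_bounded_linear linear_emb by blast

lemma emb_inner: "emb u \<bullet> emb v = u \<bullet> v"
 unfolding inner_option by (simp add: inner_vec_def)

lemma norm_emb [simp]: "norm (emb v) = norm v"
 by (simp add: norm_eq_sqrt_inner emb_inner)

lemma axis_None_nth [simp]: "axis None (1::real) $ None = 1" "axis None (1::real) $ Some k = 0"
 by (simp_all add: axis_def)

text \<open>The affine function whose length is the distance from \<open>straighten e w\<close> to \<open>- emb \<xi>\<close> in the tangential
 directions, multiplied by \<open>1 + w $ None\<close>.\<close>
definition shear :: "real ^ ('m::finite option) => real ^ 'm => real ^ 'm" where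
 "shear w \<xi> = (\<chi> j. w $ Some j + (1 + w $ None) * \<xi> $ j)"

definition reg_norm :: "real => 'a::real_inner => real" where
 "reg_norm e v = sqrt (v \<bullet> v + e\<^sup>2)"

text \<open>The distance from \<open>straighten e w\<close> to \<open>- emb \<xi>\<close>, see \<open>norm_straighten\<close>.\<close>
definition phase :: "real => ('m::finite) phase_space => real" where
 "phase e z = reg_norm e (shear (fst z) (snd z)) / (1 + fst z $ None)"

text \<open>The Hessian of \<open>reg_norm e\<close> at \<open>v\<close>, applied to \<open>h\<close>.\<close>
definition reg_hess :: "real => 'a::real_inner => 'a => 'a" where
 "reg_hess e v h = h /\<^sub>R reg_norm e v - ((v \<bullet> h) / reg_norm e v ^ 3) *\<^sub>R v"

lemma reg_norm_pos: "e > 0 ==> 0 < reg_norm e v"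
 by (simp add: reg_norm_def add_nonneg_pos)

lemma reg_norm_sq: "reg_norm e v ^ 2 = v \<bullet> v + e\<^sup>2"
 by (simp add: reg_norm_def)

lemma reg_norm_has_derivative:
 assumes "e > 0"
 shows "(reg_norm e has_derivative (%h. (v \<bullet> h) / reg_norm e v)) (at v)"
proof -
 have "v \<bullet> v + e\<^sup>2 > 0" using assms by (simp add: add_nonneg_pos)
 then show ?thesis
  unfolding reg_norm_def
  by (auto intro!: derivative_eq_intros simp: field_simps inner_commute)
qed

lemma linear_reg_hess: "linear (reg_hess e v)"
 by (rule linearI) (simp_all add: reg_hess_def algebra_simps inner_right_distrib add_divide_distrib)

text \<open>Cauchy-Schwarz, strict because \<open>e\<close> is positive. This is the source of rank, convexity and nondegeneracy.\<close>
lemma reg_hess_inner_pos: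
 assumes "e > 0" "h \<noteq> 0"
 shows "0 < reg_hess e v h \<bullet> h"
proof -
 let ?r = "reg_norm e v"
 have r: "?r > 0" by (rule reg_norm_pos[OF assms(1)])
 have cs: "(v \<bullet> h)\<^sup>2 <= (v \<bullet> v) * (h \<bullet> h)" by (rule Cauchy_Schwarz_ineq)
 have h: "h \<bullet> h > 0" using assms(2) by simp
 have "(v \<bullet> h)\<^sup>2 < ?r^2 * (h \<bullet> h)"
  unfolding reg_norm_sq distrib_right using cs mult_pos_pos[OF zero_less_power[OF assms(1), of 2] h] by linarith
 then have "0 < (?r^2 * (h \<bullet> h) - (v \<bullet> h)\<^sup>2) / ?r^3" using r by simp
 also have "... = reg_hess e v h \<bullet> h"
  using r by (simp add: reg_hess_def inner_diff_left field_simps power2_eq_square power3_eq_cube)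
 finally show ?thesis .
qed

lemma reg_hess_axis_zero:
 fixes u :: "real ^ 'm::finite"
 assumes "e > 0" "!!j. reg_hess e v (axis j 1) \<bullet> u = 0"
 shows "u = 0"
proof (rule ccontr)
 assume u: "u \<noteq> 0"
 have "u = (\<Sum>j\<in>UNIV. (u $ j) *\<^sub>R axis j 1)"
  using basis_expansion[of u] by (simp add: scalar_mult_eq_scaleR)
 then have "reg_hess e v u = (\<Sum>j\<in>UNIV. (u $ j) *\<^sub>R reg_hess e v (axis j 1))"
  using linear_sum[OF linear_reg_hess, of e v "%j. (u $ j) *\<^sub>R axis j 1" UNIV]
  by (simp add: linear_scale[OF linear_reg_hess])
 then have "reg_hess e v u \<bullet> u = 0" using assms(2) by (simp add: inner_sum_left)
 then show False using reg_hess_inner_pos[OF assms(1) u, of v] by simp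
qed

lemma shear_has_derivative_left:
 "((%w. shear w \<xi>) has_derivative (%h. \<chi> j. h $ Some j + h $ None * \<xi> $ j)) (at w)"
proof -
 have "linear (%h::real^('a option). \<chi> j. h $ Some j + h $ None * \<xi> $ j)"
  by (rule linearI) (auto simp: vec_eq_iff algebra_simps)
 then have "((%h. \<chi> j. h $ Some j + h $ None * \<xi> $ j) has_derivative (%h. \<chi> j. h $ Some j + h $ None * \<xi> $ j)) (at w)"
  by (simp add: linear_conv_bounded_linear bounded_linear_imp_has_derivative)
 moreover have "(%w. shear w \<xi>) = (%h. \<xi> + (\<chi> j. h $ Some j + h $ None * \<xi> $ j))"
  by (auto simp: shear_def vec_eq_iff algebra_simps)
 ultimately show ?thesis by (auto intro!: derivative_eq_intros)
qed

lemma shear_eq: "shear w \<xi> = (\<chi> j. w $ Some j) + (1 + w $ None) *\<^sub>R \<xi>"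
 by (simp add: shear_def vec_eq_iff)

lemma shear_has_derivative_right:
 "(shear w has_derivative (%h. (1 + w $ None) *\<^sub>R h)) (at \<xi>)"
 unfolding shear_eq[abs_def] by (auto intro!: derivative_eq_intros)

definition phase_grad :: "real => real ^ ('m::finite option) => real ^ 'm => real ^ ('m option)" where
 "phase_grad e w \<xi> = (let s = 1 + w $ None; v = shear w \<xi>; r = reg_norm e v in
   ((v \<bullet> \<xi>) / (r * s) - r / s\<^sup>2) *\<^sub>R axis None 1 + (1 / (r * s)) *\<^sub>R emb v)"

lemma grad_x_phase:
 assumes "e > 0" "0 < 1 + w $ None"
 shows "grad_x (phase e) w \<xi> = phase_grad e w \<xi>"
proof -
 let ?v = "shear w \<xi>" and ?s = "1 + w $ None"
 let ?r = "reg_norm e ?v"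
 have r: "?r > 0" by (rule reg_norm_pos[OF assms(1)])
 have d1: "((%y. reg_norm e (shear y \<xi>)) has_derivative
   (%h. (?v \<bullet> (\<chi> j. h $ Some j + h $ None * \<xi> $ j)) / ?r)) (at w)"
  by (rule has_derivative_compose[OF shear_has_derivative_left reg_norm_has_derivative[OF assms(1)]])
 have d2: "((%y. 1 + y $ None) has_derivative (%h. h $ None)) (at w)"
  by (auto intro!: derivative_eq_intros bounded_linear_imp_has_derivative bounded_linear_vec_nth)
 have "((%y. reg_norm e (shear y \<xi>) / (1 + y $ None)) has_derivative
   (%h. - ?r * (inverse ?s * h $ None * inverse ?s)
    + (?v \<bullet> (\<chi> j. h $ Some j + h $ None * \<xi> $ j)) / ?r / ?s)) (at w)"
  by (rule has_derivative_divide[OF d1 d2]) (use assms in auto)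
 then have g: "grad_x (phase e) w \<xi> $ i = - ?r * (inverse ?s * axis i (1::real) $ None * inverse ?s)
    + (?v \<bullet> (\<chi> j. axis i 1 $ Some j + axis i 1 $ None * \<xi> $ j)) / ?r / ?s" for i
  unfolding grad_x_def gradient_def phase_def by (simp add: partial_deriv_eq)
 have e1: "(\<chi> j. axis None (1::real) $ Some j + axis None 1 $ None * \<xi> $ j) = \<xi>"
  by (simp add: vec_eq_iff)
 have e2: "(\<chi> j. axis (Some k) (1::real) $ Some j + axis (Some k) 1 $ None * \<xi> $ j) = axis k 1" for k
  by (simp add: vec_eq_iff axis_def)
 have e3: "axis (Some k) (1::real) $ None = 0" for k by (simp add: axis_def)
 have "grad_x (phase e) w \<xi> $ None = (?v \<bullet> \<xi>) / (?r * ?s) - ?r / ?s\<^sup>2"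
  unfolding g e1 by (simp add: divide_inverse power2_eq_square mult_ac)
 moreover have "grad_x (phase e) w \<xi> $ Some k = ?v $ k / (?r * ?s)" for k
  unfolding g unfolding e2 unfolding e3 by (simp add: divide_inverse mult_ac inner_axis)
 ultimately show ?thesis
  by (simp add: option_vec_eq_iff phase_grad_def Let_def)
qed

lemma phase_grad_has_derivative:
 assumes "e > 0" "0 < 1 + w $ None"
 shows "(phase_grad e w has_derivative (%h. (reg_hess e (shear w \<xi>) h \<bullet> \<xi>) *\<^sub>R axis None 1
   + emb (reg_hess e (shear w \<xi>) h))) (at \<xi>)"
proof -
 let ?v = "shear w \<xi>"
 let ?r = "reg_norm e ?v"
 define s where "s = 1 + w $ None"
 have s: "s > 0" using assms by (simp add: s_def)
 have r: "?r > 0" by (rule reg_norm_pos[OF assms(1)])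
 note dsh = shear_has_derivative_right[of w \<xi>, folded s_def]
 have dr: "((%\<xi>. reg_norm e (shear w \<xi>)) has_derivative (%h. (?v \<bullet> (s *\<^sub>R h)) / ?r)) (at \<xi>)"
  by (rule has_derivative_compose[OF dsh reg_norm_has_derivative[OF assms(1)]])
 have drs: "((%\<xi>. reg_norm e (shear w \<xi>) * s) has_derivative (%h. (?v \<bullet> (s *\<^sub>R h)) / ?r * s)) (at \<xi>)"
  by (rule has_derivative_mult_left[OF dr])
 have di: "((%\<xi>. 1 / (reg_norm e (shear w \<xi>) * s)) has_derivative
   (%h. - (?v \<bullet> h) / ?r ^ 3)) (at \<xi>)"
  by (rule has_derivative_eq_rhs[OF has_derivative_divide[OF has_derivative_const drs]])
    (use r s in \<open>auto simp: field_simps power2_eq_square power3_eq_cube\<close>)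
 have dn: "((%\<xi>. (shear w \<xi> \<bullet> \<xi>) * (1 / (reg_norm e (shear w \<xi>) * s)) - reg_norm e (shear w \<xi>) * inverse (s\<^sup>2))
   has_derivative (%h. reg_hess e ?v h \<bullet> \<xi>)) (at \<xi>)"
 proof (rule has_derivative_eq_rhs[OF has_derivative_diff[OF has_derivative_mult[OF
     has_derivative_inner[OF dsh has_derivative_ident] di] has_derivative_mult_left[OF dr]]], rule ext)
  fix h
  have "a * (- b / r ^ 3) + (b + s * c) * (1 / (r * s)) - (s * b) / r * inverse (s\<^sup>2) = c / r - (b / r ^ 3) * a"
   if "r > 0" for a b c r :: real
   using that s by (simp add: field_simps power2_eq_square power3_eq_cube)
  from this[OF r, of "?v \<bullet> \<xi>" "?v \<bullet> h" "h \<bullet> \<xi>"]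
  show "(?v \<bullet> \<xi>) * (- (?v \<bullet> h) / ?r ^ 3) + (?v \<bullet> h + s *\<^sub>R h \<bullet> \<xi>) * (1 / (?r * s))
    - (?v \<bullet> s *\<^sub>R h) / ?r * inverse (s\<^sup>2) = reg_hess e ?v h \<bullet> \<xi>"
   by (simp add: reg_hess_def inner_diff_left divide_inverse mult.commute)
 qed
 have dv: "((%\<xi>. (1 / (reg_norm e (shear w \<xi>) * s)) *\<^sub>R emb (shear w \<xi>)) has_derivative
   (%h. (1 / (?r * s)) *\<^sub>R emb (s *\<^sub>R h) + (- (?v \<bullet> h) / ?r ^ 3) *\<^sub>R emb ?v)) (at \<xi>)"
  by (rule has_derivative_scaleR[OF di
    bounded_linear.has_derivative[OF bounded_linear_emb dsh]])
 have e: "(1 / (?r * s)) *\<^sub>R emb (s *\<^sub>R h) + (- (?v \<bullet> h) / ?r ^ 3) *\<^sub>R emb ?v = emb (reg_hess e ?v h)" for h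
  using r s by (auto simp: option_vec_eq_iff reg_hess_def field_simps)
 have "((%\<xi>. ((shear w \<xi> \<bullet> \<xi>) * (1 / (reg_norm e (shear w \<xi>) * s)) - reg_norm e (shear w \<xi>) * inverse (s\<^sup>2)) *\<^sub>R axis None 1
   + (1 / (reg_norm e (shear w \<xi>) * s)) *\<^sub>R emb (shear w \<xi>)) has_derivative
   (%h. (reg_hess e ?v h \<bullet> \<xi>) *\<^sub>R axis None 1 + emb (reg_hess e ?v h))) (at \<xi>)"
  using has_derivative_add[OF has_derivative_scaleR_left[OF dn, of "axis None (1::real)"] dv[unfolded e]] .
 then show ?thesis by (simp add: phase_grad_def[abs_def] Let_def s_def divide_inverse)
qed

lemma mixed_hessian_phase:
 assumes "e > 0" "0 < 1 + w $ None"
 shows "mixed_hessian (phase e) w \<xi> $ j = (reg_hess e (shear w \<xi>) (axis j 1) \<bullet> \<xi>) *\<^sub>R axis None 1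
   + emb (reg_hess e (shear w \<xi>) (axis j 1))"
 using partial_deriv_eq[OF phase_grad_has_derivative[OF assms]]
 by (simp add: mixed_hessian_def grad_x_phase[OF assms])

lemma wedge_inner:
 "wedge W \<bullet> x = det (\<chi> k. case k of None => x | Some j => W $ j)"
proof -
 have c: "(\<chi> k. case k of None => y | Some j => W $ j) = (\<chi> k. if k = None then y else (case k of None => 0 | Some j => W $ j))"
  for y :: "real^('a option)"
  by (auto simp: vec_eq_iff split: option.splits)
 have x: "x = (\<Sum>i\<in>UNIV. x $ i *s axis i 1)"
  using basis_expansion[of x] by simp
 have "det (\<chi> k. case k of None => x | Some j => W $ j) =
   (\<Sum>i\<in>UNIV. det (\<chi> k. if k = None then x $ i *s axis i 1 else (case k of None => 0 | Some j => W $ j)))"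
  by (subst c, subst x, rule det_linear_row_sum) simp
 also have "... = (\<Sum>i\<in>UNIV. x $ i * wedge W $ i)"
  by (intro sum.cong refl) (simp add: det_row_mul wedge_def c)
 finally show ?thesis by (simp add: inner_vec_def mult.commute)
qed

lemma wedge_inner_row: "wedge W \<bullet> W $ j = 0"
 unfolding wedge_inner by (rule det_identical_rows[of None "Some j"]) (auto simp: row_def vec_eq_iff)

text \<open>The \<open>\<xi>\<close>-gradient of the phase depends on \<open>w\<close> only through \<open>shear w \<xi>\<close>. So its derivative in \<open>w\<close> factors
 through the map \<open>y \<mapsto> y $ None *\<^sub>R \<xi> + y'\<close>, whose kernel does not see \<open>w\<close>: this is straightness.\<close>
lemma row_inner_phase:
 assumes "e > 0" "0 < 1 + w $ None"
 shows "mixed_hessian (phase e) w \<xi> $ j \<bullet> y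
   = reg_hess e (shear w \<xi>) (axis j 1) \<bullet> (y $ None *\<^sub>R \<xi> + (\<chi> k. y $ Some k))"
proof -
 have "emb u \<bullet> y = u \<bullet> (\<chi> k. y $ Some k)" for u :: "real^'a"
  unfolding inner_option by (simp add: inner_vec_def)
 moreover have "axis None 1 \<bullet> y = y $ None" by (simp add: inner_axis')
 ultimately show ?thesis
  by (simp add: mixed_hessian_phase[OF assms] inner_add_left inner_add_right mult.commute)
qed

lemma rows_kernel_phase:
 assumes "e > 0" "0 < 1 + w $ None" "!!j. mixed_hessian (phase e) w \<xi> $ j \<bullet> y = 0"
 shows "y = y $ None *\<^sub>R (axis None 1 - emb \<xi>)"
proof -
 have "y $ None *\<^sub>R \<xi> + (\<chi> k. y $ Some k) = 0"
  using assms(3) by (intro reg_hess_axis_zero[OF assms(1)]) (simp add: row_inner_phase[OF assms(1,2)])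
 then show ?thesis by (auto simp: option_vec_eq_iff vec_eq_iff eq_neg_iff_add_eq_0 add.commute)
qed

lemma G0_phase:
 assumes "e > 0" "0 < 1 + w $ None"
 shows "G0 (phase e) w \<xi> = G0 (phase e) w \<xi> $ None *\<^sub>R (axis None 1 - emb \<xi>)"
 by (rule rows_kernel_phase[OF assms]) (simp add: G0_def inner_commute wedge_inner_row)

lemma G0_phase_nonzero:
 assumes "e > 0" "0 < 1 + w $ None"
 shows "G0 (phase e) w \<xi> $ None \<noteq> 0"
proof -
 let ?M = "\<chi> k. case k of None => axis None 1 | Some j => mixed_hessian (phase e) w \<xi> $ j"
 have "y = 0" if "?M *v y = 0" for y
 proof -
  have r: "?M $ k \<bullet> y = 0" for k
   using that by (metis matrix_vector_mul_component zero_index)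
  have "y $ None = 0" using r[of None] by (simp add: inner_axis')
  moreover have "y = y $ None *\<^sub>R (axis None 1 - emb \<xi>)"
   by (rule rows_kernel_phase[OF assms]) (use r[of "Some _"] in simp)
  ultimately show ?thesis by simp
 qed
 then have "invertible ?M"
  using matrix_left_invertible_ker[of ?M] invertible_left_inverse by blast
 then show ?thesis by (simp add: invertible_det_nz G0_def wedge_def)
qed

lemma continuous_on_det:
 fixes M :: "'x::topological_space => real^'n^'n::finite"
 assumes "!!i j. continuous_on S (%x. M x $ i $ j)"
 shows "continuous_on S (%x. det (M x))"
 unfolding det_def by (intro continuous_intros assms)

text \<open>The sign cannot change along a segment, because \<open>G0\<close> does not vanish, and at \<open>w = 0\<close>, \<open>\<xi> = 0\<close> it is that of
 the determinant of a positive definite matrix.\<close>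
lemma G0_phase_pos:
 fixes w :: "real ^ ('m::finite option)"
 assumes e: "e > 0" and "0 < 1 + w $ None"
 shows "0 < G0 (phase e) w \<xi> $ None"
proof -
 let ?S = "{z. 0 < 1 + fst z $ None} :: 'm phase_space set"
 let ?g = "%z::'m phase_space. G0 (phase e) (fst z) (snd z) $ None"
 let ?h = "%(z::'m phase_space) j. reg_hess e (shear (fst z) (snd z)) (axis j 1)"
 let ?M = "%z::'m phase_space. \<chi> k. case k of None => axis None 1
   | Some j => (?h z j \<bullet> snd z) *\<^sub>R axis None 1 + emb (?h z j)"
 have gM: "?g z = det (?M z)" if "z \<in> ?S" for z
  using that by (simp add: G0_def wedge_def mixed_hessian_phase[OF e] cong: option.case_cong)
 have c1: "continuous_on ?S (%z::'m phase_space. shear (fst z) (snd z))"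
  unfolding shear_def by (intro continuous_intros)
 have c2: "continuous_on ?S (%z::'m phase_space. ?h z j)" for j
  unfolding reg_hess_def reg_norm_def
  by (intro continuous_intros c1) (auto simp: add_nonneg_eq_0_iff e less_imp_neq[OF e, symmetric])
 have c: "continuous_on ?S (%z. det (?M z))"
 proof (rule continuous_on_det)
  fix i l :: "'m option"
  show "continuous_on ?S (%z. ?M z $ i $ l)"
  proof (cases i)
   case (Some j)
   show ?thesis unfolding Some
    by (cases l) (auto intro!: continuous_intros c2)
  qed simp
 qed
 have conv: "convex ?S"
 proof -
  have "?S = (%z. fst z $ None) -` {-1<..}" by auto
  moreover have "linear (%z::'m phase_space. fst z $ None)" by (rule linearI) auto
  ultimately show ?thesis by (metis convex_linear_vimage convex_real_interval(3))
 qed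
 have conn: "connected (?g ` ?S)"
  using connected_continuous_image[OF c convex_connected[OF conv]] gM by (metis (no_types, lifting) image_cong)
 have nz: "?g z \<noteq> 0" if "z \<in> ?S" for z using that by (intro G0_phase_nonzero e) auto
 have z0: "(0,0) \<in> ?S" by simp
 have sh0: "shear 0 (0::real^'m) = 0" by (simp add: shear_def vec_eq_iff)
 have "det (?M (0,0)) = (\<Prod>i\<in>UNIV. ?M (0,0) $ i $ i)"
 proof (rule det_diagonal)
  fix i l :: "'m option" assume "i \<noteq> l"
  then show "?M (0,0) $ i $ l = 0"
   by (cases i; cases l) (auto simp: sh0 reg_hess_def axis_def)
 qed
 also have "... > 0"
 proof (intro prod_pos)
  fix i :: "'m option"
  show "0 < ?M (0,0) $ i $ i"
   by (cases i) (use reg_norm_pos[OF e] in \<open>auto simp: sh0 reg_hess_def\<close>)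
 qed
 finally have pos0: "?g (0,0) > 0" using gM[OF z0] by simp
 show ?thesis
 proof (rule ccontr)
  assume "\<not> ?thesis"
  then have neg: "?g (w, \<xi>) <= 0" by simp
  have m1: "?g (w,\<xi>) \<in> ?g ` ?S" by (rule imageI) (use assms(2) in simp)
  have m0: "?g (0,0) \<in> ?g ` ?S" by (rule imageI) simp
  have "0 \<in> ?g ` ?S"
   by (rule connectedD_interval[OF conn m1 m0 neg less_imp_le[OF pos0]])
  then show False using nz by auto
 qed
qed

lemma G_phase:
 assumes "e > 0" "0 < 1 + w $ None"
 shows "G (phase e) w \<xi> = (axis None 1 - emb \<xi>) /\<^sub>R norm (axis None (1::real) - emb \<xi>)"
proof -
 let ?c = "G0 (phase e) w \<xi> $ None" and ?u = "axis None (1::real) - emb \<xi>"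
 have "?c > 0" by (rule G0_phase_pos[OF assms])
 moreover have "G (phase e) w \<xi> = (?c *\<^sub>R ?u) /\<^sub>R norm (?c *\<^sub>R ?u)"
  unfolding G_def using G0_phase[OF assms, of \<xi>] by simp
 ultimately show ?thesis by simp
qed

lemma axis_minus_emb_nonzero: "axis None (1::real) - emb \<xi> \<noteq> 0"
 by (auto simp: option_vec_eq_iff)

text \<open>Pairing the spatial gradient with the fixed direction \<open>G\<close> leaves a quadratic correction whose second
 derivative at \<open>\<xi>\<^sub>0\<close> is the Hessian of the regularised norm.\<close>
lemma curvature_matrix_phase:
 assumes "e > 0" "0 < 1 + w $ None"
 shows "curvature_matrix (phase e) w \<xi>\<^sub>0 = (\<chi> i j. (reg_hess e (shear w \<xi>\<^sub>0) (axis j 1)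
   \<bullet> axis i 1) / norm (axis None (1::real) - emb \<xi>\<^sub>0))"
proof -
 let ?u = "axis None (1::real) - emb \<xi>\<^sub>0"
 let ?N = "norm ?u"
 let ?H = "%\<xi> h. reg_hess e (shear w \<xi>) h"
 have emb_u: "emb v \<bullet> ?u = - (v \<bullet> \<xi>\<^sub>0)" for v
  unfolding inner_option by (simp add: inner_vec_def sum_negf)
 have ax_u: "axis None 1 \<bullet> ?u = 1" by (simp add: inner_axis')
 have 1: "partial_deriv j (%\<xi>. grad_x (phase e) w \<xi> \<bullet> G (phase e) w \<xi>\<^sub>0) \<xi> = (?H \<xi> (axis j 1) \<bullet> (\<xi> - \<xi>\<^sub>0)) / ?N" for j \<xi>
 proof -
  have "((%\<xi>. phase_grad e w \<xi> \<bullet> (?u /\<^sub>R ?N)) has_derivative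
    (%h. ((?H \<xi> h \<bullet> \<xi>) *\<^sub>R axis None 1 + emb (?H \<xi> h)) \<bullet> (?u /\<^sub>R ?N))) (at \<xi>)"
   by (rule has_derivative_inner_left[OF phase_grad_has_derivative[OF assms]])
  moreover have "(a *\<^sub>R axis None 1 + emb b) \<bullet> (?u /\<^sub>R ?N) = (a - b \<bullet> \<xi>\<^sub>0) / ?N" for a b
   unfolding inner_add_left inner_scaleR_left inner_scaleR_right ax_u emb_u
   by (simp add: divide_inverse algebra_simps)
  ultimately have "((%\<xi>. phase_grad e w \<xi> \<bullet> (?u /\<^sub>R ?N)) has_derivative
    (%h. (?H \<xi> h \<bullet> (\<xi> - \<xi>\<^sub>0)) / ?N)) (at \<xi>)"
   by (simp only: inner_diff_right)
  from partial_deriv_eq[OF this, of j] show ?thesis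
   unfolding grad_x_phase[OF assms] G_phase[OF assms] .
 qed
 have 2: "partial_deriv i (%\<xi>. (?H \<xi> h \<bullet> (\<xi> - \<xi>\<^sub>0)) / ?N) \<xi>\<^sub>0 = (?H \<xi>\<^sub>0 h \<bullet> axis i 1) / ?N" for i h
 proof -
  have dr: "((%\<xi>. reg_norm e (shear w \<xi>)) has_derivative (%h. (shear w \<xi>\<^sub>0 \<bullet> ((1 + w $ None) *\<^sub>R h)) / reg_norm e (shear w \<xi>\<^sub>0))) (at \<xi>\<^sub>0)"
   by (rule has_derivative_compose[OF shear_has_derivative_right reg_norm_has_derivative[OF assms(1)]])
  have "(%\<xi>. ?H \<xi> h) differentiable at \<xi>\<^sub>0"
   unfolding reg_hess_def
   using differentiableI[OF dr] differentiableI[OF shear_has_derivative_right[of w \<xi>\<^sub>0]] reg_norm_pos[OF assms(1), of "shear w \<xi>\<^sub>0"]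
   by (intro differentiable_diff differentiable_scaleR differentiable_divide differentiable_inner
     differentiable_inverse differentiable_power) auto
  then obtain F' where F': "((%\<xi>. ?H \<xi> h) has_derivative F') (at \<xi>\<^sub>0)"
   by (auto simp: differentiable_def)
  have "((%\<xi>. (?H \<xi> h \<bullet> (\<xi> - \<xi>\<^sub>0)) / ?N) has_derivative (%k. (?H \<xi>\<^sub>0 h \<bullet> k) / ?N)) (at \<xi>\<^sub>0)"
   unfolding divide_inverse
   by (rule has_derivative_eq_rhs, (rule derivative_intros F')+) auto
  from partial_deriv_eq[OF this, of i] show ?thesis by simp
 qed
 show ?thesis
  unfolding curvature_matrix_def hessian_def 1[abs_def] 2 ..
qed

lemma eigenvalue_curvature_phase:
 assumes "e > 0" "0 < 1 + w $ None" "eigenvalue (curvature_matrix (phase e) w \<xi>) c"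
 shows "0 < c"
proof -
 let ?A = "curvature_matrix (phase e) w \<xi>" and ?N = "norm (axis None (1::real) - emb \<xi>)"
 let ?H = "reg_hess e (shear w \<xi>)"
 obtain x where x: "x \<noteq> 0" "?A *v x = c *\<^sub>R x" using assms(3) by (auto simp: eigenvalue_def)
 have N: "?N > 0" using axis_minus_emb_nonzero by simp
 have "x = (\<Sum>j\<in>UNIV. (x $ j) *\<^sub>R axis j 1)"
  using basis_expansion[of x] by (simp add: scalar_mult_eq_scaleR)
 then have Hx: "?H x = (\<Sum>j\<in>UNIV. (x $ j) *\<^sub>R ?H (axis j 1))"
  using linear_sum[OF linear_reg_hess, of e "shear w \<xi>" "%j. (x $ j) *\<^sub>R axis j 1" UNIV]
  by (simp add: linear_scale[OF linear_reg_hess])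
 have "?A *v x = ?H x /\<^sub>R ?N"
  unfolding Hx
  by (auto simp: vec_eq_iff curvature_matrix_phase[OF assms(1,2)] matrix_vector_mult_def inner_axis
    sum_distrib_left divide_inverse mult_ac intro!: sum.cong)
 then have "c * (x \<bullet> x) = (?H x \<bullet> x) / ?N"
  using x(2) by (metis divide_inverse inner_scaleR_left mult.commute)
 moreover have "?H x \<bullet> x > 0" by (rule reg_hess_inner_pos[OF assms(1) x(1)])
 ultimately have "c * (x \<bullet> x) > 0" using N by simp
 then show ?thesis using x(1) by (metis inner_gt_zero_iff zero_less_mult_pos2)
qed

lemma det_curvature_phase:
 assumes "e > 0" "0 < 1 + w $ None"
 shows "det (curvature_matrix (phase e) w \<xi>) \<noteq> 0"
proof -
 let ?A = "curvature_matrix (phase e) w \<xi>"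
 have "x = 0" if "?A *v x = 0" for x
 proof (rule ccontr)
  assume "x \<noteq> 0"
  then have "eigenvalue ?A 0" using that by (auto simp: eigenvalue_def)
  then show False using eigenvalue_curvature_phase[OF assms] by fastforce
 qed
 then have "invertible ?A"
  using matrix_left_invertible_ker[of ?A] invertible_left_inverse by blast
 then show ?thesis by (simp add: invertible_det_nz)
qed

lemma unit_ball_None: "w \<in> ball 0 1 ==> 0 < 1 + w $ None" for w :: "real^('m::finite option)"
 using component_le_norm_cart[of w None] by (simp add: abs_le_iff)

lemma rank_condition_phase:
 assumes "e > 0"
 shows "rank_condition (phase e :: ('m::finite) phase_space => real)"
proof -
 have "rank (mixed_hessian (phase e) w \<xi>) = CARD('m)" if w: "0 < 1 + w $ None" for w and \<xi> :: "real^'m"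
 proof -
  let ?M = "mixed_hessian (phase e) w \<xi>"
  have "x = 0" if x: "transpose ?M *v x = 0" for x
  proof -
   let ?H = "reg_hess e (shear w \<xi>)"
   have xs: "x = (\<Sum>j\<in>UNIV. (x $ j) *\<^sub>R axis j 1)"
    using basis_expansion[of x] by (simp add: scalar_mult_eq_scaleR)
   then have Hx: "?H x = (\<Sum>j\<in>UNIV. (x $ j) *\<^sub>R ?H (axis j 1))"
    using linear_sum[OF linear_reg_hess, of e "shear w \<xi>" "%j. (x $ j) *\<^sub>R axis j 1" UNIV]
    by (simp add: linear_scale[OF linear_reg_hess])
   have "(transpose ?M *v x) $ Some k = (?H x) $ k" for k
    unfolding Hx
    by (simp add: matrix_vector_mult_def transpose_def mixed_hessian_phase[OF assms w] mult.commute)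
   then have "?H x = 0" using x by (simp add: vec_eq_iff)
   then show ?thesis using reg_hess_inner_pos[OF assms, of x "shear w \<xi>"] by force
  qed
  then have "inj ((*v) (transpose ?M))"
   by (metis matrix_left_invertible_ker matrix_left_invertible_injective)
  then have "rank (transpose ?M) = CARD('m)" by (simp add: full_rank_injective)
  then show ?thesis by (simp add: rank_transpose)
 qed
 then show ?thesis
  using unit_ball_None[where 'm='m] by (auto simp: rank_condition_def unit_balls_def)
qed

lemma straight_condition_phase:
 assumes "e > 0"
 shows "straight_condition (phase e)"
 unfolding straight_condition_def using G_phase[OF assms unit_ball_None] by metis

lemma smooth_on_phase:
 fixes S :: "('m::finite) phase_space set"
 assumes "e > 0" "open S" "!!z. z \<in> S ==> 0 < 1 + fst z $ None"
 shows "smooth_on (phase e) S"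
proof -
 have b1: "bounded_linear (%z::'m phase_space. fst z $ i)" for i
  by (rule bounded_linear_compose[OF bounded_linear_vec_nth bounded_linear_fst])
 have b2: "bounded_linear (%z::'m phase_space. snd z $ i)" for i
  by (rule bounded_linear_compose[OF bounded_linear_vec_nth bounded_linear_snd])
 have sq: "smooth_on (%z::'m phase_space. (\<Sum>j\<in>UNIV. (fst z $ Some j + (1 + fst z $ None) * snd z $ j)^2) + e\<^sup>2) S"
  by (intro smooth_on_add smooth_on_sum smooth_on_power smooth_on_mult smooth_on_const assms(2)
    smooth_on_bounded_linear b1 b2)
 have pos: "(%z::'m phase_space. (\<Sum>j\<in>UNIV. (fst z $ Some j + (1 + fst z $ None) * snd z $ j)^2) + e\<^sup>2) ` S \<subseteq> {0<..}"
  using assms(1) by (auto intro!: add_nonneg_pos sum_nonneg)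
 have r: "smooth_on (%z::'m phase_space. sqrt ((\<Sum>j\<in>UNIV. (fst z $ Some j + (1 + fst z $ None) * snd z $ j)^2) + e\<^sup>2)) S"
  by (rule smooth_on_compose_real[OF assms(2) smooth_on_sqrt[of "{0<..}"] sq pos]) auto
 have "smooth_on (%z::'m phase_space. sqrt ((\<Sum>j\<in>UNIV. (fst z $ Some j + (1 + fst z $ None) * snd z $ j)^2) + e\<^sup>2) / (1 + fst z $ None)) S"
  by (intro smooth_on_divide r assms(2) smooth_on_add smooth_on_const smooth_on_bounded_linear b1)
    (use assms(3) in force)
 then show ?thesis
  by (simp add: phase_def[abs_def] reg_norm_def shear_def inner_vec_def power2_eq_square)
qed

lemma hormander_phase:
 fixes a :: "('m::finite) phase_space => real"
 assumes "e > 0" "amplitude a"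
 shows "hormander_type a (phase e)" "convex_condition a (phase e)"
proof -
 have u: "0 < 1 + w $ None" if "(w,\<xi>) \<in> unit_balls" for w and \<xi> :: "real^'m"
  using that unit_ball_None by (auto simp: unit_balls_def)
 have s: "supp a \<subseteq> unit_balls" using assms(2) by (simp add: amplitude_def)
 have "open (unit_balls :: 'm phase_space set)" by (simp add: unit_balls_def open_Times)
 then have "smooth_on (phase e) (unit_balls :: 'm phase_space set)"
  by (intro smooth_on_phase assms(1)) (use u in auto)
 then show "hormander_type a (phase e)"
  using assms rank_condition_phase[OF assms(1)] det_curvature_phase[OF assms(1) u] s
  by (auto simp: hormander_type_def nondegeneracy_condition_def)
 show "convex_condition a (phase e)"
  using eigenvalue_curvature_phase[OF assms(1) u] s by (auto simp: convex_condition_def)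
qed

section \<open>The amplitude\<close>

text \<open>A projective map. It turns the lines of direction \<open>(1, - \<xi>)\<close> into the rays issuing from \<open>- emb \<xi>\<close>.\<close>
definition straighten :: "real => real ^ ('m::finite option) => real ^ ('m option)" where
 "straighten e w = (\<chi> i. (case i of None => e | Some k => w $ Some k) / (1 + w $ None))"

text \<open>This factor is undone when damping is added: \<open>exp (- \<sigma> r)\<close> divided by it is, in the variable \<open>r - 1/2\<close>, a
 power times an exponential, which has an explicit Fourier transform.\<close>
definition weight :: "nat => real => real" where
 "weight N r = exp r * inverse (r - 1/2) ^ N"

definition shell_kernel :: "nat => real ^ ('m::finite option) => real" where
 "shell_kernel N h = box_shell None h * weight N (norm h)"

definition window :: "real ^ ('m::finite) => real" where
 "window \<xi> = (\<Prod>k\<in>UNIV. plateau (3 * real CARD('m option) * \<xi> $ k))"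

definition amp :: "real => nat => ('m::finite) phase_space => real" where
 "amp e N z = shell_kernel N (straighten e (fst z) + emb (snd z)) * window (snd z)"

lemma norm_straighten:
 assumes "0 < 1 + w $ None"
 shows "norm (straighten e w + emb \<xi>) = phase e (w, \<xi>)"
proof -
 let ?s = "1 + w $ None"
 have "(norm (straighten e w + emb \<xi>))\<^sup>2 = (e / ?s)\<^sup>2 + (\<Sum>k\<in>UNIV. (w $ Some k / ?s + \<xi> $ k)\<^sup>2)"
  unfolding power2_norm_eq_inner inner_option by (simp add: straighten_def power2_eq_square)
 also have "(\<Sum>k\<in>UNIV. (w $ Some k / ?s + \<xi> $ k)\<^sup>2) = (\<Sum>k\<in>UNIV. (w $ Some k + ?s * \<xi> $ k)\<^sup>2) / ?s\<^sup>2"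
  unfolding sum_divide_distrib
 proof (rule sum.cong[OF refl])
  fix k
  have "w $ Some k / ?s + \<xi> $ k = (w $ Some k + ?s * \<xi> $ k) / ?s"
   using assms by (simp add: add_divide_distrib)
  then show "(w $ Some k / ?s + \<xi> $ k)\<^sup>2 = (w $ Some k + ?s * \<xi> $ k)\<^sup>2 / ?s\<^sup>2"
   by (simp add: power_divide)
 qed
 also have "(e / ?s)\<^sup>2 + ... = (phase e (w, \<xi>))\<^sup>2"
  unfolding phase_def fst_conv snd_conv power_divide reg_norm_sq
  by (simp add: inner_vec_def shear_def power2_eq_square add_divide_distrib[symmetric] add.commute)
 finally show ?thesis
  using assms by (intro power2_eq_imp_eq[of _ "phase e (w, \<xi>)"])
    (auto simp: phase_def reg_norm_def intro!: divide_nonneg_pos add_nonneg_nonneg)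
qed

lemma weight_nonneg: "1 < r ==> 0 <= weight N r"
 by (simp add: weight_def)

lemma box_shell_nz:
 assumes "box_shell i h \<noteq> 0"
 shows "1 < h $ i" "h $ i < 2" "!!j. \<bar>h $ j\<bar> < 2"
proof -
 have s: "shell (h $ i) \<noteq> 0" "(\<Prod>j\<in>UNIV - {i}. plateau (h $ j)) \<noteq> 0"
  using assms by (auto simp: box_shell_def)
 show 1: "1 < h $ i" "h $ i < 2" using shell_eq_0[of "h $ i"] s(1) by force+
 show "\<bar>h $ j\<bar> < 2" for j
 proof (cases "j = i")
  case False
  then have "plateau (h $ j) \<noteq> 0" using s(2) by auto
  then show ?thesis using plateau_eq_0[of "h $ j"] by force
 qed (use 1 in auto)
qed

lemma shell_kernel_nz:
 assumes "shell_kernel N h \<noteq> 0"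
 shows "1 < h $ None" "h $ None < 2" "!!j. \<bar>h $ j\<bar> < 2" "1 < norm h"
proof -
 have "box_shell None h \<noteq> 0" using assms by (auto simp: shell_kernel_def)
 note 1 = box_shell_nz[OF this]
 show "1 < h $ None" "h $ None < 2" "!!j. \<bar>h $ j\<bar> < 2" by (fact 1)+
 show "1 < norm h" using 1(1) component_le_norm_cart[of h None] by linarith
qed

lemma shell_kernel_nonneg: "0 <= shell_kernel N h"
 using shell_kernel_nz(4)[of N h] box_shell_nonneg[of None h] weight_nonneg[of "norm h" N]
 by (cases "shell_kernel N h = 0") (auto simp: shell_kernel_def)

lemma window_nonneg: "0 <= window \<xi>"
 by (simp add: window_def plateau_nonneg prod_nonneg)

lemma window_nz:
 fixes \<xi> :: "real ^ ('m::finite)"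
 assumes "window \<xi> \<noteq> 0"
 shows "\<bar>\<xi> $ k\<bar> <= 2 / (3 * real CARD('m option))" "norm \<xi> <= 2/3"
proof -
 let ?n = "real CARD('m option)"
 have n: "?n > 0" by simp
 show 1: "\<bar>\<xi> $ k\<bar> <= 2 / (3 * ?n)" for k
 proof -
  have "plateau (3 * ?n * \<xi> $ k) \<noteq> 0" using assms by (auto simp: window_def)
  then have "\<bar>3 * ?n * \<xi> $ k\<bar> < 2" using plateau_eq_0 by force
  moreover have "\<bar>x\<bar> <= 2 / (3 * r)" if "\<bar>3 * r * x\<bar> < 2" "0 < r" for r x :: real
   using that by (simp add: abs_mult field_simps)
  ultimately show ?thesis using n by blast
 qed
 have "norm \<xi> <= (\<Sum>k\<in>UNIV. \<bar>\<xi> $ k\<bar>)" by (rule norm_le_l1_cart)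
 also have "... <= (\<Sum>k\<in>(UNIV::'m set). 2 / (3 * ?n))" by (intro sum_mono 1)
 also have "... <= 2/3" using n by (simp add: field_simps)
 finally show "norm \<xi> <= 2/3" .
qed

text \<open>Since \<open>1 < e / (1 + w $ None) < 2\<close> on the support, a small \<open>e\<close> forces \<open>w\<close> close to \<open>- axis None 1\<close>, but at a
 distance from it of order \<open>e\<close>. This keeps the support inside the open unit balls.\<close>
lemma amp_nz:
 fixes z :: "('m::finite) phase_space"
 assumes "0 < e" "e * (9 * real CARD('m option)) <= 1" "amp e N z \<noteq> 0"
 shows "e / 2 < 1 + fst z $ None" "1 + fst z $ None < e"
  "norm (fst z) <= sqrt (1 - e / 2)" "norm (snd z) <= 2/3"
proof -
 let ?n = "real CARD('m option)" and ?s = "1 + fst z $ None"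
 have k: "shell_kernel N (straighten e (fst z) + emb (snd z)) \<noteq> 0" and w: "window (snd z) \<noteq> 0"
  using assms(3) by (auto simp: amp_def)
 note k' = shell_kernel_nz[OF k] and w' = window_nz[OF w]
 show "norm (snd z) <= 2/3" by (fact w'(2))
 have t: "1 < e / ?s" "e / ?s < 2" using k'(1,2) by (simp_all add: straighten_def)
 have s: "0 < ?s" using t(1) assms(1) by (metis less_trans zero_less_divide_iff zero_less_one not_less_iff_gr_or_eq)
 show s1: "e / 2 < ?s" "?s < e" using t s by (simp_all add: field_simps)
 have c: "\<bar>fst z $ Some j\<bar> <= 3 * ?s" for j
 proof -
  have "\<bar>fst z $ Some j / ?s + snd z $ j\<bar> < 2" using k'(3)[of "Some j"] by (simp add: straighten_def)
  moreover have "\<bar>snd z $ j\<bar> <= 1"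
  proof -
   have "2 / (3 * ?n) <= 1" by (simp add: field_simps)
   then show ?thesis using w'(1)[of j] by linarith
  qed
  ultimately have "\<bar>fst z $ Some j / ?s\<bar> <= 3" by linarith
  then show ?thesis using s by (simp add: abs_divide field_simps)
 qed
 have "(norm (fst z))\<^sup>2 = (?s - 1)\<^sup>2 + (\<Sum>j\<in>UNIV. (fst z $ Some j)\<^sup>2)"
  unfolding power2_norm_eq_inner inner_option by (simp add: power2_eq_square)
 also have "(\<Sum>j\<in>UNIV. (fst z $ Some j)\<^sup>2) <= (\<Sum>j\<in>(UNIV::'m set). (3 * ?s)\<^sup>2)"
  using c s by (intro sum_mono) (metis abs_le_square_iff abs_of_pos mult_pos_pos zero_less_numeral)
 also have "... = (?n - 1) * (9 * ?s\<^sup>2)" by (simp only: sum_constant power_mult_distrib) simp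
 also have "(?s - 1)\<^sup>2 + (?n - 1) * (9 * ?s\<^sup>2) = 1 - 2 * ?s - 8 * ?s\<^sup>2 + ?s * (9 * ?n * ?s)"
  by (simp add: power2_eq_square algebra_simps)
 also have "... <= 1 - 2 * ?s + ?s * 1"
 proof -
  have "9 * ?n * ?s <= 9 * ?n * e" using s1 by (intro mult_left_mono) auto
  also have "... <= 1" using assms(2) by (simp only: mult_ac)
  finally have "?s * (9 * ?n * ?s) <= ?s * 1" using s by (intro mult_left_mono) auto
  then show ?thesis using zero_le_power2[of ?s] by linarith
 qed
 also have "... <= 1 - e / 2" using s1 by simp
 finally show "norm (fst z) <= sqrt (1 - e / 2)" using real_le_rsqrt by simp
qed

lemma smooth_on_straighten_nth:
 fixes S :: "('m::finite) phase_space set"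
 assumes "open S" "!!z. z \<in> S ==> 0 < 1 + fst z $ None"
 shows "smooth_on (%z. (straighten e (fst z) + emb (snd z)) $ i) S"
proof -
 have b1: "bounded_linear (%z::'m phase_space. fst z $ i)" for i
  by (rule bounded_linear_compose[OF bounded_linear_vec_nth bounded_linear_fst])
 have b2: "bounded_linear (%z::'m phase_space. snd z $ i)" for i
  by (rule bounded_linear_compose[OF bounded_linear_vec_nth bounded_linear_snd])
 have nz: "1 + fst z $ None \<noteq> 0" if "z \<in> S" for z using assms(2)[OF that] by linarith
 show ?thesis
 proof (cases i)
  case None
  have "smooth_on (%z::'m phase_space. e / (1 + fst z $ None)) S"
   by (rule smooth_on_divide[OF assms(1) smooth_on_const[OF assms(1)]
      smooth_on_add[OF assms(1) smooth_on_const[OF assms(1)] smooth_on_bounded_linear[OF assms(1) b1]] nz])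
  then show ?thesis by (simp add: None straighten_def)
 next
  case (Some k)
  have "smooth_on (%z::'m phase_space. fst z $ Some k / (1 + fst z $ None) + snd z $ k) S"
   by (rule smooth_on_add[OF assms(1) smooth_on_divide[OF assms(1) smooth_on_bounded_linear[OF assms(1) b1]
      smooth_on_add[OF assms(1) smooth_on_const[OF assms(1)] smooth_on_bounded_linear[OF assms(1) b1]] nz]
      smooth_on_bounded_linear[OF assms(1) b2]])
  then show ?thesis by (simp add: Some straighten_def)
 qed
qed

lemma amplitude_amp:
 fixes e :: real
 assumes e: "0 < e" "e * (9 * real CARD('m::finite option)) <= 1"
 shows "amplitude (amp e N :: 'm phase_space => real)"
proof -
 let ?a = "amp e N :: 'm phase_space => real"
 define S where "S = {z :: 'm phase_space. 0 < 1 + fst z $ None \<and> 1 + fst z $ None < 2 * e}"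
 define T where "T = {z :: 'm phase_space. 1 + fst z $ None < e / 2} \<union> {z. e < 1 + fst z $ None}"
 have oS: "open S" unfolding S_def by (intro open_Collect_conj open_Collect_less continuous_intros)
 have oT: "open T" unfolding T_def by (intro open_Un open_Collect_less continuous_intros)
 have ST: "S \<union> T = UNIV" using e(1) by (auto simp: S_def T_def)
 have "smooth_on (%z. 0) T" by (rule smooth_on_const[OF oT])
 then have "smooth_on ?a T"
  by (rule smooth_on_cong[OF oT, rotated]) (use amp_nz(1,2)[OF e] in \<open>force simp: T_def\<close>)
 moreover have "smooth_on ?a S"
 proof -
  have pos: "0 < 1 + fst z $ None" if "z \<in> S" for z using that by (simp add: S_def)
  have ph: "phase e z > 1/2" if "z \<in> S" for z
  proof -
   have "1/2 < e / (1 + fst z $ None)" using that by (simp add: S_def field_simps)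
   also have "... = (straighten e (fst z) + emb (snd z)) $ None" by (simp add: straighten_def)
   also have "... <= norm (straighten e (fst z) + emb (snd z))"
    using component_le_norm_cart abs_le_D1 by blast
   also have "... = phase e z" using norm_straighten[OF pos[OF that]] by simp
   finally show ?thesis .
  qed
  note comp = smooth_on_straighten_nth[OF oS pos, where e=e]
  have box: "smooth_on (%z. box_shell None (straighten e (fst z) + emb (snd z))) S"
   unfolding box_shell_def
   by (intro smooth_on_mult smooth_on_prod oS smooth_on_compose_real[OF oS smooth_on_shell comp]
     smooth_on_compose_real[OF oS smooth_on_plateau comp]) auto
  have p: "smooth_on (phase e) S" by (rule smooth_on_phase[OF e(1) oS pos])
  have "smooth_on (%z. weight N (phase e z)) S"
   unfolding weight_def
   by (intro smooth_on_mult smooth_on_power oS smooth_on_compose_real[OF oS smooth_on_exp[OF open_UNIV] p]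
     smooth_on_inverse_comp smooth_on_diff smooth_on_const p) (use ph in force)+
  then have wt: "smooth_on (%z. weight N (norm (straighten e (fst z) + emb (snd z)))) S"
   by (rule smooth_on_cong[OF oS, rotated]) (use norm_straighten pos in force)
  have b2: "bounded_linear (%z::'m phase_space. snd z $ i)" for i
   by (rule bounded_linear_compose[OF bounded_linear_vec_nth bounded_linear_snd])
  have lin: "smooth_on (%z::'m phase_space. 3 * real CARD('m option) * snd z $ k) S" for k
   by (intro smooth_on_mult smooth_on_const oS smooth_on_bounded_linear b2)
  have win: "smooth_on (%z::'m phase_space. window (snd z)) S"
   unfolding window_def by (intro smooth_on_prod oS smooth_on_compose_real[OF oS smooth_on_plateau lin]) auto
  show ?thesis
   unfolding amp_def[abs_def] shell_kernel_def by (intro smooth_on_mult oS box wt win)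
 qed
 ultimately have sm: "smooth_on ?a UNIV"
  using smooth_on_Un[OF oS oT] ST by metis
 let ?K = "cball 0 (sqrt (1 - e / 2)) \<times> cball 0 (2/3) :: 'm phase_space set"
 have nz: "{z. ?a z \<noteq> 0} \<subseteq> ?K" using amp_nz(3,4)[OF e] by (auto simp: mem_Times_iff)
 have cK: "compact ?K" by (intro compact_Times) auto
 have sK: "supp ?a \<subseteq> ?K"
  unfolding supp_def by (rule closure_minimal[OF nz compact_imp_closed[OF cK]])
 have "compact (supp ?a)"
  using sK cK by (metis closed_closure compact_Int_closed inf.absorb_iff2 supp_def)
 moreover have "?K \<subseteq> unit_balls"
 proof -
  have "sqrt (1 - e / 2) < 1" using e(1) by simp
  then show ?thesis unfolding unit_balls_def by (intro Sigma_mono) (simp_all add: cball_subset_ball_iff)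
 qed
 moreover have "0 <= ?a z" for z by (simp add: amp_def shell_kernel_nonneg window_nonneg)
 ultimately show ?thesis using sm sK by (auto simp: amplitude_def test_function_def)
qed

section \<open>Changes of variables\<close>

lemma nn_integral_lborel_shift:
 fixes f :: "'a::euclidean_space => ennreal"
 assumes [measurable]: "f \<in> borel_measurable borel"
 shows "(\<integral>\<^sup>+x. f (c + x) \<partial>lborel) = (\<integral>\<^sup>+x. f x \<partial>lborel)"
 by (subst (2) lborel_distr_plus[symmetric, of c]) (simp add: nn_integral_distr)

lemma integral_lborel_shift:
 fixes f :: "'a::euclidean_space => 'b::{banach, second_countable_topology}"
 assumes [measurable]: "f \<in> borel_measurable borel"
 shows "(LINT x|lborel. f (c + x)) = (LINT x|lborel. f x)"
 by (subst (2) lborel_distr_plus[symmetric, of c]) (simp add: integral_distr)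

lemma nn_integral_lborel_scale:
 fixes f :: "'a::euclidean_space => ennreal"
 assumes [measurable]: "f \<in> borel_measurable borel" and "c \<noteq> 0"
 shows "(\<integral>\<^sup>+x. f x \<partial>lborel) = ennreal (\<bar>c\<bar> ^ DIM('a)) * (\<integral>\<^sup>+x. f (c *\<^sub>R x) \<partial>lborel)"
 by (subst lborel_affine[OF assms(2), of 0])
   (simp add: nn_integral_density nn_integral_distr nn_integral_cmult ennreal_power)

lemma integral_lborel_scale:
 fixes f :: "'a::euclidean_space => 'b::{banach, second_countable_topology}"
 assumes [measurable]: "f \<in> borel_measurable borel" and "c \<noteq> 0"
 shows "(LINT x|lborel. f x) = (\<bar>c\<bar> ^ DIM('a)) *\<^sub>R (LINT x|lborel. f (c *\<^sub>R x))"
 by (subst lborel_affine[OF assms(2), of 0])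
   (simp add: integral_density integral_distr ennreal_power)

lemma nn_integral_lborel_uminus:
 fixes f :: "'a::euclidean_space => ennreal"
 assumes "f \<in> borel_measurable borel"
 shows "(\<integral>\<^sup>+x. f (- x) \<partial>lborel) = (\<integral>\<^sup>+x. f x \<partial>lborel)"
 using nn_integral_lborel_scale[OF assms, of "-1"] by simp

lemma integral_lborel_uminus:
 fixes f :: "'a::euclidean_space => 'b::{banach, second_countable_topology}"
 assumes "f \<in> borel_measurable borel"
 shows "(LINT x|lborel. f (- x)) = (LINT x|lborel. f x)"
 using integral_lborel_scale[OF assms, of "-1"] by simp

lemma prod_Basis_cart: "(\<Prod>b\<in>Basis. (x::real^'k::finite) \<bullet> b) = (\<Prod>i\<in>UNIV. x $ i)"
proof -
 have B: "(Basis :: (real^'k) set) = range (%i. axis i 1)"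
  by (auto simp: Basis_vec_def)
 have inj: "inj (%i. axis i (1::real) :: real^'k)"
  by (auto simp: inj_def axis_eq_axis)
 have "(\<Prod>b\<in>Basis. x \<bullet> b) = (\<Prod>b\<in>range (%i. axis i 1). x \<bullet> b)" by (rule arg_cong[OF B])
 also have "... = (\<Prod>i\<in>UNIV. x \<bullet> axis i 1)" by (subst prod.reindex[OF inj]) (simp add: o_def)
 finally show ?thesis by (simp add: inner_axis)
qed

lemma le_inner_Basis_cart: "(\<forall>b\<in>Basis. (l::real^'k::finite) \<bullet> b <= u \<bullet> b) \<longleftrightarrow> (\<forall>i. l $ i <= u $ i)"
 by (auto simp: Basis_vec_def inner_axis)

lemma emeasure_lborel_box_cart:
 assumes "!!i. (l::real^'k::finite) $ i <= u $ i"
 shows "emeasure lborel (box l u) = (\<Prod>i\<in>UNIV. ennreal (u $ i - l $ i))"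
 using assms le_inner_Basis_cart[of l u]
 by (simp add: emeasure_lborel_box prod_Basis_cart prod_ennreal)

lemma lborel_eqI_cart:
 fixes M :: "(real^'k::finite) measure"
 assumes "!!l u. (!!i. l $ i <= u $ i) ==> emeasure M (box l u) = (\<Prod>i\<in>UNIV. ennreal (u $ i - l $ i))"
  and "sets M = sets borel"
 shows "M = lborel"
proof (rule lborel_eqI[symmetric])
 fix l u :: "real^'k" assume lu: "!!b. b \<in> Basis ==> l \<bullet> b <= u \<bullet> b"
 then have le: "!!i. l $ i <= u $ i" using le_inner_Basis_cart[of l u] by blast
 show "emeasure M (box l u) = (\<Prod>b\<in>Basis. (u - l) \<bullet> b)"
  unfolding assms(1)[OF le] prod_Basis_cart using le by (simp add: prod_ennreal)
qed (fact assms(2))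

lemma distr_lborel_permute:
 fixes \<pi> :: "'k::finite => 'k"
 assumes "bij \<pi>"
 shows "distr lborel borel (%x. \<chi> i. x $ \<pi> i) = (lborel :: (real^'k) measure)"
proof (rule lborel_eqI_cart)
 have [measurable]: "(%x::real^'k. \<chi> i. x $ \<pi> i) \<in> borel_measurable borel"
  by (intro borel_measurable_continuous_onI continuous_intros)
 fix l u :: "real^'k" assume le: "!!i. l $ i <= u $ i"
 have surj: "\<pi> (inv \<pi> i) = i" "inv \<pi> (\<pi> i) = i" for i
  using assms by (auto simp: bij_is_surj surj_f_inv_f bij_is_inj inv_f_f)
 have "(%x::real^'k. \<chi> i. x $ \<pi> i) -` box l u = box (\<chi> i. l $ inv \<pi> i) (\<chi> i. u $ inv \<pi> i)"
  by (auto simp: mem_box_cart surj) (metis surj(1,2))+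
 then have "emeasure (distr lborel borel (%x. \<chi> i. x $ \<pi> i)) (box l u)
   = (\<Prod>i\<in>UNIV. ennreal (u $ inv \<pi> i - l $ inv \<pi> i))"
  using le by (simp add: emeasure_distr emeasure_lborel_box_cart)
 also have "... = (\<Prod>i\<in>UNIV. ennreal (u $ i - l $ i))"
  by (rule prod.reindex_bij_betw[of "inv \<pi>" UNIV UNIV "%i. ennreal (u $ i - l $ i)"]) (use assms bij_imp_bij_inv in auto)
 finally show "emeasure (distr lborel borel (%x. \<chi> i. x $ \<pi> i)) (box l u) = (\<Prod>i\<in>UNIV. ennreal (u $ i - l $ i))" .
qed simp

lemma borel_measurable_emb [measurable]: "emb \<in> borel_measurable borel"
 by (intro borel_measurable_continuous_onI linear_continuous_on bounded_linear_emb)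

text \<open>Separates the coordinate \<open>None\<close> from the others, so that Tonelli's theorem applies to them.\<close>
lemma distr_lborel_option:
 "distr lborel borel (%(t, v). t *\<^sub>R axis None 1 + emb v) = (lborel :: (real^('m::finite option)) measure)"
proof (rule lborel_eqI_cart)
 fix l u :: "real^('m option)" assume le: "!!i. l $ i <= u $ i"
 let ?P = "%(t::real, v::real^'m). t *\<^sub>R axis None 1 + emb v"
 have [measurable]: "?P \<in> borel_measurable borel"
  unfolding case_prod_beta
  by (intro borel_measurable_continuous_onI continuous_intros bounded_linear.continuous_on[OF bounded_linear_emb])
 have "?P -` box l u = box (l $ None) (u $ None) \<times> box (\<chi> k. l $ Some k) (\<chi> k. u $ Some k)"
 proof (rule set_eqI)
  fix z :: "real \<times> (real^'m)"
  have "?P z \<in> box l u \<longleftrightarrow> (\<forall>i. l $ i < ?P z $ i \<and> ?P z $ i < u $ i)" by (simp add: mem_box_cart)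
  also have "... \<longleftrightarrow> (l $ None < fst z \<and> fst z < u $ None) \<and> (\<forall>k. l $ Some k < snd z $ k \<and> snd z $ k < u $ Some k)"
   by (cases z) (auto simp: split_option_all)
  also have "... \<longleftrightarrow> z \<in> box (l $ None) (u $ None) \<times> box (\<chi> k. l $ Some k) (\<chi> k. u $ Some k)"
   by (auto simp: mem_box_cart mem_Times_iff)
  finally show "z \<in> ?P -` box l u \<longleftrightarrow> z \<in> box (l $ None) (u $ None) \<times> box (\<chi> k. l $ Some k) (\<chi> k. u $ Some k)" by simp
 qed
 then have "emeasure (distr lborel borel ?P) (box l u)
   = emeasure lborel2 (box (l $ None) (u $ None) \<times> box (\<chi> k. l $ Some k) (\<chi> k. u $ Some k))"
  by (simp add: emeasure_distr lborel_prod)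
 also have "... = emeasure lborel (box (l $ None) (u $ None)) * emeasure lborel (box (\<chi> k. l $ Some k) (\<chi> k. u $ Some k))"
  by (rule lborel.emeasure_pair_measure_Times) auto
 also have "... = (\<Prod>i\<in>UNIV. ennreal (u $ i - l $ i))"
  using le by (simp add: emeasure_lborel_box_cart prod_option_UNIV)
 finally show "emeasure (distr lborel borel ?P) (box l u) = (\<Prod>i\<in>UNIV. ennreal (u $ i - l $ i))" .
qed simp

lemma nn_integral_lborel_option:
 fixes H :: "real^('m::finite option) => ennreal"
 assumes [measurable]: "H \<in> borel_measurable borel"
 shows "(\<integral>\<^sup>+x. H x \<partial>lborel) = (\<integral>\<^sup>+t. (\<integral>\<^sup>+v. H (t *\<^sub>R axis None 1 + emb v) \<partial>lborel) \<partial>lborel)"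
proof -
 have "(\<integral>\<^sup>+x. H x \<partial>lborel) = (\<integral>\<^sup>+z. H (fst z *\<^sub>R axis None 1 + emb (snd z)) \<partial>(lborel :: (real \<times> (real^'m)) measure))"
 proof (subst distr_lborel_option[symmetric], subst nn_integral_distr)
  show "(%(t, v). t *\<^sub>R axis None 1 + emb v :: real^('m option)) \<in> measurable lborel borel"
   unfolding case_prod_beta measurable_lborel2
   by (intro borel_measurable_continuous_onI continuous_intros bounded_linear.continuous_on[OF bounded_linear_emb])
 qed (simp_all add: case_prod_beta)
 also have "... = (\<integral>\<^sup>+t. (\<integral>\<^sup>+v. H (t *\<^sub>R axis None 1 + emb v) \<partial>lborel) \<partial>lborel)"
  unfolding lborel_prod[symmetric] by (subst lborel.nn_integral_fst[symmetric]) auto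
 finally show ?thesis .
qed

lemma borel_measurable_vec_lambda:
 fixes f :: "'x => 'k::finite => real"
 assumes "!!i. (%x. f x i) \<in> borel_measurable M"
 shows "(%x. \<chi> i. f x i) \<in> borel_measurable M"
proof (rule borel_measurable_euclidean_space[THEN iffD2], rule ballI)
 fix b :: "real^'k" assume "b \<in> Basis"
 then obtain i where "b = axis i 1" by (auto simp: Basis_vec_def)
 then show "(%x. (\<chi> i. f x i) \<bullet> b) \<in> borel_measurable M" using assms by (simp add: inner_axis)
qed

lemma borel_measurable_straighten [measurable]: "straighten e \<in> borel_measurable borel"
proof -
 have "(%w. (case i of None => e | Some k => w $ Some k) / (1 + w $ None)) \<in> borel_measurable borel" for i :: "'a option"
  by (cases i) (auto intro!: borel_measurable_divide borel_measurable_continuous_onI continuous_intros)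
 then show ?thesis unfolding straighten_def[abs_def] by (rule borel_measurable_vec_lambda)
qed

text \<open>Split off the first coordinate, scale the others, and substitute in one variable. The Jacobian is bounded
 because \<open>e / (1 + w $ None)\<close> stays between 1 and 2.\<close>
lemma nn_integral_straighten:
 fixes H :: "real^('m::finite option) => ennreal"
 assumes [measurable]: "H \<in> borel_measurable borel" and e: "0 < e"
 shows "(\<integral>\<^sup>+x. H x * indicator {x. 1 < x $ None \<and> x $ None < 2} x \<partial>lborel)
  <= ennreal ((2 / e) ^ CARD('m) * (4 / e)) *
   (\<integral>\<^sup>+w. H (straighten e w) * indicator {w. 0 < 1 + w $ None} w \<partial>lborel)"
proof -
 let ?P = "%t v. t *\<^sub>R axis None 1 + emb v :: real^('m option)"
 define F where "F s = (\<integral>\<^sup>+v. H (straighten e (?P s v)) \<partial>lborel)" for s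
 have F[measurable]: "F \<in> borel_measurable borel"
  unfolding F_def by measurable
 have m1[measurable]: "{x::real^('m option). 1 < x $ None \<and> x $ None < 2} \<in> sets borel"
  by (intro borel_open open_Collect_conj open_Collect_less continuous_intros)
 have m2[measurable]: "{w::real^('m option). 0 < 1 + w $ None} \<in> sets borel"
  by (intro borel_open open_Collect_less continuous_intros)
 have slice: "(\<integral>\<^sup>+v. H (?P t v) \<partial>lborel) <= ennreal ((2 / e) ^ CARD('m)) * F (e / t - 1)" if t: "1 < t" "t < 2" for t
 proof -
  have "?P t ((t / e) *\<^sub>R v) = straighten e (?P (e / t - 1) v)" for v
   using t e by (auto simp: option_vec_eq_iff straighten_def)
  then have "(\<integral>\<^sup>+v. H (?P t v) \<partial>lborel) = ennreal ((t / e) ^ CARD('m)) * F (e / t - 1)"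
   using t e by (subst nn_integral_lborel_scale[of _ "t / e"]) (auto simp: F_def)
  also have "... <= ennreal ((2 / e) ^ CARD('m)) * F (e / t - 1)"
   using t e by (intro mult_right_mono ennreal_leI power_mono divide_right_mono) auto
  finally show ?thesis .
 qed
 define g where "g y = - e / y - 1" for y
 have "(\<integral>\<^sup>+x. H x * indicator {x. 1 < x $ None \<and> x $ None < 2} x \<partial>lborel)
   = (\<integral>\<^sup>+t. (\<integral>\<^sup>+v. H (?P t v) \<partial>lborel) * indicator {1<..<2} t \<partial>lborel)"
  by (subst nn_integral_lborel_option) (auto intro!: nn_integral_cong simp: indicator_def)
 also have "... <= (\<integral>\<^sup>+t. ennreal ((2 / e) ^ CARD('m)) * (F (e / t - 1) * indicator {1..2} t) \<partial>lborel)"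
  by (intro nn_integral_mono) (use slice in \<open>auto simp: indicator_def\<close>)
 also have "... = ennreal ((2 / e) ^ CARD('m)) * (\<integral>\<^sup>+t. F (e / t - 1) * indicator {1..2} t \<partial>lborel)"
  by (rule nn_integral_cmult) measurable
 finally have A: "(\<integral>\<^sup>+x. H x * indicator {x. 1 < x $ None \<and> x $ None < 2} x \<partial>lborel)
  <= ennreal ((2 / e) ^ CARD('m)) * (\<integral>\<^sup>+t. F (e / t - 1) * indicator {1..2} t \<partial>lborel)" .
 have "(\<integral>\<^sup>+t. F (e / t - 1) * indicator {1..2} t \<partial>lborel) = (\<integral>\<^sup>+y. F (g y) * indicator {-2..-1} y \<partial>lborel)"
  by (subst nn_integral_real_affine[where c="-1" and t=0])
    (auto intro!: nn_integral_cong simp: indicator_def g_def)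
 also have "... <= (\<integral>\<^sup>+y. ennreal (4 / e) * (F (g y) * ennreal (e / y\<^sup>2) * indicator {-2..-1} y) \<partial>lborel)"
 proof (intro nn_integral_mono)
  fix y :: real
  show "F (g y) * indicator {-2..-1} y <= ennreal (4 / e) * (F (g y) * ennreal (e / y\<^sup>2) * indicator {-2..-1} y)"
  proof (cases "y \<in> {-2..-1}")
   case True
   have "y\<^sup>2 <= 2\<^sup>2" using True by (intro abs_le_square_iff[THEN iffD1]) auto
   moreover have "y\<^sup>2 > 0" using True by auto
   ultimately have "1 <= (4 / e) * (e / y\<^sup>2)" using e by (simp add: field_simps)
   then have "F (g y) * 1 <= F (g y) * ennreal ((4 / e) * (e / y\<^sup>2))"
    by (intro mult_left_mono) (simp_all add: ennreal_leI flip: ennreal_1)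
   also have "ennreal ((4 / e) * (e / y\<^sup>2)) = ennreal (4 / e) * ennreal (e / y\<^sup>2)"
    by (rule ennreal_mult) (use e in auto)
   finally show ?thesis using True by (simp add: mult_ac)
  qed simp
 qed
 also have "... = ennreal (4 / e) * (\<integral>\<^sup>+y. F (g y) * ennreal (e / y\<^sup>2) * indicator {-2..-1} y \<partial>lborel)"
  unfolding g_def by (rule nn_integral_cmult) measurable
 finally have B: "(\<integral>\<^sup>+t. F (e / t - 1) * indicator {1..2} t \<partial>lborel) <= ennreal (4 / e) * (\<integral>\<^sup>+y. F (g y) * ennreal (e / y\<^sup>2) * indicator {-2..-1} y \<partial>lborel)" .
 have "(\<integral>\<^sup>+y. F (g y) * ennreal (e / y\<^sup>2) * indicator {-2..-1} y \<partial>lborel)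
   = (\<integral>\<^sup>+s. F s * indicator {g (-2)..g (-1)} s \<partial>lborel)"
 proof (rule nn_integral_substitution_aux[symmetric])
  show "(g has_real_derivative e / y\<^sup>2) (at y)" if "y \<in> {-2..-1}" for y
   unfolding g_def using that by (auto intro!: derivative_eq_intros simp: power2_eq_square)
  show "continuous_on {-2..-1} (%y. e / y\<^sup>2)" by (intro continuous_intros) auto
 qed (use e in auto)
 also have "... <= (\<integral>\<^sup>+s. F s * indicator {-1<..} s \<partial>lborel)"
  by (intro nn_integral_mono) (use e in \<open>auto simp: indicator_def g_def\<close>)
 also have "... = (\<integral>\<^sup>+w. H (straighten e w) * indicator {w. 0 < 1 + w $ None} w \<partial>lborel)"
  by (subst nn_integral_lborel_option)
    (auto intro!: nn_integral_cong simp: indicator_def F_def)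
 finally have C: "(\<integral>\<^sup>+y. F (g y) * ennreal (e / y\<^sup>2) * indicator {-2..-1} y \<partial>lborel)
  <= (\<integral>\<^sup>+w. H (straighten e w) * indicator {w. 0 < 1 + w $ None} w \<partial>lborel)" .
 have "ennreal ((2 / e) ^ CARD('m) * (4 / e)) = ennreal ((2 / e) ^ CARD('m)) * ennreal (4 / e)"
  by (rule ennreal_mult) (use e in auto)
 then show ?thesis
  using order_trans[OF A mult_left_mono[OF order_trans[OF B mult_left_mono[OF C]]]] by (simp add: mult.assoc)
qed

section \<open>Bilinear forms on bounded functions of bounded support\<close>

lemma Holder_inequality_real:
 fixes u v :: "'a => real"
 assumes pq: "1 < p" "1 < q" "1 / p + 1 / q = 1"
  and [measurable]: "u \<in> borel_measurable M" "v \<in> borel_measurable M"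
  and nn: "!!x. 0 <= u x" "!!x. 0 <= v x"
  and iu: "integrable M (%x. u x powr p)" and iv: "integrable M (%x. v x powr q)"
 shows "integrable M (%x. u x * v x)" (is ?I)
  and "(LINT x|M. u x * v x) <= (LINT x|M. u x powr p) powr (1 / p) * (LINT x|M. v x powr q) powr (1 / q)" (is ?L)
proof -
 let ?A = "LINT x|M. u x powr p" and ?B = "LINT x|M. v x powr q"
 have Y: "u x * v x <= u x powr p / p + v x powr q / q" for x
  by (rule Youngs_inequality[OF pq nn])
 show I: ?I
  by (rule integrable_dominated[of M "%x. u x powr p / p + v x powr q / q"])
    (use iu iv Y nn pq in \<open>auto simp: abs_mult intro!: AE_I2\<close>)
 have A0: "?A \<ge> 0" "?B \<ge> 0" by (simp_all add: integral_nonneg)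
 show ?L
 proof (cases "?A = 0 \<or> ?B = 0")
  case True
  have "AE x in M. u x * v x = 0"
  proof (cases "?A = 0")
   case True
   then have "AE x in M. u x powr p = 0"
    using integral_nonneg_eq_0_iff_AE[OF iu] by simp
   then show ?thesis by eventually_elim (use pq in auto)
  next
   case False
   then have "AE x in M. v x powr q = 0"
    using integral_nonneg_eq_0_iff_AE[OF iv] \<open>?A = 0 \<or> ?B = 0\<close> by simp
   then show ?thesis by eventually_elim (use pq in auto)
  qed
  then have "(LINT x|M. u x * v x) = 0" by (simp add: integral_eq_zero_AE)
  then show ?thesis using A0 by simp
 next
  case False
  then have pos: "?A > 0" "?B > 0" using A0 by (simp_all add: less_le)
  let ?a = "?A powr (1 / p)" and ?b = "?B powr (1 / q)"
  have ab: "?a > 0" "?b > 0" using pos by auto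
  have pw: "?a powr p = ?A" "?b powr q = ?B" using pos pq by (simp_all add: powr_powr)
  have "(u x / ?a) * (v x / ?b) <= u x powr p / (p * ?A) + v x powr q / (q * ?B)" for x
  proof -
   have "(u x / ?a) * (v x / ?b) <= (u x / ?a) powr p / p + (v x / ?b) powr q / q"
    by (rule Youngs_inequality[OF pq]) (use nn ab in auto)
   also have "(u x / ?a) powr p = u x powr p / ?A" using nn ab pw by (simp add: powr_divide)
   also have "(v x / ?b) powr q = v x powr q / ?B" using nn ab pw by (simp add: powr_divide)
   finally show ?thesis by (simp add: mult.commute)
  qed
  then have "(LINT x|M. (u x / ?a) * (v x / ?b)) <= (LINT x|M. u x powr p / (p * ?A) + v x powr q / (q * ?B))"
   using I iu iv by (intro integral_mono) (auto simp: )
  also have "... = ?A / (p * ?A) + ?B / (q * ?B)" using iu iv by simp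
  also have "... = 1" using pos pq by simp
  finally have "(LINT x|M. u x * v x) / (?a * ?b) <= 1" by simp
  then show ?thesis using ab by (simp add: field_simps)
 qed
qed

text \<open>Bounded Borel functions of bounded support: integrability and Fubini hold for all expressions formed
 from them, and they suffice for duality.\<close>
definition nice :: "('a::euclidean_space => 'b::{banach, second_countable_topology}) => bool" where
 "nice f \<longleftrightarrow> f \<in> borel_measurable borel \<and> (\<exists>M. \<forall>x. norm (f x) <= M) \<and> (\<exists>R. \<forall>x. R < norm x --> f x = 0)"

lemma niceI:
 assumes "f \<in> borel_measurable borel" "!!x. norm (f x) <= M" "!!x. R < norm x ==> f x = 0"
 shows "nice f"
 using assms by (auto simp: nice_def)

lemma niceE:
 assumes "nice f"
 obtains M R where "0 <= M" "0 <= R" "!!x. norm (f x) <= M" "!!x. R < norm x ==> f x = 0"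
proof -
 obtain M R where 1: "!!x. norm (f x) <= M" "!!x. R < norm x ==> f x = 0"
  using assms by (auto simp: nice_def)
 have "0 <= M" using 1(1)[of 0] norm_ge_zero order_trans by blast
 then show ?thesis using that[of M "max R 0"] 1 by auto
qed

lemma nice_measurable [measurable_dest]: "nice f ==> f \<in> borel_measurable borel"
 by (simp add: nice_def)

lemma nice_integrable:
 assumes "nice f" shows "integrable lborel f"
proof -
 obtain M R where 1: "0 <= M" "0 <= R" "!!x. norm (f x) <= M" "!!x. R < norm x ==> f x = 0"
  using niceE[OF assms] by metis
 have "integrable lborel (%x. M * indicator (cball 0 R) x)"
  by (intro integrable_mult_right integrable_real_indicator emeasure_bounded_finite bounded_cball) simp
 then show ?thesis
  by (rule integrable_dominated)
    (use 1 nice_measurable[OF assms] in \<open>force simp: indicator_def intro!: AE_I2\<close>)+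
qed

lemma nice_dominated:
 assumes "nice f" "g \<in> borel_measurable borel" "!!x. norm (g x) <= C * norm (f x)" "0 <= C"
 shows "nice g"
proof -
 obtain M R where 1: "0 <= M" "0 <= R" "!!x. norm (f x) <= M" "!!x. R < norm x ==> f x = 0"
  using niceE[OF assms(1)] by metis
 have "norm (g x) <= C * M" for x
  using assms(3)[of x] mult_left_mono[OF 1(3) assms(4)] order_trans by blast
 moreover have "g x = 0" if "R < norm x" for x
  using assms(3)[of x] 1(4)[OF that] by simp
 ultimately show ?thesis using assms(2) by (intro niceI)
qed

lemma nice_mult:
 fixes f g :: "'a::euclidean_space => 'b::{banach, second_countable_topology, real_normed_div_algebra}"
 assumes "nice f" "g \<in> borel_measurable borel" "!!x. norm (g x) <= C"
 shows "nice (%x. f x * g x)" "nice (%x. g x * f x)"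
proof -
 have C: "0 <= C" using assms(3)[of 0] norm_ge_zero order_trans by blast
 note [measurable] = nice_measurable[OF assms(1)] assms(2)
 have b: "norm (f x) * norm (g x) <= C * norm (f x)" for x
  using mult_right_mono[OF assms(3)[of x] norm_ge_zero[of "f x"]] by (simp add: mult.commute)
 show "nice (%x. f x * g x)" by (rule nice_dominated[OF assms(1) _ _ C]) (use b in \<open>auto simp: norm_mult\<close>)
 show "nice (%x. g x * f x)" by (rule nice_dominated[OF assms(1) _ _ C]) (use b in \<open>auto simp: norm_mult mult.commute\<close>)
qed

lemma nice_norm_powr:
 assumes "nice f" "0 < p" shows "nice (%x. norm (f x) powr p)"
proof -
 obtain M R where 1: "0 <= M" "0 <= R" "!!x. norm (f x) <= M" "!!x. R < norm x ==> f x = 0"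
  using niceE[OF assms(1)] by metis
 note [measurable] = nice_measurable[OF assms(1)]
 show ?thesis
  by (rule niceI[where M="M powr p" and R=R]) (use 1 assms(2) in \<open>auto intro!: powr_mono2\<close>)
qed

lemma nice_norm: "nice f ==> nice (%x. norm (f x))"
 by (rule nice_dominated[of f _ 1]) (auto simp: nice_measurable)

lemma nice_compose_affine:
 fixes f :: "'a::euclidean_space => 'b::{banach, second_countable_topology}"
 assumes "nice f" "c \<noteq> 0" shows "nice (%x. f (t + c *\<^sub>R x))"
proof -
 obtain M R where 1: "0 <= M" "0 <= R" "!!x. norm (f x) <= M" "!!x. R < norm x ==> f x = 0"
  using niceE[OF assms(1)] by metis
 note [measurable] = nice_measurable[OF assms(1)]
 have "f (t + c *\<^sub>R x) = 0" if "(R + norm t) / \<bar>c\<bar> < norm x" for x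
 proof (rule 1(4))
  have "R + norm t < norm (c *\<^sub>R x)" using that assms(2) by (simp add: field_simps)
  also have "norm (c *\<^sub>R x) <= norm (t + c *\<^sub>R x) + norm t" by (metis add_diff_cancel_left' norm_triangle_sub norm_minus_commute norm_triangle_ineq4)
  finally show "R < norm (t + c *\<^sub>R x)" by simp
 qed
 then show ?thesis using 1(3) by (intro niceI) auto
qed

lemma nice_shift: "nice f ==> nice (%x. f (t + x))"
 using nice_compose_affine[of f 1 t] by simp

lemma nice_section:
 assumes "nice F" shows "nice (%y. F (x, y))" "nice (%y. F (y, z))"
proof -
 obtain M R where 1: "0 <= M" "0 <= R" "!!x. norm (F x) <= M" "!!x. R < norm x ==> F x = 0"
  using niceE[OF assms] by metis
 note [measurable] = nice_measurable[OF assms, unfolded borel_prod[symmetric]]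
 have "F (x, y) = 0" if "R < norm y" for y using 1(4)[of "(x,y)"] that norm_snd_le[of y x] by simp
 then show "nice (%y. F (x, y))" by (intro niceI[OF _ 1(3)]) auto
 have "F (y, z) = 0" if "R < norm y" for y using 1(4)[of "(y,z)"] that norm_fst_le[of y z] by simp
 then show "nice (%y. F (y, z))" by (intro niceI[OF _ 1(3)]) auto
qed

lemma nice_integral_snd:
 fixes F :: "'a::euclidean_space \<times> 'b::euclidean_space => 'c::{banach, second_countable_topology}"
 assumes "nice F" shows "nice (%x. LINT y|lborel. F (x, y))"
proof -
 obtain M R where 1: "0 <= M" "0 <= R" "!!x. norm (F x) <= M" "!!x. R < norm x ==> F x = 0"
  using niceE[OF assms] by metis
 note [measurable] = nice_measurable[OF assms, unfolded borel_prod[symmetric]]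
 have m: "(%x. LINT y|lborel. F (x, y)) \<in> borel_measurable borel"
  by (rule lborel.borel_measurable_lebesgue_integral) (simp add: case_prod_beta')
 have "norm (LINT y|lborel. F (x, y)) <= M * measure lborel (cball (0::'b) R)" for x
 proof -
  have i: "integrable lborel (%y::'b. M * indicator (cball 0 R) y)"
   by (intro integrable_mult_right integrable_real_indicator emeasure_bounded_finite bounded_cball) simp
  have b: "norm (F (x, y)) <= M * indicator (cball 0 R) y" for y
   using 1(3)[of "(x,y)"] 1(4)[of "(x,y)"] norm_snd_le[of y x] 1(1)
   by (cases "norm y <= R") (auto simp: indicator_def)
  have "norm (LINT y|lborel. F (x, y)) <= (LINT y|lborel. norm (F (x, y)))" by (rule integral_norm_bound)
  also have "... <= (LINT y::'b|lborel. M * indicator (cball 0 R) y)"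
  proof (rule integral_mono)
   show "integrable lborel (%y. norm (F (x, y)))"
    by (intro nice_integrable nice_norm nice_section(1)[OF assms])
  qed (use i b in auto)
  finally show ?thesis by simp
 qed
 moreover have "(LINT y|lborel. F (x, y)) = 0" if "R < norm x" for x
 proof -
  have "F (x, y) = 0" for y using 1(4)[of "(x,y)"] that norm_fst_le[of x y] by simp
  then show ?thesis by simp
 qed
 ultimately show ?thesis using m by (intro niceI)
qed

lemma nice_Fubini:
 fixes F :: "'a::euclidean_space \<times> 'b::euclidean_space => 'c::{banach, second_countable_topology}"
 assumes "nice F"
 shows "(LINT z|lborel. F z) = (LINT x|lborel. LINT y|lborel. F (x, y))"
  and "(LINT y|lborel. LINT x|lborel. F (x, y)) = (LINT x|lborel. LINT y|lborel. F (x, y))"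
proof -
 have i: "integrable lborel2 F" using nice_integrable[OF assms] by (simp add: lborel_prod)
 show "(LINT z|lborel. F z) = (LINT x|lborel. LINT y|lborel. F (x, y))"
  using lborel_pair.integral_fst'[OF i] by (simp add: lborel_prod)
 show "(LINT y|lborel. LINT x|lborel. F (x, y)) = (LINT x|lborel. LINT y|lborel. F (x, y))"
  using lborel_pair.Fubini_integral[of "%x y. F (x, y)"] i by simp
qed

definition lp_norm :: "real => ('a::euclidean_space => complex) => real" where
 "lp_norm p f = (LINT x|lborel. cmod (f x) powr p) powr (1 / p)"

lemma lp_norm_nonneg: "0 <= lp_norm p f"
 by (simp add: lp_norm_def)

definition corr :: "('a::euclidean_space => complex) => ('a => complex) => 'a => complex" where
 "corr f g h = (LINT x|lborel. f (x - h) * g x)"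

abbreviation pairing :: "('a::euclidean_space => complex) => ('a => complex) => ('a => complex) => complex" where
 "pairing k f g == LINT h|lborel. k h * corr f g h"

lemma nice_corr_integrand:
 fixes f g :: "'a::euclidean_space => complex"
 assumes "nice f" "nice g"
 shows "nice (%(h, x). f (x - h) * g x)"
proof -
 obtain M R where 1: "0 <= M" "0 <= R" "!!x. norm (f x) <= M" "!!x. R < norm x ==> f x = 0"
  using niceE[OF assms(1)] by metis
 obtain M' R' where 2: "0 <= M'" "0 <= R'" "!!x. norm (g x) <= M'" "!!x. R' < norm x ==> g x = 0"
  using niceE[OF assms(2)] by metis
 note [measurable] = nice_measurable[OF assms(1)] nice_measurable[OF assms(2)]
 show ?thesis
 proof (rule niceI[where M="M * M'" and R="R + 2 * R'"])
  show "(%(h, x). f (x - h) * g x) \<in> borel_measurable borel"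
   unfolding borel_prod[symmetric] by measurable
  show "norm (case z of (h, x) => f (x - h) * g x) <= M * M'" for z
   using 1(1,3) 2(3) by (auto simp: norm_mult case_prod_beta intro!: mult_mono)
  show "(case z of (h, x) => f (x - h) * g x) = 0" if "R + 2 * R' < norm z" for z
  proof (cases z)
   case (Pair h x)
   have "norm z <= norm h + norm x" unfolding Pair by (rule norm_Pair_le)
   also have "norm h <= norm (x - h) + norm x" by (metis norm_minus_commute norm_triangle_sub add.commute)
   finally have "R + 2 * R' < norm (x - h) + 2 * norm x" using that by simp
   then have "R < norm (x - h) \<or> R' < norm x" by linarith
   then show ?thesis using 1(4) 2(4) by (auto simp: Pair)
  qed
 qed
qed

lemma nice_corr: "nice f ==> nice g ==> nice (corr f g)"
 unfolding corr_def[abs_def] using nice_integral_snd[OF nice_corr_integrand, of f g] by simp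

lemma integrable_lp_nice: "nice f ==> 0 < p ==> integrable lborel (%x. norm (f x) powr p)"
 by (intro nice_integrable nice_norm_powr)

lemma lp_norm_shift:
 assumes [measurable]: "f \<in> borel_measurable borel"
 shows "lp_norm p (%x. f (c + x)) = lp_norm p f"
 unfolding lp_norm_def by (subst integral_lborel_shift[of "%x. cmod (f x) powr p"]) auto

lemma norm_corr_le:
 assumes "1 < p" "1 < q" "1 / p + 1 / q = 1" "nice f" "nice g"
 shows "cmod (corr f g h) <= lp_norm p f * lp_norm q g"
proof -
 note [measurable] = nice_measurable[OF assms(4)] nice_measurable[OF assms(5)]
 have nf: "nice (%x. f (x - h))" using nice_shift[OF assms(4), of "- h"] by simp
 have "cmod (corr f g h) <= (LINT x|lborel. cmod (f (x - h)) * cmod (g x))"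
  unfolding corr_def using integral_norm_bound[of lborel "%x. f (x - h) * g x"] by (simp add: norm_mult)
 also have "... <= (LINT x|lborel. cmod (f (x - h)) powr p) powr (1 / p) * (LINT x|lborel. cmod (g x) powr q) powr (1 / q)"
  using assms by (intro Holder_inequality_real(2)) (auto intro!: integrable_lp_nice nf)
 also have "... = lp_norm p (%x. f (- h + x)) * lp_norm q g" by (simp add: lp_norm_def)
 also have "lp_norm p (%x. f (- h + x)) = lp_norm p f" by (rule lp_norm_shift) measurable
 finally show ?thesis .
qed

lemma corr_scale:
 assumes "nice f" "nice g" "l > 0"
 shows "corr (f :: 'a::euclidean_space => complex) g (l *\<^sub>R h)
   = of_real (l ^ DIM('a)) * corr (%x. f (l *\<^sub>R x)) (%x. g (l *\<^sub>R x)) h"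
proof -
 note [measurable] = nice_measurable[OF assms(1)] nice_measurable[OF assms(2)]
 show ?thesis unfolding corr_def
  by (subst integral_lborel_scale[of _ l]) (use assms in \<open>auto simp: scaleR_diff_right scaleR_conv_of_real\<close>)
qed

lemma lp_norm_scale:
 fixes f :: "'a::euclidean_space => complex"
 assumes [measurable]: "f \<in> borel_measurable borel" and "l > 0" "0 < p"
 shows "lp_norm p (%x. f (l *\<^sub>R x)) = l powr (- real DIM('a) / p) * lp_norm p f"
proof -
 have "(LINT x|lborel. cmod (f x) powr p) = l ^ DIM('a) * (LINT x|lborel. cmod (f (l *\<^sub>R x)) powr p)"
  by (subst integral_lborel_scale[of _ l]) (use assms in auto)
 then have "(LINT x|lborel. cmod (f (l *\<^sub>R x)) powr p) = l powr (- real DIM('a)) * (LINT x|lborel. cmod (f x) powr p)"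
  using assms(2) by (simp add: powr_minus powr_realpow field_simps)
 then show ?thesis unfolding lp_norm_def using assms by (simp add: powr_mult powr_powr)
qed

lemma corr_cnj: "corr (%x. cnj (f x)) (%x. cnj (g x)) h = cnj (corr f g h)"
 unfolding corr_def by (simp flip: complex_cnj_mult)

lemma lp_norm_cnj: "lp_norm p (%x. cnj (f x)) = lp_norm p f"
 by (simp add: lp_norm_def)

lemma nice_cnj: "nice f ==> nice (%x. cnj (f x))"
proof (rule nice_dominated[of f _ 1])
 assume "nice f"
 then show "(%x. cnj (f x)) \<in> borel_measurable borel"
  by (intro borel_measurable_continuous_on[OF _ nice_measurable] continuous_intros)
qed auto

lemma corr_uminus:
 assumes "nice f" "nice g"
 shows "corr f g (- h) = corr (%x. f (- x)) (%x. g (- x)) h"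
proof -
 note [measurable] = nice_measurable[OF assms(1)] nice_measurable[OF assms(2)]
 show ?thesis unfolding corr_def
  by (subst integral_lborel_uminus[symmetric]) (auto simp: algebra_simps)
qed

lemma lp_norm_uminus:
 assumes [measurable]: "f \<in> borel_measurable borel"
 shows "lp_norm p (%x. f (- x)) = lp_norm p f"
 unfolding lp_norm_def by (subst integral_lborel_uminus[of "%x. cmod (f x) powr p"]) auto

lemma nice_uminus: "nice f ==> nice (%x. f (- x))"
 using nice_compose_affine[of f "-1" 0] by simp

lemma nice_scale: "nice f ==> l \<noteq> 0 ==> nice (%x. f (l *\<^sub>R x))"
 using nice_compose_affine[of f l 0] by simp

definition permute :: "('k => 'k) => real^'k => real^('k::finite)" where
 "permute \<pi> x = (\<chi> i. x $ \<pi> i)"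

lemma borel_measurable_permute [measurable]: "permute \<pi> \<in> borel_measurable borel"
 unfolding permute_def by (intro borel_measurable_continuous_onI continuous_intros)

lemma integral_lborel_permute:
 fixes f :: "real^'k::finite => 'b::{banach, second_countable_topology}"
 assumes [measurable]: "f \<in> borel_measurable borel" and "bij \<pi>"
 shows "(LINT x|lborel. f (permute \<pi> x)) = (LINT x|lborel. f x)"
 by (subst (2) distr_lborel_permute[OF assms(2), symmetric])
   (simp add: integral_distr borel_measurable_permute[unfolded permute_def[abs_def]] permute_def)

lemma norm_permute: "bij \<pi> ==> norm (permute \<pi> x) = norm x"
 unfolding norm_vec_def L2_set_def permute_def
 by (simp add: sum.reindex_bij_betw[of \<pi> UNIV UNIV "%i. (x $ i)\<^sup>2"])

lemma permute_diff: "permute \<pi> (x - y) = permute \<pi> x - permute \<pi> y"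
 by (simp add: permute_def vec_eq_iff)

lemma nice_permute:
 assumes "nice f" "bij \<pi>" shows "nice (%x. f (permute \<pi> x))"
proof -
 obtain M R where 1: "0 <= M" "0 <= R" "!!x. norm (f x) <= M" "!!x. R < norm x ==> f x = 0"
  using niceE[OF assms(1)] by metis
 note [measurable] = nice_measurable[OF assms(1)]
 show ?thesis using 1(3,4) norm_permute[OF assms(2)] by (intro niceI[of _ M R]) auto
qed

lemma corr_permute:
 assumes "nice f" "nice g" "bij \<pi>"
 shows "corr f g (permute \<pi> h) = corr (%x. f (permute \<pi> x)) (%x. g (permute \<pi> x)) h"
proof -
 note [measurable] = nice_measurable[OF assms(1)] nice_measurable[OF assms(2)]
 show ?thesis unfolding corr_def permute_diff
  by (subst integral_lborel_permute[OF _ assms(3), symmetric]) auto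
qed

lemma lp_norm_permute:
 assumes [measurable]: "f \<in> borel_measurable borel" and "bij \<pi>"
 shows "lp_norm p (%x. f (permute \<pi> x)) = lp_norm p f"
 unfolding lp_norm_def by (subst integral_lborel_permute[OF _ assms(2), of "%x. cmod (f x) powr p"]) auto

section \<open>Slicing\<close>

lemma nice_continuous:
 fixes f :: "'a::euclidean_space => 'b::{banach, second_countable_topology}"
 assumes "continuous_on UNIV f" "!!x. R < norm x ==> f x = 0"
 shows "nice f"
proof -
 have "compact (f ` cball 0 R)"
  by (intro compact_continuous_image continuous_on_subset[OF assms(1)]) auto
 then obtain M where M: "!!x. x \<in> cball 0 R ==> norm (f x) <= M"
  using compact_imp_bounded bounded_iff by (metis imageI)
 have "norm (f x) <= max M 0" for x
  using M[of x] assms(2)[of x] by (cases "norm x <= R") auto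
 then show ?thesis using assms by (intro niceI borel_measurable_continuous_onI)
qed

lemma norm_le_of_components:
 assumes "!!j. \<bar>(h :: real^'k::finite) $ j\<bar> <= c"
 shows "norm h <= real CARD('k) * c"
 using norm_le_l1_cart[of h] sum_mono[of UNIV "%j. \<bar>h $ j\<bar>" "%j. c"] assms by simp

lemma nice_box_shell: "nice (box_shell i)"
proof (rule nice_continuous[OF continuous_on_box_shell])
 fix h :: "real^'a" assume "real CARD('a) * 2 < norm h"
 then show "box_shell i h = 0"
  using norm_le_of_components[of h 2] box_shell_nz(3)[of i h] by (meson less_imp_le not_le)
qed

lemma nice_shell_kernel: "nice (shell_kernel N :: real^('m::finite option) => real)"
proof -
 let ?R = "real CARD('m option) * 2"
 have m: "shell_kernel N \<in> borel_measurable (borel :: (real^('m option)) measure)"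
  unfolding shell_kernel_def weight_def by measurable
 have "norm (shell_kernel N h) <= (exp ?R * 2 ^ N) * norm (box_shell None h)" for h :: "real^('m option)"
 proof (cases "shell_kernel N h = 0")
  case False
  have h: "1 < norm h" "norm h <= ?R"
   using shell_kernel_nz(3,4)[OF False] norm_le_of_components[of h 2] by (auto intro: less_imp_le)
  have "inverse (norm h - 1/2) <= inverse (1/2)" using h by (intro le_imp_inverse_le) auto
  then have "inverse (norm h - 1/2) ^ N <= 2 ^ N" using h by (intro power_mono) auto
  then have "weight N (norm h) <= exp ?R * 2 ^ N"
   unfolding weight_def using h by (intro mult_mono) auto
  then have "\<bar>box_shell None h\<bar> * weight N (norm h) <= \<bar>box_shell None h\<bar> * (exp ?R * 2 ^ N)"
   by (rule mult_left_mono) simp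
  moreover have "norm (shell_kernel N h) = \<bar>box_shell None h\<bar> * weight N (norm h)"
   using weight_nonneg[OF h(1), of N] by (simp add: shell_kernel_def abs_mult)
  ultimately show ?thesis by (simp add: mult.commute)
 qed auto
 then show ?thesis by (intro nice_dominated[OF nice_box_shell m]) auto
qed

definition osc_kernel :: "nat => real => real^('m::finite option) => complex" where
 "osc_kernel N \<omega> h = exp (\<i> * of_real (\<omega> * norm h)) * of_real (shell_kernel N h)"

lemma nice_osc_kernel: "nice (osc_kernel N \<omega>)"
proof (rule nice_dominated[OF nice_shell_kernel])
 show "osc_kernel N \<omega> \<in> borel_measurable borel"
  unfolding osc_kernel_def using nice_measurable[OF nice_shell_kernel, measurable] by measurable
 show "norm (osc_kernel N \<omega> h) <= 1 * norm (shell_kernel N h)" for h :: "real^('a option)"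
  by (simp add: osc_kernel_def norm_mult)
qed auto

lemma osc_kernel_nz:
 assumes "osc_kernel N \<omega> h \<noteq> 0" shows "1 < h $ None" "h $ None < 2"
 using assms shell_kernel_nz(1,2)[of N h] by (auto simp: osc_kernel_def)

lemma continuous_on_window: "continuous_on UNIV window"
 unfolding window_def
 by (intro continuous_intros continuous_on_compose2[OF continuous_on_plateau[of UNIV]]) auto

lemma nice_window: "nice window"
proof (rule nice_continuous[OF continuous_on_window])
 fix \<xi> :: "real^'a" assume "2/3 < norm \<xi>"
 then show "window \<xi> = 0" using window_nz(2)[of \<xi>] by (meson not_le)
qed

lemma window_ball: "window \<xi> \<noteq> 0 ==> \<xi> \<in> ball 0 1"
 using window_nz(2)[of \<xi>] by simp

lemma window_integral_pos: "0 < (LINT \<xi>|lborel. window (\<xi> :: real^'m::finite))"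
proof -
 have i: "integrable lborel (window :: real^'m => real)" by (rule nice_integrable[OF nice_window])
 have "(LINT \<xi>|lborel. window (\<xi> :: real^'m)) \<noteq> 0"
 proof
  assume "(LINT \<xi>|lborel. window (\<xi> :: real^'m)) = 0"
  moreover have "AE \<xi> in lborel. 0 <= window (\<xi> :: real^'m)" by (simp add: window_nonneg)
  ultimately have "AE \<xi> in lborel. window (\<xi> :: real^'m) = 0"
   using integral_nonneg_eq_0_iff_AE[OF i] by blast
  then have "AE \<xi> in lebesgue. window (\<xi> :: real^'m) = 0" by (rule AE_completion)
  then have "window (0 :: real^'m) = 0"
   using mem_closed_if_AE_lebesgue[of "{\<xi>::real^'m. window \<xi> = 0}" 0]
    continuous_closed_preimage_constant[OF continuous_on_window closed_UNIV, of 0]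
   by (auto simp: vimage_def)
  then show False by (simp add: window_def plateau_eq_1)
 qed
 moreover have "0 <= (LINT \<xi>|lborel. window (\<xi> :: real^'m))" by (simp add: integral_nonneg window_nonneg)
 ultimately show ?thesis by simp
qed

lemma nice_slice:
 assumes "nice f" shows "nice (%\<xi>. f (Z - emb \<xi>))"
proof -
 obtain M R where 1: "0 <= M" "0 <= R" "!!x. norm (f x) <= M" "!!x. R < norm x ==> f x = 0"
  using niceE[OF assms] by metis
 note [measurable] = nice_measurable[OF assms]
 have "f (Z - emb \<xi>) = 0" if "R + norm Z < norm \<xi>" for \<xi>
 proof (rule 1(4))
  have "norm \<xi> <= norm (Z - emb \<xi>) + norm Z"
   using norm_triangle_ineq4[of "Z" "Z - emb \<xi>"] by (simp add: add.commute)
  then show "R < norm (Z - emb \<xi>)" using that by simp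
 qed
 then show ?thesis by (intro niceI[OF _ 1(3)]) auto
qed

lemma nice_swap:
 fixes F :: "'a::euclidean_space \<times> 'b::euclidean_space => 'c::{banach, second_countable_topology}"
 assumes "nice F" shows "nice (%w. F (snd w, fst w))"
proof -
 obtain M R where 1: "0 <= M" "0 <= R" "!!x. norm (F x) <= M" "!!x. R < norm x ==> F x = 0"
  using niceE[OF assms] by metis
 show ?thesis
 proof (rule niceI[where M=M and R=R])
  show "(%w. F (snd w, fst w)) \<in> borel_measurable borel"
   using nice_measurable[OF assms, unfolded borel_prod[symmetric]] unfolding borel_prod[symmetric] by measurable
  show "norm (F (snd w, fst w)) <= M" for w by (rule 1(3))
  show "F (snd w, fst w) = 0" if "R < norm w" for w
   by (rule 1(4)) (use that in \<open>simp add: norm_prod_def add.commute\<close>)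
 qed
qed

text \<open>The kernel restricted to the slice of \<open>f\<close> through \<open>Z\<close> parallel to the plate.\<close>
definition slice_op :: "nat => real => (real^('m::finite option) => complex) => real^('m option) => real^('m option) => complex" where
 "slice_op N \<omega> f Z x = (LINT \<xi>|lborel. of_real (window \<xi>) * osc_kernel N \<omega> (x + emb \<xi>) * f (Z - emb \<xi>))"

lemma nice_slab:
 fixes f g :: "real^('m::finite option) => complex"
 assumes "nice f" "nice g"
 shows "nice (%(Z, x, \<xi>). of_real (window \<xi>) * osc_kernel N \<omega> (x + emb \<xi>) * f (Z - emb (\<xi>::real^'m)) * g (Z + x) :: complex)"
proof -
 obtain M R where 1: "0 <= M" "0 <= R" "!!x. norm (f x) <= M" "!!x. R < norm x ==> f x = 0"
  using niceE[OF assms(1)] by metis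
 obtain M' R' where 2: "0 <= M'" "0 <= R'" "!!x. norm (g x) <= M'" "!!x. R' < norm x ==> g x = 0"
  using niceE[OF assms(2)] by metis
 obtain M1 R1 where 3: "0 <= M1" "0 <= R1" "!!x. norm (window (x::real^'m)) <= M1" "!!x. R1 < norm x ==> window (x::real^'m) = 0"
  using niceE[OF nice_window] by metis
 obtain M2 R2 where 4: "0 <= M2" "0 <= R2" "!!x. norm (osc_kernel N \<omega> (x::real^('m option))) <= M2" "!!x. R2 < norm x ==> osc_kernel N \<omega> (x::real^('m option)) = 0"
  using niceE[OF nice_osc_kernel] by metis
 note [measurable] = nice_measurable[OF assms(1)] nice_measurable[OF assms(2)] nice_measurable[OF nice_window]
  nice_measurable[OF nice_osc_kernel]
 show ?thesis
 proof (rule niceI[where M="M1 * M2 * M * M'" and R="R + R2 + 3 * R1"])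
  show "(%(Z, x, \<xi>). of_real (window \<xi>) * osc_kernel N \<omega> (x + emb \<xi>) * f (Z - emb \<xi>) * g (Z + x)) \<in> borel_measurable borel"
   unfolding borel_prod[symmetric] by measurable
  show "norm (case z of (Z, x, \<xi>) => of_real (window \<xi>) * osc_kernel N \<omega> (x + emb \<xi>) * f (Z - emb \<xi>) * g (Z + x)) <= M1 * M2 * M * M'" for z
   using 1(1,3) 2(1,3) 3(1,3) 4(1,3) by (auto simp: norm_mult case_prod_beta intro!: mult_mono mult_nonneg_nonneg)
  show "(case z of (Z, x, \<xi>) => of_real (window \<xi>) * osc_kernel N \<omega> (x + emb \<xi>) * f (Z - emb \<xi>) * g (Z + x)) = 0"
   if "R + R2 + 3 * R1 < norm z" for z
  proof -
   obtain Z x \<xi> where z: "z = (Z, x, \<xi>)" by (cases z) auto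
   have "norm z <= norm Z + (norm x + norm \<xi>)"
    unfolding z using norm_Pair_le[of Z "(x,\<xi>)"] norm_Pair_le[of x \<xi>] by linarith
   moreover have "norm Z <= norm (Z - emb \<xi>) + norm \<xi>"
    using norm_triangle_ineq[of "Z - emb \<xi>" "emb \<xi>"] by simp
   moreover have "norm x <= norm (x + emb \<xi>) + norm \<xi>"
    using norm_triangle_ineq4[of "x + emb \<xi>" "emb \<xi>"] by simp
   ultimately have "R < norm (Z - emb \<xi>) \<or> R2 < norm (x + emb \<xi>) \<or> R1 < norm \<xi>" using that by linarith
   then show ?thesis using 1(4) 3(4) 4(4) by (auto simp: z)
  qed
 qed
qed

text \<open>Insert \<open>\<integral> window\<close>, shift \<open>x\<close> by \<open>Z\<close> and then substitute \<open>h = x + emb \<xi>\<close>: translations preserve the measure,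
 so averaging over tangential translations costs only the constant factor.\<close>
lemma slab_identity:
 fixes f g :: "real^('m::finite option) => complex"
 assumes "nice f" "nice g"
 shows "of_real (LINT \<xi>|lborel. window (\<xi>::real^'m)) * (pairing (osc_kernel N \<omega>) f g)
  = (LINT Z|lborel. LINT x|lborel. slice_op N \<omega> f Z x * g (Z + x))"
  and "nice (%Z. LINT x|lborel. slice_op N \<omega> f Z x * g (Z + x))"
  and "nice (%x. slice_op N \<omega> f Z x * g (Z + x))"
proof -
 let ?F = "%(Z, x, \<xi>). of_real (window \<xi>) * osc_kernel N \<omega> (x + emb \<xi>) * f (Z - emb \<xi>) * g (Z + x) :: complex"
 have F: "nice ?F" by (rule nice_slab[OF assms])
 note nc = nice_corr[OF assms]
 note [measurable] = nice_measurable[OF assms(1)] nice_measurable[OF assms(2)] nice_measurable[OF nice_osc_kernel]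
  nice_measurable[OF nc]
 have sec: "nice (%z. ?F (Z, z))" for Z by (rule nice_section(1)[OF F])
 have sl: "slice_op N \<omega> f Z x * g (Z + x) = (LINT \<xi>|lborel. ?F (Z, x, \<xi>))" for Z x
  unfolding slice_op_def by simp
 have n2: "nice (%x. LINT \<xi>|lborel. ?F (Z, x, \<xi>))" for Z
  using nice_integral_snd[OF sec[of Z]] by simp
 then show "nice (%x. slice_op N \<omega> f Z x * g (Z + x))" for Z by (simp add: sl)
 have inner: "(LINT z|lborel. ?F (Z, z)) = (LINT x|lborel. slice_op N \<omega> f Z x * g (Z + x))" for Z
  using nice_Fubini(1)[OF sec[of Z]] by (simp add: sl)
 show "nice (%Z. LINT x|lborel. slice_op N \<omega> f Z x * g (Z + x))"
  using nice_integral_snd[OF F] by (simp only: inner)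
 let ?H = "%z::(real^('m option)) \<times> (real^'m). of_real (window (snd z)) *
   (osc_kernel N \<omega> (fst z + emb (snd z)) * corr f g (fst z + emb (snd z)))"
 have H: "(LINT Z|lborel. ?F (Z, z)) = ?H z" for z
 proof -
  let ?h = "fst z + emb (snd z)"
  have sh: "fst z + Z - ?h = Z - emb (snd z)" for Z by simp
  have m: "(%y. f (y - ?h) * g y) \<in> borel_measurable borel" by measurable
  have "(LINT Z|lborel. f (Z - emb (snd z)) * g (Z + fst z)) = (LINT Z|lborel. f ((fst z + Z) - ?h) * g (fst z + Z))"
   unfolding sh by (simp only: add.commute)
  also have "... = corr f g ?h"
   unfolding corr_def by (rule integral_lborel_shift[OF m])
  finally have c: "corr f g ?h = (LINT Z|lborel. f (Z - emb (snd z)) * g (Z + fst z))" ..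
  show ?thesis unfolding c case_prod_beta fst_conv snd_conv by (simp add: mult.assoc)
 qed
 have "nice (%w. ?F (snd w, fst w))" by (rule nice_swap[OF F])
 from nice_integral_snd[OF this] have nH: "nice ?H"
  unfolding snd_conv fst_conv H .
 have "(LINT Z|lborel. LINT x|lborel. slice_op N \<omega> f Z x * g (Z + x)) = (LINT Z|lborel. LINT z|lborel. ?F (Z, z))"
  by (simp only: inner)
 also have "... = (LINT z|lborel. LINT Z|lborel. ?F (Z, z))" by (rule nice_Fubini(2)[OF F, symmetric])
 also have "... = (LINT z|lborel. ?H z)" by (simp only: H)
 also have "... = (LINT x|lborel. LINT \<xi>|lborel. ?H (x, \<xi>))" by (rule nice_Fubini(1)[OF nH])
 also have "... = (LINT \<xi>|lborel. LINT x|lborel. ?H (x, \<xi>))" by (rule nice_Fubini(2)[OF nH, symmetric])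
 also have "... = (LINT \<xi>|lborel. of_real (window (\<xi>::real^'m)) * (pairing (osc_kernel N \<omega>) f g))"
 proof (intro lint_cong refl)
  fix \<xi> :: "real^'m"
  have "(LINT x|lborel. osc_kernel N \<omega> (emb \<xi> + x) * corr f g (emb \<xi> + x)) = (pairing (osc_kernel N \<omega>) f g)"
   by (rule integral_lborel_shift) measurable
  then show "(LINT x|lborel. ?H (x, \<xi>)) = of_real (window \<xi>) * (pairing (osc_kernel N \<omega>) f g)"
   by (simp add: add.commute)
 qed
 also have "... = of_real (LINT \<xi>|lborel. window (\<xi>::real^'m)) * (pairing (osc_kernel N \<omega>) f g)"
  by simp
 finally show "of_real (LINT \<xi>|lborel. window (\<xi>::real^'m)) * (pairing (osc_kernel N \<omega>) f g)
  = (LINT Z|lborel. LINT x|lborel. slice_op N \<omega> f Z x * g (Z + x))" ..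
qed

lemma nice_slice_op:
 fixes f :: "real^('m::finite option) => complex"
 assumes "nice f" shows "nice (slice_op N \<omega> f Z)"
proof -
 obtain R where R: "0 <= R" "!!x. R < norm x ==> osc_kernel N \<omega> (x::real^('m option)) = 0"
  using niceE[OF nice_osc_kernel] by metis
 let ?g = "indicator (cball 0 (norm Z + R + 1)) :: real^('m option) => complex"
 have z: "slice_op N \<omega> f Z x = 0" if x: "R + 1 < norm x" for x
 proof -
  have "of_real (window \<xi>) * osc_kernel N \<omega> (x + emb \<xi>) * f (Z - emb \<xi>) = 0" for \<xi>
  proof (cases "window \<xi> = 0")
   case False
   then have "norm \<xi> < 1" using window_ball by force
   moreover have "norm x <= norm (x + emb \<xi>) + norm \<xi>"
    using norm_triangle_ineq4[of "x + emb \<xi>" "emb \<xi>"] by simp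
   ultimately have "R < norm (x + emb \<xi>)" using x by linarith
   then show ?thesis using R(2) by simp
  qed simp
  then show ?thesis unfolding slice_op_def by (simp only: integral_zero)
 qed
 have "nice ?g"
 proof (rule niceI[where M=1 and R="norm Z + R + 1"])
  show "?g \<in> borel_measurable borel" by (intro borel_measurable_indicator borel_closed closed_cball)
 qed (auto simp: indicator_def)
 from slab_identity(3)[OF assms this, of N \<omega> Z]
 have "nice (%x. slice_op N \<omega> f Z x * ?g (Z + x))" .
 moreover have "slice_op N \<omega> f Z x * ?g (Z + x) = slice_op N \<omega> f Z x" for x
  using z[of x] norm_triangle_ineq[of Z x] by (cases "norm x <= R + 1") (auto simp: indicator_def)
 ultimately show ?thesis by simp
qed

lemma slice_op_eq_0:
 assumes "\<not> (1 < x $ None \<and> x $ None < 2)"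
 shows "slice_op N \<omega> f Z x = 0"
proof -
 have "osc_kernel N \<omega> (x + emb \<xi>) = 0" for \<xi>
  using osc_kernel_nz[of N \<omega> "x + emb \<xi>"] assms by auto
 then show ?thesis by (simp add: slice_op_def)
qed

text \<open>In straightened coordinates the slice operator is one of the operators of the hypothesis. The factor
 \<open>2 \<pi>\<close> is the one in the exponent of \<open>T_op\<close>.\<close>
lemma slice_op_straighten:
 fixes f :: "real^('m::finite option) => complex"
 assumes "nice f" "0 < 1 + w $ None" "0 < l"
 shows "slice_op N (2 * pi * l) f Z (straighten e w)
  = T_op (amp e N) (phase e) l (%\<xi>. f (Z - emb \<xi>)) (l *\<^sub>R w)"
proof -
 let ?G = "%\<xi>. of_real (window \<xi>) * osc_kernel N (2 * pi * l) (straighten e w + emb \<xi>) * f (Z - emb \<xi>)"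
 note [measurable] = nice_measurable[OF assms(1)] nice_measurable[OF nice_osc_kernel] nice_measurable[OF nice_window]
 have "T_op (amp e N) (phase e) l (%\<xi>. f (Z - emb \<xi>)) (l *\<^sub>R w) = (LINT \<xi>|lebesgue. ?G \<xi>)"
  unfolding T_op_def set_lebesgue_integral_def
 proof (intro lint_cong refl)
  fix \<xi> :: "real^'m"
  show "indicator (ball 0 1) \<xi> *\<^sub>R (exp (2 * of_real pi * \<i> * of_real (l * phase e ((l *\<^sub>R w) /\<^sub>R l, \<xi>)))
    * of_real (amp e N ((l *\<^sub>R w) /\<^sub>R l, \<xi>)) * f (Z - emb \<xi>)) = ?G \<xi>"
  proof (cases "window \<xi> = 0")
   case False
   then show ?thesis using window_ball[OF False] assms(3)
    by (simp add: osc_kernel_def amp_def norm_straighten[OF assms(2)] mult_ac)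
  qed (simp add: amp_def)
 qed
 also have "... = (LINT \<xi>|lborel. ?G \<xi>)" by (rule integral_completion) measurable
 finally show ?thesis by (simp add: slice_op_def)
qed

lemma integral_scale_real:
 fixes f :: "real => complex"
 assumes "f \<in> borel_measurable borel" "0 < c"
 shows "(LINT x|lborel. f x) = of_real c * (LINT x|lborel. f (c * x))"
 using lborel_integral_real_affine[of c f 0] assms by (simp add: scaleR_conv_of_real)

section \<open>Fourier inversion for powers of a resolvent\<close>

lemma gaussian_integrable: "0 < \<eta> ==> integrable lborel (%t::real. exp (- ((\<eta> * t)\<^sup>2 / 2)))"
proof -
 assume e: "0 < \<eta>"
 have "integrable lborel (%t. std_normal_density t)" by (simp add: integrable_normal_density)
 then have "integrable lborel (%t. sqrt (2 * pi) * std_normal_density t)" by simp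
 then have "integrable lborel (%t::real. exp (- (t\<^sup>2 / 2)))" by (simp add: std_normal_density_def)
 from lborel_integrable_real_affine[OF this, of \<eta> 0] show ?thesis using e by simp
qed

text \<open>The Gaussian is its own Fourier transform, taken from the characteristic function of the normal law.\<close>
lemma gaussian_fourier:
 assumes "0 < \<eta>"
 shows "(LINT \<tau>|lborel. exp (\<i> * of_real (\<tau> * s)) * of_real (exp (- ((\<eta> * \<tau>)\<^sup>2 / 2))))
  = of_real (sqrt (2 * pi) / \<eta> * exp (- ((s / \<eta>)\<^sup>2 / 2)))"
proof -
 let ?f = "%\<tau>. exp (\<i> * of_real (\<tau> * (s / \<eta>))) * of_real (std_normal_density \<tau>)"
 have c: "(LINT \<tau>|lborel. ?f \<tau>) = of_real (exp (- ((s / \<eta>)\<^sup>2 / 2)))"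
 proof -
  have "char std_normal_distribution (s / \<eta>) = (LINT \<tau>|lborel. std_normal_density \<tau> *\<^sub>R iexp ((s / \<eta>) * \<tau>))"
   unfolding char_def by (subst integral_density) (auto simp: )
  also have "... = (LINT \<tau>|lborel. ?f \<tau>)"
   by (intro lint_cong refl) (simp add: scaleR_conv_of_real mult_ac)
  finally show ?thesis by (simp add: char_std_normal_distribution)
 qed
 have "(LINT \<tau>|lborel. ?f \<tau>) = of_real \<eta> * (LINT \<tau>|lborel. ?f (\<eta> * \<tau>))"
  by (rule integral_scale_real) (use assms in measurable)
 also have "(LINT \<tau>|lborel. ?f (\<eta> * \<tau>)) = (LINT \<tau>|lborel. of_real (1 / sqrt (2 * pi)) *
   (exp (\<i> * of_real (\<tau> * s)) * of_real (exp (- ((\<eta> * \<tau>)\<^sup>2 / 2)))))"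
  by (intro lint_cong refl) (use assms in \<open>simp add: std_normal_density_def\<close>)
 also have "... = of_real (1 / sqrt (2 * pi)) *
   (LINT \<tau>|lborel. exp (\<i> * of_real (\<tau> * s)) * of_real (exp (- ((\<eta> * \<tau>)\<^sup>2 / 2))))"
  by (rule integral_mult_right_zero)
 finally show ?thesis
  unfolding c using assms by (simp add: field_simps)
qed

definition gamma_fun :: "nat => real => real => real" where
 "gamma_fun k \<sigma> y = (if 0 < y then y ^ k * exp (- \<sigma> * y) else 0)"

lemma gamma_fun_measurable [measurable]: "gamma_fun k \<sigma> \<in> borel_measurable borel"
 unfolding gamma_fun_def by measurable

lemma gamma_fun_nonneg: "0 <= gamma_fun k \<sigma> y"
 by (simp add: gamma_fun_def)

lemma gamma_fun_integrable:
 assumes "0 < \<sigma>" shows "integrable lborel (gamma_fun k \<sigma>)"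
proof -
 have "(\<integral>\<^sup>+x. ennreal (x ^ k * exp (- x)) * indicator {0..} x \<partial>lborel) < \<infinity>"
  using nn_intergal_power_times_exp_Ici[of k] by simp
 then have "integrable lborel (%x::real. x ^ k * exp (- x) * indicator {0..} x)"
 proof (intro integrableI_nonneg)
  have e: "ennreal (x ^ k * exp (- x) * indicator {0..} x) = ennreal (x ^ k * exp (- x)) * indicator {0..} x" for x :: real
   by (auto simp: indicator_def)
  show "(\<integral>\<^sup>+x. ennreal (x ^ k * exp (- x) * indicator {0..} x) \<partial>lborel) < \<infinity>"
   unfolding e by fact
 qed (auto simp: indicator_def)
 from lborel_integrable_real_affine[OF this, of \<sigma> 0]
 have "integrable lborel (%x. (1 / \<sigma> ^ k) * ((\<sigma> * x) ^ k * exp (- (\<sigma> * x)) * indicator {0..} (\<sigma> * x)))"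
  using assms by (intro integrable_mult_right) simp
 then show ?thesis
 proof (rule integrable_dominated)
  show "AE x in lborel. norm (gamma_fun k \<sigma> x) <= norm ((1 / \<sigma> ^ k) * ((\<sigma> * x) ^ k * exp (- (\<sigma> * x)) * indicator {0..} (\<sigma> * x)))"
   using assms by (intro AE_I2) (auto simp: gamma_fun_def power_mult_distrib indicator_def)
 qed measurable
qed

lemma gamma_fun_bounded:
 assumes "0 < \<sigma>" obtains B where "!!y. gamma_fun k \<sigma> y <= B"
proof -
 have "((%y. y ^ k / exp y) \<longlongrightarrow> (0::real)) at_top" by (rule tendsto_power_div_exp_0)
 then have "eventually (%y::real. y ^ k / exp y < 1) at_top" by (rule order_tendstoD) simp
 then obtain Y where Y: "!!y::real. y \<ge> Y ==> y ^ k / exp y < 1" by (auto simp: eventually_at_top_linorder)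
 have "y ^ k * exp (- y) <= max 1 (\<bar>Y\<bar> ^ k)" if "0 < y" for y :: real
 proof (cases "y \<ge> Y")
  case True
  then show ?thesis using Y[OF True] by (simp add: exp_minus divide_inverse)
 next
  case False
  then have "y ^ k <= \<bar>Y\<bar> ^ k" using that by (intro power_mono) auto
  then have "y ^ k * exp (- y) <= \<bar>Y\<bar> ^ k * 1" using that by (intro mult_mono) auto
  then show ?thesis by simp
 qed
 note b = this
 have "gamma_fun k \<sigma> y <= max 1 (\<bar>Y\<bar> ^ k) / \<sigma> ^ k" for y
 proof (cases "0 < y")
  case True
  have "\<sigma> ^ k * gamma_fun k \<sigma> y = (\<sigma> * y) ^ k * exp (- (\<sigma> * y))"
   using True by (simp add: gamma_fun_def power_mult_distrib)
  then show ?thesis using b[of "\<sigma> * y"] True assms by (simp add: field_simps)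
 qed (use assms in \<open>auto simp: gamma_fun_def\<close>)
 then show ?thesis using that by blast
qed

text \<open>Induction on \<open>k\<close> by partial integration.\<close>
lemma gamma_fun_fourier:
 assumes "0 < \<sigma>"
 shows "(LINT y|lborel. of_real (gamma_fun k \<sigma> y) * exp (- \<i> * of_real (\<tau> * y)))
  = of_real (fact k) / (of_real \<sigma> + \<i> * of_real \<tau>) ^ Suc k"
proof -
 define c where "c = of_real \<sigma> + \<i> * of_real \<tau>"
 have c0: "c \<noteq> 0" using assms by (auto simp: c_def complex_eq_iff)
 have rc: "Re c = \<sigma>" by (simp add: c_def)
 let ?J = "%k. LBINT y=0..\<infinity>. of_real (y ^ k) * exp (- c * of_real y)"
 have nrm: "norm (of_real (y ^ k) * exp (- c * of_real y)) = \<bar>y\<bar> ^ k * exp (- \<sigma> * y)" for k y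
  by (simp add: norm_mult rc power_abs del: of_real_power)
 have nrm': "norm (of_real (y ^ k) * exp (- (c * of_real y))) = \<bar>y\<bar> ^ k * exp (- (\<sigma> * y))" for k y
  using nrm[of y k] by simp
 have int: "set_integrable lborel (einterval 0 \<infinity>) (%y. of_real (y ^ k) * exp (- c * of_real y))" for k
  unfolding set_integrable_def
  by (rule integrable_dominated[OF gamma_fun_integrable[OF assms, of k]])
    (auto intro!: AE_I2 simp: indicator_def einterval_def gamma_fun_def nrm' simp del: of_real_power)
 have eq: "(LINT y|lborel. of_real (gamma_fun k \<sigma> y) * exp (- \<i> * of_real (\<tau> * y))) = ?J k" for k
 proof -
  have "of_real (gamma_fun k \<sigma> y) * exp (- \<i> * of_real (\<tau> * y))
    = indicator (einterval 0 \<infinity>) y *\<^sub>R (of_real (y ^ k) * exp (- c * of_real y))" for y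
  proof (cases "0 < y")
   case True
   have "exp (- c * of_real y) = exp (- of_real (\<sigma> * y)) * exp (- \<i> * of_real (\<tau> * y))"
    unfolding exp_add[symmetric] by (simp add: c_def algebra_simps)
   then show ?thesis using True by (simp add: gamma_fun_def einterval_def exp_of_real[symmetric])
  qed (auto simp: gamma_fun_def einterval_def indicator_def)
  then show ?thesis
   by (simp add: interval_lebesgue_integral_def set_lebesgue_integral_def)
 qed
 have lim0: "((%y::real. of_real (y ^ k) * exp (- c * of_real y)) \<longlongrightarrow> 0) at_top" for k
 proof (rule tendsto_norm_zero_cancel)
  have "((%y. (1 / \<sigma> ^ k) * ((\<sigma> * y) ^ k / exp (\<sigma> * y))) \<longlongrightarrow> (1 / \<sigma> ^ k) * 0) at_top"
   by (intro tendsto_mult tendsto_const filterlim_compose[OF tendsto_power_div_exp_0]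
     filterlim_tendsto_pos_mult_at_top[OF tendsto_const assms filterlim_ident])
  then have "((%y. (1 / \<sigma> ^ k) * ((\<sigma> * y) ^ k / exp (\<sigma> * y))) \<longlongrightarrow> 0) at_top" by simp
  then show "((%y::real. norm (of_real (y ^ k) * exp (- c * of_real y))) \<longlongrightarrow> 0) at_top"
  proof (rule Lim_transform_eventually)
   show "\<forall>\<^sub>F y in at_top. (1 / \<sigma> ^ k) * ((\<sigma> * y) ^ k / exp (\<sigma> * y)) = norm (of_real (y ^ k) * exp (- c * of_real y) :: complex)"
    using eventually_gt_at_top[of 0]
    by eventually_elim (unfold nrm, use assms in \<open>simp add: power_mult_distrib exp_minus divide_inverse\<close>)
  qed
 qed
 have FTC: "(LBINT y=0..\<infinity>. f y) = 0 - B"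
  if "!!y. (F has_vector_derivative f y) (at y)" "!!y. isCont f y" "set_integrable lborel (einterval 0 \<infinity>) f"
   "F 0 = B" "(F \<longlongrightarrow> 0) at_top" for F f :: "real => complex" and B
 proof (rule interval_integral_FTC_integrable)
  have "isCont F 0" using that(1) has_vector_derivative_continuous by blast
  then have "(F \<longlongrightarrow> B) (at_right 0)" using that(4) by (metis isCont_def filterlim_at_split)
  then show "((F \<circ> real_of_ereal) \<longlongrightarrow> B) (at_right 0)"
   by (simp add: ereal_tendsto_simps zero_ereal_def)
  show "((F \<circ> real_of_ereal) \<longlongrightarrow> 0) (at_left \<infinity>)"
   using that(5) by (simp add: ereal_tendsto_simps)
 qed (use that in auto)
 have "?J k = of_real (fact k) / c ^ Suc k"
 proof (induction k)
  case 0
  have "(LBINT y=0..\<infinity>. of_real (y ^ 0) * exp (- c * of_real y)) = 0 - (- inverse c)"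
  proof (rule FTC[where F="%y. - inverse c * (of_real (y ^ 0) * exp (- c * of_real y))"])
   show "((%y. - inverse c * (of_real (y ^ 0) * exp (- c * of_real y))) \<longlongrightarrow> 0) at_top"
    using tendsto_mult[OF tendsto_const[of "- inverse c"] lim0[of 0]] by simp
   show "((%y. - inverse c * (of_real (y ^ 0) * exp (- c * of_real y))) has_vector_derivative
     of_real (y ^ 0) * exp (- c * of_real y)) (at y)" for y
   proof -
    have "((%z. - inverse c * exp (- c * z)) has_field_derivative exp (- c * of_real y)) (at (of_real y))"
     using c0 by (auto intro!: derivative_eq_intros)
    from has_vector_derivative_real_field[OF this] show ?thesis by simp
   qed
  qed (use int[of 0] in \<open>auto intro!: continuous_intros\<close>)
  then show ?case by (simp add: divide_inverse)
 next
  case (Suc k)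
  have "(LBINT y=0..\<infinity>. of_real (Suc k) * (of_real (y ^ k) * exp (- c * of_real y))
    - c * (of_real (y ^ Suc k) * exp (- c * of_real y))) = 0 - 0"
  proof (rule FTC[where F="%y. of_real (y ^ Suc k) * exp (- c * of_real y)"])
   show "((%y. of_real (y ^ Suc k) * exp (- c * of_real y)) has_vector_derivative
     of_real (Suc k) * (of_real (y ^ k) * exp (- c * of_real y)) - c * (of_real (y ^ Suc k) * exp (- c * of_real y))) (at y)" for y
   proof -
    have "((%z. z ^ Suc k * exp (- c * z)) has_field_derivative of_nat (Suc k) * (of_real y ^ k * exp (- c * of_real y))
      - c * (of_real y ^ Suc k * exp (- c * of_real y))) (at (of_real y))"
     by (rule derivative_eq_intros refl | simp add: algebra_simps)+
    from has_vector_derivative_real_field[OF this] show ?thesis by simp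
   qed
   show "set_integrable lborel (einterval 0 \<infinity>) (%y. of_real (Suc k) * (of_real (y ^ k) * exp (- c * of_real y))
    - c * (of_real (y ^ Suc k) * exp (- c * of_real y)))"
    by (intro set_integral_diff(1) set_integrable_mult_right int)
  qed (use lim0[of "Suc k"] in \<open>auto intro!: continuous_intros\<close>)
  moreover have "(LBINT y=0..\<infinity>. of_real (Suc k) * (of_real (y ^ k) * exp (- c * of_real y))
    - c * (of_real (y ^ Suc k) * exp (- c * of_real y))) = of_real (Suc k) * ?J k - c * ?J (Suc k)"
   using int[of k] int[of "Suc k"]
   by (subst interval_lebesgue_integral_diff(2)) (auto simp: interval_lebesgue_integrable_def intro: set_integrable_mult_right)
  ultimately have "c * ?J (Suc k) = of_real (Suc k) * ?J k" by simp
  then show ?case unfolding Suc using c0 by (simp add: field_simps)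
 qed
 then show ?thesis unfolding eq c_def .
qed

lemma resolvent_power_bound:
 assumes "0 < \<sigma>" "1 <= k"
 shows "cmod (1 / (of_real \<sigma> + \<i> * of_real \<tau>) ^ Suc k) <= 1 / (\<sigma> ^ (k - 1) * (\<sigma>\<^sup>2 + \<tau>\<^sup>2))"
proof -
 let ?c = "cmod (of_real \<sigma> + \<i> * of_real \<tau>)"
 have c2: "?c ^ 2 = \<sigma>\<^sup>2 + \<tau>\<^sup>2" by (simp add: cmod_power2)
 have "\<sigma> <= ?c" using abs_Re_le_cmod[of "of_real \<sigma> + \<i> * of_real \<tau>"] by simp
 then have "\<sigma> ^ (k - 1) * ?c ^ 2 <= ?c ^ (k - 1) * ?c ^ 2" using assms by (intro mult_right_mono power_mono) auto
 also have "... = ?c ^ Suc k" using assms(2) by (simp add: power_add[symmetric])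
 finally have "\<sigma> ^ (k - 1) * (\<sigma>\<^sup>2 + \<tau>\<^sup>2) <= ?c ^ Suc k" by (simp add: c2)
 moreover have "0 < \<sigma> ^ (k - 1) * (\<sigma>\<^sup>2 + \<tau>\<^sup>2)" using assms by (intro mult_pos_pos add_pos_nonneg) auto
 ultimately show ?thesis unfolding norm_divide norm_power by (simp add: frac_le)
qed

lemma integrable_cauchy: "0 < \<sigma> ==> integrable lborel (%\<tau>::real. 1 / (\<sigma>\<^sup>2 + \<tau>\<^sup>2))"
proof -
 assume s: "0 < \<sigma>"
 have "integrable lborel (%x::real. inverse (1 + x\<^sup>2))"
  using integrable_inverse_1_plus_square by (simp add: set_integrable_def einterval_def)
 from lborel_integrable_real_affine[OF this, of "1 / \<sigma>" 0] s
 have "integrable lborel (%x::real. (1 / \<sigma>\<^sup>2) * inverse (1 + (1 / \<sigma> * x)\<^sup>2))" by (intro integrable_mult_right) simp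
 moreover have "(1 / \<sigma>\<^sup>2) * inverse (1 + (1 / \<sigma> * x)\<^sup>2) = 1 / (\<sigma>\<^sup>2 + x\<^sup>2)" for x
 proof -
  have "\<sigma>\<^sup>2 * (1 + (1 / \<sigma> * x)\<^sup>2) = \<sigma>\<^sup>2 + x\<^sup>2" using s by (simp add: power_divide distrib_left)
  then show ?thesis by (simp add: divide_inverse flip: inverse_mult_distrib)
 qed
 ultimately show ?thesis by simp
qed

lemma integrable_resolvent_power:
 assumes "0 < \<sigma>" "1 <= k"
 shows "integrable lborel (%\<tau>. 1 / (of_real \<sigma> + \<i> * of_real \<tau>) ^ Suc k)"
proof (rule integrable_dominated)
 show "integrable lborel (%\<tau>. (1 / \<sigma> ^ (k - 1)) * (1 / (\<sigma>\<^sup>2 + \<tau>\<^sup>2)))"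
  by (intro integrable_mult_right integrable_cauchy assms)
 show "AE \<tau> in lborel. cmod (1 / (of_real \<sigma> + \<i> * of_real \<tau>) ^ Suc k) <= norm ((1 / \<sigma> ^ (k - 1)) * (1 / (\<sigma>\<^sup>2 + \<tau>\<^sup>2)))"
  using resolvent_power_bound[OF assms] assms by (intro AE_I2) (simp add: abs_mult del: power_Suc)
qed measurable

text \<open>Regularise with a Gaussian of width \<open>1/\<eta>\<close> in \<open>\<tau>\<close>. By Fubini the regularised integral averages
 \<open>gamma_fun\<close> near \<open>v\<close>, where it is continuous; then let \<open>\<eta>\<close> tend to 0.\<close>
lemma gamma_fun_inversion:
 assumes s: "0 < \<sigma>" and k: "1 <= k" and v: "0 < v"
 shows "(LINT \<tau>|lborel. exp (\<i> * of_real (\<tau> * v)) * (1 / (of_real \<sigma> + \<i> * of_real \<tau>) ^ Suc k))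
  = of_real (2 * pi * v ^ k * exp (- \<sigma> * v) / fact k)"
proof -
 let ?R = "%\<tau>::real. 1 / (of_real \<sigma> + \<i> * of_real \<tau>) ^ Suc k"
 let ?D = "%\<tau>::real. exp (\<i> * of_real (\<tau> * v)) * ?R \<tau>"
 let ?g = "%\<eta> t::real. exp (- ((\<eta> * t)\<^sup>2 / 2)) :: real"
 let ?\<gamma> = "gamma_fun k \<sigma>"
 define \<eta> where "\<eta> m = 1 / (real m + 1)" for m
 have e: "0 < \<eta> m" for m by (simp add: \<eta>_def)
 have e0: "\<eta> \<longlonglongrightarrow> 0" unfolding \<eta>_def by real_asymp
 have Ri: "integrable lborel (%\<tau>. cmod (?R \<tau>))" by (intro integrable_norm integrable_resolvent_power s k)
 have lim1: "(%m. LINT \<tau>|lborel. ?D \<tau> * of_real (?g (\<eta> m) \<tau>)) \<longlonglongrightarrow> (LINT \<tau>|lborel. ?D \<tau>)"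
 proof (rule integral_dominated_convergence[OF _ _ Ri])
  show "AE \<tau> in lborel. (%m. ?D \<tau> * of_real (?g (\<eta> m) \<tau>)) \<longlonglongrightarrow> ?D \<tau>"
  proof (intro AE_I2)
   fix \<tau> :: real
   have "(%m. ?D \<tau> * of_real (?g (\<eta> m) \<tau>)) \<longlonglongrightarrow> ?D \<tau> * of_real (?g 0 \<tau>)"
    by (intro tendsto_intros e0) auto
   then show "(%m. ?D \<tau> * of_real (?g (\<eta> m) \<tau>)) \<longlonglongrightarrow> ?D \<tau>" by simp
  qed
  show "AE \<tau> in lborel. cmod (?D \<tau> * of_real (?g (\<eta> m) \<tau>)) <= cmod (?R \<tau>)" for m
   unfolding norm_mult norm_exp_i_times norm_of_real
   by (intro AE_I2) (simp add: mult_left_le del: power_Suc)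
 qed measurable
 have eq: "of_real (fact k) * (LINT \<tau>|lborel. ?D \<tau> * of_real (?g (\<eta> m) \<tau>))
   = of_real (sqrt (2 * pi)) * (LINT t|lborel. of_real (?\<gamma> (v + \<eta> m * t) * ?g 1 t))" for m
 proof -
  let ?e = "\<eta> m"
  let ?H = "%\<tau> y. of_real (?\<gamma> y) * exp (- \<i> * of_real (\<tau> * y)) * (exp (\<i> * of_real (\<tau> * v)) * of_real (?g ?e \<tau>)) :: complex"
  have Hn: "cmod (?H \<tau> y) = ?\<gamma> y * ?g ?e \<tau>" for \<tau> y
   by (simp add: norm_mult gamma_fun_nonneg)
  have Hi: "integrable lborel2 (%(\<tau>, y). ?H \<tau> y)"
  proof (rule lborel_pair.Fubini_integrable)
   show "(%(\<tau>, y). ?H \<tau> y) \<in> borel_measurable lborel2" by measurable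
   show "integrable lborel (%\<tau>. LINT y|lborel. norm (case (\<tau>, y) of (\<tau>, y) => ?H \<tau> y))"
    unfolding prod.case Hn using gaussian_integrable[OF e] by simp
   show "AE \<tau> in lborel. integrable lborel (%y. case (\<tau>, y) of (\<tau>, y) => ?H \<tau> y)"
   proof (intro AE_I2)
    fix \<tau> :: real
    have "integrable lborel (%y. ?\<gamma> y * ?g ?e \<tau>)" using gamma_fun_integrable[OF s] by simp
    then show "integrable lborel (%y. case (\<tau>, y) of (\<tau>, y) => ?H \<tau> y)"
     unfolding prod.case
    proof (rule integrable_dominated)
     show "AE y in lborel. cmod (?H \<tau> y) <= norm (?\<gamma> y * ?g ?e \<tau>)"
      unfolding Hn by (intro AE_I2) simp
    qed measurable
   qed
  qed
  have "of_real (fact k) * (LINT \<tau>|lborel. ?D \<tau> * of_real (?g ?e \<tau>)) = (LINT \<tau>|lborel. LINT y|lborel. ?H \<tau> y)"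
  proof (subst integral_mult_right_zero[symmetric], intro lint_cong refl)
   fix \<tau> :: real
   have "(LINT y|lborel. ?H \<tau> y) = (of_real (fact k) * ?R \<tau>) * (exp (\<i> * of_real (\<tau> * v)) * of_real (?g ?e \<tau>))"
    using gamma_fun_fourier[OF s, of k \<tau>] by (simp del: power_Suc)
   then show "of_real (fact k) * (?D \<tau> * of_real (?g ?e \<tau>)) = (LINT y|lborel. ?H \<tau> y)"
    by (simp only: mult_ac)
  qed
  also have "... = (LINT y|lborel. LINT \<tau>|lborel. ?H \<tau> y)"
   by (rule lborel_pair.Fubini_integral[OF Hi, symmetric])
  also have "... = (LINT y|lborel. of_real (?\<gamma> y * (sqrt (2 * pi) / ?e * exp (- (((v - y) / ?e)\<^sup>2 / 2)))))"
  proof (intro lint_cong refl)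
   fix y :: real
   have "(LINT \<tau>|lborel. ?H \<tau> y) = (LINT \<tau>|lborel. of_real (?\<gamma> y) * (exp (\<i> * of_real (\<tau> * (v - y))) * of_real (?g ?e \<tau>)))"
   proof (intro lint_cong refl)
    fix \<tau> :: real
    have "exp (\<i> * of_real (\<tau> * (v - y))) = exp (- \<i> * of_real (\<tau> * y)) * exp (\<i> * of_real (\<tau> * v))"
     unfolding exp_add[symmetric] by (simp add: algebra_simps)
    then show "?H \<tau> y = of_real (?\<gamma> y) * (exp (\<i> * of_real (\<tau> * (v - y))) * of_real (?g ?e \<tau>))"
     by (simp only: mult_ac)
   qed
   also have "... = of_real (?\<gamma> y) * of_real (sqrt (2 * pi) / ?e * exp (- (((v - y) / ?e)\<^sup>2 / 2)))"
    by (simp only: integral_mult_right_zero gaussian_fourier[OF e])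
   finally show "(LINT \<tau>|lborel. ?H \<tau> y) = of_real (?\<gamma> y * (sqrt (2 * pi) / ?e * exp (- (((v - y) / ?e)\<^sup>2 / 2))))"
    by (simp only: of_real_mult)
  qed
  also have "... = of_real ?e * (LINT t|lborel. of_real (?\<gamma> (v + ?e * t) * (sqrt (2 * pi) / ?e * exp (- (((v - (v + ?e * t)) / ?e)\<^sup>2 / 2)))))"
   using lborel_integral_real_affine[of ?e "%y. complex_of_real (?\<gamma> y * (sqrt (2 * pi) / ?e * exp (- (((v - y) / ?e)\<^sup>2 / 2))))" v] e[of m]
   by (simp add: scaleR_conv_of_real)
  also have "... = (LINT t|lborel. of_real ?e * of_real (?\<gamma> (v + ?e * t) * (sqrt (2 * pi) / ?e * exp (- (((v - (v + ?e * t)) / ?e)\<^sup>2 / 2)))))"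
   by (rule integral_mult_right_zero[symmetric])
  also have "... = (LINT t|lborel. of_real (sqrt (2 * pi)) * of_real (?\<gamma> (v + ?e * t) * ?g 1 t))"
  proof (intro lint_cong refl)
   fix t
   have "?e * (?\<gamma> (v + ?e * t) * (sqrt (2 * pi) / ?e * exp (- (((v - (v + ?e * t)) / ?e)\<^sup>2 / 2))))
     = sqrt (2 * pi) * (?\<gamma> (v + ?e * t) * ?g 1 t)" using e[of m] by simp
   then show "of_real ?e * of_real (?\<gamma> (v + ?e * t) * (sqrt (2 * pi) / ?e * exp (- (((v - (v + ?e * t)) / ?e)\<^sup>2 / 2))))
     = complex_of_real (sqrt (2 * pi)) * of_real (?\<gamma> (v + ?e * t) * ?g 1 t)"
    by (metis of_real_mult)
  qed
  also have "... = of_real (sqrt (2 * pi)) * (LINT t|lborel. of_real (?\<gamma> (v + ?e * t) * ?g 1 t))"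
   by (rule integral_mult_right_zero)
  finally show ?thesis .
 qed
 obtain B where B: "!!y. ?\<gamma> y <= B" using gamma_fun_bounded[OF s] by blast
 have lim2: "(%m. LINT t|lborel. complex_of_real (?\<gamma> (v + \<eta> m * t) * ?g 1 t)) \<longlonglongrightarrow> (LINT t|lborel. complex_of_real (?\<gamma> v * ?g 1 t))"
 proof (rule integral_dominated_convergence[where w="%t. B * ?g 1 t"])
  show "integrable lborel (%t. B * ?g 1 t)" by (intro integrable_mult_right gaussian_integrable) simp
  show "AE t in lborel. cmod (complex_of_real (?\<gamma> (v + \<eta> m * t) * ?g 1 t)) <= B * ?g 1 t" for m
   unfolding norm_of_real abs_mult by (intro AE_I2) (simp add: gamma_fun_nonneg B)
  have c: "isCont ?\<gamma> v"
  proof -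
   have "isCont (%y. y ^ k * exp (- \<sigma> * y)) v" by (intro continuous_intros)
   moreover have "eventually (%y. ?\<gamma> y = y ^ k * exp (- \<sigma> * y)) (nhds v)"
    using eventually_nhds_in_open[of "{0<..}" v] v by (auto elim!: eventually_mono simp: gamma_fun_def)
   ultimately show ?thesis using isCont_cong by metis
  qed
  show "AE t in lborel. (%m. complex_of_real (?\<gamma> (v + \<eta> m * t) * ?g 1 t)) \<longlonglongrightarrow> complex_of_real (?\<gamma> v * ?g 1 t)"
  proof (intro AE_I2)
   fix t :: real
   have "(%m. v + \<eta> m * t) \<longlonglongrightarrow> v + 0 * t" by (intro tendsto_intros e0)
   then have "(%m. ?\<gamma> (v + \<eta> m * t)) \<longlonglongrightarrow> ?\<gamma> v" using isCont_tendsto_compose[OF c] by simp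
   then show "(%m. complex_of_real (?\<gamma> (v + \<eta> m * t) * ?g 1 t)) \<longlonglongrightarrow> complex_of_real (?\<gamma> v * ?g 1 t)"
    by (intro tendsto_intros)
  qed
 qed measurable
 have gi: "(LINT t|lborel. complex_of_real (?\<gamma> v * ?g 1 t)) = of_real (?\<gamma> v * sqrt (2 * pi))"
  using gaussian_fourier[of 1 0] by simp
 have "(%m. of_real (fact k) * (LINT \<tau>|lborel. ?D \<tau> * of_real (?g (\<eta> m) \<tau>))) \<longlonglongrightarrow> of_real (sqrt (2 * pi)) * of_real (?\<gamma> v * sqrt (2 * pi))"
  unfolding eq using lim2 unfolding gi by (intro tendsto_intros)
 moreover have "(%m. of_real (fact k) * (LINT \<tau>|lborel. ?D \<tau> * of_real (?g (\<eta> m) \<tau>))) \<longlonglongrightarrow> of_real (fact k) * (LINT \<tau>|lborel. ?D \<tau>)"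
  by (intro tendsto_intros lim1)
 ultimately have "of_real (fact k) * (LINT \<tau>|lborel. ?D \<tau>) = of_real (sqrt (2 * pi)) * of_real (?\<gamma> v * sqrt (2 * pi))"
  using LIMSEQ_unique by blast
 also have "... = of_real (2 * pi * ?\<gamma> v)"
 proof -
  have sq: "sqrt (2 * pi) * sqrt (2 * pi) = 2 * pi" by simp
  have "sqrt (2 * pi) * (?\<gamma> v * sqrt (2 * pi)) = ?\<gamma> v * (sqrt (2 * pi) * sqrt (2 * pi))"
   by (simp only: mult_ac)
  also have "... = 2 * pi * ?\<gamma> v" unfolding sq by (simp only: mult_ac)
  finally show ?thesis by (simp only: of_real_mult[symmetric])
 qed
 finally have "(LINT \<tau>|lborel. ?D \<tau>) = of_real (2 * pi * ?\<gamma> v / fact k)"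
  by (simp add: field_simps)
 then show ?thesis using v by (simp add: gamma_fun_def mult.assoc)
qed

section \<open>Oscillating kernels at unit scale\<close>

text \<open>Integrating a function over translates through a fixed bounded set only multiplies its integral by the
 measure of the set. Applied to slices of \<open>f\<close> and \<open>g\<close>, this recovers their full norms.\<close>
lemma local_average:
 fixes \<phi> :: "'a::euclidean_space => real" and L :: "'b::euclidean_space => 'a"
 assumes "nice \<phi>" and [measurable]: "L \<in> borel_measurable borel" "K \<in> sets borel"
  and K: "!!\<xi>. \<xi> \<in> K ==> norm \<xi> <= r" "!!\<xi>. \<xi> \<in> K ==> norm (L \<xi>) <= r"
 shows "nice (%Z. LINT \<xi>|lborel. indicator K \<xi> * \<phi> (Z + L \<xi>))"
  and "(LINT Z|lborel. LINT \<xi>|lborel. indicator K \<xi> * \<phi> (Z + L \<xi>)) = measure lborel K * (LINT Z|lborel. \<phi> Z)"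
  and "nice (%\<xi>. indicator K \<xi> * \<phi> (Z + L \<xi>))"
proof -
 obtain M R where 1: "0 <= M" "0 <= R" "!!x. norm (\<phi> x) <= M" "!!x. R < norm x ==> \<phi> x = 0"
  using niceE[OF assms(1)] by metis
 note [measurable] = nice_measurable[OF assms(1)]
 let ?F = "%z. indicator K (snd z) * \<phi> (fst z + L (snd z)) :: real"
 have F: "nice ?F"
 proof (rule niceI[where M=M and R="R + 2 * \<bar>r\<bar>"])
  show "?F \<in> borel_measurable borel" unfolding borel_prod[symmetric] by measurable
  show "norm (?F z) <= M" for z using 1(1,3) by (auto simp: indicator_def)
  show "?F z = 0" if "R + 2 * \<bar>r\<bar> < norm z" for z
  proof (cases "snd z \<in> K")
   case True
   have "norm z <= norm (fst z) + norm (snd z)" by (metis norm_Pair_le prod.collapse)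
   moreover have "norm (fst z) <= norm (fst z + L (snd z)) + norm (L (snd z))"
    using norm_triangle_ineq4[of "fst z + L (snd z)" "L (snd z)"] by simp
   ultimately have "R < norm (fst z + L (snd z))" using that K[OF True] by linarith
   then show ?thesis using 1(4) by simp
  qed simp
 qed
 from nice_integral_snd[OF F] show "nice (%Z. LINT \<xi>|lborel. indicator K \<xi> * \<phi> (Z + L \<xi>))" by simp
 from nice_section(1)[OF F] show "nice (%\<xi>. indicator K \<xi> * \<phi> (Z + L \<xi>))" by simp
 have "(LINT Z|lborel. LINT \<xi>|lborel. indicator K \<xi> * \<phi> (Z + L \<xi>)) = (LINT \<xi>|lborel. LINT Z|lborel. indicator K \<xi> * \<phi> (Z + L \<xi>))"
  using nice_Fubini(2)[OF F] by simp
 also have "... = (LINT \<xi>|lborel. indicator K \<xi> * (LINT Z|lborel. \<phi> Z))"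
 proof (intro lint_cong refl)
  fix \<xi>
  have "(LINT Z|lborel. \<phi> (L \<xi> + Z)) = (LINT Z|lborel. \<phi> Z)" by (rule integral_lborel_shift) measurable
  then show "(LINT Z|lborel. indicator K \<xi> * \<phi> (Z + L \<xi>)) = indicator K \<xi> * (LINT Z|lborel. \<phi> Z)"
   by (simp add: add.commute)
 qed
 also have "... = measure lborel K * (LINT Z|lborel. \<phi> Z)" by simp
 finally show "(LINT Z|lborel. LINT \<xi>|lborel. indicator K \<xi> * \<phi> (Z + L \<xi>)) = measure lborel K * (LINT Z|lborel. \<phi> Z)" .
qed

text \<open>The hypothesis in straightened coordinates. The power of \<open>l\<close> comes from the dilation \<open>l *\<^sub>R w\<close> in \<open>T_op\<close>.\<close>
lemma slice_op_lp:
 fixes f :: "real^('m::finite option) => complex" and C0 :: real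
 assumes e: "0 < e" and p: "0 < p" and l: "1 <= l" and f: "nice f"
  and hyp: "!!F. F \<in> Lp p (ball 0 1) ==> T_op (amp e N) (phase e) l F \<in> Lp p (UNIV :: (real^('m option)) set) \<and>
    Lp_norm p UNIV (T_op (amp e N) (phase e) l F) <= C0 * Lp_norm p (ball 0 1) F"
 shows "(LINT x|lborel. cmod (slice_op N (2 * pi * l) f Z x) powr p)
  <= (2 / e) ^ CARD('m) * (4 / e) * \<bar>C0\<bar> powr p * l powr (- real CARD('m option)) *
    (LINT \<xi>|lborel. indicator (ball 0 1) \<xi> * cmod (f (Z - emb \<xi>)) powr p)"
proof -
 let ?F = "%\<xi>. f (Z - emb \<xi>)" and ?S = "slice_op N (2 * pi * l) f Z"
 let ?T = "T_op (amp e N) (phase e) l ?F"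
 let ?B = "LINT \<xi>|lborel. indicator (ball 0 1) \<xi> * cmod (f (Z - emb \<xi>)) powr p"
 let ?n = "CARD('m option)"
 have nS: "nice ?S" by (rule nice_slice_op[OF f])
 have nF: "nice ?F" by (rule nice_slice[OF f])
 note [measurable] = nice_measurable[OF nS] nice_measurable[OF nF]
 have mb[measurable]: "ball (0::real^'m) 1 \<in> sets borel" by simp
 have mFi: "(%\<xi>. indicator (ball 0 1) \<xi> * cmod (?F \<xi>) powr p) \<in> borel_measurable borel" by measurable
 have nFi: "nice (%\<xi>. indicator (ball 0 1) \<xi> * cmod (?F \<xi>) powr p)"
  by (rule nice_dominated[OF nice_norm_powr[OF nF p] mFi, of 1]) (auto simp: indicator_def)
 have B0: "0 <= ?B" by (simp add: integral_nonneg)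
 have "set_borel_measurable lebesgue (ball 0 1) ?F"
  unfolding set_borel_measurable_def by (rule measurable_completion) measurable
 moreover have "set_integrable lebesgue (ball 0 1) (%\<xi>. cmod (?F \<xi>) powr p)"
  unfolding set_integrable_def using nice_integrable[OF nFi] mFi by (subst integrable_completion) auto
 ultimately have FL: "?F \<in> Lp p (ball 0 1)" by (simp add: Lp_def)
 have "(LINT \<xi>:ball 0 1|lebesgue. cmod (?F \<xi>) powr p) = ?B"
  unfolding set_lebesgue_integral_def using mFi by (subst integral_completion) auto
 then have LF: "Lp_norm p (ball 0 1) ?F = ?B powr (1 / p)" by (simp add: Lp_norm_def)
 define TT where "TT = (LINT x|lebesgue. cmod (?T x) powr p)"
 have Ti: "integrable lebesgue (%x. cmod (?T x) powr p)"
  using hyp[OF FL] by (simp add: Lp_def set_integrable_def)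
 have TT0: "0 <= TT" by (simp add: TT_def integral_nonneg)
 have "TT powr (1 / p) <= C0 * ?B powr (1 / p)"
  using hyp[OF FL, THEN conjunct2] unfolding LF
  by (simp add: Lp_norm_def TT_def set_lebesgue_integral_def)
 also have "... <= \<bar>C0\<bar> * ?B powr (1 / p)" by (intro mult_right_mono) auto
 finally have "(TT powr (1 / p)) powr p <= (\<bar>C0\<bar> * ?B powr (1 / p)) powr p"
  by (intro powr_mono2) (use p in auto)
 then have TTle: "TT <= \<bar>C0\<bar> powr p * ?B"
  using p TT0 B0 by (simp add: powr_powr powr_mult)
 define h where "h w = ennreal (cmod (?S (straighten e w)) powr p) * indicator {w. 0 < 1 + w $ None} w" for w
 have m2[measurable]: "{w::real^('m option). 0 < 1 + w $ None} \<in> sets borel"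
  by (intro borel_open open_Collect_less continuous_intros)
 have h[measurable]: "h \<in> borel_measurable borel" unfolding h_def by measurable
 have hT: "h ((1 / l) *\<^sub>R x) <= ennreal (cmod (?T x) powr p)" for x
 proof (cases "0 < 1 + ((1 / l) *\<^sub>R x) $ None")
  case True
  have "?S (straighten e ((1 / l) *\<^sub>R x)) = ?T (l *\<^sub>R ((1 / l) *\<^sub>R x))"
   by (rule slice_op_straighten[OF f True]) (use l in simp)
  also have "l *\<^sub>R ((1 / l) *\<^sub>R x) = x" using l by simp
  finally show ?thesis by (simp add: h_def indicator_def)
 qed (simp add: h_def indicator_def)
 have "ennreal (LINT x|lborel. cmod (?S x) powr p) = (\<integral>\<^sup>+x. ennreal (cmod (?S x) powr p) \<partial>lborel)"
  using integrable_lp_nice[OF nS p] by (simp add: nn_integral_eq_integral)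
 also have "... = (\<integral>\<^sup>+x. ennreal (cmod (?S x) powr p) * indicator {x. 1 < x $ None \<and> x $ None < 2} x \<partial>lborel)"
 proof (intro nn_integral_cong)
  fix x
  show "ennreal (cmod (?S x) powr p) = ennreal (cmod (?S x) powr p) * indicator {x. 1 < x $ None \<and> x $ None < 2} x"
   using slice_op_eq_0[of x N "2 * pi * l" f Z]
   by (cases "1 < x $ None \<and> x $ None < 2") (auto simp: indicator_def)
 qed
 also have "... <= ennreal ((2 / e) ^ CARD('m) * (4 / e)) * (\<integral>\<^sup>+w. h w \<partial>lborel)"
  unfolding h_def by (rule nn_integral_straighten[OF _ e]) measurable
 also have "(\<integral>\<^sup>+w. h w \<partial>lborel) = ennreal (\<bar>1 / l\<bar> ^ ?n) * (\<integral>\<^sup>+x. h ((1 / l) *\<^sub>R x) \<partial>lborel)"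
  by (subst nn_integral_lborel_scale[of _ "1 / l"]) (use l in auto)
 also have "(\<integral>\<^sup>+x. h ((1 / l) *\<^sub>R x) \<partial>lborel) = (\<integral>\<^sup>+x. h ((1 / l) *\<^sub>R x) \<partial>lebesgue)"
  by (simp add: nn_integral_completion)
 also have "ennreal ((2 / e) ^ CARD('m) * (4 / e)) * (ennreal (\<bar>1 / l\<bar> ^ ?n) * (\<integral>\<^sup>+x. h ((1 / l) *\<^sub>R x) \<partial>lebesgue))
   <= ennreal ((2 / e) ^ CARD('m) * (4 / e)) * (ennreal (\<bar>1 / l\<bar> ^ ?n) * (\<integral>\<^sup>+x. ennreal (cmod (?T x) powr p) \<partial>lebesgue))"
  by (intro mult_left_mono nn_integral_mono hT) auto
 also have "(\<integral>\<^sup>+x. ennreal (cmod (?T x) powr p) \<partial>lebesgue) = ennreal TT"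
  unfolding TT_def using Ti by (simp add: nn_integral_eq_integral)
 also have "ennreal ((2 / e) ^ CARD('m) * (4 / e)) * (ennreal (\<bar>1 / l\<bar> ^ ?n) * ennreal TT)
   = ennreal (((2 / e) ^ CARD('m) * (4 / e)) * (\<bar>1 / l\<bar> ^ ?n * TT))"
 proof -
  have "ennreal a * (ennreal b * ennreal t) = ennreal (a * (b * t))" if "0 <= a" "0 <= b" "0 <= t" for a b t
   using that by (simp add: ennreal_mult)
  then show ?thesis using e TT0 by auto
 qed
 finally have "(LINT x|lborel. cmod (?S x) powr p) <= ((2 / e) ^ CARD('m) * (4 / e)) * (\<bar>1 / l\<bar> ^ ?n * TT)"
  using e TT0 by (subst (asm) ennreal_le_iff) auto
 also have "\<bar>1 / l\<bar> ^ ?n = l powr (- real ?n)"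
 proof -
  have "\<bar>1 / l\<bar> ^ m = l powr (- real m)" for m
   using l by (simp add: powr_minus powr_realpow power_divide divide_inverse power_inverse)
  then show ?thesis .
 qed
 also have "((2 / e) ^ CARD('m) * (4 / e)) * (l powr (- real ?n) * TT) <= ((2 / e) ^ CARD('m) * (4 / e)) * (l powr (- real ?n) * (\<bar>C0\<bar> powr p * ?B))"
  using e by (intro mult_left_mono TTle) auto
 finally show ?thesis by (simp only: mult_ac)
qed

lemma slice_op_support:
 fixes x :: "real^('m::finite option)"
 assumes "2 * real CARD('m option) + 1 < norm x"
 shows "slice_op N \<omega> f Z x = 0"
proof -
 have "of_real (window \<xi>) * osc_kernel N \<omega> (x + emb \<xi>) * f (Z - emb \<xi>) = 0" for \<xi>
 proof (cases "window \<xi> = 0 \<or> osc_kernel N \<omega> (x + emb \<xi>) = 0")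
  case False
  then have "norm \<xi> < 1" using window_ball by force
  moreover have "shell_kernel N (x + emb \<xi>) \<noteq> 0" using False by (auto simp: osc_kernel_def)
  then have "\<bar>(x + emb \<xi>) $ j\<bar> <= 2" for j
   using shell_kernel_nz(3)[of N "x + emb \<xi>" j] by (intro less_imp_le)
  then have "norm (x + emb \<xi>) <= real CARD('m option) * 2" by (rule norm_le_of_components)
  moreover have "norm x <= norm (x + emb \<xi>) + norm \<xi>"
   using norm_triangle_ineq4[of "x + emb \<xi>" "emb \<xi>"] by simp
  ultimately show ?thesis using assms by linarith
 qed auto
 then show ?thesis unfolding slice_op_def by (simp only: integral_zero)
qed

text \<open>Hoelder's inequality on each slab, first in \<open>x\<close> and then in \<open>Z\<close>. The slab operator is local, so \<open>g\<close> enters only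
 through its restriction to a ball around \<open>Z\<close>.\<close>
lemma osc_kernel_bound_large:
 fixes C0 :: real
 assumes e: "0 < e" and pq: "1 < p" "1 < q" "1 / p + 1 / q = 1"
  and hyp: "!!l F. 1 <= l ==> F \<in> Lp p (ball 0 1) ==> T_op (amp e N) (phase e) l F \<in> Lp p (UNIV :: (real^('m::finite option)) set) \<and>
    Lp_norm p UNIV (T_op (amp e N) (phase e) l F) <= C0 * Lp_norm p (ball 0 1) F"
 shows "\<exists>C\<ge>0. \<forall>l\<ge>1. \<forall>f g. nice f --> nice g -->
  cmod (LINT h|lborel. osc_kernel N (2 * pi * l) h * corr f g (h :: real^('m option)))
   <= C * l powr (- real CARD('m option) / p) * lp_norm p f * lp_norm q g"
proof -
 \<comment> \<open>outside the ball of radius \<open>R\<close> the slice operator vanishes\<close>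
 define R where "R = 2 * real CARD('m option) + 1"
 define C1 where "C1 = (2 / e) ^ CARD('m) * (4 / e) * \<bar>C0\<bar> powr p"
 define V where "V = measure lborel (ball (0::real^'m) 1)"
 define V' where "V' = measure lborel (cball (0::real^('m option)) R)"
 define W where "W = (LINT \<xi>|lborel. window (\<xi>::real^'m))"
 define C where "C = C1 powr (1 / p) * V powr (1 / p) * V' powr (1 / q) / W"
 have W: "W > 0" unfolding W_def by (rule window_integral_pos)
 have C1: "C1 \<ge> 0" unfolding C1_def using e by simp
 have VV: "V \<ge> 0" "V' \<ge> 0" by (simp_all add: V_def V'_def)
 have "cmod (pairing (osc_kernel N (2 * pi * l)) f g)
   <= C * l powr (- real CARD('m option) / p) * lp_norm p f * lp_norm q g"
  if l: "1 <= l" and f: "nice f" and g: "nice g" for l and f g :: "real^('m option) => complex"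
 proof -
  let ?A = "%Z. LINT \<xi>|lborel. indicator (ball 0 1) \<xi> * cmod (f (Z - emb (\<xi>::real^'m))) powr p"
  let ?B = "%Z. LINT x|lborel. indicator (cball 0 R) x * cmod (g (Z + x)) powr q"
  let ?S = "%Z. slice_op N (2 * pi * l) f Z"
  let ?\<Lambda> = "%Z. LINT x|lborel. ?S Z x * g (Z + x)"
  have p0: "0 < p" "0 < q" using pq by auto
  note [measurable] = nice_measurable[OF f] nice_measurable[OF g]
  have nS: "nice (?S Z)" for Z by (rule nice_slice_op[OF f])
  have A: "nice ?A" "(LINT Z|lborel. ?A Z) = V * (LINT x|lborel. cmod (f x) powr p)"
   using local_average(1,2)[OF nice_norm_powr[OF f p0(1)], of "%\<xi>. - emb \<xi>" "ball (0::real^'m) 1" 1]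
   by (simp_all add: V_def less_imp_le)
  have B: "nice ?B" "(LINT Z|lborel. ?B Z) = V' * (LINT x|lborel. cmod (g x) powr q)"
   "nice (%x. indicator (cball 0 R) x * cmod (g (Z + x)) powr q)" for Z
   using local_average[OF nice_norm_powr[OF g p0(2)], of "%x. x" "cball (0::real^('m option)) R" R]
   by (simp_all add: V'_def)
  have A0: "0 <= ?A Z" and B0: "0 <= ?B Z" for Z by (simp_all add: integral_nonneg)
  have L: "cmod (?\<Lambda> Z) <= C1 powr (1 / p) * l powr (- real CARD('m option) / p) * ((?A Z) powr (1 / p) * (?B Z) powr (1 / q))" for Z
  proof -
   have [measurable]: "cball (0::real^('m option)) R \<in> sets borel" by simp
   let ?v = "%x. indicator (cball 0 R) x * cmod (g (Z + x))"
   have "cmod (?S Z x * g (Z + x)) = cmod (?S Z x) * ?v x" for x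
    using slice_op_support[of x N "2 * pi * l" f Z]
    by (cases "norm x <= R") (auto simp: R_def indicator_def norm_mult)
   then have "cmod (?\<Lambda> Z) <= (LINT x|lborel. cmod (?S Z x) * ?v x)"
    using integral_norm_bound[of lborel "%x. ?S Z x * g (Z + x)"] by simp
   also have "... <= (LINT x|lborel. cmod (?S Z x) powr p) powr (1 / p) * (LINT x|lborel. ?v x powr q) powr (1 / q)"
   proof (rule Holder_inequality_real(2)[OF pq])
    have vq: "?v x powr q = indicator (cball 0 R) x * cmod (g (Z + x)) powr q" for x
     using p0 by (auto simp: indicator_def)
    show "integrable lborel (%x. ?v x powr q)" unfolding vq by (rule nice_integrable[OF B(3)])
   qed (use integrable_lp_nice[OF nS p0(1)] nice_measurable[OF nS] in auto)
   also have "(LINT x|lborel. ?v x powr q) = ?B Z"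
    using p0 by (intro lint_cong refl) (auto simp: indicator_def)
   also have "(LINT x|lborel. cmod (?S Z x) powr p) powr (1 / p) <= (C1 * l powr (- real CARD('m option)) * ?A Z) powr (1 / p)"
    unfolding C1_def by (intro powr_mono2 slice_op_lp[OF e p0(1) l f hyp[OF l]]) (use p0 in \<open>auto simp: integral_nonneg\<close>)
   also have "... = C1 powr (1 / p) * l powr (- real CARD('m option) / p) * (?A Z) powr (1 / p)"
    using C1 A0 l by (simp add: powr_mult powr_powr)
   finally show ?thesis by (simp add: mult_right_mono mult.assoc)
  qed
  have AB: "integrable lborel (%Z. (?A Z) powr (1 / p) * (?B Z) powr (1 / q))"
   "(LINT Z|lborel. (?A Z) powr (1 / p) * (?B Z) powr (1 / q)) <= (LINT Z|lborel. ?A Z) powr (1 / p) * (LINT Z|lborel. ?B Z) powr (1 / q)"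
  proof -
   have r: "((?A Z) powr (1 / p)) powr p = ?A Z" "((?B Z) powr (1 / q)) powr q = ?B Z" for Z
    using A0[of Z] B0[of Z] p0 by (simp_all add: powr_powr)
   note H = Holder_inequality_real[OF pq, of "%Z. (?A Z) powr (1 / p)" lborel "%Z. (?B Z) powr (1 / q)", unfolded r]
   have m: "(%Z. (?A Z) powr (1 / p)) \<in> borel_measurable lborel" "(%Z. (?B Z) powr (1 / q)) \<in> borel_measurable lborel"
    using nice_measurable[OF A(1)] nice_measurable[OF B(1)] by auto
   show "integrable lborel (%Z. (?A Z) powr (1 / p) * (?B Z) powr (1 / q))"
    "(LINT Z|lborel. (?A Z) powr (1 / p) * (?B Z) powr (1 / q)) <= (LINT Z|lborel. ?A Z) powr (1 / p) * (LINT Z|lborel. ?B Z) powr (1 / q)"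
    by (rule H[OF m _ _ nice_integrable[OF A(1)] nice_integrable[OF B(1)]]; simp)+
  qed
  let ?k = "C1 powr (1 / p) * l powr (- real CARD('m option) / p)"
  have k: "0 <= ?k" by simp
  have "W * cmod (pairing (osc_kernel N (2 * pi * l)) f g) = cmod (LINT Z|lborel. ?\<Lambda> Z)"
   using arg_cong[OF slab_identity(1)[OF f g, of N "2 * pi * l"], of cmod]
   unfolding W_def[symmetric] norm_mult norm_of_real abs_of_pos[OF W] .
  also have "... <= (LINT Z|lborel. cmod (?\<Lambda> Z))" by (rule integral_norm_bound)
  also have "... <= (LINT Z|lborel. ?k * ((?A Z) powr (1 / p) * (?B Z) powr (1 / q)))"
   by (intro integral_mono integrable_mult_right AB(1) L nice_integrable nice_norm slab_identity(2)[OF f g])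
  also have "... = ?k * (LINT Z|lborel. (?A Z) powr (1 / p) * (?B Z) powr (1 / q))" by simp
  also have "... <= ?k * ((LINT Z|lborel. ?A Z) powr (1 / p) * (LINT Z|lborel. ?B Z) powr (1 / q))"
   by (rule mult_left_mono[OF AB(2) k])
  also have "... = ?k * ((V powr (1 / p) * lp_norm p f) * (V' powr (1 / q) * lp_norm q g))"
   unfolding A(2) B(2) lp_norm_def using VV by (simp add: powr_mult integral_nonneg)
  finally have "cmod (pairing (osc_kernel N (2 * pi * l)) f g)
    <= ?k * ((V powr (1 / p) * lp_norm p f) * (V' powr (1 / q) * lp_norm q g)) / W"
   using W by (simp add: pos_le_divide_eq mult.commute)
  also have "... = C * l powr (- real CARD('m option) / p) * lp_norm p f * lp_norm q g"
   unfolding C_def by (simp add: mult_ac)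
  finally show ?thesis .
 qed
 moreover have "C \<ge> 0" unfolding C_def using W by simp
 ultimately show ?thesis by blast
qed

text \<open>Negative frequencies follow by complex conjugation, bounded ones from the integrability of the kernel.\<close>
lemma osc_kernel_bound:
 fixes C0 :: real
 assumes e: "0 < e" and pq: "1 < p" "1 < q" "1 / p + 1 / q = 1"
  and hyp: "!!l F. 1 <= l ==> F \<in> Lp p (ball 0 1) ==> T_op (amp e N) (phase e) l F \<in> Lp p (UNIV :: (real^('m::finite option)) set) \<and>
    Lp_norm p UNIV (T_op (amp e N) (phase e) l F) <= C0 * Lp_norm p (ball 0 1) F"
 shows "\<exists>C\<ge>0. \<forall>\<omega> f g. nice f --> nice g -->
  cmod (LINT h|lborel. osc_kernel N \<omega> h * corr f g (h :: real^('m option)))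
   <= C * (1 + \<bar>\<omega>\<bar>) powr (- real CARD('m option) / p) * (lp_norm p f * lp_norm q g)"
proof -
 let ?\<beta> = "real CARD('m option) / p"
 obtain C where C: "0 <= C" "!!l f g. 1 <= l ==> nice f ==> nice g ==>
  cmod (LINT h|lborel. osc_kernel N (2 * pi * l) h * corr f g (h :: real^('m option)))
   <= C * l powr (- real CARD('m option) / p) * lp_norm p f * lp_norm q g"
  using osc_kernel_bound_large[OF e pq hyp] by blast
 define S where "S = (LINT h|lborel. shell_kernel N (h :: real^('m option)))"
 define K where "K = (1 + 2 * pi) powr ?\<beta>"
 have K: "K > 0" unfolding K_def powr_gt_zero using pi_gt_zero by linarith
 have S: "0 <= S" unfolding S_def by (simp add: integral_nonneg shell_kernel_nonneg)
 have b: "0 < ?\<beta>" using pq by simp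
 have large: "cmod (pairing (osc_kernel N \<omega>) f g) <= C * K * (1 + \<bar>\<omega>\<bar>) powr (- ?\<beta>) * (lp_norm p f * lp_norm q g)"
  if w: "2 * pi <= \<omega>" and f: "nice f" and g: "nice g" for \<omega> and f g :: "real^('m option) => complex"
 proof -
  define l where "l = \<omega> / (2 * pi)"
  have l: "1 <= l" "\<omega> = 2 * pi * l" using w pi_gt_zero by (auto simp: l_def)
  have "(1 + \<bar>\<omega>\<bar>) / (1 + 2 * pi) <= l"
   using l pi_gt_zero by (simp add: pos_divide_le_eq add_pos_pos algebra_simps)
  moreover have "0 < (1 + \<bar>\<omega>\<bar>) / (1 + 2 * pi)"
   by (rule divide_pos_pos) (use pi_gt_zero in linarith)+
  moreover have "- ?\<beta> <= 0" using b by linarith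
  ultimately have "l powr (- ?\<beta>) <= ((1 + \<bar>\<omega>\<bar>) / (1 + 2 * pi)) powr (- ?\<beta>)"
   by (intro powr_mono2')
  also have "... = K * (1 + \<bar>\<omega>\<bar>) powr (- ?\<beta>)"
  proof -
   have "(x / y) powr (- b) = y powr b * x powr (- b)" if "0 < x" "0 < y" for x y b :: real
    using that by (simp add: powr_divide powr_minus field_simps)
   then show ?thesis unfolding K_def using pi_gt_zero by (simp add: add_pos_pos add_pos_nonneg)
  qed
  finally have "l powr (- ?\<beta>) <= K * (1 + \<bar>\<omega>\<bar>) powr (- ?\<beta>)" .
  then have "C * l powr (- ?\<beta>) * (lp_norm p f * lp_norm q g) <= C * (K * (1 + \<bar>\<omega>\<bar>) powr (- ?\<beta>)) * (lp_norm p f * lp_norm q g)"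
   using C(1) by (intro mult_right_mono mult_left_mono) (auto simp: lp_norm_nonneg)
  moreover have "cmod (pairing (osc_kernel N \<omega>) f g) <= C * l powr (- ?\<beta>) * (lp_norm p f * lp_norm q g)"
   using C(2)[OF l(1) f g] unfolding minus_divide_left[symmetric] l(2) by (simp only: mult.assoc)
  ultimately show ?thesis by (simp only: mult.assoc)
 qed
 have cj: "cmod (LINT h|lborel. osc_kernel N (- \<omega>) h * corr f g h)
   = cmod (LINT h|lborel. osc_kernel N \<omega> h * corr (%x. cnj (f x)) (%x. cnj (g x)) h)"
  for \<omega> and f g :: "real^('m option) => complex"
 proof -
  have "osc_kernel N \<omega> h * corr (%x. cnj (f x)) (%x. cnj (g x)) h = cnj (osc_kernel N (- \<omega>) h * corr f g h)" for h
   by (simp add: corr_cnj osc_kernel_def exp_cnj)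
  then have "(LINT h|lborel. osc_kernel N \<omega> h * corr (%x. cnj (f x)) (%x. cnj (g x)) h)
    = cnj (LINT h|lborel. osc_kernel N (- \<omega>) h * corr f g h)"
   by (simp only: Bochner_Integration.integral_cnj)
  then show ?thesis by (simp only: complex_mod_cnj)
 qed
 have small: "cmod (pairing (osc_kernel N \<omega>) f g) <= S * K * (1 + \<bar>\<omega>\<bar>) powr (- ?\<beta>) * (lp_norm p f * lp_norm q g)"
  if w: "\<bar>\<omega>\<bar> <= 2 * pi" and f: "nice f" and g: "nice g" for \<omega> and f g :: "real^('m option) => complex"
 proof -
  let ?L = "lp_norm p f * lp_norm q g"
  have "cmod (pairing (osc_kernel N \<omega>) f g) <= (LINT h|lborel. shell_kernel N (h :: real^('m option)) * ?L)"
  proof (rule order_trans[OF integral_norm_bound], rule integral_mono)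
   show "integrable lborel (%h::real^('m option). cmod (osc_kernel N \<omega> h * corr f g h))"
   proof -
    obtain M where "!!x. cmod (corr f g x) <= M" using nice_corr[OF f g] by (auto simp: nice_def)
    then show ?thesis
     by (intro nice_integrable nice_norm nice_mult(1)[OF nice_osc_kernel]) (auto intro: nice_measurable nice_corr f g)
   qed
   show "integrable lborel (%h. shell_kernel N (h :: real^('m option)) * ?L)"
    by (intro integrable_mult_left nice_integrable nice_shell_kernel)
   show "cmod (osc_kernel N \<omega> h * corr f g h) <= shell_kernel N h * ?L" for h :: "real^('m option)"
    using norm_corr_le[OF pq f g, of h] shell_kernel_nonneg[of N h]
    by (auto simp: norm_mult osc_kernel_def intro!: mult_mono)
  qed
  also have "... = S * ?L" by (simp add: S_def)
  also have "... <= S * (K * (1 + \<bar>\<omega>\<bar>) powr (- ?\<beta>)) * ?L"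
  proof -
   have "(1 + \<bar>\<omega>\<bar>) powr ?\<beta> <= K" unfolding K_def using w b by (intro powr_mono2) auto
   then have "1 <= K * (1 + \<bar>\<omega>\<bar>) powr (- ?\<beta>)" by (simp add: powr_minus field_simps)
   then have "S * 1 * ?L <= S * (K * (1 + \<bar>\<omega>\<bar>) powr (- ?\<beta>)) * ?L"
    using S by (intro mult_right_mono mult_left_mono) (auto simp: lp_norm_nonneg)
   then show ?thesis by simp
  qed
  finally show ?thesis by (simp add: mult.assoc)
 qed
 have "cmod (pairing (osc_kernel N \<omega>) f g) <= ((C + S) * K) * (1 + \<bar>\<omega>\<bar>) powr (- ?\<beta>) * (lp_norm p f * lp_norm q g)"
  if f: "nice f" and g: "nice g" for \<omega> and f g :: "real^('m option) => complex"
 proof -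
  let ?P = "(1 + \<bar>\<omega>\<bar>) powr (- ?\<beta>) * (lp_norm p f * lp_norm q g)"
  have P: "0 <= ?P" by (simp add: lp_norm_nonneg)
  have "cmod (pairing (osc_kernel N \<omega>) f g) <= C * K * ?P \<or> cmod (pairing (osc_kernel N \<omega>) f g) <= S * K * ?P"
  proof -
   consider "2 * pi <= \<omega>" | "2 * pi <= - \<omega>" | "\<bar>\<omega>\<bar> <= 2 * pi" by linarith
   then show ?thesis
   proof cases
    case 1 then show ?thesis using large[OF 1 f g] by (simp add: mult.assoc)
   next
    case 2
    then show ?thesis using large[OF 2 nice_cnj[OF f] nice_cnj[OF g]] cj[of "- \<omega>" f g]
     by (simp add: mult.assoc lp_norm_cnj)
   next
    case 3 then show ?thesis using small[OF 3 f g] by (simp add: mult.assoc)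
   qed
  qed
  moreover have "C * K * ?P <= (C + S) * K * ?P" "S * K * ?P <= (C + S) * K * ?P"
   using P K C(1) S by (auto intro!: mult_right_mono)
  ultimately show ?thesis by (simp add: mult.assoc) linarith
 qed
 moreover have "0 <= (C + S) * K" using C(1) S K by simp
 ultimately show ?thesis unfolding minus_divide_left[symmetric] by blast
qed

section \<open>Damped kernels at unit scale\<close>

text \<open>Shows that a superposition of frequencies \<open>\<tau> - \<omega>\<close> with a rapidly decreasing weight inherits the decay in \<open>\<omega>\<close>.\<close>
lemma peetre:
 fixes \<beta> :: real assumes "0 <= \<beta>"
 shows "(1 + \<bar>\<tau> - \<omega>\<bar>) powr (- \<beta>) <= (1 + \<bar>\<omega>\<bar>) powr (- \<beta>) * (1 + \<bar>\<tau>\<bar>) powr \<beta>"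
proof -
 have "1 + \<bar>\<omega>\<bar> <= (1 + \<bar>\<tau> - \<omega>\<bar>) * (1 + \<bar>\<tau>\<bar>)"
 proof -
  have "\<bar>\<omega>\<bar> <= \<bar>\<tau> - \<omega>\<bar> + \<bar>\<tau>\<bar>" by linarith
  moreover have "0 <= \<bar>\<tau> - \<omega>\<bar> * \<bar>\<tau>\<bar>" by simp
  moreover have "(1 + \<bar>\<tau> - \<omega>\<bar>) * (1 + \<bar>\<tau>\<bar>) = 1 + \<bar>\<tau> - \<omega>\<bar> + \<bar>\<tau>\<bar> + \<bar>\<tau> - \<omega>\<bar> * \<bar>\<tau>\<bar>"
   by (simp only: distrib_left distrib_right mult_1_left mult_1_right add_ac)
  ultimately show ?thesis by linarith
 qed
 then have "(1 + \<bar>\<omega>\<bar>) powr \<beta> <= ((1 + \<bar>\<tau> - \<omega>\<bar>) * (1 + \<bar>\<tau>\<bar>)) powr \<beta>"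
  using assms by (intro powr_mono2) auto
 then have "(1 + \<bar>\<omega>\<bar>) powr \<beta> <= (1 + \<bar>\<tau> - \<omega>\<bar>) powr \<beta> * (1 + \<bar>\<tau>\<bar>) powr \<beta>"
  by (simp add: powr_mult)
 moreover have "(1 + \<bar>\<omega>\<bar>) powr \<beta> > 0" "(1 + \<bar>\<tau> - \<omega>\<bar>) powr \<beta> > 0" by auto
 ultimately show ?thesis by (simp add: powr_minus field_simps)
qed

definition damped_kernel :: "real => real => real^('m::finite option) => complex" where
 "damped_kernel \<sigma> \<omega> h = exp (- (of_real \<sigma> + \<i> * of_real \<omega>) * of_real (norm h)) * of_real (box_shell None h)"

lemma damped_kernel_superposition:
 fixes h :: "real^('m::finite option)"
 assumes s: "0 <= \<sigma>" and N: "1 <= N"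
 shows "(LINT \<tau>|lborel. exp (- \<i> * of_real (\<tau> / 2)) * (1 / (of_real (\<sigma> + 1) + \<i> * of_real \<tau>) ^ Suc N) * osc_kernel N (\<tau> - \<omega>) h)
   = of_real (2 * pi / fact N * exp (1 / 2) * exp (\<sigma> / 2)) * damped_kernel \<sigma> \<omega> h"
proof (cases "box_shell None h = 0")
 case False
 let ?r = "norm h"
 have r: "1 < ?r" using box_shell_nz(1)[OF False] component_le_norm_cart[of h None] by linarith
 define v where "v = ?r - 1/2"
 have v: "0 < v" using r by (simp add: v_def)
 let ?R = "%\<tau>. 1 / (of_real (\<sigma> + 1) + \<i> * of_real \<tau>) ^ Suc N :: complex"
 have "exp (- \<i> * of_real (\<tau> / 2)) * ?R \<tau> * osc_kernel N (\<tau> - \<omega>) h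
   = (exp (- \<i> * of_real (\<omega> * ?r)) * of_real (shell_kernel N h)) * (exp (\<i> * of_real (\<tau> * v)) * ?R \<tau>)" for \<tau>
 proof -
  have "exp (- \<i> * of_real (\<tau> / 2)) * exp (\<i> * of_real ((\<tau> - \<omega>) * ?r)) = exp (- \<i> * of_real (\<omega> * ?r)) * exp (\<i> * of_real (\<tau> * v))"
   unfolding exp_add[symmetric] by (rule arg_cong[of _ _ exp]) (simp add: v_def algebra_simps)
  moreover have "a * R * (b * S) = (c * S) * (d * R)" if "a * b = c * d" for a b c d R S :: complex
   using that by algebra
  ultimately show ?thesis unfolding osc_kernel_def by blast
 qed
 then have "(LINT \<tau>|lborel. exp (- \<i> * of_real (\<tau> / 2)) * ?R \<tau> * osc_kernel N (\<tau> - \<omega>) h)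
   = (exp (- \<i> * of_real (\<omega> * ?r)) * of_real (shell_kernel N h)) * of_real (2 * pi * v ^ N * exp (- (\<sigma> + 1) * v) / fact N)"
  using gamma_fun_inversion[of "\<sigma> + 1" N v] s N v by (simp only: integral_mult_right_zero)
 also have "... = exp (- \<i> * of_real (\<omega> * ?r)) * of_real (box_shell None h) * of_real (exp ?r * inverse v ^ N * (2 * pi * v ^ N * exp (- (\<sigma> + 1) * v) / fact N))"
  by (simp add: shell_kernel_def weight_def v_def)
 also have "exp ?r * inverse v ^ N * (2 * pi * v ^ N * exp (- (\<sigma> + 1) * v) / fact N)
   = 2 * pi / fact N * (exp ?r * exp (- (\<sigma> + 1) * v))"
  using v by (simp add: power_inverse field_simps)
 also have "exp ?r * exp (- (\<sigma> + 1) * v) = exp (1 / 2) * exp (\<sigma> / 2) * exp (- \<sigma> * ?r)"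
  unfolding exp_add[symmetric] by (rule arg_cong[of _ _ exp]) (simp add: v_def field_simps)
 also have "exp (- \<i> * of_real (\<omega> * ?r)) * of_real (box_shell None h) * of_real (2 * pi / fact N * (exp (1 / 2) * exp (\<sigma> / 2) * exp (- \<sigma> * ?r)))
   = of_real (2 * pi / fact N * exp (1 / 2) * exp (\<sigma> / 2)) * ((of_real (exp (- \<sigma> * ?r)) * exp (- \<i> * of_real (\<omega> * ?r))) * of_real (box_shell None h))"
  by (simp only: of_real_mult mult_ac)
 also have "of_real (exp (- \<sigma> * ?r)) * exp (- \<i> * of_real (\<omega> * ?r)) = exp (- (of_real \<sigma> + \<i> * of_real \<omega>) * of_real ?r)"
  unfolding exp_of_real[symmetric] exp_add[symmetric] by (rule arg_cong[of _ _ exp]) (simp add: algebra_simps)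
 finally show ?thesis by (simp only: damped_kernel_def)
qed (simp add: osc_kernel_def shell_kernel_def damped_kernel_def)

text \<open>The weight of the superposition decays like \<open>|\<tau>|\<^bsup>-N-1\<^esup>\<close>, which absorbs the loss \<open>|\<tau>|\<^bsup>\<beta>\<^esup>\<close>; this is why \<open>N\<close> is
 at least \<open>\<beta> + 1\<close>.\<close>
lemma damped_kernel_bound:
 fixes \<beta> :: real
 assumes pq: "1 < p" "1 < q" "1 / p + 1 / q = 1" and \<beta>: "0 <= \<beta>" "\<beta> + 1 <= real N" and C: "0 <= C"
  and osc: "!!\<omega> f g. nice f ==> nice g ==>
   cmod (LINT h|lborel. osc_kernel N \<omega> h * corr f g (h :: real^('m::finite option)))
   <= C * (1 + \<bar>\<omega>\<bar>) powr (- \<beta>) * (lp_norm p f * lp_norm q g)"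
 shows "\<exists>D\<ge>0. \<forall>\<sigma>\<ge>0. \<forall>\<omega> f g. nice f --> nice g -->
  cmod (LINT h|lborel. damped_kernel \<sigma> \<omega> h * corr f g (h :: real^('m option)))
   <= D * exp (- \<sigma> / 2) * (1 + \<bar>\<omega>\<bar>) powr (- \<beta>) * (lp_norm p f * lp_norm q g)"
proof -
 have N: "1 <= N" using \<beta> by linarith
 define I where "I = (LINT \<tau>|lborel. 1 / (1 + \<tau>\<^sup>2) :: real)"
 have Ii: "integrable lborel (%\<tau>::real. 1 / (1 + \<tau>\<^sup>2))" using integrable_cauchy[of 1] by simp
 have I: "0 <= I" unfolding I_def by (rule lint_nonneg) simp
 define K where "K = fact N / (2 * pi * exp (1/2)) * (C * 2 powr \<beta> * I)"
 have "cmod (pairing (damped_kernel \<sigma> \<omega>) f g) <= K * exp (- \<sigma> / 2) * (1 + \<bar>\<omega>\<bar>) powr (- \<beta>) * (lp_norm p f * lp_norm q g)"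
  if s: "0 <= \<sigma>" and f: "nice f" and g: "nice g" for \<sigma> \<omega> and f g :: "real^('m option) => complex"
 proof -
  let ?R = "%\<tau>. 1 / (of_real (\<sigma> + 1) + \<i> * of_real \<tau>) ^ Suc N :: complex"
  let ?w = "%\<tau>. exp (- \<i> * of_real (\<tau> / 2)) * ?R \<tau>"
  let ?L = "lp_norm p f * lp_norm q g"
  let ?c = "2 * pi / fact N * exp (1 / 2) * exp (\<sigma> / 2)"
  have L: "0 <= ?L" by (simp add: lp_norm_nonneg)
  have c: "0 < ?c" by simp
  have nc: "nice (corr f g)" by (rule nice_corr[OF f g])
  obtain M where M: "!!x. cmod (corr f g x) <= M" using nc by (auto simp: nice_def)
  have M0: "0 <= M" using M[of 0] norm_ge_zero order_trans by blast
  note [measurable] = nice_measurable[OF nc] nice_measurable[OF nice_shell_kernel]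
  have wn: "cmod (?w \<tau>) = cmod (?R \<tau>)" for \<tau>
  proof -
   have "cmod (exp (- \<i> * of_real (\<tau> / 2))) = 1" by (simp add: norm_exp_eq_Re)
   then show ?thesis by (simp only: norm_mult mult_1_left)
  qed
  have Rint: "integrable lborel ?R" by (rule integrable_resolvent_power) (use s N in auto)
  have oscn: "cmod (osc_kernel N \<omega>' h) = shell_kernel N h" for \<omega>' and h :: "real^('m option)"
   by (simp add: osc_kernel_def norm_mult shell_kernel_nonneg)
  have prodi: "integrable lborel2 (%(\<tau>, h). ?w \<tau> * osc_kernel N (\<tau> - \<omega>) h * corr f g h)"
  proof (rule lborel_pair.Fubini_integrable)
   show "(%(\<tau>, h). ?w \<tau> * osc_kernel N (\<tau> - \<omega>) h * corr f g h) \<in> borel_measurable lborel2"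
    unfolding osc_kernel_def by measurable
   have n1: "cmod (?w \<tau> * osc_kernel N (\<tau> - \<omega>) h * corr f g h) = cmod (?R \<tau>) * (shell_kernel N h * cmod (corr f g h))" for \<tau> h
    unfolding norm_mult[of "?w \<tau> * _"] norm_mult[of "?w \<tau>"] wn oscn by (simp only: mult.assoc)
   show "integrable lborel (%\<tau>. LINT h|lborel. norm (case (\<tau>, h) of (\<tau>, h) => ?w \<tau> * osc_kernel N (\<tau> - \<omega>) h * corr f g h))"
    unfolding prod.case n1 integral_mult_right_zero using Rint by (intro integrable_mult_left integrable_norm)
   show "AE \<tau> in lborel. integrable lborel (%h. case (\<tau>, h) of (\<tau>, h) => ?w \<tau> * osc_kernel N (\<tau> - \<omega>) h * corr f g h)"
    unfolding prod.case mult.assoc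
    by (intro AE_I2 integrable_mult_right nice_integrable nice_mult(1)[OF nice_osc_kernel nice_measurable[OF nc] M])
  qed
  have "of_real ?c * (pairing (damped_kernel \<sigma> \<omega>) f g) = (LINT h|lborel. (of_real ?c * damped_kernel \<sigma> \<omega> h) * corr f g h)"
   by (simp only: mult.assoc integral_mult_right_zero)
  also have "... = (LINT h|lborel. LINT \<tau>|lborel. ?w \<tau> * osc_kernel N (\<tau> - \<omega>) h * corr f g h)"
   unfolding damped_kernel_superposition[OF s N, symmetric] integral_mult_left_zero[symmetric] ..
  also have "... = (LINT \<tau>|lborel. LINT h|lborel. ?w \<tau> * osc_kernel N (\<tau> - \<omega>) h * corr f g h)"
   by (rule lborel_pair.Fubini_integral[OF prodi])
  finally have E: "of_real ?c * (pairing (damped_kernel \<sigma> \<omega>) f g)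
    = (LINT \<tau>|lborel. LINT h|lborel. ?w \<tau> * osc_kernel N (\<tau> - \<omega>) h * corr f g h)" .
  have "?c * cmod (pairing (damped_kernel \<sigma> \<omega>) f g)
    = cmod (of_real ?c * (pairing (damped_kernel \<sigma> \<omega>) f g))"
   by (simp only: norm_mult norm_of_real abs_of_pos[OF c])
  also have "... = cmod (LINT \<tau>|lborel. LINT h|lborel. ?w \<tau> * osc_kernel N (\<tau> - \<omega>) h * corr f g h)"
   by (rule arg_cong[OF E])
  also have "... <= (LINT \<tau>|lborel. (C * 2 powr \<beta> * (1 + \<bar>\<omega>\<bar>) powr (- \<beta>) * ?L) * (1 / (1 + \<tau>\<^sup>2)))"
  proof (rule order_trans[OF integral_norm_bound], rule integral_mono)
   show "integrable lborel (%\<tau>. cmod (LINT h|lborel. ?w \<tau> * osc_kernel N (\<tau> - \<omega>) h * corr f g h))"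
    using lborel_pair.integrable_fst[OF prodi] by (intro integrable_norm) simp
   show "integrable lborel (%\<tau>::real. (C * 2 powr \<beta> * (1 + \<bar>\<omega>\<bar>) powr (- \<beta>) * ?L) * (1 / (1 + \<tau>\<^sup>2)))"
    by (intro integrable_mult_right Ii)
   fix \<tau> :: real
   have R1: "cmod (?R \<tau>) * (1 + \<bar>\<tau>\<bar>) powr \<beta> <= 2 powr \<beta> * (1 / (1 + \<tau>\<^sup>2))"
   proof -
    define t where "t = 1 + \<tau>\<^sup>2"
    have t: "1 <= t" by (simp add: t_def)
    let ?c = "cmod (of_real (\<sigma> + 1) + \<i> * of_real \<tau>)"
    have "t <= (\<sigma> + 1)\<^sup>2 + \<tau>\<^sup>2" using s by (simp add: t_def power2_eq_square algebra_simps)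
    also have "... = ?c\<^sup>2" by (simp add: cmod_power2)
    finally have "sqrt t <= ?c" by (simp add: real_le_lsqrt)
    then have "sqrt t ^ Suc N <= ?c ^ Suc N" using t by (intro power_mono) auto
    then have a: "cmod (?R \<tau>) <= 1 / sqrt t ^ Suc N"
    proof -
     have "cmod (?R \<tau>) = 1 / ?c ^ Suc N" by (simp add: norm_divide norm_power del: power_Suc)
     also have "... <= 1 / sqrt t ^ Suc N"
      by (rule frac_le) (use \<open>sqrt t ^ Suc N <= ?c ^ Suc N\<close> t in \<open>auto simp del: power_Suc\<close>)
     finally show ?thesis .
    qed
    have "(1 + \<bar>\<tau>\<bar>) <= 2 * sqrt t"
    proof -
     have "1 <= sqrt t" "\<bar>\<tau>\<bar> <= sqrt t" using t by (auto simp: t_def intro: real_le_rsqrt)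
     then show ?thesis by linarith
    qed
    then have "(1 + \<bar>\<tau>\<bar>) powr \<beta> <= (2 * sqrt t) powr \<beta>" using \<beta> by (intro powr_mono2) auto
    also have "... = 2 powr \<beta> * sqrt t powr \<beta>" using t by (simp add: powr_mult)
    also have "... <= 2 powr \<beta> * sqrt t powr (real N - 1)" using t \<beta> by (intro mult_left_mono powr_mono) auto
    also have "sqrt t powr (real N - 1) = sqrt t ^ (N - 1)"
     using t N by (subst powr_realpow[symmetric]) (auto simp: of_nat_diff)
    finally have bb: "(1 + \<bar>\<tau>\<bar>) powr \<beta> <= 2 powr \<beta> * sqrt t ^ (N - 1)" .
    have "cmod (?R \<tau>) * (1 + \<bar>\<tau>\<bar>) powr \<beta> <= (1 / sqrt t ^ Suc N) * (2 powr \<beta> * sqrt t ^ (N - 1))"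
     using a bb t by (intro mult_mono) auto
    also have "sqrt t ^ Suc N = sqrt t ^ (N - 1) * t"
    proof -
     have "sqrt t ^ Suc N = sqrt t ^ (N - 1) * sqrt t ^ 2" using N by (simp add: power_add[symmetric])
     then show ?thesis using t by simp
    qed
    also have "(1 / (sqrt t ^ (N - 1) * t)) * (2 powr \<beta> * sqrt t ^ (N - 1)) = 2 powr \<beta> * (1 / t)"
     using t by (simp add: field_simps)
    finally show ?thesis by (simp add: t_def)
   qed
   have "cmod (LINT h|lborel. ?w \<tau> * osc_kernel N (\<tau> - \<omega>) h * corr f g h) = cmod (?R \<tau>) * cmod (pairing (osc_kernel N (\<tau> - \<omega>)) f g)"
   proof -
    let ?X = "LINT h|lborel. osc_kernel N (\<tau> - \<omega>) h * corr f g h"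
    have a: "?w \<tau> * osc_kernel N (\<tau> - \<omega>) h * corr f g h = ?w \<tau> * (osc_kernel N (\<tau> - \<omega>) h * corr f g h)" for h
     by (rule mult.assoc)
    have "(LINT h|lborel. ?w \<tau> * osc_kernel N (\<tau> - \<omega>) h * corr f g h) = ?w \<tau> * ?X"
     unfolding a by (rule integral_mult_right_zero)
    then have "cmod (LINT h|lborel. ?w \<tau> * osc_kernel N (\<tau> - \<omega>) h * corr f g h) = cmod (?w \<tau> * ?X)"
     by (rule arg_cong)
    also have "... = cmod (?R \<tau>) * cmod ?X"
     by (rule trans[OF norm_mult arg_cong[OF wn, of "%z. z * cmod ?X"]])
    finally show ?thesis .
   qed
   also have "... <= cmod (?R \<tau>) * (C * (1 + \<bar>\<tau> - \<omega>\<bar>) powr (- \<beta>) * ?L)"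
    by (intro mult_left_mono osc f g) auto
   also have "... <= cmod (?R \<tau>) * (C * ((1 + \<bar>\<omega>\<bar>) powr (- \<beta>) * (1 + \<bar>\<tau>\<bar>) powr \<beta>) * ?L)"
    using C L peetre[OF \<beta>(1)] by (intro mult_left_mono mult_right_mono) auto
   also have "... = (C * (1 + \<bar>\<omega>\<bar>) powr (- \<beta>) * ?L) * (cmod (?R \<tau>) * (1 + \<bar>\<tau>\<bar>) powr \<beta>)"
    by (simp only: mult_ac)
   also have "... <= (C * (1 + \<bar>\<omega>\<bar>) powr (- \<beta>) * ?L) * (2 powr \<beta> * (1 / (1 + \<tau>\<^sup>2)))"
    using C L by (intro mult_left_mono R1) auto
   finally show "cmod (LINT h|lborel. ?w \<tau> * osc_kernel N (\<tau> - \<omega>) h * corr f g h)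
    <= (C * 2 powr \<beta> * (1 + \<bar>\<omega>\<bar>) powr (- \<beta>) * ?L) * (1 / (1 + \<tau>\<^sup>2))" by (simp only: mult_ac)
  qed
  also have "... = (C * 2 powr \<beta> * I) * ((1 + \<bar>\<omega>\<bar>) powr (- \<beta>) * ?L)"
   unfolding integral_mult_right_zero I_def[symmetric] by (simp only: mult_ac)
  finally have "?c * cmod (pairing (damped_kernel \<sigma> \<omega>) f g) <= (C * 2 powr \<beta> * I) * ((1 + \<bar>\<omega>\<bar>) powr (- \<beta>) * ?L)" .
  then have "cmod (pairing (damped_kernel \<sigma> \<omega>) f g) <= (C * 2 powr \<beta> * I) * ((1 + \<bar>\<omega>\<bar>) powr (- \<beta>) * ?L) / ?c"
   using c by (simp only: pos_le_divide_eq mult.commute)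
  also have "... = K * exp (- \<sigma> / 2) * (1 + \<bar>\<omega>\<bar>) powr (- \<beta>) * ?L"
  proof -
   have "A * (P * L) / (a / F * e1 * e2) = F / (a * e1) * A * inverse e2 * P * L" for A P L a F e1 e2 :: real
    by (simp add: divide_inverse mult_ac)
   moreover have "exp (- \<sigma> / 2) = inverse (exp (\<sigma> / 2))" by (simp add: exp_minus)
   ultimately show ?thesis unfolding K_def by (simp only:)
  qed
  finally show ?thesis .
 qed
 moreover have "0 <= K" unfolding K_def using C I by simp
 ultimately show ?thesis by blast
qed

section \<open>Exponentials and their Laplacian\<close>

text \<open>Layer cake formula, used with the explicit volume of balls.\<close>
lemma nn_integral_radial:
 fixes w :: "real => ennreal"
 assumes [measurable]: "w \<in> borel_measurable borel"
 shows "(\<integral>\<^sup>+(x::'a::euclidean_space). (\<integral>\<^sup>+r. w r * indicator {norm x<..} r \<partial>lborel) \<partial>lborel)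
  = (\<integral>\<^sup>+r. w r * emeasure lborel (ball (0::'a::euclidean_space) r) \<partial>lborel)"
proof -
 have "(\<integral>\<^sup>+(x::'a). (\<integral>\<^sup>+r. w r * indicator {norm x<..} r \<partial>lborel) \<partial>lborel)
   = (\<integral>\<^sup>+(x::'a). (\<integral>\<^sup>+r. w r * of_bool (norm x < r) \<partial>lborel) \<partial>lborel)"
  by (intro nn_integral_cong) (auto simp: indicator_def)
 also have "... = (\<integral>\<^sup>+r. (\<integral>\<^sup>+(x::'a). w r * of_bool (norm x < r) \<partial>lborel) \<partial>lborel)"
  by (rule lborel_pair.Fubini'[symmetric]) (simp add: split_beta')
 also have "... = (\<integral>\<^sup>+r. (\<integral>\<^sup>+(x::'a). w r * indicator (ball 0 r) x \<partial>lborel) \<partial>lborel)"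
  by (intro nn_integral_cong) (auto simp: indicator_def)
 also have "... = (\<integral>\<^sup>+r. w r * emeasure lborel (ball (0::'a::euclidean_space) r) \<partial>lborel)"
  by (intro nn_integral_cong) (simp add: nn_integral_cmult_indicator)
 finally show ?thesis .
qed

lemma emeasure_lborel_ball_scale:
 "0 < r ==> emeasure lborel (ball (0::'a::euclidean_space) r) = ennreal (r ^ DIM('a) * measure lborel (ball (0::'a) 1))"
proof -
 assume r: "0 < r"
 have "emeasure lborel (ball (0::'a) r) = (\<integral>\<^sup>+x. indicator (ball (0::'a) r) x \<partial>lborel)" by simp
 also have "... = ennreal (\<bar>r\<bar> ^ DIM('a)) * (\<integral>\<^sup>+x. indicator (ball (0::'a) r) (r *\<^sub>R x) \<partial>lborel)"
  by (subst nn_integral_lborel_scale[of _ r]) (use r in \<open>auto intro!: borel_measurable_indicator\<close>)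
 also have "(\<integral>\<^sup>+x. indicator (ball (0::'a) r) (r *\<^sub>R x) \<partial>lborel) = (\<integral>\<^sup>+x. indicator (ball (0::'a) 1) x \<partial>lborel)"
  by (intro nn_integral_cong) (use r in \<open>auto simp: indicator_def\<close>)
 also have "... = ennreal (measure lborel (ball (0::'a) 1))"
  using emeasure_bounded_finite[of "ball (0::'a) 1"] by (simp add: emeasure_eq_ennreal_measure less_top)
 finally show ?thesis using r by (simp add: ennreal_mult)
qed

text \<open>The profile is minus the integral of its own derivative, so the radial formula reduces the claim to Gamma
 integrals. Dimension at least two makes the singularity integrable.\<close>
lemma integrable_yukawa:
 assumes "2 <= DIM('a::euclidean_space)" "0 < a"
 shows "integrable lborel (%x::'a. exp (- a * norm x) / norm x)"
proof -
 let ?f = "%r::real. exp (- a * r) * (a / r + 1 / r\<^sup>2)"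
 define w where "w r = ennreal (?f r) * pos_ind r" for r :: real
 have [measurable]: "w \<in> borel_measurable borel" unfolding w_def by measurable
 let ?V = "measure lborel (ball (0::'a) 1)"
 have f: "ennreal (exp (- a * norm x) / norm x) <= (\<integral>\<^sup>+r. w r * indicator {norm x<..} r \<partial>lborel)" if x: "x \<noteq> 0" for x :: 'a
 proof -
  have "(\<integral>\<^sup>+r. ennreal (?f r) * indicator {norm x..} r \<partial>lborel) = ennreal (0 - (- (exp (- a * norm x) / norm x)))"
  proof (rule nn_integral_FTC_atLeast[where F="%r. - (exp (- a * r) / r)"])
   show "((%r. - (exp (- a * r) / r)) has_real_derivative ?f r) (at r)" if "norm x <= r" for r
   proof -
    have "r \<noteq> 0" using that x by auto
    then show ?thesis by (auto intro!: derivative_eq_intros simp: field_simps power2_eq_square)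
   qed
   show "0 <= ?f r" if "norm x <= r" for r
    using assms(2) order_trans[OF norm_ge_zero that] by (intro mult_nonneg_nonneg add_nonneg_nonneg divide_nonneg_nonneg) auto
   show "((%r. - (exp (- a * r) / r)) \<longlongrightarrow> 0) at_top" using assms(2) by real_asymp
  qed measurable
  moreover have "(\<integral>\<^sup>+r. ennreal (?f r) * indicator {norm x..} r \<partial>lborel) = (\<integral>\<^sup>+r. w r * indicator {norm x<..} r \<partial>lborel)"
  proof (rule nn_integral_cong_AE)
   have "AE r in lborel. r \<noteq> norm x" by (rule AE_lborel_singleton)
   then show "AE r in lborel. ennreal (?f r) * indicator {norm x..} r = w r * indicator {norm x<..} r"
    by eventually_elim (use x order_le_less_trans[OF norm_ge_zero[of x]] in \<open>auto simp: w_def indicator_def\<close>)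
  qed
  ultimately show ?thesis by simp
 qed
 have "(\<integral>\<^sup>+(x::'a). ennreal (exp (- a * norm x) / norm x) \<partial>lborel) <= (\<integral>\<^sup>+(x::'a). (\<integral>\<^sup>+r. w r * indicator {norm x<..} r \<partial>lborel) \<partial>lborel)"
 proof (rule nn_integral_mono_AE)
  have "AE x in lborel. x \<noteq> (0::'a)" by (rule AE_lborel_singleton)
  then show "AE x::'a in lborel. ennreal (exp (- a * norm x) / norm x) <= (\<integral>\<^sup>+r. w r * indicator {norm x<..} r \<partial>lborel)"
   by eventually_elim (rule f)
 qed
 also have "... = (\<integral>\<^sup>+r. w r * emeasure lborel (ball (0::'a) r) \<partial>lborel)" by (rule nn_integral_radial) measurable
 also have "... = (\<integral>\<^sup>+r. ennreal (?V * (a * (r ^ (DIM('a) - 1) * exp (- a * r)) + r ^ (DIM('a) - 2) * exp (- a * r)) * pos_ind r) \<partial>lborel)"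
 proof (intro nn_integral_cong)
  fix r :: real
  show "w r * emeasure lborel (ball (0::'a) r) = ennreal (?V * (a * (r ^ (DIM('a) - 1) * exp (- a * r)) + r ^ (DIM('a) - 2) * exp (- a * r)) * pos_ind r)"
  proof (cases "0 < r")
   case True
   obtain m where m: "DIM('a) = Suc (Suc m)" using assms(1) by (metis Suc_le_D numeral_2_eq_2 Suc_le_mono add_2_eq_Suc le_Suc_ex)
   have eq: "?f r * (r ^ Suc (Suc m) * ?V) = ?V * (a * (r ^ Suc m * exp (- a * r)) + r ^ m * exp (- a * r))"
    using True by (simp add: field_simps power2_eq_square)
   have f0: "0 <= ?f r" using True assms(2) by simp
   have "w r * emeasure lborel (ball (0::'a) r) = ennreal (?f r) * ennreal (r ^ Suc (Suc m) * ?V)"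
    using True by (simp add: w_def emeasure_lborel_ball_scale m del: power_Suc)
   also have "... = ennreal (?f r * (r ^ Suc (Suc m) * ?V))" by (rule ennreal_mult'[OF f0, symmetric])
   finally show ?thesis unfolding eq using True by (simp add: m del: power_Suc)
  qed (simp add: w_def)
 qed
 also have "... < \<infinity>"
 proof -
  have i1: "integrable lborel (%r. ?V * (a * gamma_fun (DIM('a) - 1) a r + gamma_fun (DIM('a) - 2) a r))"
   by (intro integrable_mult_right Bochner_Integration.integrable_add gamma_fun_integrable assms(2))
  have e: "?V * (a * gamma_fun (DIM('a) - 1) a r + gamma_fun (DIM('a) - 2) a r)
    = ?V * (a * (r ^ (DIM('a) - 1) * exp (- a * r)) + r ^ (DIM('a) - 2) * exp (- a * r)) * pos_ind r" for r
   by (simp add: gamma_fun_def indicator_def)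
  have "integrable lborel (%r. ?V * (a * (r ^ (DIM('a) - 1) * exp (- a * r)) + r ^ (DIM('a) - 2) * exp (- a * r)) * pos_ind r)"
   using i1 unfolding e .
  moreover have "0 <= ?V * (a * (r ^ (DIM('a) - 1) * exp (- a * r)) + r ^ (DIM('a) - 2) * exp (- a * r)) * pos_ind r" for r
   using assms(2) by (auto simp: indicator_def)
  ultimately show ?thesis by (subst nn_integral_eq_integral) auto
 qed
 finally show ?thesis by (intro integrableI_nonneg) auto
qed

lemma integrable_exp_norm:
 assumes "2 <= DIM('a::euclidean_space)" "0 < a"
 shows "integrable lborel (%x::'a. exp (- a * norm x))"
proof (rule integrable_dominated)
 show "integrable lborel (%x::'a. (2 / a) * (exp (- (a / 2) * norm x) / norm x))"
  by (intro integrable_mult_right integrable_yukawa assms) (use assms in auto)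
 have "AE x in lborel. x \<noteq> (0::'a)" by (rule AE_lborel_singleton)
 then show "AE x::'a in lborel. norm (exp (- a * norm x)) <= norm ((2 / a) * (exp (- (a / 2) * norm x) / norm x))"
 proof eventually_elim
  case (elim x)
  have r: "0 < norm x" using elim by simp
  have "a / 2 * norm x <= exp (a / 2 * norm x)" using exp_ge_add_one_self[of "a / 2 * norm x"] by linarith
  then have "a / 2 * norm x * exp (- a * norm x) <= exp (a / 2 * norm x) * exp (- a * norm x)" by (intro mult_right_mono) auto
  also have "... = exp (- (a / 2) * norm x)" unfolding exp_add[symmetric] by (simp add: field_simps)
  finally have "exp (- a * norm x) <= (2 / a) * (exp (- (a / 2) * norm x) / norm x)"
   using r assms(2) by (simp add: field_simps)
  then show ?case using r assms(2) by (simp add: abs_mult)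
 qed
qed measurable

text \<open>The translates of \<open>F\<close> have the same integral, so the derivative in the direction of translation integrates
 to zero.\<close>
lemma integral_translate_zero:
 fixes F F' :: "'a::euclidean_space => complex"
 assumes F: "integrable lborel F" and F': "integrable lborel F'" "continuous_on UNIV F'"
  and d: "!!x t. ((%t. F (x + t *\<^sub>R u)) has_vector_derivative F' (x + t *\<^sub>R u)) (at t)"
 shows "(LINT x|lborel. F' x) = 0"
proof -
 have [measurable]: "F \<in> borel_measurable borel" "F' \<in> borel_measurable borel"
  using F F' by auto
 have sh: "integrable lborel (%x. G (t + x))" if "integrable lborel G" for G :: "'a => complex" and t
  using that integrable_distr_eq[of "(+) t" lborel borel G] borel_measurable_integrable[OF that]
  by (simp add: lborel_distr_plus)
 have pi: "integrable lborel2 (%(t::real, x). indicator {0..1} t *\<^sub>R F' (x + t *\<^sub>R u))"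
 proof (rule lborel_pair.Fubini_integrable)
  show "(%(t::real, x). indicator {0..1} t *\<^sub>R F' (x + t *\<^sub>R u)) \<in> borel_measurable lborel2" by measurable
  have n: "(LINT x|lborel. norm (indicator {0..1} t *\<^sub>R F' (x + t *\<^sub>R u))) = indicator {0..1} t * (LINT x|lborel. norm (F' x))" for t :: real
  proof -
   have "(LINT x|lborel. norm (F' (t *\<^sub>R u + x))) = (LINT x|lborel. norm (F' x))"
    by (rule integral_lborel_shift[of "%x. norm (F' x)"]) measurable
   then show ?thesis by (simp add: add.commute)
  qed
  then show "integrable lborel (%t::real. LINT x|lborel. norm (case (t, x) of (t, x) => indicator {0..1} t *\<^sub>R F' (x + t *\<^sub>R u)))"
   unfolding prod.case n by (intro integrable_mult_left integrable_real_indicator) auto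
  show "AE t in lborel. integrable lborel (%x. case (t::real, x) of (t, x) => indicator {0..1} t *\<^sub>R F' (x + t *\<^sub>R u))"
   unfolding prod.case
  proof (intro AE_I2 integrable_scaleR_right)
   fix t :: real
   have "integrable lborel (%x. F' (t *\<^sub>R u + x))" by (rule sh[OF F'(1)])
   then show "integrable lborel (%x. F' (x + t *\<^sub>R u))" by (simp only: add.commute)
  qed
 qed
 have ftc: "(LINT t|lborel. indicator {0..1} t *\<^sub>R F' (x + t *\<^sub>R u)) = F (x + u) - F x" for x
 proof -
  have "continuous_on {0..1} (%t. F' (x + t *\<^sub>R u))"
   by (intro continuous_on_compose2[OF F'(2)] continuous_intros) auto
  then have "(LINT t|lborel. indicator {0..1} t *\<^sub>R F' (x + t *\<^sub>R u)) = F (x + 1 *\<^sub>R u) - F (x + 0 *\<^sub>R u)"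
   by (intro integral_FTC_Icc) (auto intro: has_vector_derivative_at_within d)
  then show ?thesis by simp
 qed
 have "0 = (LINT x|lborel. F (x + u) - F x)"
 proof -
  have "(LINT x|lborel. F (u + x)) = (LINT x|lborel. F x)" by (rule integral_lborel_shift) measurable
  then show ?thesis using sh[OF F, of u] F by (simp add: add.commute)
 qed
 also have "... = (LINT x|lborel. LINT t|lborel. indicator {0..1} t *\<^sub>R F' (x + t *\<^sub>R u))" by (simp only: ftc)
 also have "... = (LINT t|lborel. LINT x|lborel. indicator {0..1} t *\<^sub>R F' (x + t *\<^sub>R u))"
  by (rule lborel_pair.Fubini_integral[OF pi])
 also have "... = (LINT (t::real)|lborel. indicator {0..1} t *\<^sub>R (LINT x|lborel. F' x))"
 proof (intro lint_cong refl)
  fix t :: real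
  have "(LINT x|lborel. F' (t *\<^sub>R u + x)) = (LINT x|lborel. F' x)" by (rule integral_lborel_shift) measurable
  then show "(LINT x|lborel. indicator {0..1} t *\<^sub>R F' (x + t *\<^sub>R u)) = indicator {0..1} t *\<^sub>R (LINT x|lborel. F' x)"
   by (simp add: add.commute)
 qed
 also have "... = (LINT x|lborel. F' x)" by simp
 finally show ?thesis ..
qed

text \<open>The regularised distance removes the singularity of \<open>exp (- \<mu> |x|)\<close> at the origin. \<open>yuk1\<close> and \<open>yuk2\<close> are its
 first and second derivatives along a coordinate axis.\<close>
definition yuk :: "complex => real => real^'k::finite => complex" where
 "yuk \<mu> \<eta> x = exp (- \<mu> * of_real (reg_norm \<eta> x))"

definition yuk1 :: "complex => real => 'k => real^'k::finite => complex" where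
 "yuk1 \<mu> \<eta> i x = of_real (x $ i / reg_norm \<eta> x) * (- \<mu> * yuk \<mu> \<eta> x)"

definition yuk2 :: "complex => real => 'k => real^'k::finite => complex" where
 "yuk2 \<mu> \<eta> i x = of_real (1 / reg_norm \<eta> x - (x $ i)\<^sup>2 / reg_norm \<eta> x ^ 3) * (- \<mu> * yuk \<mu> \<eta> x)
   + of_real ((x $ i)\<^sup>2 / (reg_norm \<eta> x)\<^sup>2) * (\<mu>\<^sup>2 * yuk \<mu> \<eta> x)"

lemma reg_norm_line_derivative:
 fixes x :: "real^'k::finite"
 assumes "0 < \<eta>"
 shows "((%t. reg_norm \<eta> (x + t *\<^sub>R axis i 1)) has_real_derivative
  (x + t *\<^sub>R axis i 1) $ i / reg_norm \<eta> (x + t *\<^sub>R axis i 1)) (at t)"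
proof -
 have "((%t. x + t *\<^sub>R axis i 1) has_derivative (%h. h *\<^sub>R axis i 1)) (at t)"
  by (auto intro!: derivative_eq_intros)
 note d = has_derivative_compose[OF this reg_norm_has_derivative[OF assms]]
 show ?thesis
  unfolding has_field_derivative_def
  by (rule has_derivative_eq_rhs[OF d]) (auto simp: fun_eq_iff inner_axis mult.commute)
qed

lemma yuk_line_derivative:
 fixes x :: "real^'k::finite"
 assumes "0 < \<eta>"
 shows "((%t. yuk \<mu> \<eta> (x + t *\<^sub>R axis i 1)) has_vector_derivative yuk1 \<mu> \<eta> i (x + t *\<^sub>R axis i 1)) (at t)"
  and "((%t. yuk1 \<mu> \<eta> i (x + t *\<^sub>R axis i 1)) has_vector_derivative yuk2 \<mu> \<eta> i (x + t *\<^sub>R axis i 1)) (at t)"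
proof -
 let ?y = "%t. x + t *\<^sub>R axis i 1"
 let ?R = "%t. reg_norm \<eta> (?y t)"
 note R = reg_norm_line_derivative[OF assms, of x i t]
 have Rp: "0 < ?R t" by (rule reg_norm_pos[OF assms])
 have Rv: "((%t. complex_of_real (?R t)) has_vector_derivative of_real (?y t $ i / ?R t)) (at t)"
  by (rule has_vector_derivative_of_real[OF R])
 have g: "((%z. exp (- \<mu> * z)) has_field_derivative - \<mu> * exp (- \<mu> * of_real (?R t))) (at (of_real (?R t)))"
  by (auto intro!: derivative_eq_intros)
 show 1: "((%t. yuk \<mu> \<eta> (?y t)) has_vector_derivative yuk1 \<mu> \<eta> i (?y t)) (at t)"
  using field_vector_diff_chain_at[OF Rv g] unfolding yuk_def yuk1_def o_def by (simp only: mult_ac)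
 have q: "((%t. ?y t $ i / ?R t) has_real_derivative 1 / ?R t - (?y t $ i)\<^sup>2 / ?R t ^ 3) (at t)"
 proof -
  have yi: "((%t. ?y t $ i) has_real_derivative 1) (at t)"
   by (auto intro!: derivative_eq_intros simp: axis_def)
  show ?thesis
   by (rule DERIV_cong[OF DERIV_divide[OF yi R]]) (use Rp in \<open>auto simp: field_simps power2_eq_square power3_eq_cube\<close>)
 qed
 have "((%t. of_real (?y t $ i / ?R t) * (- \<mu> * yuk \<mu> \<eta> (?y t))) has_vector_derivative
   of_real (?y t $ i / ?R t) * (- \<mu> * yuk1 \<mu> \<eta> i (?y t)) + of_real (1 / ?R t - (?y t $ i)\<^sup>2 / ?R t ^ 3) * (- \<mu> * yuk \<mu> \<eta> (?y t))) (at t)"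
  by (rule has_vector_derivative_mult[OF has_vector_derivative_of_real[OF q]
    bounded_linear.has_vector_derivative[OF bounded_linear_mult_right 1]])
 moreover have "of_real (?y t $ i / ?R t) * (- \<mu> * yuk1 \<mu> \<eta> i (?y t)) = of_real ((?y t $ i)\<^sup>2 / (?R t)\<^sup>2) * (\<mu>\<^sup>2 * yuk \<mu> \<eta> (?y t))"
  unfolding yuk1_def by (simp add: power2_eq_square)
 ultimately show "((%t. yuk1 \<mu> \<eta> i (?y t)) has_vector_derivative yuk2 \<mu> \<eta> i (?y t)) (at t)"
  unfolding yuk1_def[of \<mu> \<eta> i] yuk2_def by (simp only: add.commute)
qed

lemma continuous_on_reg_norm: "continuous_on S (reg_norm \<eta>)"
 unfolding reg_norm_def by (intro continuous_intros)

lemma continuous_on_yuk: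
 assumes "0 < \<eta>"
 shows "continuous_on UNIV (yuk \<mu> \<eta> :: real^'k::finite => complex)"
  "continuous_on UNIV (yuk1 \<mu> \<eta> i :: real^'k => complex)" "continuous_on UNIV (yuk2 \<mu> \<eta> i :: real^'k => complex)"
proof -
 have nz: "reg_norm \<eta> x \<noteq> 0" for x :: "real^'k" using reg_norm_pos[OF assms, of x] by simp
 show y: "continuous_on UNIV (yuk \<mu> \<eta> :: real^'k => complex)"
  unfolding yuk_def by (intro continuous_intros continuous_on_reg_norm)
 show "continuous_on UNIV (yuk1 \<mu> \<eta> i :: real^'k => complex)"
  unfolding yuk1_def by (intro continuous_intros continuous_on_reg_norm y) (simp add: nz)
 show "continuous_on UNIV (yuk2 \<mu> \<eta> i :: real^'k => complex)"
  unfolding yuk2_def by (intro continuous_intros continuous_on_reg_norm y) (simp_all add: nz)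
qed

lemma norm_le_reg_norm: "norm x <= reg_norm \<eta> x"
 unfolding reg_norm_def norm_eq_sqrt_inner by simp

lemma yuk_bounds:
 fixes x :: "real^'k::finite"
 assumes "0 < \<eta>" "0 < Re \<mu>"
 shows "cmod (yuk \<mu> \<eta> x) <= exp (- Re \<mu> * norm x)"
  "cmod (yuk1 \<mu> \<eta> i x) <= cmod \<mu> * exp (- Re \<mu> * norm x)"
  "cmod (yuk2 \<mu> \<eta> i x) <= (2 * cmod \<mu> / reg_norm \<eta> x + (cmod \<mu>)\<^sup>2) * exp (- Re \<mu> * norm x)"
proof -
 let ?R = "reg_norm \<eta> x"
 have R: "0 < ?R" by (rule reg_norm_pos[OF assms(1)])
 have xi: "\<bar>x $ i\<bar> <= ?R" using component_le_norm_cart[of x i] norm_le_reg_norm[of x \<eta>] by linarith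
 show y: "cmod (yuk \<mu> \<eta> x) <= exp (- Re \<mu> * norm x)"
  unfolding yuk_def using mult_left_mono[OF norm_le_reg_norm[of x \<eta>], of "Re \<mu>"] assms(2) by simp
 have 1: "\<bar>x $ i / ?R\<bar> <= 1" using xi R by (simp add: abs_divide)
 then have 2: "\<bar>(x $ i)\<^sup>2 / ?R\<^sup>2\<bar> <= 1" by (simp add: abs_square_le_1 flip: power_divide)
 have 3: "\<bar>1 / ?R - (x $ i)\<^sup>2 / ?R ^ 3\<bar> <= 2 / ?R"
 proof -
  have "(x $ i)\<^sup>2 / ?R ^ 3 = ((x $ i)\<^sup>2 / ?R\<^sup>2) * (1 / ?R)" by (simp add: power2_eq_square power3_eq_cube)
  then have "\<bar>1 / ?R - (x $ i)\<^sup>2 / ?R ^ 3\<bar> <= 1 / ?R + \<bar>(x $ i)\<^sup>2 / ?R\<^sup>2\<bar> * (1 / ?R)"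
   using R by (metis abs_mult abs_of_pos abs_triangle_ineq4 zero_less_divide_1_iff)
  also have "... <= 1 / ?R + 1 * (1 / ?R)" using 2 R by (intro add_left_mono mult_right_mono) auto
  finally show ?thesis by simp
 qed
 have "cmod (yuk1 \<mu> \<eta> i x) = \<bar>x $ i / ?R\<bar> * (cmod \<mu> * cmod (yuk \<mu> \<eta> x))"
  unfolding yuk1_def norm_mult norm_of_real norm_minus_cancel ..
 also have "... <= 1 * (cmod \<mu> * exp (- Re \<mu> * norm x))" using 1 y by (intro mult_mono) auto
 finally show "cmod (yuk1 \<mu> \<eta> i x) <= cmod \<mu> * exp (- Re \<mu> * norm x)" by simp
 have "cmod (yuk2 \<mu> \<eta> i x) <= \<bar>1 / ?R - (x $ i)\<^sup>2 / ?R ^ 3\<bar> * (cmod \<mu> * cmod (yuk \<mu> \<eta> x)) + \<bar>(x $ i)\<^sup>2 / ?R\<^sup>2\<bar> * ((cmod \<mu>)\<^sup>2 * cmod (yuk \<mu> \<eta> x))"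
  unfolding yuk2_def by (rule order_trans[OF norm_triangle_ineq]) (simp only: norm_mult norm_of_real norm_minus_cancel norm_power order_refl)
 also have "... <= (2 / ?R) * (cmod \<mu> * exp (- Re \<mu> * norm x)) + 1 * ((cmod \<mu>)\<^sup>2 * exp (- Re \<mu> * norm x))"
  using 2 3 y R by (intro add_mono mult_mono) auto
 finally show "cmod (yuk2 \<mu> \<eta> i x) <= (2 * cmod \<mu> / ?R + (cmod \<mu>)\<^sup>2) * exp (- Re \<mu> * norm x)"
  by (simp add: distrib_right)
qed

lemma reg_norm_ge: "0 < \<eta> ==> \<eta> <= reg_norm \<eta> x"
 unfolding reg_norm_def by (rule real_le_rsqrt) simp

text \<open>\<open>D1 i\<close> and \<open>D2 i\<close> are the first two derivatives along the \<open>i\<close>-th axis. Derivatives along lines are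
 all that partial integration needs.\<close>
definition bdd_C2 :: "(real^'k::finite => complex) => ('k => real^'k => complex) => ('k => real^'k => complex) => bool" where
 "bdd_C2 \<psi> D1 D2 \<longleftrightarrow> continuous_on UNIV \<psi> \<and> bounded (range \<psi>) \<and>
  (\<forall>i. continuous_on UNIV (D1 i) \<and> bounded (range (D1 i)) \<and> continuous_on UNIV (D2 i) \<and> bounded (range (D2 i)) \<and>
   (\<forall>x t. ((%t. \<psi> (x + t *\<^sub>R axis i 1)) has_vector_derivative D1 i (x + t *\<^sub>R axis i 1)) (at t)) \<and>
   (\<forall>x t. ((%t. D1 i (x + t *\<^sub>R axis i 1)) has_vector_derivative D2 i (x + t *\<^sub>R axis i 1)) (at t)))"

lemma integrable_bounded_exp:
 fixes F :: "real^'k::finite => complex"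
 assumes n: "2 <= CARD('k)" and "F \<in> borel_measurable borel" "0 < a" "!!x. cmod (F x) <= C * exp (- a * norm x)"
 shows "integrable lborel F"
proof (rule integrable_dominated)
 show "integrable lborel (%x::real^'k. C * exp (- a * norm x))"
  by (intro integrable_mult_right integrable_exp_norm) (use n assms in auto)
 show "AE x in lborel. cmod (F x) <= norm (C * exp (- a * norm x))"
  using assms(4) abs_ge_self order_trans by (intro AE_I2) fastforce
qed (use assms in simp)

lemma yuk_green:
 fixes \<psi> :: "real^'k::finite => complex"
 assumes n: "2 <= CARD('k)" and e: "0 < \<eta>" and mu: "0 < Re \<mu>" and C2: "bdd_C2 \<psi> D1 D2"
 shows "(LINT x|lborel. yuk \<mu> \<eta> x * (\<Sum>i\<in>UNIV. D2 i x)) = (LINT x|lborel. \<psi> x * (\<Sum>i\<in>UNIV. yuk2 \<mu> \<eta> i x))"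
  and "integrable lborel (%x. yuk \<mu> \<eta> x * (\<Sum>i\<in>UNIV. D2 i x))"
proof -
 let ?ex = "%x::real^'k. exp (- Re \<mu> * norm x)"
 note B = yuk_bounds[OF e mu]
 have c: "continuous_on UNIV \<psi>" "continuous_on UNIV (D1 i)" "continuous_on UNIV (D2 i)" for i
  using C2 by (auto simp: bdd_C2_def)
 obtain M where M: "!!x. cmod (\<psi> x) <= M" using C2 by (auto simp: bdd_C2_def bounded_iff)
 have M0: "0 <= M" using M[of 0] norm_ge_zero order_trans by blast
 note cy = continuous_on_yuk[OF e, of \<mu>]
 have ii: "integrable lborel (%x. yuk \<mu> \<eta> x * D2 i x)" "integrable lborel (%x. \<psi> x * yuk2 \<mu> \<eta> i x)"
  "integrable lborel (%x. yuk \<mu> \<eta> x * D1 i x)" "integrable lborel (%x. \<psi> x * yuk1 \<mu> \<eta> i x)" for i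
 proof -
  have b: "bounded (range (D1 i))" "bounded (range (D2 i))" using C2 unfolding bdd_C2_def by blast+
  obtain M1 where M1: "!!x. cmod (D1 i x) <= M1" using b(1) by (auto simp: bounded_iff)
  obtain M2 where M2: "!!x. cmod (D2 i x) <= M2" using b(2) by (auto simp: bounded_iff)
  have m: "0 <= M1" "0 <= M2" using M1[of 0] M2[of 0] norm_ge_zero order_trans by blast+
  have "cmod (yuk \<mu> \<eta> x * D2 i x) <= M2 * ?ex x" for x
   using mult_mono[OF M2 B(1)[of x]] m by (simp add: norm_mult mult.commute)
  then show "integrable lborel (%x. yuk \<mu> \<eta> x * D2 i x)"
   by (intro integrable_bounded_exp[OF n _ mu] borel_measurable_continuous_onI continuous_on_mult c cy)
  have "cmod (yuk \<mu> \<eta> x * D1 i x) <= M1 * ?ex x" for x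
   using mult_mono[OF M1 B(1)[of x]] m by (simp add: norm_mult mult.commute)
  then show "integrable lborel (%x. yuk \<mu> \<eta> x * D1 i x)"
   by (intro integrable_bounded_exp[OF n _ mu] borel_measurable_continuous_onI continuous_on_mult c cy)
  have "cmod (\<psi> x * yuk1 \<mu> \<eta> i x) <= (M * cmod \<mu>) * ?ex x" for x
   using mult_mono[OF M B(2)[of i x]] M0 by (simp add: norm_mult mult.assoc)
  then show "integrable lborel (%x. \<psi> x * yuk1 \<mu> \<eta> i x)"
   by (intro integrable_bounded_exp[OF n _ mu] borel_measurable_continuous_onI continuous_on_mult c cy)
  have "cmod (\<psi> x * yuk2 \<mu> \<eta> i x) <= (M * (2 * cmod \<mu> / \<eta> + (cmod \<mu>)\<^sup>2)) * ?ex x" for x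
  proof -
   have "2 * cmod \<mu> / reg_norm \<eta> x <= 2 * cmod \<mu> / \<eta>"
    by (rule divide_left_mono[OF reg_norm_ge[OF e]]) (use e reg_norm_pos[OF e, of x] in auto)
   then have "(2 * cmod \<mu> / reg_norm \<eta> x + (cmod \<mu>)\<^sup>2) * ?ex x <= (2 * cmod \<mu> / \<eta> + (cmod \<mu>)\<^sup>2) * ?ex x"
    by (intro mult_right_mono) auto
   from order_trans[OF B(3)[of i x] this]
   show ?thesis using mult_mono[OF M[of x], of "cmod (yuk2 \<mu> \<eta> i x)"] M0 by (simp add: norm_mult mult.assoc)
  qed
  then show "integrable lborel (%x. \<psi> x * yuk2 \<mu> \<eta> i x)"
   by (intro integrable_bounded_exp[OF n _ mu] borel_measurable_continuous_onI continuous_on_mult c cy)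
 qed
 have z: "(LINT x|lborel. yuk \<mu> \<eta> x * D2 i x - \<psi> x * yuk2 \<mu> \<eta> i x) = 0" for i
 proof (rule integral_translate_zero[where F="%x. yuk \<mu> \<eta> x * D1 i x - \<psi> x * yuk1 \<mu> \<eta> i x" and u="axis i 1"])
  show "integrable lborel (%x. yuk \<mu> \<eta> x * D1 i x - \<psi> x * yuk1 \<mu> \<eta> i x)"
   "integrable lborel (%x. yuk \<mu> \<eta> x * D2 i x - \<psi> x * yuk2 \<mu> \<eta> i x)"
   by (intro Bochner_Integration.integrable_diff ii)+
  show "continuous_on UNIV (%x. yuk \<mu> \<eta> x * D2 i x - \<psi> x * yuk2 \<mu> \<eta> i x)"
   by (intro continuous_on_diff continuous_on_mult c cy)
  fix x :: "real^'k" and t :: real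
  have d1: "((%t. \<psi> (x + t *\<^sub>R axis i 1)) has_vector_derivative D1 i (x + t *\<^sub>R axis i 1)) (at t)"
   and d2: "((%t. D1 i (x + t *\<^sub>R axis i 1)) has_vector_derivative D2 i (x + t *\<^sub>R axis i 1)) (at t)"
   using C2 by (auto simp: bdd_C2_def)
  let ?y = "x + t *\<^sub>R axis i 1"
  have "((%t. yuk \<mu> \<eta> (x + t *\<^sub>R axis i 1) * D1 i (x + t *\<^sub>R axis i 1) - \<psi> (x + t *\<^sub>R axis i 1) * yuk1 \<mu> \<eta> i (x + t *\<^sub>R axis i 1)) has_vector_derivative
    (yuk \<mu> \<eta> ?y * D2 i ?y + yuk1 \<mu> \<eta> i ?y * D1 i ?y) - (\<psi> ?y * yuk2 \<mu> \<eta> i ?y + D1 i ?y * yuk1 \<mu> \<eta> i ?y)) (at t)"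
   by (intro has_vector_derivative_diff has_vector_derivative_mult d1 d2 yuk_line_derivative[OF e])
  then show "((%t. yuk \<mu> \<eta> (x + t *\<^sub>R axis i 1) * D1 i (x + t *\<^sub>R axis i 1) - \<psi> (x + t *\<^sub>R axis i 1) * yuk1 \<mu> \<eta> i (x + t *\<^sub>R axis i 1)) has_vector_derivative
    yuk \<mu> \<eta> ?y * D2 i ?y - \<psi> ?y * yuk2 \<mu> \<eta> i ?y) (at t)" by (simp add: algebra_simps)
 qed
 have "(LINT x|lborel. yuk \<mu> \<eta> x * D2 i x) = (LINT x|lborel. \<psi> x * yuk2 \<mu> \<eta> i x)" for i
  using z[of i] ii(1,2)[of i] by simp
 then show "(LINT x|lborel. yuk \<mu> \<eta> x * (\<Sum>i\<in>UNIV. D2 i x)) = (LINT x|lborel. \<psi> x * (\<Sum>i\<in>UNIV. yuk2 \<mu> \<eta> i x))"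
  unfolding sum_distrib_left by (simp add: ii)
 show "integrable lborel (%x. yuk \<mu> \<eta> x * (\<Sum>i\<in>UNIV. D2 i x))"
  unfolding sum_distrib_left by (intro Bochner_Integration.integrable_sum ii)
qed

lemma sum_yuk2:
 fixes x :: "real^'k::finite"
 shows "(\<Sum>i\<in>UNIV. yuk2 \<mu> \<eta> i x) = (of_real (real CARD('k) / reg_norm \<eta> x - (norm x)\<^sup>2 / reg_norm \<eta> x ^ 3) * (- \<mu>)
   + of_real ((norm x)\<^sup>2 / (reg_norm \<eta> x)\<^sup>2) * \<mu>\<^sup>2) * yuk \<mu> \<eta> x"
proof -
 have s: "(\<Sum>i\<in>UNIV. (x $ i)\<^sup>2) = (norm x)\<^sup>2" unfolding power2_norm_eq_inner inner_vec_def by (simp add: power2_eq_square)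
 have "(\<Sum>i\<in>(UNIV::'k set). 1 / reg_norm \<eta> x - (x $ i)\<^sup>2 / reg_norm \<eta> x ^ 3) = real CARD('k) / reg_norm \<eta> x - (norm x)\<^sup>2 / reg_norm \<eta> x ^ 3"
  unfolding sum_subtractf sum_divide_distrib[symmetric] s by simp
 moreover have "(\<Sum>i\<in>(UNIV::'k set). (x $ i)\<^sup>2 / (reg_norm \<eta> x)\<^sup>2) = (norm x)\<^sup>2 / (reg_norm \<eta> x)\<^sup>2"
  unfolding sum_divide_distrib[symmetric] s ..
 ultimately show ?thesis
  unfolding yuk2_def sum.distrib sum_distrib_right[symmetric] of_real_sum[symmetric]
  by (simp only: distrib_right mult.assoc mult_minus_left mult_minus_right)
qed

text \<open>Partial integration for the regularised exponential, then \<open>\<eta> \<rightarrow> 0\<close>. In dimension at least two the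
 singularity is too weak to produce a contribution at the origin.\<close>
lemma yukawa_green:
 fixes \<psi> :: "real^'k::finite => complex"
 assumes n: "2 <= CARD('k)" and mu: "0 < Re \<mu>" and C2: "bdd_C2 \<psi> D1 D2"
 shows "(LINT x|lborel. exp (- \<mu> * of_real (norm x)) * (\<Sum>i\<in>UNIV. D2 i x))
   = (LINT x|lborel. \<psi> x * ((\<mu>\<^sup>2 - \<mu> * of_real ((real CARD('k) - 1) / norm x)) * exp (- \<mu> * of_real (norm x))))"
proof -
 define \<eta> where "\<eta> m = 1 / (real m + 1)" for m
 have e: "0 < \<eta> m" for m by (simp add: \<eta>_def)
 have e0: "\<eta> \<longlonglongrightarrow> 0" unfolding \<eta>_def by real_asymp
 let ?n = "real CARD('k)" and ?D = "%x. \<Sum>i\<in>UNIV. D2 i x"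
 let ?ex = "%x::real^'k. exp (- Re \<mu> * norm x)"
 have c: "continuous_on UNIV \<psi>" "continuous_on UNIV (D2 i)" for i
  using C2 by (auto simp: bdd_C2_def)
 have cD: "continuous_on UNIV ?D" by (intro continuous_on_sum c)
 obtain M where M: "!!x. cmod (\<psi> x) <= M" using C2 by (auto simp: bdd_C2_def bounded_iff)
 have M0: "0 <= M" using M[of 0] norm_ge_zero order_trans by blast
 have "\<forall>i. \<exists>B. \<forall>x. cmod (D2 i x) <= B"
 proof
  fix i have "bounded (range (D2 i))" using C2 unfolding bdd_C2_def by blast
  then show "\<exists>B. \<forall>x. cmod (D2 i x) <= B" by (auto simp: bounded_iff)
 qed
 then obtain B2 where B2: "!!i x. cmod (D2 i x) <= B2 i" by metis
 have DB: "cmod (?D x) <= (\<Sum>i\<in>UNIV. B2 i)" for x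
  by (rule order_trans[OF norm_sum sum_mono[OF B2]])
 have rlim: "(%m. reg_norm (\<eta> m) x) \<longlonglongrightarrow> norm x" for x :: "real^'k"
 proof -
  have "(%m. sqrt (x \<bullet> x + (\<eta> m)\<^sup>2)) \<longlonglongrightarrow> sqrt (x \<bullet> x + 0\<^sup>2)" by (intro tendsto_intros e0)
  then show ?thesis by (simp add: reg_norm_def norm_eq_sqrt_inner)
 qed
 have ylim: "(%m. yuk \<mu> (\<eta> m) x) \<longlonglongrightarrow> exp (- \<mu> * of_real (norm x))" for x :: "real^'k"
  unfolding yuk_def by (intro tendsto_intros rlim)
 have m_yuk: "yuk \<mu> (\<eta> m) \<in> borel_measurable (borel :: (real^'k) measure)" for m
  by (intro borel_measurable_continuous_onI continuous_on_yuk e)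
 have m_yuk2: "yuk2 \<mu> (\<eta> m) i \<in> borel_measurable (borel :: (real^'k) measure)" for m i
  by (intro borel_measurable_continuous_onI continuous_on_yuk e)
 have [measurable]: "\<psi> \<in> borel_measurable borel" "?D \<in> borel_measurable borel"
  by (intro borel_measurable_continuous_onI c cD)+
 have L: "(%m. LINT x|lborel. yuk \<mu> (\<eta> m) x * ?D x) \<longlonglongrightarrow> (LINT x|lborel. exp (- \<mu> * of_real (norm x)) * ?D x)"
 proof (rule integral_dominated_convergence[where w="%x. (\<Sum>i\<in>UNIV. B2 i) * ?ex x"])
  show "integrable lborel (%x::real^'k. (\<Sum>i\<in>UNIV. B2 i) * ?ex x)"
   by (intro integrable_mult_right integrable_exp_norm) (use n mu in auto)
  show "AE x in lborel. (%m. yuk \<mu> (\<eta> m) x * ?D x) \<longlonglongrightarrow> exp (- \<mu> * of_real (norm x)) * ?D x"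
   by (intro AE_I2 tendsto_mult ylim tendsto_const)
  show "AE x in lborel. cmod (yuk \<mu> (\<eta> m) x * ?D x) <= (\<Sum>i\<in>UNIV. B2 i) * ?ex x" for m
  proof (intro AE_I2)
   fix x
   have "cmod (yuk \<mu> (\<eta> m) x) * cmod (?D x) <= ?ex x * (\<Sum>i\<in>UNIV. B2 i)"
    by (intro mult_mono yuk_bounds(1)[OF e mu] DB) auto
   then show "cmod (yuk \<mu> (\<eta> m) x * ?D x) <= (\<Sum>i\<in>UNIV. B2 i) * ?ex x" by (simp add: norm_mult mult.commute)
  qed
 qed (use m_yuk in measurable)
 have R: "(%m. LINT x|lborel. \<psi> x * (\<Sum>i\<in>UNIV. yuk2 \<mu> (\<eta> m) i x)) \<longlonglongrightarrow>
   (LINT x|lborel. \<psi> x * ((\<mu>\<^sup>2 - \<mu> * of_real ((?n - 1) / norm x)) * exp (- \<mu> * of_real (norm x))))"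
 proof (rule integral_dominated_convergence[where w="%x. M * (?n * (2 * cmod \<mu> * (?ex x / norm x) + (cmod \<mu>)\<^sup>2 * ?ex x))"])
  show "integrable lborel (%x::real^'k. M * (?n * (2 * cmod \<mu> * (?ex x / norm x) + (cmod \<mu>)\<^sup>2 * ?ex x)))"
   by (intro integrable_mult_right Bochner_Integration.integrable_add integrable_exp_norm integrable_yukawa) (use n mu in auto)
  have nz: "AE x in lborel. x \<noteq> (0::real^'k)" by (rule AE_lborel_singleton)
  then show "AE x in lborel. (%m. \<psi> x * (\<Sum>i\<in>UNIV. yuk2 \<mu> (\<eta> m) i x)) \<longlonglongrightarrow>
    \<psi> x * ((\<mu>\<^sup>2 - \<mu> * of_real ((?n - 1) / norm x)) * exp (- \<mu> * of_real (norm x)))"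
  proof eventually_elim
   case (elim x)
   have r: "norm x \<noteq> 0" using elim by simp
   have "(%m. \<psi> x * (\<Sum>i\<in>UNIV. yuk2 \<mu> (\<eta> m) i x)) \<longlonglongrightarrow> \<psi> x * ((of_real (?n / norm x - (norm x)\<^sup>2 / norm x ^ 3) * (- \<mu>)
      + of_real ((norm x)\<^sup>2 / (norm x)\<^sup>2) * \<mu>\<^sup>2) * exp (- \<mu> * of_real (norm x)))"
    unfolding sum_yuk2 by (intro tendsto_intros rlim ylim) (use r in auto)
   moreover have "?n / norm x - (norm x)\<^sup>2 / norm x ^ 3 = (?n - 1) / norm x"
    using r by (simp add: field_simps power2_eq_square power3_eq_cube)
   moreover have "(norm x)\<^sup>2 / (norm x)\<^sup>2 = 1" using r by simp
   ultimately show ?case by (simp only: of_real_1 mult_1_left mult_minus_right diff_conv_add_uminus add.commute mult.commute[of _ \<mu>])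
  qed
  show "AE x in lborel. cmod (\<psi> x * (\<Sum>i\<in>UNIV. yuk2 \<mu> (\<eta> m) i x)) <= M * (?n * (2 * cmod \<mu> * (?ex x / norm x) + (cmod \<mu>)\<^sup>2 * ?ex x))" for m
   using nz
  proof eventually_elim
   case (elim x)
   have "cmod (yuk2 \<mu> (\<eta> m) i x) <= 2 * cmod \<mu> * (?ex x / norm x) + (cmod \<mu>)\<^sup>2 * ?ex x" for i
   proof -
    have "2 * cmod \<mu> / reg_norm (\<eta> m) x <= 2 * cmod \<mu> / norm x"
     by (rule divide_left_mono[OF norm_le_reg_norm]) (use elim reg_norm_pos[OF e[of m], of x] in auto)
    then have "(2 * cmod \<mu> / reg_norm (\<eta> m) x + (cmod \<mu>)\<^sup>2) * ?ex x <= (2 * cmod \<mu> / norm x + (cmod \<mu>)\<^sup>2) * ?ex x"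
     by (intro mult_right_mono) auto
    from order_trans[OF yuk_bounds(3)[OF e[of m] mu, of i x] this] show ?thesis by (simp add: distrib_right)
   qed
   then have "cmod (\<Sum>i\<in>UNIV. yuk2 \<mu> (\<eta> m) i x) <= (\<Sum>i\<in>(UNIV::'k set). 2 * cmod \<mu> * (?ex x / norm x) + (cmod \<mu>)\<^sup>2 * ?ex x)"
    by (intro order_trans[OF norm_sum sum_mono])
   then have "cmod (\<psi> x) * cmod (\<Sum>i\<in>UNIV. yuk2 \<mu> (\<eta> m) i x) <= M * (?n * (2 * cmod \<mu> * (?ex x / norm x) + (cmod \<mu>)\<^sup>2 * ?ex x))"
    using M[of x] M0 by (intro mult_mono) (simp_all only: sum_constant norm_ge_zero)
   then show ?case by (simp only: norm_mult)
  qed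
 qed (use m_yuk2 in measurable)
 show ?thesis
  using LIMSEQ_unique[OF L] R yuk_green(1)[OF n e mu C2] by simp
qed

section \<open>The integral over frequencies and scales\<close>

lemma nn_integral_laplace_powr:
 assumes x: "0 < x" and c: "0 < c"
 shows "(\<integral>\<^sup>+s. ennreal (s powr (x - 1) * exp (- c * s)) * pos_ind s \<partial>lborel) = ennreal (Gamma x * c powr (- x))"
proof -
 let ?f = "%t::real. ennreal (indicator {0..} t * t powr (x - 1) / exp t)"
 have "ennreal (Gamma x) = (\<integral>\<^sup>+t. ?f t \<partial>lborel)" using Gamma_conv_nn_integral_real[OF x] .
 also have "... = ennreal \<bar>c\<bar> * (\<integral>\<^sup>+s. ?f (0 + c * s) \<partial>lborel)"
  by (rule nn_integral_real_affine) (use c in auto)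
 also have "(\<integral>\<^sup>+s. ?f (0 + c * s) \<partial>lborel) = (\<integral>\<^sup>+s. ennreal (c powr (x - 1)) * (ennreal (s powr (x - 1) * exp (- c * s)) * pos_ind s) \<partial>lborel)"
 proof (intro nn_integral_cong)
  fix s :: real
  consider "s < 0" | "s = 0" | "0 < s" by linarith
  then show "?f (0 + c * s) = ennreal (c powr (x - 1)) * (ennreal (s powr (x - 1) * exp (- c * s)) * pos_ind s)"
  proof cases
   case 1
   then have "c * s < 0" using c by (simp add: mult_pos_neg)
   then show ?thesis using 1 by (simp add: indicator_def)
  next
   case 3
   then have "?f (0 + c * s) = ennreal (c powr (x - 1) * (s powr (x - 1) * exp (- c * s)))"
    using c by (simp add: powr_mult exp_minus divide_inverse mult.assoc)
   then show ?thesis using 3 by (simp add: ennreal_mult)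
  qed simp
 qed
 also have "... = ennreal (c powr (x - 1)) * (\<integral>\<^sup>+s. ennreal (s powr (x - 1) * exp (- c * s)) * pos_ind s \<partial>lborel)"
  by (rule nn_integral_cmult) measurable
 finally have "ennreal (Gamma x) = ennreal c * (ennreal (c powr (x - 1)) * (\<integral>\<^sup>+s. ennreal (s powr (x - 1) * exp (- c * s)) * pos_ind s \<partial>lborel))"
  using c by simp
 also have "... = ennreal (c powr x) * (\<integral>\<^sup>+s. ennreal (s powr (x - 1) * exp (- c * s)) * pos_ind s \<partial>lborel)"
 proof -
  have "c * c powr (x - 1) = c powr x" using c by (simp add: powr_mult_base)
  then show ?thesis using c by (simp add: mult.assoc[symmetric] ennreal_mult[symmetric])
 qed
 finally have G: "ennreal (Gamma x) = ennreal (c powr x) * (\<integral>\<^sup>+s. ennreal (s powr (x - 1) * exp (- c * s)) * pos_ind s \<partial>lborel)" .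
 have "ennreal (Gamma x * c powr (- x)) = ennreal (c powr (- x)) * ennreal (Gamma x)"
  using Gamma_real_pos[OF x] by (simp add: ennreal_mult mult.commute)
 also have "... = ennreal (c powr (- x) * c powr x) * (\<integral>\<^sup>+s. ennreal (s powr (x - 1) * exp (- c * s)) * pos_ind s \<partial>lborel)"
  unfolding G by (simp add: ennreal_mult mult.assoc)
 also have "c powr (- x) * c powr x = 1" using c by (simp add: powr_minus)
 finally show ?thesis by simp
qed

text \<open>The density \<open>(s (2 \<kappa> + s))\<^bsup>\<nu>\<^esup>\<close>, split into its two factors to fix the branch: \<open>2 \<kappa> + s\<close> lies in the right half plane.\<close>
definition spec_wt :: "real => complex => real => complex" where
 "spec_wt \<nu> \<kappa> s = of_real (s powr \<nu>) * (2 * \<kappa> + of_real s) powr of_real \<nu>"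

lemma borel_measurable_spec_wt [measurable]:
 assumes "0 < Re \<kappa>" shows "(%s. spec_wt \<nu> \<kappa> s * pos_ind s) \<in> borel_measurable borel"
proof -
 have "continuous_on {0<..} (spec_wt \<nu> \<kappa>)"
 proof (intro continuous_at_imp_continuous_on ballI)
  fix s :: real assume s: "s \<in> {0<..}"
  have "2 * \<kappa> + complex_of_real s \<notin> \<real>\<^sub>\<le>\<^sub>0"
  proof
   assume "2 * \<kappa> + complex_of_real s \<in> \<real>\<^sub>\<le>\<^sub>0"
   then have "Re (2 * \<kappa> + complex_of_real s) <= 0" by (simp add: complex_nonpos_Reals_iff)
   then show False using assms s by simp
  qed
  moreover have "isCont (%s. complex_of_real (s powr \<nu>)) s" using s by (intro continuous_intros) auto
  ultimately show "isCont (spec_wt \<nu> \<kappa>) s"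
   unfolding spec_wt_def using s by (intro continuous_mult isCont_powr_complex continuous_intros) auto
 qed
 then have "(%s. pos_ind s *\<^sub>R spec_wt \<nu> \<kappa> s) \<in> borel_measurable borel"
  by (intro borel_measurable_continuous_on_indicator) auto
 then show ?thesis by (rule measurable_cong[THEN iffD1, rotated]) (auto simp: indicator_def)
qed

lemma norm_spec_wt:
 assumes "0 < s" shows "cmod (spec_wt \<nu> \<kappa> s) = s powr \<nu> * cmod (2 * \<kappa> + of_real s) powr \<nu>"
 using assms by (simp add: spec_wt_def norm_mult norm_powr_real_powr')

lemma powr_add_le:
 fixes x y :: real
 assumes "0 <= r" "0 < x" "0 < y" shows "(x + y) powr r <= 2 powr r * (x powr r + y powr r)"
proof -
 have "(x + y) powr r <= (2 * max x y) powr r" using assms by (intro powr_mono2) auto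
 also have "... = 2 powr r * max x y powr r" using assms by (simp add: powr_mult)
 also have "max x y powr r <= x powr r + y powr r" by (auto simp: max_def)
 finally show ?thesis by simp
qed

text \<open>For \<open>n = 2\<close> the exponent \<open>\<nu> = - 1/2\<close> is negative and the second term of the bounds below is absent; keeping it
 would give a divergent integral.\<close>
definition nonplanar :: "nat => real" where "nonplanar n = (if n = 2 then 0 else 1)"

lemma norm_spec_wt_le:
 assumes n: "2 <= n" and \<nu>: "\<nu> = (real n - 3) / 2" and s: "0 < s" and k: "0 < Re \<kappa>"
 shows "cmod (spec_wt \<nu> \<kappa> s) <= 4 powr \<bar>\<nu>\<bar> * (s powr \<nu> * (cmod \<kappa> powr \<nu> + nonplanar n * s powr \<nu>))"
proof -
 have k0: "0 < cmod \<kappa>" using k abs_Re_le_cmod[of \<kappa>] by linarith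
 have "cmod (2 * \<kappa> + of_real s) powr \<nu> <= 4 powr \<bar>\<nu>\<bar> * (cmod \<kappa> powr \<nu> + nonplanar n * s powr \<nu>)"
 proof (cases "n = 2")
  case True
  then have nu: "\<nu> <= 0" "\<nu> = -1/2" by (simp_all add: \<nu>)
  have "(cmod \<kappa>)\<^sup>2 <= (cmod (2 * \<kappa> + of_real s))\<^sup>2"
  proof -
   have "(Re \<kappa>)\<^sup>2 <= (2 * Re \<kappa> + s)\<^sup>2" using k s by (intro power_mono) auto
   moreover have "(Im \<kappa>)\<^sup>2 <= (2 * Im \<kappa>)\<^sup>2" by (simp add: power_mult_distrib)
   ultimately show ?thesis
    unfolding cmod_power2 by simp (use zero_le_power2[of "Im \<kappa>"] in linarith)
  qed
  then have "cmod \<kappa> <= cmod (2 * \<kappa> + of_real s)" by (rule power2_le_imp_le) simp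
  then have "cmod (2 * \<kappa> + of_real s) powr \<nu> <= cmod \<kappa> powr \<nu>" using nu k0 by (intro powr_mono2')
  also have "... <= 4 powr \<bar>\<nu>\<bar> * cmod \<kappa> powr \<nu>" using mult_right_mono[OF ge_one_powr_ge_zero[of 4 "\<bar>\<nu>\<bar>"], of "cmod \<kappa> powr \<nu>"] by simp
  finally show ?thesis using True by (simp add: nonplanar_def)
 next
  case False
  then have nu: "0 <= \<nu>" using n by (simp add: \<nu>)
  have "cmod (2 * \<kappa> + of_real s) <= 2 * cmod \<kappa> + 2 * s"
   using norm_triangle_ineq[of "2 * \<kappa>" "of_real s"] s by (simp add: norm_mult)
  then have "cmod (2 * \<kappa> + of_real s) powr \<nu> <= (2 * cmod \<kappa> + 2 * s) powr \<nu>" using nu by (intro powr_mono2) auto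
  also have "... <= 2 powr \<nu> * ((2 * cmod \<kappa>) powr \<nu> + (2 * s) powr \<nu>)" using nu k0 s by (intro powr_add_le) auto
  also have "... = (2 powr \<nu> * 2 powr \<nu>) * (cmod \<kappa> powr \<nu> + s powr \<nu>)" using s by (simp add: powr_mult algebra_simps)
  also have "2 powr \<nu> * 2 powr \<nu> = 4 powr \<bar>\<nu>\<bar>" using nu by (simp flip: powr_mult)
  finally show ?thesis using False by (simp add: nonplanar_def)
 qed
 then have "s powr \<nu> * cmod (2 * \<kappa> + of_real s) powr \<nu> <= s powr \<nu> * (4 powr \<bar>\<nu>\<bar> * (cmod \<kappa> powr \<nu> + nonplanar n * s powr \<nu>))"
  by (intro mult_left_mono) auto
 then show ?thesis unfolding norm_spec_wt[OF s] by (simp add: mult_ac)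
qed

text \<open>Bound \<open>|2 \<kappa> + s|\<close> by \<open>|\<kappa>| + s\<close> if the exponent is nonnegative, from below by \<open>|\<kappa>|\<close> otherwise, and use Gamma
 integrals.\<close>
lemma inner_spec_bound:
 assumes n: "2 <= n" and \<nu>: "\<nu> = (real n - 3) / 2"
 shows "\<exists>C\<ge>0. \<forall>\<kappa> l. 0 < Re \<kappa> --> 0 < l -->
  (\<integral>\<^sup>+s. ennreal (cmod (spec_wt \<nu> \<kappa> s) * exp (- (l / 2) * s)) * pos_ind s \<partial>lborel)
   <= ennreal (C * (l powr (- (real n - 2)) * ((l * cmod \<kappa>) powr \<nu> + nonplanar n)))"
proof -
 have rn: "2 <= real n" using n by simp
 then have p1: "0 < \<nu> + 1" unfolding \<nu> by (simp add: field_simps)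
 have nu2: "2 * \<nu> + 1 = real n - 2" unfolding \<nu> by (simp add: field_simps)
 define G where "G = (if n = 2 then 0 else Gamma (2 * \<nu> + 1) * 2 powr (2 * \<nu> + 1))"
 define A where "A = Gamma (\<nu> + 1) * 2 powr (\<nu> + 1)"
 have A: "0 <= A" using Gamma_real_pos[OF p1] by (simp add: A_def less_imp_le)
 have G: "0 <= G"
 proof (cases "n = 2")
  case False
  then have "0 < 2 * \<nu> + 1" using n unfolding nu2 by simp
  from Gamma_real_pos[OF this] show ?thesis by (simp add: G_def less_imp_le)
 qed (simp add: G_def)
 have "(\<integral>\<^sup>+s. ennreal (cmod (spec_wt \<nu> \<kappa> s) * exp (- (l / 2) * s)) * pos_ind s \<partial>lborel)
   <= ennreal ((4 powr \<bar>\<nu>\<bar> * (A + G)) * (l powr (- (real n - 2)) * ((l * cmod \<kappa>) powr \<nu> + nonplanar n)))"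
  if k: "0 < Re \<kappa>" and l: "0 < l" for \<kappa> l
 proof -
  have k0: "0 < cmod \<kappa>" using k abs_Re_le_cmod[of \<kappa>] by linarith
  have hl: "(l / 2) powr (- x) = 2 powr x * l powr (- x)" for x
   using l by (simp add: powr_divide powr_minus field_simps)
  let ?I = "%x. (\<integral>\<^sup>+s. ennreal (s powr (x - 1) * exp (- (l / 2) * s)) * pos_ind s \<partial>lborel)"
  let ?c1 = "4 powr \<bar>\<nu>\<bar> * cmod \<kappa> powr \<nu>" and ?c2 = "4 powr \<bar>\<nu>\<bar> * nonplanar n"
  have t0: "0 <= nonplanar n" by (simp add: nonplanar_def)
  have "(\<integral>\<^sup>+s. ennreal (cmod (spec_wt \<nu> \<kappa> s) * exp (- (l / 2) * s)) * pos_ind s \<partial>lborel)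
   <= (\<integral>\<^sup>+s. ennreal ?c1 * (ennreal (s powr ((\<nu> + 1) - 1) * exp (- (l / 2) * s)) * pos_ind s)
      + ennreal ?c2 * (ennreal (s powr ((2 * \<nu> + 1) - 1) * exp (- (l / 2) * s)) * pos_ind s) \<partial>lborel)"
  proof (rule nn_integral_mono)
   fix s :: real
   show "ennreal (cmod (spec_wt \<nu> \<kappa> s) * exp (- (l / 2) * s)) * pos_ind s
    <= ennreal ?c1 * (ennreal (s powr ((\<nu> + 1) - 1) * exp (- (l / 2) * s)) * pos_ind s)
      + ennreal ?c2 * (ennreal (s powr ((2 * \<nu> + 1) - 1) * exp (- (l / 2) * s)) * pos_ind s)"
   proof (cases "0 < s")
    case True
    have "cmod (spec_wt \<nu> \<kappa> s) * exp (- (l / 2) * s) <= 4 powr \<bar>\<nu>\<bar> * (s powr \<nu> * (cmod \<kappa> powr \<nu> + nonplanar n * s powr \<nu>)) * exp (- (l / 2) * s)"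
     by (intro mult_right_mono norm_spec_wt_le[OF n \<nu> True k]) auto
    also have "... = ?c1 * (s powr ((\<nu> + 1) - 1) * exp (- (l / 2) * s)) + ?c2 * (s powr ((2 * \<nu> + 1) - 1) * exp (- (l / 2) * s))"
    proof -
     have "s powr \<nu> * s powr \<nu> = s powr (2 * \<nu>)" by (simp add: powr_add[symmetric])
     then show ?thesis by (simp add: algebra_simps)
    qed
    finally show ?thesis using True t0
     by (simp add: ennreal_plus[symmetric] ennreal_mult[symmetric] ennreal_leI del: ennreal_plus)
   qed simp
  qed
  also have "... = ennreal ?c1 * ?I (\<nu> + 1) + ennreal ?c2 * ?I (2 * \<nu> + 1)"
   by (subst nn_integral_add) (auto simp: nn_integral_cmult)
  also have "ennreal ?c1 * ?I (\<nu> + 1) = ennreal (?c1 * (A * l powr (- (\<nu> + 1))))"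
  proof -
   have "?I (\<nu> + 1) = ennreal (Gamma (\<nu> + 1) * (l / 2) powr (- (\<nu> + 1)))"
    by (rule nn_integral_laplace_powr[OF p1]) (use l in simp)
   also have "Gamma (\<nu> + 1) * (l / 2) powr (- (\<nu> + 1)) = A * l powr (- (\<nu> + 1))"
    unfolding A_def hl by (simp only: mult.assoc)
   finally show ?thesis using A by (simp add: ennreal_mult)
  qed
  also have "ennreal ?c2 * ?I (2 * \<nu> + 1) = ennreal (?c2 * (G * l powr (- (2 * \<nu> + 1))))"
  proof (cases "n = 2")
   case False
   then have p2: "0 < 2 * \<nu> + 1" using n unfolding nu2 by simp
   have "?I (2 * \<nu> + 1) = ennreal (Gamma (2 * \<nu> + 1) * (l / 2) powr (- (2 * \<nu> + 1)))"
    by (rule nn_integral_laplace_powr[OF p2]) (use l in simp)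
   also have "Gamma (2 * \<nu> + 1) * (l / 2) powr (- (2 * \<nu> + 1)) = G * l powr (- (2 * \<nu> + 1))"
    unfolding G_def hl using False by (simp only: mult.assoc if_False)
   finally show ?thesis using G t0 by (simp add: ennreal_mult)
  qed (simp add: nonplanar_def)
  also have "ennreal (?c1 * (A * l powr (- (\<nu> + 1)))) + ennreal (?c2 * (G * l powr (- (2 * \<nu> + 1))))
    = ennreal (?c1 * (A * l powr (- (\<nu> + 1))) + ?c2 * (G * l powr (- (2 * \<nu> + 1))))"
   using A G t0 by (simp add: ennreal_plus)
  also have "... <= ennreal ((4 powr \<bar>\<nu>\<bar> * (A + G)) * (l powr (- (real n - 2)) * ((l * cmod \<kappa>) powr \<nu> + nonplanar n)))"
  proof (rule ennreal_leI)
   have e1: "l powr (- (\<nu> + 1)) * cmod \<kappa> powr \<nu> = l powr (- (real n - 2)) * (l * cmod \<kappa>) powr \<nu>"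
   proof -
    have "l powr (- (\<nu> + 1)) = l powr (- (real n - 2)) * l powr \<nu>"
     unfolding powr_add[symmetric] by (rule arg_cong[of _ _ "%r. l powr r"]) (simp add: \<nu> field_simps)
    then show ?thesis using l by (simp add: powr_mult)
   qed
   have e2: "l powr (- (2 * \<nu> + 1)) = l powr (- (real n - 2))"
    by (rule arg_cong[of _ _ "%r. l powr r"]) (simp add: \<nu> field_simps)
   let ?P = "l powr (- (real n - 2)) * (l * cmod \<kappa>) powr \<nu>" and ?Q = "l powr (- (real n - 2)) * nonplanar n"
   have pq: "0 <= ?P" "0 <= ?Q" using t0 by simp_all
   have "?c1 * (A * l powr (- (\<nu> + 1))) + ?c2 * (G * l powr (- (2 * \<nu> + 1))) = 4 powr \<bar>\<nu>\<bar> * (A * ?P + G * ?Q)"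
    unfolding e2 e1[symmetric] by (simp add: algebra_simps)
   also have "... <= 4 powr \<bar>\<nu>\<bar> * ((A + G) * (?P + ?Q))"
    using A G pq by (intro mult_left_mono) (auto simp: algebra_simps intro!: add_nonneg_nonneg mult_nonneg_nonneg)
   also have "... = (4 powr \<bar>\<nu>\<bar> * (A + G)) * (l powr (- (real n - 2)) * ((l * cmod \<kappa>) powr \<nu> + nonplanar n))"
    by (simp add: algebra_simps)
   finally show "?c1 * (A * l powr (- (\<nu> + 1))) + ?c2 * (G * l powr (- (2 * \<nu> + 1)))
    <= (4 powr \<bar>\<nu>\<bar> * (A + G)) * (l powr (- (real n - 2)) * ((l * cmod \<kappa>) powr \<nu> + nonplanar n))" .
  qed
  finally show ?thesis .
 qed
 then show ?thesis using A G by (intro exI[of _ "4 powr \<bar>\<nu>\<bar> * (A + G)"]) auto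
qed

text \<open>Half of the exponential damping pays for replacing \<open>|Im \<kappa>|\<close> by \<open>|\<kappa>|\<close> in the polynomial factor.\<close>
lemma damping_weight_le:
 fixes \<beta> :: real
 assumes "0 <= \<beta>"
 shows "\<exists>C\<ge>0. \<forall>l \<kappa>. 0 < l --> 0 < Re \<kappa> -->
  exp (- (l * Re \<kappa>) / 2) * (1 + l * \<bar>Im \<kappa>\<bar>) powr (- \<beta>) <= C * (exp (- (l * Re \<kappa>) / 4) * (1 + l * cmod \<kappa>) powr (- \<beta>))"
proof -
 have "((%u::real. (1 + u) powr \<beta> * exp (- u / 4)) \<longlongrightarrow> 0) at_top" by real_asymp
 then have "eventually (%u::real. (1 + u) powr \<beta> * exp (- u / 4) < 1) at_top" by (rule order_tendstoD) simp
 then obtain U where U: "!!u::real. U <= u ==> (1 + u) powr \<beta> * exp (- u / 4) < 1" by (auto simp: eventually_at_top_linorder)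
 define C where "C = max 1 ((1 + \<bar>U\<bar>) powr \<beta>)"
 have C: "(1 + u) powr \<beta> * exp (- u / 4) <= C" if "0 <= u" for u
 proof (cases "U <= u")
  case False
  then have "(1 + u) powr \<beta> <= (1 + \<bar>U\<bar>) powr \<beta>" using that assms by (intro powr_mono2) auto
  then have "(1 + u) powr \<beta> * exp (- u / 4) <= (1 + \<bar>U\<bar>) powr \<beta> * 1" using that by (intro mult_mono) auto
  then show ?thesis by (simp add: C_def)
 qed (use U in \<open>force simp: C_def\<close>)
 have "exp (- (l * Re \<kappa>) / 2) * (1 + l * \<bar>Im \<kappa>\<bar>) powr (- \<beta>) <= C * (exp (- (l * Re \<kappa>) / 4) * (1 + l * cmod \<kappa>) powr (- \<beta>))"
  if l: "0 < l" and k: "0 < Re \<kappa>" for l \<kappa>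
 proof -
  let ?u = "l * Re \<kappa>" and ?b = "l * \<bar>Im \<kappa>\<bar>" and ?t = "l * cmod \<kappa>"
  have u: "0 <= ?u" "0 <= ?b" using l k by simp_all
  have "?t <= ?u + ?b" using mult_left_mono[OF cmod_le[of \<kappa>], of l] l k by (simp add: distrib_left)
  moreover have "(1 + ?u) * (1 + ?b) = 1 + ?u + ?b + ?u * ?b" by (simp only: distrib_left distrib_right mult_1_left mult_1_right add_ac)
  moreover have "0 <= ?u * ?b" using u by (rule mult_nonneg_nonneg)
  ultimately have "1 + ?t <= (1 + ?u) * (1 + ?b)" by linarith
  then have "(1 + ?t) powr \<beta> <= ((1 + ?u) * (1 + ?b)) powr \<beta>" using l assms by (intro powr_mono2) auto
  also have "... = (1 + ?u) powr \<beta> * (1 + ?b) powr \<beta>" using u by (intro powr_mult)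
  finally have p: "(1 + ?t) powr \<beta> <= (1 + ?u) powr \<beta> * (1 + ?b) powr \<beta>" .
  have t0: "0 < 1 + ?t" "0 < 1 + ?b" using l u by (auto intro: add_pos_nonneg)
  have "(1 + ?b) powr (- \<beta>) <= (1 + ?u) powr \<beta> * (1 + ?t) powr (- \<beta>)"
   using p t0 by (simp add: powr_minus field_simps)
  then have "exp (- ?u / 2) * (1 + ?b) powr (- \<beta>) <= exp (- ?u / 2) * ((1 + ?u) powr \<beta> * (1 + ?t) powr (- \<beta>))"
   by (intro mult_left_mono) auto
  also have "... = ((1 + ?u) powr \<beta> * exp (- ?u / 4)) * (exp (- ?u / 4) * (1 + ?t) powr (- \<beta>))"
  proof -
   have "exp (- ?u / 2) = exp (- ?u / 4) * exp (- ?u / 4)" unfolding exp_add[symmetric] by simp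
   then show ?thesis by (simp only: mult_ac)
  qed
  also have "... <= C * (exp (- ?u / 4) * (1 + ?t) powr (- \<beta>))" by (intro mult_right_mono C u) auto
  finally show ?thesis .
 qed
 moreover have "0 <= C" by (simp add: C_def)
 ultimately show ?thesis by blast
qed

lemma scale_weight_le:
 fixes t :: real
 assumes n: "2 <= n" and \<nu>: "\<nu> = (real n - 3) / 2" and \<beta>: "0 <= \<beta>" and \<gamma>: "\<gamma> = 2 + \<nu> - \<beta>" "1 < \<gamma>" and t: "0 < t"
 shows "t * (t powr \<nu> + nonplanar n) * (1 + t) powr (- \<beta>) <= (1 + 2 powr (\<gamma> - 1)) * (1 + t powr (\<gamma> - 1))"
proof -
 have b: "t powr (\<nu> + 1) * (1 + t) powr (- \<beta>) <= 1 * (1 + t powr (\<gamma> - 1))"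
 proof -
  have "(1 + t) powr (- \<beta>) <= t powr (- \<beta>)" using t \<beta> by (intro powr_mono2') auto
  then have "t powr (\<nu> + 1) * (1 + t) powr (- \<beta>) <= t powr (\<nu> + 1) * t powr (- \<beta>)" by (intro mult_left_mono) auto
  also have "... = t powr (\<gamma> - 1)" unfolding powr_add[symmetric] \<gamma> by (rule arg_cong[of _ _ "%r. t powr r"]) simp
  finally show ?thesis by simp
 qed
 have th: "nonplanar n * (t * (1 + t) powr (- \<beta>)) <= 2 powr (\<gamma> - 1) * (1 + t powr (\<gamma> - 1))"
 proof (cases "n = 2")
  case False
  then have nu: "0 <= \<nu>" using n by (simp add: \<nu>)
  have "t * (1 + t) powr (- \<beta>) <= (1 + t) * (1 + t) powr (- \<beta>)" by (intro mult_right_mono) auto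
  also have "... = (1 + t) powr (1 - \<beta>)" using t by (simp add: powr_mult_base)
  also have "... <= (1 + t) powr (\<gamma> - 1)" using t nu \<gamma> by (intro powr_mono) auto
  also have "... <= 2 powr (\<gamma> - 1) * (1 powr (\<gamma> - 1) + t powr (\<gamma> - 1))" using t \<gamma> by (intro powr_add_le) auto
  finally show ?thesis using False by (simp add: nonplanar_def)
 qed (simp add: nonplanar_def)
 have "t * (t powr \<nu> + nonplanar n) * (1 + t) powr (- \<beta>) = t powr (\<nu> + 1) * (1 + t) powr (- \<beta>) + nonplanar n * (t * (1 + t) powr (- \<beta>))"
  using t by (simp add: powr_add algebra_simps)
 also have "... <= (1 + 2 powr (\<gamma> - 1)) * (1 + t powr (\<gamma> - 1))" using add_mono[OF b th] by (simp add: distrib_right)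
 finally show ?thesis .
qed

definition scale_wt :: "nat => real => complex => real => real => real" where
 "scale_wt n \<beta> \<kappa> s l = l powr (real n - 1) * exp (- (l / 2) * (Re \<kappa> + s)) * (1 + l * \<bar>Im \<kappa>\<bar>) powr (- \<beta>)"

abbreviation scale_int :: "nat => real => complex => real => ennreal" where
 "scale_int n \<beta> \<kappa> s == \<integral>\<^sup>+l. ennreal (scale_wt n \<beta> \<kappa> s l) * pos_ind l \<partial>lborel"

lemma borel_measurable_scale_wt [measurable]:
 "(%(s, l). scale_wt n \<beta> \<kappa> s l) \<in> borel_measurable (borel \<Otimes>\<^sub>M borel)"
 unfolding scale_wt_def by measurable

lemma scale_wt_nonneg: "0 <= scale_wt n \<beta> \<kappa> s l"
 by (simp add: scale_wt_def)

text \<open>By Tonelli the integral over \<open>s\<close> is taken first. What remains is \<open>|\<kappa>|\<^bsup>-1\<^esup> \<integral> (1 + (l |\<kappa>|)\<^bsup>\<gamma>-1\<^esup>) exp (- l Re \<kappa> / 4) dl\<close>,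
 and the second term dominates because \<open>|\<kappa>| \<ge> Re \<kappa>\<close> and \<open>\<gamma> > 1\<close>.\<close>
lemma double_integral_bound:
 assumes n: "2 <= n" and \<nu>: "\<nu> = (real n - 3) / 2" and \<beta>: "0 <= \<beta>" and \<gamma>: "\<gamma> = 2 + \<nu> - \<beta>" "1 < \<gamma>"
 shows "\<exists>C\<ge>0. \<forall>\<kappa>. 0 < Re \<kappa> -->
  (\<integral>\<^sup>+s. ennreal (cmod (spec_wt \<nu> \<kappa> s)) * pos_ind s * (scale_int n \<beta> \<kappa> s) \<partial>lborel)
   <= ennreal (C * (cmod \<kappa>) powr (-2) * (cmod \<kappa> / Re \<kappa>) powr \<gamma>)"
proof -
 obtain C1 where C1: "0 <= C1" "!!\<kappa> l. 0 < Re \<kappa> ==> 0 < l ==>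
  (\<integral>\<^sup>+s. ennreal (cmod (spec_wt \<nu> \<kappa> s) * exp (- (l / 2) * s)) * pos_ind s \<partial>lborel)
   <= ennreal (C1 * (l powr (- (real n - 2)) * ((l * cmod \<kappa>) powr \<nu> + nonplanar n)))"
  using inner_spec_bound[OF n \<nu>] by blast
 obtain C2 where C2: "0 <= C2" "!!l \<kappa>. 0 < l ==> 0 < Re \<kappa> ==>
  exp (- (l * Re \<kappa>) / 2) * (1 + l * \<bar>Im \<kappa>\<bar>) powr (- \<beta>) <= C2 * (exp (- (l * Re \<kappa>) / 4) * (1 + l * cmod \<kappa>) powr (- \<beta>))"
  using damping_weight_le[OF \<beta>] by blast
 define C3 where "C3 = 1 + 2 powr (\<gamma> - 1)"
 have C3: "0 <= C3" by (simp add: C3_def)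
 define C where "C = C1 * C2 * C3 * (4 + Gamma \<gamma> * 4 powr \<gamma>)"
 have G: "0 < Gamma \<gamma>" using \<gamma> by (intro Gamma_real_pos) simp
 have t0: "0 <= nonplanar n" by (simp add: nonplanar_def)
 have "(\<integral>\<^sup>+s. ennreal (cmod (spec_wt \<nu> \<kappa> s)) * pos_ind s * (scale_int n \<beta> \<kappa> s) \<partial>lborel)
   <= ennreal (C * (cmod \<kappa>) powr (-2) * (cmod \<kappa> / Re \<kappa>) powr \<gamma>)" if k: "0 < Re \<kappa>" for \<kappa>
 proof -
  let ?k = "cmod \<kappa>" and ?a = "Re \<kappa>"
  have k0: "0 < ?k" and ak: "?a <= ?k" using k abs_Re_le_cmod[of \<kappa>] by linarith+
  define W where "W s = cmod (spec_wt \<nu> \<kappa> s) * pos_ind s" for s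
  have W[measurable]: "W \<in> borel_measurable borel"
  proof -
   have "(%s. cmod (spec_wt \<nu> \<kappa> s * pos_ind s)) \<in> borel_measurable borel"
    by (intro measurable_compose[OF borel_measurable_spec_wt[OF k]] borel_measurable_continuous_onI continuous_on_norm_id)
   then show ?thesis unfolding W_def by (rule measurable_cong[THEN iffD1, rotated]) (auto simp: norm_mult indicator_def)
  qed
  have W': "ennreal (cmod (spec_wt \<nu> \<kappa> s)) * pos_ind s = ennreal (W s)" for s
   by (simp add: W_def indicator_def)
  let ?D = "%l. l powr (real n - 1) * exp (- (l * ?a) / 2) * (1 + l * \<bar>Im \<kappa>\<bar>) powr (- \<beta>)"
  have "(\<integral>\<^sup>+s. ennreal (W s) * (scale_int n \<beta> \<kappa> s) \<partial>lborel)
    = (\<integral>\<^sup>+s. (\<integral>\<^sup>+l. ennreal (W s) * (ennreal (scale_wt n \<beta> \<kappa> s l) * pos_ind l) \<partial>lborel) \<partial>lborel)"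
   by (intro nn_integral_cong nn_integral_cmult[symmetric]) measurable
  also have "... = (\<integral>\<^sup>+l. (\<integral>\<^sup>+s. ennreal (W s) * (ennreal (scale_wt n \<beta> \<kappa> s l) * pos_ind l) \<partial>lborel) \<partial>lborel)"
   by (rule lborel_pair.Fubini') measurable
  also have "... <= (\<integral>\<^sup>+l. ennreal (C1 * C2 * C3 / ?k * ((1 + (l * ?k) powr (\<gamma> - 1)) * exp (- (?a / 4) * l))) * pos_ind l \<partial>lborel)"
  proof (rule nn_integral_mono)
   fix l :: real
   show "(\<integral>\<^sup>+s. ennreal (W s) * (ennreal (scale_wt n \<beta> \<kappa> s l) * pos_ind l) \<partial>lborel)
    <= ennreal (C1 * C2 * C3 / ?k * ((1 + (l * ?k) powr (\<gamma> - 1)) * exp (- (?a / 4) * l))) * pos_ind l"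
   proof (cases "0 < l")
    case True
    have D0: "0 <= ?D l" by simp
    have "(\<integral>\<^sup>+s. ennreal (W s) * (ennreal (scale_wt n \<beta> \<kappa> s l) * pos_ind l) \<partial>lborel)
     = (\<integral>\<^sup>+s. ennreal (?D l) * (ennreal (cmod (spec_wt \<nu> \<kappa> s) * exp (- (l / 2) * s)) * pos_ind s) \<partial>lborel)"
    proof (intro nn_integral_cong)
     fix s :: real
     have "exp (- (l / 2) * (?a + s)) = exp (- (l * ?a) / 2) * exp (- (l / 2) * s)"
      unfolding exp_add[symmetric] by (rule arg_cong[of _ _ exp]) (simp add: field_simps)
     then have "cmod (spec_wt \<nu> \<kappa> s) * scale_wt n \<beta> \<kappa> s l = ?D l * (cmod (spec_wt \<nu> \<kappa> s) * exp (- (l / 2) * s))"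
      unfolding scale_wt_def by (simp only: mult_ac)
     moreover have "ennreal (cmod (spec_wt \<nu> \<kappa> s)) * ennreal (scale_wt n \<beta> \<kappa> s l) = ennreal (cmod (spec_wt \<nu> \<kappa> s) * scale_wt n \<beta> \<kappa> s l)"
      by (rule ennreal_mult[symmetric]) (auto simp: scale_wt_nonneg)
     moreover have "ennreal (?D l) * ennreal (cmod (spec_wt \<nu> \<kappa> s) * exp (- (l / 2) * s)) = ennreal (?D l * (cmod (spec_wt \<nu> \<kappa> s) * exp (- (l / 2) * s)))"
      by (rule ennreal_mult[symmetric, OF D0]) auto
     ultimately have "ennreal (cmod (spec_wt \<nu> \<kappa> s)) * ennreal (scale_wt n \<beta> \<kappa> s l) = ennreal (?D l) * ennreal (cmod (spec_wt \<nu> \<kappa> s) * exp (- (l / 2) * s))"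
      by (simp only:)
     then show "ennreal (W s) * (ennreal (scale_wt n \<beta> \<kappa> s l) * pos_ind l)
       = ennreal (?D l) * (ennreal (cmod (spec_wt \<nu> \<kappa> s) * exp (- (l / 2) * s)) * pos_ind s)"
      using True by (cases "0 < s") (simp_all add: W_def del: ennreal_mult'')
    qed
    also have "... = ennreal (?D l) * (\<integral>\<^sup>+s. ennreal (cmod (spec_wt \<nu> \<kappa> s) * exp (- (l / 2) * s)) * pos_ind s \<partial>lborel)"
    proof (rule nn_integral_cmult)
     have "ennreal (cmod (spec_wt \<nu> \<kappa> s) * exp (- (l / 2) * s)) * pos_ind s = ennreal (W s * exp (- (l / 2) * s))" for s
      by (simp add: W_def indicator_def)
     then show "(%s. ennreal (cmod (spec_wt \<nu> \<kappa> s) * exp (- (l / 2) * s)) * pos_ind s) \<in> borel_measurable lborel" by simp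
    qed
    also have "... <= ennreal (?D l) * ennreal (C1 * (l powr (- (real n - 2)) * ((l * ?k) powr \<nu> + nonplanar n)))"
     by (intro mult_left_mono C1(2)[OF k True]) simp
    also have "... = ennreal (?D l * (C1 * (l powr (- (real n - 2)) * ((l * ?k) powr \<nu> + nonplanar n))))"
     by (rule ennreal_mult[symmetric, OF D0]) (use C1(1) t0 in auto)
    also have "... <= ennreal (C1 * C2 * C3 / ?k * ((1 + (l * ?k) powr (\<gamma> - 1)) * exp (- (?a / 4) * l)))"
    proof (rule ennreal_leI)
     let ?t = "l * ?k"
     have tp: "0 < ?t" using True k0 by simp
     let ?X = "exp (- (l * ?a) / 4) * (1 + ?t) powr (- \<beta>)"
     have ll: "l powr (real n - 1) * l powr (- (real n - 2)) = ?t / ?k"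
      using True k0 unfolding powr_add[symmetric] by simp
     have "?D l * (C1 * (l powr (- (real n - 2)) * (?t powr \<nu> + nonplanar n)))
       = (C1 * (l powr (real n - 1) * l powr (- (real n - 2))) * (?t powr \<nu> + nonplanar n)) * (exp (- (l * ?a) / 2) * (1 + l * \<bar>Im \<kappa>\<bar>) powr (- \<beta>))"
      by (simp only: mult_ac)
     also have "... <= (C1 * (?t / ?k) * (?t powr \<nu> + nonplanar n)) * (C2 * ?X)"
      unfolding ll using C1(1) tp k0 t0 True by (intro mult_left_mono C2(2) True k mult_nonneg_nonneg add_nonneg_nonneg divide_nonneg_pos) auto
     also have "... = (C1 * C2 / ?k * exp (- (l * ?a) / 4)) * (?t * (?t powr \<nu> + nonplanar n) * (1 + ?t) powr (- \<beta>))"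
      by (simp only: mult_ac divide_inverse)
     also have "... <= (C1 * C2 / ?k * exp (- (l * ?a) / 4)) * (C3 * (1 + ?t powr (\<gamma> - 1)))"
      unfolding C3_def by (intro mult_left_mono scale_weight_le[OF n \<nu> \<beta> \<gamma> tp]) (use C1(1) C2(1) k0 in auto)
     also have "... = C1 * C2 * C3 / ?k * ((1 + ?t powr (\<gamma> - 1)) * exp (- (l * ?a) / 4))"
      by (simp only: mult_ac divide_inverse)
     also have "- (l * ?a) / 4 = - (?a / 4) * l" by simp
     finally show "?D l * (C1 * (l powr (- (real n - 2)) * (?t powr \<nu> + nonplanar n)))
      <= C1 * C2 * C3 / ?k * ((1 + ?t powr (\<gamma> - 1)) * exp (- (?a / 4) * l))" .
    qed
    finally show ?thesis using True by simp
   qed simp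
  qed
  also have "... = (\<integral>\<^sup>+l. ennreal (C1 * C2 * C3 / ?k) * (ennreal (l powr (1 - 1) * exp (- (?a / 4) * l)) * pos_ind l)
    + ennreal (C1 * C2 * C3 / ?k * ?k powr (\<gamma> - 1)) * (ennreal (l powr (\<gamma> - 1) * exp (- (?a / 4) * l)) * pos_ind l) \<partial>lborel)"
  proof (intro nn_integral_cong)
   fix l :: real
   let ?c = "C1 * C2 * C3 / ?k"
   have c0: "0 <= ?c" using C1(1) C2(1) C3 by simp
   show "ennreal (?c * ((1 + (l * ?k) powr (\<gamma> - 1)) * exp (- (?a / 4) * l))) * pos_ind l
    = ennreal ?c * (ennreal (l powr (1 - 1) * exp (- (?a / 4) * l)) * pos_ind l)
    + ennreal (?c * ?k powr (\<gamma> - 1)) * (ennreal (l powr (\<gamma> - 1) * exp (- (?a / 4) * l)) * pos_ind l)"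
   proof (cases "0 < l")
    case True
    have e: "?c * ((1 + (l * ?k) powr (\<gamma> - 1)) * exp (- (?a / 4) * l)) = ?c * (l powr (1 - 1) * exp (- (?a / 4) * l)) + (?c * ?k powr (\<gamma> - 1)) * (l powr (\<gamma> - 1) * exp (- (?a / 4) * l))"
     using True k0 by (simp add: powr_mult algebra_simps)
    have g: "ennreal (x * y + z * w) = ennreal x * ennreal y + ennreal z * ennreal w" if "0 <= x" "0 <= y" "0 <= z" "0 <= w" for x y z w :: real
     using that by (simp add: ennreal_mult)
    have E: "ennreal (?c * (l powr (1 - 1) * exp (- (?a / 4) * l)) + (?c * ?k powr (\<gamma> - 1)) * (l powr (\<gamma> - 1) * exp (- (?a / 4) * l)))
     = ennreal ?c * ennreal (l powr (1 - 1) * exp (- (?a / 4) * l)) + ennreal (?c * ?k powr (\<gamma> - 1)) * ennreal (l powr (\<gamma> - 1) * exp (- (?a / 4) * l))"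
     by (rule g) (auto simp only: c0 powr_ge_zero exp_ge_zero intro!: mult_nonneg_nonneg)
    have i: "pos_ind l = (1::ennreal)" using True by simp
    show ?thesis unfolding e E i mult_1_right ..
   qed simp
  qed
  also have "... = ennreal (C1 * C2 * C3 / ?k) * ennreal (Gamma 1 * (?a / 4) powr (- 1))
    + ennreal (C1 * C2 * C3 / ?k * ?k powr (\<gamma> - 1)) * ennreal (Gamma \<gamma> * (?a / 4) powr (- \<gamma>))"
  proof -
   have I1: "(\<integral>\<^sup>+l. ennreal (l powr (1 - 1) * exp (- (?a / 4) * l)) * pos_ind l \<partial>lborel) = ennreal (Gamma 1 * (?a / 4) powr (- 1))"
    by (rule nn_integral_laplace_powr) (use k in auto)
   have I2: "(\<integral>\<^sup>+l. ennreal (l powr (\<gamma> - 1) * exp (- (?a / 4) * l)) * pos_ind l \<partial>lborel) = ennreal (Gamma \<gamma> * (?a / 4) powr (- \<gamma>))"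
    by (rule nn_integral_laplace_powr) (use k \<gamma> in auto)
   show ?thesis unfolding I1[symmetric] I2[symmetric]
    by (subst nn_integral_add) (auto simp: nn_integral_cmult)
  qed
  also have "... = ennreal (C1 * C2 * C3 / ?k * (Gamma 1 * (?a / 4) powr (- 1)) + C1 * C2 * C3 / ?k * ?k powr (\<gamma> - 1) * (Gamma \<gamma> * (?a / 4) powr (- \<gamma>)))"
  proof -
   have "ennreal x * ennreal y + ennreal z * ennreal w = ennreal (x * y + z * w)" if "0 <= x" "0 <= y" "0 <= z" "0 <= w" for x y z w :: real
    using that by (simp add: ennreal_mult)
   then show ?thesis using C1(1) C2(1) C3 G by auto
  qed
  also have "... <= ennreal (C * ?k powr (-2) * (?k / ?a) powr \<gamma>)"
  proof (rule ennreal_leI)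
   let ?P = "C1 * C2 * C3" and ?q = "?k / ?a"
   have P: "0 <= ?P" using C1(1) C2(1) C3 by simp
   have q: "1 <= ?q" using k ak by simp
   have "?P / ?k * (Gamma 1 * (?a / 4) powr (- 1)) = ?P * ?k powr (-2) * (4 * ?q powr 1)"
    using k k0 by (simp add: powr_minus powr_numeral power2_eq_square field_simps)
   also have "... <= ?P * ?k powr (-2) * (4 * ?q powr \<gamma>)"
    using P q \<gamma> by (intro mult_left_mono powr_mono) auto
   finally have A: "?P / ?k * (Gamma 1 * (?a / 4) powr (- 1)) <= ?P * ?k powr (-2) * (4 * ?q powr \<gamma>)" .
   have B: "?P / ?k * ?k powr (\<gamma> - 1) * (Gamma \<gamma> * (?a / 4) powr (- \<gamma>)) = ?P * ?k powr (-2) * (Gamma \<gamma> * 4 powr \<gamma> * ?q powr \<gamma>)"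
   proof -
    have e1: "?k powr (\<gamma> - 1) / ?k = ?k powr (-2) * ?k powr \<gamma>"
    proof -
     have "?k powr (\<gamma> - 1) / ?k = ?k powr (\<gamma> - 1) * ?k powr (-1)" using k0 by (simp add: powr_minus divide_inverse)
     also have "... = ?k powr (-2) * ?k powr \<gamma>" unfolding powr_add[symmetric] by simp
     finally show ?thesis .
    qed
    have e2: "(?a / 4) powr (- \<gamma>) = 4 powr \<gamma> * ?a powr (- \<gamma>)" using k by (simp add: powr_divide powr_minus field_simps)
    have e3: "?q powr \<gamma> = ?k powr \<gamma> * ?a powr (- \<gamma>)" using k k0 by (simp add: powr_divide powr_minus field_simps)
    have "?P / ?k * ?k powr (\<gamma> - 1) * (Gamma \<gamma> * (?a / 4) powr (- \<gamma>)) = ?P * (?k powr (\<gamma> - 1) / ?k) * (Gamma \<gamma> * (?a / 4) powr (- \<gamma>))"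
     by simp
    then show ?thesis unfolding e1 e2 e3 by (simp only: mult_ac)
   qed
   show "?P / ?k * (Gamma 1 * (?a / 4) powr (- 1)) + ?P / ?k * ?k powr (\<gamma> - 1) * (Gamma \<gamma> * (?a / 4) powr (- \<gamma>)) <= C * ?k powr (-2) * (?k / ?a) powr \<gamma>"
    using A unfolding B C_def by (simp add: algebra_simps)
  qed
  finally show ?thesis unfolding W' .
 qed
 moreover have "0 <= C" unfolding C_def using C1(1) C2(1) C3 G by (intro mult_nonneg_nonneg add_nonneg_nonneg) auto
 ultimately show ?thesis by blast
qed

section \<open>Summation over all scales\<close>

definition decay :: "real => real => 'a::real_normed_vector => complex" where
 "decay \<sigma> \<omega> h = exp (- (of_real \<sigma> + \<i> * of_real \<omega>) * of_real (norm h))"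

lemma borel_measurable_decay [measurable]: "decay \<sigma> \<omega> \<in> borel_measurable borel"
 unfolding decay_def by measurable

lemma norm_decay: "cmod (decay \<sigma> \<omega> h) = exp (- \<sigma> * norm h)"
 by (simp add: decay_def)

lemma permute_transpose_twice: "permute (Transposition.transpose i j) (permute (Transposition.transpose i j) h) = h"
 by (simp add: permute_def vec_eq_iff)

lemma box_shell_permute:
 fixes h :: "real^('k::finite)"
 shows "box_shell j (permute (Transposition.transpose j i) h) = box_shell i h"
proof -
 let ?\<pi> = "Transposition.transpose j i"
 have "(\<Prod>l\<in>UNIV - {j}. plateau (h $ ?\<pi> l)) = (\<Prod>l\<in>UNIV - {i}. plateau (h $ l))"
 proof (rule prod.reindex_bij_betw[of ?\<pi> "UNIV - {j}" "UNIV - {i}" "%l. plateau (h $ l)"])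
  have "inj_on ?\<pi> (UNIV - {j})" using bij_transpose by (meson bij_is_inj inj_on_subset subset_UNIV)
  moreover have "?\<pi> ` (UNIV - {j}) = UNIV - {i}"
   using bij_transpose[of j i] by (simp add: image_set_diff[OF bij_is_inj] bij_is_surj)
  ultimately show "bij_betw ?\<pi> (UNIV - {j}) (UNIV - {i})" by (simp add: bij_betw_def)
 qed
 then show ?thesis by (simp add: box_shell_def permute_def)
qed

text \<open>Rescaling to unit size multiplies the form by \<open>l\<^bsup>n\<^esup>\<close> after the norms of \<open>f\<close> and \<open>g\<close> are rescaled back. A
 transposition of coordinates and a reflection reduce all faces of the cube to one.\<close>
lemma damped_shell_bound_all:
 fixes \<beta> D :: real
 assumes pq: "1 < p" "1 < q" "1 / p + 1 / q = 1" and D: "0 <= D"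
  and damp: "!!\<sigma> \<omega> f g. 0 <= \<sigma> ==> nice f ==> nice g ==>
   cmod (LINT h|lborel. damped_kernel \<sigma> \<omega> h * corr f g (h :: real^('m::finite option)))
   <= D * exp (- \<sigma> / 2) * (1 + \<bar>\<omega>\<bar>) powr (- \<beta>) * (lp_norm p f * lp_norm q g)"
  and s: "0 <= \<sigma>" and l: "0 < l" and f: "nice f" and g: "nice g"
 shows "cmod (LINT h|lborel. decay \<sigma> \<omega> h * of_real (box_shell i (h /\<^sub>R l)) * corr f g (h :: real^('m option)))
   <= D * (l ^ CARD('m option) * exp (- (l * \<sigma>) / 2) * (1 + l * \<bar>\<omega>\<bar>) powr (- \<beta>)) * (lp_norm p f * lp_norm q g)" (is ?A)
  and "cmod (LINT h|lborel. decay \<sigma> \<omega> h * of_real (box_shell i (- (h /\<^sub>R l))) * corr f g (h :: real^('m option)))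
   <= D * (l ^ CARD('m option) * exp (- (l * \<sigma>) / 2) * (1 + l * \<bar>\<omega>\<bar>) powr (- \<beta>)) * (lp_norm p f * lp_norm q g)" (is ?B)
proof -
 let ?n = "CARD('m option)"
 have unit: "cmod (LINT h|lborel. decay \<sigma> \<omega> h * of_real (box_shell i h) * corr f g (h :: real^('m option)))
   <= D * exp (- \<sigma> / 2) * (1 + \<bar>\<omega>\<bar>) powr (- \<beta>) * (lp_norm p f * lp_norm q g)"
  if s: "0 <= \<sigma>" and f: "nice f" and g: "nice g" for \<sigma> \<omega> f g
 proof -
  let ?\<pi> = "Transposition.transpose None i"
  note [measurable] = nice_measurable[OF nice_corr[OF f g]]
  have pf: "nice (%x. f (permute ?\<pi> x))" "nice (%x. g (permute ?\<pi> x))"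
   using f g by (auto intro: nice_permute bij_transpose)
  let ?F = "%h. damped_kernel \<sigma> \<omega> h * corr f g (permute ?\<pi> h)"
  have "(LINT h|lborel. decay \<sigma> \<omega> h * of_real (box_shell i h) * corr f g h) = (LINT h|lborel. ?F (permute ?\<pi> h))"
   by (intro lint_cong refl)
     (simp only: damped_kernel_def decay_def permute_transpose_twice box_shell_permute norm_permute[OF bij_transpose])
  also have "... = (LINT h|lborel. ?F h)"
  proof (rule integral_lborel_permute[OF _ bij_transpose])
   show "?F \<in> borel_measurable borel" unfolding damped_kernel_def by measurable
  qed
  also have "... = (LINT h|lborel. damped_kernel \<sigma> \<omega> h * corr (%x. f (permute ?\<pi> x)) (%x. g (permute ?\<pi> x)) h)"
   by (simp only: corr_permute[OF f g bij_transpose])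
  finally show ?thesis
   using damp[OF s pf, of \<omega>] by (simp only: lp_norm_permute[OF nice_measurable[OF f] bij_transpose] lp_norm_permute[OF nice_measurable[OF g] bij_transpose])
 qed
 have pos: "cmod (LINT h|lborel. decay \<sigma> \<omega> h * of_real (box_shell i (h /\<^sub>R l)) * corr f g (h :: real^('m option)))
   <= D * (l ^ ?n * exp (- (l * \<sigma>) / 2) * (1 + l * \<bar>\<omega>\<bar>) powr (- \<beta>)) * (lp_norm p f * lp_norm q g)"
  if f: "nice f" and g: "nice g" for f g
 proof -
  note [measurable] = nice_measurable[OF nice_corr[OF f g]] nice_measurable[OF f] nice_measurable[OF g]
  let ?f = "%x. f (l *\<^sub>R x)" and ?g = "%x. g (l *\<^sub>R x)"
  have l0: "l \<noteq> 0" using l by simp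
  have nf: "nice ?f" "nice ?g" by (intro nice_scale f g l0)+
  have "(LINT h|lborel. decay \<sigma> \<omega> h * of_real (box_shell i (h /\<^sub>R l)) * corr f g h)
    = (\<bar>l\<bar> ^ DIM(real^('m option))) *\<^sub>R (LINT h|lborel. decay \<sigma> \<omega> (l *\<^sub>R h) * of_real (box_shell i ((l *\<^sub>R h) /\<^sub>R l)) * corr f g (l *\<^sub>R h))"
   by (rule integral_lborel_scale[OF _ l0]) measurable
  also have "(LINT h|lborel. decay \<sigma> \<omega> (l *\<^sub>R h) * of_real (box_shell i ((l *\<^sub>R h) /\<^sub>R l)) * corr f g (l *\<^sub>R h))
    = (LINT h|lborel. of_real (l ^ ?n) * (decay (l * \<sigma>) (l * \<omega>) h * of_real (box_shell i h) * corr ?f ?g h))"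
  proof (intro lint_cong refl)
   fix h :: "real^('m option)"
   have "decay \<sigma> \<omega> (l *\<^sub>R h) = decay (l * \<sigma>) (l * \<omega>) h"
    unfolding decay_def using l by (intro arg_cong[of _ _ exp]) (simp add: algebra_simps)
   moreover have "(l *\<^sub>R h) /\<^sub>R l = h" using l by simp
   moreover have "corr f g (l *\<^sub>R h) = of_real (l ^ ?n) * corr ?f ?g h" using corr_scale[OF f g l, of h] by simp
   ultimately show "decay \<sigma> \<omega> (l *\<^sub>R h) * of_real (box_shell i ((l *\<^sub>R h) /\<^sub>R l)) * corr f g (l *\<^sub>R h)
    = of_real (l ^ ?n) * (decay (l * \<sigma>) (l * \<omega>) h * of_real (box_shell i h) * corr ?f ?g h)"
    by (simp only: mult_ac)
  qed
  finally have "cmod (LINT h|lborel. decay \<sigma> \<omega> h * of_real (box_shell i (h /\<^sub>R l)) * corr f g h)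
    = l ^ ?n * (l ^ ?n * cmod (LINT h|lborel. decay (l * \<sigma>) (l * \<omega>) h * of_real (box_shell i h) * corr ?f ?g h))"
   using l by (simp add: norm_mult norm_power del: of_real_power)
  also have "... <= l ^ ?n * (l ^ ?n * (D * exp (- (l * \<sigma>) / 2) * (1 + \<bar>l * \<omega>\<bar>) powr (- \<beta>) * (lp_norm p ?f * lp_norm q ?g)))"
   using l s by (intro mult_left_mono unit nf) auto
  also have "lp_norm p ?f * lp_norm q ?g = l powr (- real ?n) * (lp_norm p f * lp_norm q g)"
  proof -
   have "lp_norm p ?f * lp_norm q ?g = (l powr (- real ?n / p) * l powr (- real ?n / q)) * (lp_norm p f * lp_norm q g)"
    using lp_norm_scale[OF nice_measurable[OF f] l, of p] lp_norm_scale[OF nice_measurable[OF g] l, of q] pq by simp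
   also have "l powr (- real ?n / p) * l powr (- real ?n / q) = l powr (- real ?n * (1 / p + 1 / q))"
    unfolding powr_add[symmetric] by (rule arg_cong[of _ _ "%r. l powr r"]) (simp add: field_simps)
   finally show ?thesis unfolding pq(3) by simp
  qed
  also have "l ^ ?n * (l ^ ?n * (D * exp (- (l * \<sigma>) / 2) * (1 + \<bar>l * \<omega>\<bar>) powr (- \<beta>) * (l powr (- real ?n) * (lp_norm p f * lp_norm q g))))
   = (l ^ ?n * l powr (- real ?n)) * (D * (l ^ ?n * exp (- (l * \<sigma>) / 2) * (1 + \<bar>l * \<omega>\<bar>) powr (- \<beta>)) * (lp_norm p f * lp_norm q g))"
   by (simp only: mult_ac)
  also have "l ^ ?n * l powr (- real ?n) = 1"
  proof -
   have "l ^ m * l powr (- real m) = 1" for m using l by (simp add: powr_minus powr_realpow)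
   then show ?thesis .
  qed
  also have "\<bar>l * \<omega>\<bar> = l * \<bar>\<omega>\<bar>" using l by (simp add: abs_mult)
  finally show ?thesis by simp
 qed
 show ?A by (rule pos[OF f g])
 note [measurable] = nice_measurable[OF nice_corr[OF f g]]
 let ?G = "%h. decay \<sigma> \<omega> h * of_real (box_shell i (- (h /\<^sub>R l))) * corr f g h"
 have "(LINT h|lborel. ?G h) = (LINT h|lborel. ?G (- h))"
  by (rule integral_lborel_uminus[symmetric]) measurable
 also have "... = (LINT h|lborel. decay \<sigma> \<omega> h * of_real (box_shell i (h /\<^sub>R l)) * corr (%x. f (- x)) (%x. g (- x)) h)"
  by (simp only: corr_uminus[OF f g] decay_def norm_minus_cancel scaleR_minus_right minus_minus)
 finally show ?B
  using pos[OF nice_uminus[OF f] nice_uminus[OF g]]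
  by (simp only: lp_norm_uminus[OF nice_measurable[OF f]] lp_norm_uminus[OF nice_measurable[OF g]])
qed

definition shells :: "real^('k::finite) => real" where
 "shells h = (\<Sum>i\<in>UNIV. box_shell i h + box_shell i (- h))"

lemma shells_nonneg: "0 <= shells h"
 unfolding shells_def by (intro sum_nonneg add_nonneg_nonneg box_shell_nonneg)

lemma borel_measurable_shells [measurable]: "shells \<in> borel_measurable borel"
 unfolding shells_def by measurable

lemma shells_integral:
 fixes h :: "real^('k::finite)"
 assumes "h \<noteq> 0"
 shows "integrable lborel (%l. pos_ind l * (shells (h /\<^sub>R l) / l))"
  and "(LINT l|lborel. pos_ind l * (shells (h /\<^sub>R l) / l)) = 1"
proof -
 have "(\<integral>\<^sup>+l. ennreal (pos_ind l * (shells (h /\<^sub>R l) / l)) \<partial>lborel) = 1"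
  using nn_integral_box_shell_scale[OF assms]
  by (subst (asm) nn_integral_cong[of _ _ "%l. ennreal (pos_ind l * (shells (h /\<^sub>R l) / l))"])
    (auto simp: shells_def indicator_def)
 moreover have nn: "0 <= pos_ind l * (shells (h /\<^sub>R l) / l)" for l :: real
  using shells_nonneg[of "h /\<^sub>R l"] by (auto simp: indicator_def)
 moreover have m: "(%l. pos_ind l * (shells (h /\<^sub>R l) / l)) \<in> borel_measurable lborel" by measurable
 ultimately have "has_bochner_integral lborel (%l. pos_ind l * (shells (h /\<^sub>R l) / l)) 1"
  by (intro has_bochner_integral_nn_integral) auto
 then show "integrable lborel (%l. pos_ind l * (shells (h /\<^sub>R l) / l))"
  and "(LINT l|lborel. pos_ind l * (shells (h /\<^sub>R l) / l)) = 1"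
  by (auto simp: has_bochner_integral_iff)
qed

text \<open>Insert the partition of unity over scales and exchange the integrals.\<close>
lemma decay_form_bound:
 fixes \<beta> D :: real
 assumes pq: "1 < p" "1 < q" "1 / p + 1 / q = 1" and D: "0 <= D"
  and damp: "!!\<sigma> \<omega> f g. 0 <= \<sigma> ==> nice f ==> nice g ==>
   cmod (LINT h|lborel. damped_kernel \<sigma> \<omega> h * corr f g (h :: real^('m::finite option)))
   <= D * exp (- \<sigma> / 2) * (1 + \<bar>\<omega>\<bar>) powr (- \<beta>) * (lp_norm p f * lp_norm q g)"
  and s: "0 <= \<sigma>" and f: "nice f" and g: "nice g"
 shows "ennreal (cmod (LINT h|lborel. decay \<sigma> \<omega> h * corr f g (h :: real^('m option))))
  <= ennreal (2 * real CARD('m option) * D * (lp_norm p f * lp_norm q g)) *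
   (\<integral>\<^sup>+l. ennreal (l powr (real CARD('m option) - 1) * exp (- (l / 2) * \<sigma>) * (1 + l * \<bar>\<omega>\<bar>) powr (- \<beta>)) * pos_ind l \<partial>lborel)"
proof -
 let ?n = "CARD('m option)" and ?L = "lp_norm p f * lp_norm q g"
 note nc = nice_corr[OF f g]
 note [measurable] = nice_measurable[OF nc]
 let ?c = "%h. decay \<sigma> \<omega> h * corr f g h"
 let ?w = "%h l. pos_ind l * (shells (h /\<^sub>R l) / l) :: real"
 have wn: "0 <= ?w h l" for h :: "real^('m option)" and l using shells_nonneg[of "h /\<^sub>R l"] by (auto simp: indicator_def)
 have L0: "0 <= ?L" by (simp add: lp_norm_nonneg)
 have dle: "cmod (decay \<sigma> \<omega> h) <= 1" for h :: "real^('m option)" unfolding norm_decay using s by simp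
 have nd: "nice ?c" by (rule nice_mult(2)[OF nc borel_measurable_decay dle])
 have nz: "AE h in lborel. h \<noteq> (0::real^('m option))" by (rule AE_lborel_singleton)
 have pi: "integrable lborel2 (%(h, l). ?c h * of_real (?w h l))"
 proof (rule lborel_pair.Fubini_integrable)
  show "(%(h, l). ?c h * of_real (?w h l)) \<in> borel_measurable lborel2" by measurable
  have "integrable lborel (%h. cmod (?c h))" by (intro nice_integrable nice_norm nd)
  then show "integrable lborel (%h. LINT l|lborel. norm (case (h, l) of (h, l) => ?c h * of_real (?w h l)))"
  proof (rule integrable_cong_AE_imp)
   show "AE h in lborel. cmod (?c h) = (LINT l|lborel. norm (case (h, l) of (h, l) => ?c h * of_real (?w h l)))"
    using nz
   proof eventually_elim
    case (elim h)
    have "(LINT l|lborel. norm (?c h * of_real (?w h l))) = (LINT l|lborel. cmod (?c h) * ?w h l)"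
     by (simp only: norm_mult norm_of_real abs_of_nonneg[OF wn])
    also have "... = cmod (?c h)" unfolding integral_mult_right_zero shells_integral(2)[OF elim] by simp
    finally show ?case by simp
   qed
  qed measurable
  show "AE h in lborel. integrable lborel (%l. case (h, l) of (h, l) => ?c h * of_real (?w h l))"
   using nz
  proof eventually_elim
   case (elim h)
   show ?case unfolding prod.case by (intro integrable_mult_right integrable_of_real shells_integral(1)[OF elim])
  qed
 qed
 have "(LINT h|lborel. ?c h) = (LINT h|lborel. LINT l|lborel. ?c h * of_real (?w h l))"
 proof (rule integral_cong_AE)
  show "AE h in lborel. ?c h = (LINT l|lborel. ?c h * of_real (?w h l))"
   using nz
  proof eventually_elim
   case (elim h)
   show ?case unfolding integral_mult_right_zero integral_complex_of_real shells_integral(2)[OF elim] by simp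
  qed
 qed measurable
 also have "... = (LINT l|lborel. LINT h|lborel. ?c h * of_real (?w h l))"
  by (rule lborel_pair.Fubini_integral[OF pi, symmetric])
 finally have E: "(LINT h|lborel. ?c h) = (LINT l|lborel. LINT h|lborel. ?c h * of_real (?w h l))" .
 let ?S = "%l. l powr (real ?n - 1) * exp (- (l / 2) * \<sigma>) * (1 + l * \<bar>\<omega>\<bar>) powr (- \<beta>)"
 have inner: "cmod (LINT h|lborel. ?c h * of_real (?w h l)) <= (2 * real ?n * D * ?L) * ?S l" if l: "0 < l" for l
 proof -
  let ?T = "%i h. decay \<sigma> \<omega> h * of_real (box_shell i (h /\<^sub>R l)) * corr f g h"
  let ?U = "%i h. decay \<sigma> \<omega> h * of_real (box_shell i (- (h /\<^sub>R l))) * corr f g h"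
  let ?X = "l ^ ?n * exp (- (l * \<sigma>) / 2) * (1 + l * \<bar>\<omega>\<bar>) powr (- \<beta>)"
  have iT: "integrable lborel (?T i)" "integrable lborel (?U i)" for i
  proof -
   obtain M where M: "!!h. norm (box_shell i (h::real^('m option))) <= M" using nice_box_shell[of i] unfolding nice_def by blast
   have b: "cmod (decay \<sigma> \<omega> h * of_real (box_shell i h')) <= 1 * M" for h h' :: "real^('m option)"
    unfolding norm_mult norm_of_real using M[of h'] dle[of h] by (intro mult_mono) auto
   show "integrable lborel (?T i)" by (intro nice_integrable nice_mult(2)[OF nc _ b]) measurable
   show "integrable lborel (?U i)" by (intro nice_integrable nice_mult(2)[OF nc _ b]) measurable
  qed
  have "(LINT h|lborel. ?c h * of_real (?w h l)) = (LINT h|lborel. of_real (1 / l) * (\<Sum>i\<in>UNIV. ?T i h + ?U i h))"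
   using l by (intro lint_cong refl)
    (simp add: shells_def sum_distrib_left sum_distrib_right sum_divide_distrib distrib_left distrib_right add_divide_distrib mult_ac)
  also have "... = of_real (1 / l) * (\<Sum>i\<in>UNIV. (LINT h|lborel. ?T i h) + (LINT h|lborel. ?U i h))"
   unfolding integral_mult_right_zero using iT by (subst Bochner_Integration.integral_sum) (auto intro!: sum.cong)
  finally have "cmod (LINT h|lborel. ?c h * of_real (?w h l)) = (1 / l) * cmod (\<Sum>i\<in>UNIV. (LINT h|lborel. ?T i h) + (LINT h|lborel. ?U i h))"
   using l by (simp only: norm_mult norm_of_real) simp
  also have "... <= (1 / l) * (\<Sum>i\<in>(UNIV::'m option set). D * ?X * ?L + D * ?X * ?L)"
   using l by (intro mult_left_mono order_trans[OF norm_sum sum_mono] order_trans[OF norm_triangle_ineq add_mono]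
     damped_shell_bound_all[OF pq D damp s l f g]) auto
  also have "... = (2 * real ?n * D * ?L) * (?X / l)" by simp
  also have "?X / l = ?S l"
  proof -
   have "l ^ m / l = l powr (real m - 1)" for m using l by (simp add: powr_diff powr_realpow)
   then have e1: "l ^ ?n / l = l powr (real ?n - 1)" .
   have e2: "exp (- (l * \<sigma>) / 2) = exp (- (l / 2) * \<sigma>)" by simp
   have "x * y * w / l = (x / l) * y * w" for x y w :: real by simp
   then have "?X / l = (l ^ ?n / l) * exp (- (l * \<sigma>) / 2) * (1 + l * \<bar>\<omega>\<bar>) powr (-\<beta>)" .
   then show ?thesis unfolding e1 e2 .
  qed
  finally show ?thesis .
 qed
 have iG: "integrable lborel (%l. LINT h|lborel. ?c h * of_real (?w h l))"
  using lborel_pair.integrable_snd[OF pi] by simp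
 have "ennreal (cmod (LINT h|lborel. ?c h)) <= (\<integral>\<^sup>+l. ennreal (cmod (LINT h|lborel. ?c h * of_real (?w h l))) \<partial>lborel)"
  unfolding E by (rule integral_norm_bound_ennreal[OF iG])
 also have "... <= (\<integral>\<^sup>+l. ennreal (2 * real ?n * D * ?L) * (ennreal (?S l) * pos_ind l) \<partial>lborel)"
 proof (rule nn_integral_mono)
  fix l :: real
  show "ennreal (cmod (LINT h|lborel. ?c h * of_real (?w h l))) <= ennreal (2 * real ?n * D * ?L) * (ennreal (?S l) * pos_ind l)"
  proof (cases "0 < l")
   case True
   have "ennreal (cmod (LINT h|lborel. ?c h * of_real (?w h l))) <= ennreal ((2 * real ?n * D * ?L) * ?S l)"
    by (rule ennreal_leI[OF inner[OF True]])
   also have "... = ennreal (2 * real ?n * D * ?L) * ennreal (?S l)"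
    by (rule ennreal_mult) (use D L0 in auto)
   finally show ?thesis using True by simp
  qed simp
 qed
 also have "... = ennreal (2 * real ?n * D * ?L) * (\<integral>\<^sup>+l. ennreal (?S l) * pos_ind l \<partial>lborel)"
  by (rule nn_integral_cmult) measurable
 finally show ?thesis .
qed

section \<open>The Bessel kernel\<close>

definition kernel_order :: "nat => real" where
 "kernel_order n = (real n - 3) / 2"

text \<open>Normalises the Yukawa kernels that arise by truncation to have integral one, see \<open>yukawa_concentrates\<close>.\<close>
definition kernel_const :: "'k::finite itself => real" where
 "kernel_const _ = 1 / (LINT x|lborel. exp (- norm (x::real^'k)) / norm x)"

definition spec_density :: "nat => complex => real => complex" where
 "spec_density n \<kappa> s = spec_wt (kernel_order n) \<kappa> s * pos_ind s"

definition helmholtz_kernel :: "complex => real^('k::finite) => complex" where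
 "helmholtz_kernel \<kappa> h = of_real (kernel_const TYPE('k)) *
   (LINT s|lborel. spec_density CARD('k) \<kappa> s * decay (Re \<kappa> + s) (Im \<kappa>) h)"

lemma borel_measurable_spec_density: "0 < Re \<kappa> ==> spec_density n \<kappa> \<in> borel_measurable borel"
 unfolding spec_density_def[abs_def] by (rule borel_measurable_spec_wt)

lemma norm_spec_density: "cmod (spec_density n \<kappa> s) = cmod (spec_wt (kernel_order n) \<kappa> s) * pos_ind s"
 by (simp add: spec_density_def norm_mult indicator_def)

lemma spec_density_neg: "s <= 0 ==> spec_density n \<kappa> s = 0"
 by (simp add: spec_density_def)

lemma decay_eq: "decay (Re \<kappa> + s) (Im \<kappa>) h = exp (- (\<kappa> + of_real s) * of_real (norm h))"
proof -
 have "of_real (Re \<kappa> + s) + \<i> * of_real (Im \<kappa>) = \<kappa> + of_real s"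
  by (simp add: complex_eq_iff)
 then show ?thesis by (simp only: decay_def)
qed

lemma borel_measurable_decay2 [measurable]:
 "(%(s, h). decay (Re \<kappa> + s) (Im \<kappa>) h) \<in> borel_measurable (borel \<Otimes>\<^sub>M borel)"
 unfolding decay_def by measurable

lemma integral_exp_norm_scale:
 assumes "2 <= CARD('k::finite)" "0 < t"
 shows "(LINT x|lborel. exp (- t * norm (x::real^'k))) = t powr (- real CARD('k)) * (LINT x|lborel. exp (- norm (x::real^'k)))"
proof -
 have "(LINT x|lborel. exp (- norm (x::real^'k))) = (\<bar>t\<bar> ^ DIM(real^'k)) *\<^sub>R (LINT x|lborel. exp (- norm (t *\<^sub>R (x::real^'k))))"
  by (rule integral_lborel_scale) (use assms in auto)
 then have "(LINT x|lborel. exp (- norm (x::real^'k))) = t ^ CARD('k) * (LINT x|lborel. exp (- t * norm (x::real^'k)))"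
  using assms by simp
 moreover have "t powr (- real m) * (t ^ m * y) = y" for m y using assms by (simp add: powr_minus powr_realpow)
 ultimately show ?thesis by simp
qed

lemma scale_wt_zero:
 assumes n: "1 <= n" and t: "0 < Re \<kappa> + s"
 shows "(scale_int n 0 \<kappa> s) = ennreal (Gamma (real n) * 2 powr (real n) * (Re \<kappa> + s) powr (- real n))"
proof -
 let ?t = "Re \<kappa> + s"
 have "(scale_int n 0 \<kappa> s)
   = (\<integral>\<^sup>+l. ennreal (l powr (real n - 1) * exp (- (?t / 2) * l)) * pos_ind l \<partial>lborel)"
 proof (rule nn_integral_cong)
  fix l :: real
  have "1 + l * \<bar>Im \<kappa>\<bar> > 0" if "0 < l" using that by (intro add_pos_nonneg) auto
  then show "ennreal (scale_wt n 0 \<kappa> s l) * pos_ind l = ennreal (l powr (real n - 1) * exp (- (?t / 2) * l)) * pos_ind l"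
   by (cases "0 < l") (auto simp: scale_wt_def field_simps)
 qed
 also have "... = ennreal (Gamma (real n) * (?t / 2) powr (- real n))"
  by (rule nn_integral_laplace_powr) (use n t in auto)
 also have "(?t / 2) powr (- real n) = 2 powr (real n) * ?t powr (- real n)" using t by (simp add: powr_divide powr_minus field_simps)
 finally show ?thesis by (simp add: mult.assoc)
qed

text \<open>The double integral at \<open>\<beta> = 0\<close>: the integral of \<open>exp (- t |h|)\<close> over space is a multiple of \<open>t\<^bsup>- n\<^esup>\<close>, which is
 itself an integral over scales.\<close>
lemma integrable_density_exp:
 assumes n: "2 <= CARD('k::finite)" and k: "0 < Re \<kappa>"
 shows "integrable lborel2 (%(s, h::real^'k). spec_density CARD('k) \<kappa> s * decay (Re \<kappa> + s) (Im \<kappa>) h)"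
proof -
 let ?n = "CARD('k)"
 note [measurable] = borel_measurable_spec_density[OF k]
 define V where "V = (LINT x|lborel. exp (- norm (x::real^'k)))"
 have V: "0 <= V" unfolding V_def by (intro lint_nonneg) simp
 have t: "0 < Re \<kappa> + s" if "0 < s" for s using k that by simp
 obtain C where C: "(\<integral>\<^sup>+s. ennreal (cmod (spec_wt (kernel_order ?n) \<kappa> s)) * pos_ind s * (scale_int ?n 0 \<kappa> s) \<partial>lborel)
   <= ennreal C"
 proof -
  have g: "1 < 2 + kernel_order ?n - 0" using n by (simp add: kernel_order_def field_simps)
  show ?thesis
   using double_integral_bound[OF n kernel_order_def order_refl refl g] k that by blast
 qed
 let ?G = "Gamma (real ?n) * 2 powr (real ?n)"
 have G: "0 < ?G" using n by (intro mult_pos_pos Gamma_real_pos) auto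
 have fin: "(\<integral>\<^sup>+s. ennreal (cmod (spec_density ?n \<kappa> s) * ((Re \<kappa> + s) powr (- real ?n) * V)) \<partial>lborel) < \<infinity>"
 proof -
  have "(\<integral>\<^sup>+s. ennreal (cmod (spec_density ?n \<kappa> s) * ((Re \<kappa> + s) powr (- real ?n) * V)) \<partial>lborel)
    = (\<integral>\<^sup>+s. ennreal (V / ?G) * (ennreal (cmod (spec_wt (kernel_order ?n) \<kappa> s)) * pos_ind s * (scale_int ?n 0 \<kappa> s)) \<partial>lborel)"
  proof (rule nn_integral_cong)
   fix s :: real
   show "ennreal (cmod (spec_density ?n \<kappa> s) * ((Re \<kappa> + s) powr (- real ?n) * V))
    = ennreal (V / ?G) * (ennreal (cmod (spec_wt (kernel_order ?n) \<kappa> s)) * pos_ind s * (scale_int ?n 0 \<kappa> s))"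
   proof (cases "0 < s")
    case True
    have i: "pos_ind s = (1::ennreal)" "pos_ind s = (1::real)" using True by simp_all
    have "ennreal (V / ?G) * (ennreal w * ennreal (?G * y)) = ennreal (w * (y * V))" if "0 <= w" "0 <= y" for w y
    proof -
     have "V / ?G * (w * (?G * y)) = w * (y * V)"
     proof -
      have "V / g * (w * (g * y)) = w * (y * V)" if "0 < g" for g :: real using that by simp
      then show ?thesis using G .
     qed
     then show ?thesis using that V G by (simp add: ennreal_mult[symmetric] del: ennreal_mult'' times_divide_eq_left)
    qed
    then show ?thesis
     using n unfolding norm_spec_density i mult_1_right by (subst scale_wt_zero[OF _ t[OF True]]) auto
   qed (simp add: norm_spec_density)
  qed
  also have "... <= (\<integral>\<^sup>+s. ennreal (V / ?G) * (ennreal (cmod (spec_wt (kernel_order ?n) \<kappa> s)) * pos_ind s * (scale_int ?n 0 \<kappa> s)) \<partial>lborel)" ..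
  also have "... = ennreal (V / ?G) * (\<integral>\<^sup>+s. (ennreal (cmod (spec_wt (kernel_order ?n) \<kappa> s)) * pos_ind s * (scale_int ?n 0 \<kappa> s)) \<partial>lborel)"
  proof (rule nn_integral_cmult)
   have e: "ennreal (cmod (spec_wt (kernel_order ?n) \<kappa> s)) * pos_ind s = ennreal (cmod (spec_density ?n \<kappa> s))" for s
    by (simp add: norm_spec_density indicator_def)
   show "(%s. ennreal (cmod (spec_wt (kernel_order ?n) \<kappa> s)) * pos_ind s * (scale_int ?n 0 \<kappa> s)) \<in> borel_measurable lborel"
    unfolding e by measurable
  qed
  also have "... <= ennreal (V / ?G) * ennreal C" by (intro mult_left_mono C) simp
  also have "... < \<infinity>" by (simp add: ennreal_mult_less_top)
  finally show ?thesis .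
 qed
 have ie: "integrable lborel (%h::real^'k. exp (- t * norm h))" if "0 < t" for t
  by (rule integrable_exp_norm) (use n that in auto)
 show ?thesis
 proof (rule lborel_pair.Fubini_integrable)
  show "(%(s, h::real^'k). spec_density ?n \<kappa> s * decay (Re \<kappa> + s) (Im \<kappa>) h) \<in> borel_measurable lborel2" by measurable
  have e: "(LINT h|lborel. norm (spec_density ?n \<kappa> s * decay (Re \<kappa> + s) (Im \<kappa>) (h::real^'k))) = cmod (spec_density ?n \<kappa> s) * ((Re \<kappa> + s) powr (- real ?n) * V)" for s
  proof (cases "0 < s")
   case True
   show ?thesis unfolding norm_mult norm_decay integral_mult_right_zero integral_exp_norm_scale[OF n t[OF True]] V_def ..
  qed (simp add: spec_density_neg)
  show "integrable lborel (%s. LINT h|lborel. norm (case (s, h) of (s, h::real^'k) => spec_density ?n \<kappa> s * decay (Re \<kappa> + s) (Im \<kappa>) h))"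
   unfolding prod.case e
  proof (rule integrableI_nonneg)
   show "(\<integral>\<^sup>+s. ennreal (cmod (spec_density ?n \<kappa> s) * ((Re \<kappa> + s) powr (- real ?n) * V)) \<partial>lborel) < \<infinity>" by (rule fin)
  qed (use V in auto)
  show "AE s in lborel. integrable lborel (%h. case (s, h) of (s, h::real^'k) => spec_density ?n \<kappa> s * decay (Re \<kappa> + s) (Im \<kappa>) h)"
   unfolding prod.case
  proof (intro AE_I2)
   fix s :: real
   show "integrable lborel (%h::real^'k. spec_density ?n \<kappa> s * decay (Re \<kappa> + s) (Im \<kappa>) h)"
   proof (cases "0 < s")
    case True
    have "integrable lborel (%h::real^'k. decay (Re \<kappa> + s) (Im \<kappa>) h)"
     by (rule integrable_dominated[OF ie[OF t[OF True]]]) (auto simp: norm_decay)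
    then show ?thesis by (rule integrable_mult_right)
   qed (simp add: spec_density_neg)
  qed
 qed
qed

lemma integrable_helmholtz_kernel:
 assumes "2 <= CARD('k::finite)" "0 < Re \<kappa>"
 shows "integrable lborel (helmholtz_kernel \<kappa> :: real^'k => complex)"
 unfolding helmholtz_kernel_def[abs_def]
 using lborel_pair.integrable_snd[OF integrable_density_exp[OF assms]] by (intro integrable_mult_right) simp

lemma helmholtz_kernel_pairing:
 assumes n: "2 <= CARD('k::finite)" and k: "0 < Re \<kappa>"
  and [measurable]: "c \<in> borel_measurable borel" and M: "!!h. cmod (c h) <= M"
 shows "(LINT h|lborel. helmholtz_kernel \<kappa> h * c (h::real^'k))
   = of_real (kernel_const TYPE('k)) * (LINT s|lborel. spec_density CARD('k) \<kappa> s * (LINT h|lborel. decay (Re \<kappa> + s) (Im \<kappa>) h * c h))"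
  and "integrable lborel (%s. spec_density CARD('k) \<kappa> s * (LINT h|lborel. decay (Re \<kappa> + s) (Im \<kappa>) h * c (h::real^'k)))"
proof -
 let ?F = "%s h. spec_density CARD('k) \<kappa> s * decay (Re \<kappa> + s) (Im \<kappa>) (h::real^'k)"
 note [measurable] = borel_measurable_spec_density[OF k]
 have i: "integrable lborel2 (%(s, h). ?F s h * c h)"
 proof (rule integrable_dominated)
  show "integrable lborel2 (%z. (case z of (s, h) => ?F s h) * of_real M)"
   by (rule integrable_mult_left) (rule integrable_density_exp[OF n k])
  show "AE z in lborel \<Otimes>\<^sub>M lborel. cmod (case z of (s, h) => ?F s h * c h) <= cmod ((case z of (s, h) => ?F s h) * of_real M)"
  proof (intro AE_I2)
   fix z :: "real \<times> (real^'k)"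
   have "cmod (c (snd z)) <= \<bar>M\<bar>" using M[of "snd z"] by linarith
   then have "cmod (?F (fst z) (snd z)) * cmod (c (snd z)) <= cmod (?F (fst z) (snd z)) * \<bar>M\<bar>" by (rule mult_left_mono) simp
   then show "cmod (case z of (s, h) => ?F s h * c h) <= cmod ((case z of (s, h) => ?F s h) * of_real M)"
    by (simp only: case_prod_beta norm_mult norm_of_real)
  qed
 qed measurable
 have "(LINT h|lborel. helmholtz_kernel \<kappa> h * c h) = (LINT h|lborel. of_real (kernel_const TYPE('k)) * (LINT s|lborel. ?F s h * c h))"
  unfolding helmholtz_kernel_def integral_mult_left_zero by (simp only: mult.assoc)
 also have "... = of_real (kernel_const TYPE('k)) * (LINT h|lborel. LINT s|lborel. ?F s h * c h)"
  by (rule integral_mult_right_zero)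
 also have "(LINT h|lborel. LINT s|lborel. ?F s h * c h) = (LINT s|lborel. LINT h|lborel. ?F s h * c h)"
  by (rule lborel_pair.Fubini_integral[OF i])
 finally show "(LINT h|lborel. helmholtz_kernel \<kappa> h * c h)
   = of_real (kernel_const TYPE('k)) * (LINT s|lborel. spec_density CARD('k) \<kappa> s * (LINT h|lborel. decay (Re \<kappa> + s) (Im \<kappa>) h * c h))"
  by (simp only: mult.assoc integral_mult_right_zero)
 have "integrable lborel (%s. LINT h|lborel. ?F s h * c h)" using lborel_pair.integrable_fst[OF i] by simp
 then show "integrable lborel (%s. spec_density CARD('k) \<kappa> s * (LINT h|lborel. decay (Re \<kappa> + s) (Im \<kappa>) h * c (h::real^'k)))"
  by (simp only: mult.assoc integral_mult_right_zero)
qed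

lemma kernel_const_pos:
 assumes "2 <= CARD('k::finite)" shows "0 < kernel_const TYPE('k)"
proof -
 let ?f = "%x::real^'k. exp (- norm x) / norm x"
 have i: "integrable lborel ?f" using integrable_yukawa[where 'a="real^'k", of 1] assms by simp
 have "(LINT x|lborel. ?f x) \<noteq> 0"
 proof
  assume "(LINT x|lborel. ?f x) = 0"
  moreover have "AE x in lborel. 0 <= ?f x" by simp
  ultimately have "AE x in lborel. ?f x = 0" using integral_nonneg_eq_0_iff_AE[OF i] by blast
  moreover have "AE x in lborel. x \<noteq> (0::real^'k)" by (rule AE_lborel_singleton)
  ultimately have "AE x in (lborel :: (real^'k) measure). False" by eventually_elim simp
  then have "{x \<in> space lborel. \<not> False} \<in> null_sets (lborel :: (real^'k) measure)"
   by (subst (asm) AE_iff_null) auto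
  then show False by (simp add: null_sets_def)
 qed
 moreover have "0 <= (LINT x|lborel. ?f x)" by (intro lint_nonneg) simp
 ultimately show ?thesis by (simp add: kernel_const_def less_le)
qed

lemma helmholtz_form_bound:
 fixes \<beta> D :: real
 assumes pq: "1 < p" "1 < q" "1 / p + 1 / q = 1" and D: "0 <= D" and \<beta>: "0 <= \<beta>"
  and n: "2 <= CARD('m::finite option)"
  and \<gamma>: "\<gamma> = 2 + kernel_order CARD('m option) - \<beta>" "1 < \<gamma>"
  and damp: "!!\<sigma> \<omega> f g. 0 <= \<sigma> ==> nice f ==> nice g ==>
   cmod (LINT h|lborel. damped_kernel \<sigma> \<omega> h * corr f g (h :: real^('m option)))
   <= D * exp (- \<sigma> / 2) * (1 + \<bar>\<omega>\<bar>) powr (- \<beta>) * (lp_norm p f * lp_norm q g)"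
 shows "\<exists>C\<ge>0. \<forall>\<kappa> f g. 0 < Re \<kappa> --> nice f --> nice g -->
  cmod (LINT h|lborel. helmholtz_kernel \<kappa> h * corr f g (h :: real^('m option)))
   <= C * ((cmod \<kappa>) powr (-2) * (cmod \<kappa> / Re \<kappa>) powr \<gamma>) * (lp_norm p f * lp_norm q g)"
proof -
 let ?n = "CARD('m option)"
 let ?c = "kernel_const TYPE('m option)"
 have c: "0 < ?c" by (rule kernel_const_pos[OF n])
 obtain C1 where C1: "0 <= C1" "!!\<kappa>. 0 < Re \<kappa> ==>
  (\<integral>\<^sup>+s. ennreal (cmod (spec_wt (kernel_order ?n) \<kappa> s)) * pos_ind s * (scale_int ?n \<beta> \<kappa> s) \<partial>lborel)
   <= ennreal (C1 * (cmod \<kappa>) powr (-2) * (cmod \<kappa> / Re \<kappa>) powr \<gamma>)"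
  using double_integral_bound[OF n kernel_order_def \<beta> \<gamma>] by blast
 have "cmod (LINT h|lborel. helmholtz_kernel \<kappa> h * corr f g (h :: real^('m option)))
   <= (?c * (2 * real ?n * D) * C1) * ((cmod \<kappa>) powr (-2) * (cmod \<kappa> / Re \<kappa>) powr \<gamma>) * (lp_norm p f * lp_norm q g)"
  if k: "0 < Re \<kappa>" and f: "nice f" and g: "nice g" for \<kappa> f g
 proof -
  let ?L = "lp_norm p f * lp_norm q g" and ?B = "(cmod \<kappa>) powr (-2) * (cmod \<kappa> / Re \<kappa>) powr \<gamma>"
  have L0: "0 <= ?L" by (simp add: lp_norm_nonneg)
  note nc = nice_corr[OF f g]
  note [measurable] = nice_measurable[OF nc] borel_measurable_spec_density[OF k]
  obtain M where M: "!!h. cmod (corr f g h) <= M" using nc by (auto simp: nice_def)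
  let ?A = "%s. LINT h|lborel. decay (Re \<kappa> + s) (Im \<kappa>) h * corr f g (h :: real^('m option))"
  let ?J = "%s. (scale_int ?n \<beta> \<kappa> s)"
  note P = helmholtz_kernel_pairing[OF n k nice_measurable[OF nc] M]
  have A: "ennreal (cmod (spec_density ?n \<kappa> s * ?A s)) <= ennreal (2 * real ?n * D * ?L) * (ennreal (cmod (spec_wt (kernel_order ?n) \<kappa> s)) * pos_ind s * ?J s)" for s
  proof (cases "0 < s")
   case True
   have "ennreal (cmod (?A s)) <= ennreal (2 * real ?n * D * ?L) * ?J s"
    using decay_form_bound[OF pq D damp _ f g, of "Re \<kappa> + s" "Im \<kappa>"] True k unfolding scale_wt_def by simp
   then have "ennreal (cmod (spec_wt (kernel_order ?n) \<kappa> s)) * ennreal (cmod (?A s)) <= ennreal (cmod (spec_wt (kernel_order ?n) \<kappa> s)) * (ennreal (2 * real ?n * D * ?L) * ?J s)"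
    by (rule mult_left_mono) simp
   moreover have "ennreal (cmod (spec_density ?n \<kappa> s * ?A s)) = ennreal (cmod (spec_wt (kernel_order ?n) \<kappa> s)) * ennreal (cmod (?A s))"
    unfolding norm_mult norm_spec_density using True by (simp add: ennreal_mult)
   ultimately show ?thesis using True by (simp add: mult_ac)
  qed (simp add: spec_density_neg)
  have "ennreal (cmod (LINT s|lborel. spec_density ?n \<kappa> s * ?A s)) <= (\<integral>\<^sup>+s. ennreal (cmod (spec_density ?n \<kappa> s * ?A s)) \<partial>lborel)"
   by (rule integral_norm_bound_ennreal[OF P(2)])
  also have "... <= (\<integral>\<^sup>+s. ennreal (2 * real ?n * D * ?L) * (ennreal (cmod (spec_wt (kernel_order ?n) \<kappa> s)) * pos_ind s * ?J s) \<partial>lborel)"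
   by (rule nn_integral_mono) (rule A)
  also have "... = ennreal (2 * real ?n * D * ?L) * (\<integral>\<^sup>+s. ennreal (cmod (spec_wt (kernel_order ?n) \<kappa> s)) * pos_ind s * ?J s \<partial>lborel)"
  proof (rule nn_integral_cmult)
   have e: "ennreal (cmod (spec_wt (kernel_order ?n) \<kappa> s)) * pos_ind s = ennreal (cmod (spec_density ?n \<kappa> s))" for s
    by (simp add: norm_spec_density indicator_def)
   show "(%s. ennreal (cmod (spec_wt (kernel_order ?n) \<kappa> s)) * pos_ind s * ?J s) \<in> borel_measurable lborel"
    unfolding e by measurable
  qed
  also have "... <= ennreal (2 * real ?n * D * ?L) * ennreal (C1 * (cmod \<kappa>) powr (-2) * (cmod \<kappa> / Re \<kappa>) powr \<gamma>)"
   by (intro mult_left_mono C1(2) k) simp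
  also have "... = ennreal ((2 * real ?n * D * ?L) * (C1 * (cmod \<kappa>) powr (-2) * (cmod \<kappa> / Re \<kappa>) powr \<gamma>))"
   by (rule ennreal_mult[symmetric]) (use D L0 C1(1) in auto)
  finally have "cmod (LINT s|lborel. spec_density ?n \<kappa> s * ?A s) <= (2 * real ?n * D * ?L) * (C1 * (cmod \<kappa>) powr (-2) * (cmod \<kappa> / Re \<kappa>) powr \<gamma>)"
   by (rule ennreal_le_iff[THEN iffD1, rotated]) (use D L0 C1(1) in \<open>auto intro!: mult_nonneg_nonneg\<close>)
  then have "?c * cmod (LINT s|lborel. spec_density ?n \<kappa> s * ?A s) <= ?c * ((2 * real ?n * D * ?L) * (C1 * (cmod \<kappa>) powr (-2) * (cmod \<kappa> / Re \<kappa>) powr \<gamma>))"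
   using c by (intro mult_left_mono) auto
  then show ?thesis unfolding P(1) norm_mult norm_of_real abs_of_pos[OF c] by (simp only: mult_ac)
 qed
 moreover have "0 <= ?c * (2 * real ?n * D) * C1" using c D C1(1) by simp
 ultimately show ?thesis by blast
qed

section \<open>The fundamental solution\<close>

lemma integrable_pair_mult:
 fixes f :: "'b::euclidean_space => complex" and g :: "'a::euclidean_space => complex"
 assumes f: "integrable lborel f" and g: "integrable lborel g"
 shows "integrable lborel2 (%(s, x). f s * g x)"
proof -
 have [measurable]: "f \<in> borel_measurable borel" "g \<in> borel_measurable borel"
  using borel_measurable_integrable[OF f] borel_measurable_integrable[OF g] by simp_all
 show ?thesis
 proof (rule lborel_pair.Fubini_integrable)
  show "integrable lborel (%s. LINT x|lborel. norm (case (s, x) of (s, x) => f s * g x))"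
   unfolding prod.case norm_mult integral_mult_right_zero
   by (intro integrable_mult_left integrable_norm f)
  show "AE s in lborel. integrable lborel (%x. case (s, x) of (s, x) => f s * g x)"
   unfolding prod.case by (intro AE_I2 integrable_mult_right g)
 qed measurable
qed

lemma integrable_spec_density_exp:
 assumes n: "2 <= n" and k: "0 < Re \<kappa>"
 shows "integrable lborel (%s. spec_density n \<kappa> s * of_real (exp (- (1 / 2) * s)))"
proof -
 note [measurable] = borel_measurable_spec_density[OF k]
 obtain C where C: "(\<integral>\<^sup>+s. ennreal (cmod (spec_wt (kernel_order n) \<kappa> s) * exp (- (1 / 2) * s)) * pos_ind s \<partial>lborel) <= ennreal C"
  using inner_spec_bound[OF n kernel_order_def] k zero_less_one by blast
 have "(\<integral>\<^sup>+s. ennreal (cmod (spec_density n \<kappa> s * of_real (exp (- (1 / 2) * s)))) \<partial>lborel)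
   = (\<integral>\<^sup>+s. ennreal (cmod (spec_wt (kernel_order n) \<kappa> s) * exp (- (1 / 2) * s)) * pos_ind s \<partial>lborel)"
  by (intro nn_integral_cong) (auto simp: norm_mult norm_spec_density indicator_def)
 also have "... < \<infinity>" using C by (rule le_less_trans) simp
 finally show ?thesis by (intro integrableI_bounded) auto
qed

text \<open>A primitive of the density times \<open>(n - 1) (\<kappa> + s)\<close> that vanishes at \<open>s = 0\<close>.\<close>
definition spec_primitive :: "nat => complex => real => complex" where
 "spec_primitive n \<kappa> s = of_real s powr of_real ((real n - 1) / 2) * (2 * \<kappa> + of_real s) powr of_real ((real n - 1) / 2)"

text \<open>The density times \<open>\<kappa>\<^sup>2\<close> minus the Laplacian, applied to \<open>exp (- (\<kappa> + s) r)\<close>, as a function of \<open>s\<close>.\<close>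
definition spec_integrand :: "nat => complex => real => real => complex" where
 "spec_integrand n \<kappa> r s = spec_density n \<kappa> s *
   ((of_real (real n - 1) * (\<kappa> + of_real s) / of_real r - of_real s * (2 * \<kappa> + of_real s)) * exp (- (\<kappa> + of_real s) * of_real r))"

lemma plus_nonpos_Reals: "0 < Re \<kappa> ==> 0 <= s ==> 2 * \<kappa> + complex_of_real s \<notin> \<real>\<^sub>\<le>\<^sub>0"
 by (auto simp: complex_nonpos_Reals_iff)

text \<open>This is what determines the density: with it, the equation applied to the exponentials gives an exact derivative in \<open>s\<close>.\<close>
lemma spec_primitive_derivative:
 assumes n: "2 <= n" and k: "0 < Re \<kappa>" and r: "0 < r" and s: "0 < s"
 shows "((%s. spec_primitive n \<kappa> s * exp (- (\<kappa> + of_real s) * of_real r) / of_real r) has_vector_derivative spec_integrand n \<kappa> r s) (at s within T)"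
proof -
 let ?a = "complex_of_real ((real n - 1) / 2)" and ?w = "complex_of_real s"
 let ?b = "complex_of_real (kernel_order n)"
 have b: "?a - 1 = ?b" by (simp add: kernel_order_def field_simps)
 have w: "?w \<notin> \<real>\<^sub>\<le>\<^sub>0" "2 * \<kappa> + ?w \<notin> \<real>\<^sub>\<le>\<^sub>0" using s plus_nonpos_Reals[OF k, of s] by auto
 then have w0: "?w \<noteq> 0" "2 * \<kappa> + ?w \<noteq> 0" by auto
 have p: "?w powr ?a = ?w * ?w powr ?b" "(2 * \<kappa> + ?w) powr ?a = (2 * \<kappa> + ?w) * (2 * \<kappa> + ?w) powr ?b"
  using w0 unfolding b[symmetric] by (simp_all add: powr_diff)
 have sd: "spec_density n \<kappa> s = ?w powr ?b * (2 * \<kappa> + ?w) powr ?b"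
  using s by (simp add: spec_density_def spec_wt_def powr_of_real)
 have "((%w. w powr ?a * (2 * \<kappa> + w) powr ?a * exp (- (\<kappa> + w) * of_real r) / of_real r) has_field_derivative
  ((?a * ?w powr (?a - 1) * (2 * \<kappa> + ?w) powr ?a + ?w powr ?a * (?a * (2 * \<kappa> + ?w) powr (?a - 1))) * exp (- (\<kappa> + ?w) * of_real r)
   + ?w powr ?a * (2 * \<kappa> + ?w) powr ?a * (- of_real r * exp (- (\<kappa> + ?w) * of_real r))) / of_real r) (at ?w)"
  using w r by (auto intro!: derivative_eq_intros)
 also have "((?a * ?w powr (?a - 1) * (2 * \<kappa> + ?w) powr ?a + ?w powr ?a * (?a * (2 * \<kappa> + ?w) powr (?a - 1))) * exp (- (\<kappa> + ?w) * of_real r)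
   + ?w powr ?a * (2 * \<kappa> + ?w) powr ?a * (- of_real r * exp (- (\<kappa> + ?w) * of_real r))) / of_real r = spec_integrand n \<kappa> r s"
 proof -
  have "((a * A * (v * B) + (w * A) * (a * B)) * e + (w * A) * (v * B) * (- \<rho> * e)) / \<rho>
    = A * B * ((2 * a * ((v + w) / 2) / \<rho> - w * v) * e)" if "\<rho> \<noteq> 0" for a A v B w e \<rho> :: complex
   using that by (simp add: field_simps)
  from this[of "of_real r" ?a "?w powr ?b" "2 * \<kappa> + ?w" "(2 * \<kappa> + ?w) powr ?b" ?w "exp (- (\<kappa> + ?w) * of_real r)"]
  have "((?a * ?w powr (?a - 1) * (2 * \<kappa> + ?w) powr ?a + ?w powr ?a * (?a * (2 * \<kappa> + ?w) powr (?a - 1))) * exp (- (\<kappa> + ?w) * of_real r)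
   + ?w powr ?a * (2 * \<kappa> + ?w) powr ?a * (- of_real r * exp (- (\<kappa> + ?w) * of_real r))) / of_real r
   = ?w powr ?b * (2 * \<kappa> + ?w) powr ?b * ((2 * ?a * ((2 * \<kappa> + ?w + ?w) / 2) / of_real r - ?w * (2 * \<kappa> + ?w)) * exp (- (\<kappa> + ?w) * of_real r))"
   using r unfolding b p by simp
  moreover have "2 * ?a * ((2 * \<kappa> + ?w + ?w) / 2) = of_real (real n - 1) * (\<kappa> + ?w)" by (simp add: field_simps)
  ultimately show ?thesis unfolding spec_integrand_def sd by simp
 qed
 finally show ?thesis unfolding spec_primitive_def by (rule has_vector_derivative_real_field)
qed

lemma spec_integrand_bound:
 assumes n: "2 <= n" and k: "0 < Re \<kappa>" and r: "0 < r" and s: "0 <= s" "s <= S"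
 shows "cmod (spec_integrand n \<kappa> r s) <= (real n * (2 * cmod \<kappa> + S) * (1 + S) * exp (S / 2)) *
  (cmod (spec_density n \<kappa> s * of_real (exp (- (1 / 2) * s))) * (exp (- Re \<kappa> * r) / r + exp (- Re \<kappa> * r)))"
proof -
 let ?K = "2 * cmod \<kappa> + S"
 have S: "0 <= S" using s by simp
 have K: "0 <= ?K" using S by simp
 have a: "cmod (\<kappa> + of_real s) <= ?K" "cmod (2 * \<kappa> + of_real s) <= ?K"
 proof -
  have "cmod (of_real s) = s" "cmod (2 * \<kappa>) = 2 * cmod \<kappa>" using s by (simp_all add: norm_mult)
  then show "cmod (\<kappa> + of_real s) <= ?K" "cmod (2 * \<kappa> + of_real s) <= ?K"
   using norm_triangle_ineq[of \<kappa> "of_real s"] norm_triangle_ineq[of "2 * \<kappa>" "of_real s"] s norm_ge_zero[of \<kappa>] by linarith+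
 qed
 have n1: "cmod (of_real (real n - 1)) <= real n" "1 <= real n" using n by (simp_all only: norm_of_real)
 have "cmod (of_real (real n - 1) * (\<kappa> + of_real s) / of_real r) <= real n * ?K / r"
  unfolding norm_divide norm_mult norm_of_real[of r]
  using frac_le[OF mult_nonneg_nonneg[OF of_nat_0_le_iff K] mult_mono[OF n1(1) a(1) of_nat_0_le_iff norm_ge_zero], of r "\<bar>r\<bar>"] r by simp
 also have "... <= real n * ?K * (1 + S) / r"
 proof -
  have "0 <= real n * ?K" by (intro mult_nonneg_nonneg K) simp
  then have "real n * ?K * 1 <= real n * ?K * (1 + S)" using S by (intro mult_left_mono) auto
  then show ?thesis using r by (intro divide_right_mono) auto
 qed
 finally have A: "cmod (of_real (real n - 1) * (\<kappa> + of_real s) / of_real r) <= real n * ?K * (1 + S) / r" .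
 have "cmod (of_real s * (2 * \<kappa> + of_real s)) <= S * ?K"
  unfolding norm_mult using s a(2) by (intro mult_mono) auto
 also have "... <= real n * ((1 + S) * ?K)"
 proof -
  have "S * ?K <= 1 * ((1 + S) * ?K)" using K by (simp add: mult_right_mono)
  also have "... <= real n * ((1 + S) * ?K)" using n1(2) K S by (intro mult_right_mono) auto
  finally show ?thesis .
 qed
 finally have B: "cmod (of_real s * (2 * \<kappa> + of_real s)) <= real n * ?K * (1 + S)" by (simp add: mult_ac)
 have e: "cmod (exp (- (\<kappa> + of_real s) * of_real r)) <= exp (- Re \<kappa> * r)"
  using s r mult_nonneg_nonneg[of s r] by (simp add: algebra_simps)
 have w: "1 <= exp (S / 2) * exp (- (1 / 2) * s)" using s by (simp add: exp_add[symmetric] del: exp_le_cancel_iff)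
 have "cmod ((of_real (real n - 1) * (\<kappa> + of_real s) / of_real r - of_real s * (2 * \<kappa> + of_real s)) * exp (- (\<kappa> + of_real s) * of_real r))
   <= (real n * ?K * (1 + S) / r + real n * ?K * (1 + S)) * exp (- Re \<kappa> * r)"
  unfolding norm_mult using K S n1 r by (intro mult_mono e order_trans[OF norm_triangle_ineq4 add_mono[OF A B]] add_nonneg_nonneg divide_nonneg_nonneg mult_nonneg_nonneg) auto
 then have "cmod (spec_integrand n \<kappa> r s) <= (cmod (spec_density n \<kappa> s) * (exp (S / 2) * exp (- (1 / 2) * s))) * ((real n * ?K * (1 + S) / r + real n * ?K * (1 + S)) * exp (- Re \<kappa> * r))"
  unfolding spec_integrand_def norm_mult[of "spec_density n \<kappa> s"] using mult_left_mono[OF w norm_ge_zero[of "spec_density n \<kappa> s"]]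
  by (intro mult_mono) (simp_all only: mult_1_right norm_ge_zero mult_nonneg_nonneg exp_ge_zero)
 also have "... = (real n * ?K * (1 + S) * exp (S / 2)) *
  (cmod (spec_density n \<kappa> s * of_real (exp (- (1 / 2) * s))) * (exp (- Re \<kappa> * r) / r + exp (- Re \<kappa> * r)))"
 proof -
  have "(m * (E * F)) * ((Q / r + Q) * x) = (Q * E) * (m * F * (x / r + x))" for m E F Q x by (simp add: algebra_simps)
  then show ?thesis unfolding norm_mult norm_of_real abs_exp_cancel .
 qed
 finally show ?thesis .
qed

lemma borel_measurable_spec_integrand:
 assumes "0 < Re \<kappa>" shows "(%(s, r). spec_integrand n \<kappa> r s) \<in> borel_measurable (borel \<Otimes>\<^sub>M borel)"
 using borel_measurable_spec_density[OF assms] unfolding spec_integrand_def by measurable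

lemma integral_spec_integrand:
 assumes n: "2 <= n" and k: "0 < Re \<kappa>" and r: "0 < r" and S: "0 <= S"
 shows "(LINT s|lborel. indicator {0..S} s *\<^sub>R spec_integrand n \<kappa> r s) = spec_primitive n \<kappa> S * exp (- (\<kappa> + of_real S) * of_real r) / of_real r"
proof -
 note [measurable] = borel_measurable_spec_integrand[OF k] borel_measurable_spec_density[OF k]
 let ?P = "%s. spec_primitive n \<kappa> s * exp (- (\<kappa> + of_real s) * of_real r) / of_real r"
 have e0: "0 < (real n - 1) / 2" using n by simp
 have "continuous_on {0..S} (%s. complex_of_real s powr of_real ((real n - 1) / 2))"
 proof -
  have "continuous_on {0..S} (%s. complex_of_real (s powr ((real n - 1) / 2)))"
   using e0 by (intro continuous_on_of_real continuous_on_powr' continuous_intros) auto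
  then show ?thesis by (rule continuous_on_cong[THEN iffD1, rotated 2]) (auto simp only: atLeastAtMost_iff powr_of_real)
 qed
 moreover have "continuous_on {0..S} (%s. (2 * \<kappa> + complex_of_real s) powr of_real ((real n - 1) / 2))"

 proof (intro continuous_at_imp_continuous_on ballI)
  fix s assume "s \<in> {0..S}"
  then have "2 * \<kappa> + complex_of_real s \<notin> \<real>\<^sub>\<le>\<^sub>0" using plus_nonpos_Reals[OF k, of s] by simp
  moreover have "isCont (%s. 2 * \<kappa> + complex_of_real s) s" by (intro continuous_intros)
  ultimately show "isCont (%s. (2 * \<kappa> + complex_of_real s) powr of_real ((real n - 1) / 2)) s"
   by (intro isCont_powr_complex continuous_const)
 qed
 ultimately have c: "continuous_on {0..S} ?P"
  unfolding spec_primitive_def using r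
  by (intro continuous_on_divide continuous_on_mult continuous_on_exp continuous_on_minus continuous_on_add continuous_on_const continuous_on_of_real continuous_on_id) auto
 have "(spec_integrand n \<kappa> r has_integral (?P S - ?P 0)) {0..S}"
  by (rule fundamental_theorem_of_calculus_interior[OF S c]) (use spec_primitive_derivative[OF n k r] in auto)
 moreover have "?P 0 = 0" by (simp add: spec_primitive_def)
 ultimately have I: "integral {0..S} (spec_integrand n \<kappa> r) = ?P S" by (simp add: integral_unique)
 have "set_integrable lborel {0..S} (spec_integrand n \<kappa> r)"
  unfolding set_integrable_def
 proof (rule integrable_dominated)
  let ?C = "real n * (2 * cmod \<kappa> + S) * (1 + S) * exp (S / 2)"
  show "integrable lborel (%s. ?C * (cmod (spec_density n \<kappa> s * of_real (exp (- (1 / 2) * s))) * (exp (- Re \<kappa> * r) / r + exp (- Re \<kappa> * r))))"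
   by (intro integrable_mult_right integrable_mult_left integrable_norm integrable_spec_density_exp n k)
  have C: "0 <= ?C" using S by simp
  show "AE s in lborel. norm (indicat_real {0..S} s *\<^sub>R spec_integrand n \<kappa> r s) <= norm (?C * (cmod (spec_density n \<kappa> s * of_real (exp (- (1 / 2) * s))) * (exp (- Re \<kappa> * r) / r + exp (- Re \<kappa> * r))))"
  proof (intro AE_I2)
   fix s
   have "norm (indicat_real {0..S} s *\<^sub>R spec_integrand n \<kappa> r s) <= ?C * (cmod (spec_density n \<kappa> s * of_real (exp (- (1 / 2) * s))) * (exp (- Re \<kappa> * r) / r + exp (- Re \<kappa> * r)))"
   proof (cases "s \<in> {0..S}")
    case True
    then show ?thesis using spec_integrand_bound[OF n k r, of s S] by simp
   next
    case False
    then show ?thesis using C r by simp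
   qed
   then show "norm (indicat_real {0..S} s *\<^sub>R spec_integrand n \<kappa> r s) <= norm (?C * (cmod (spec_density n \<kappa> s * of_real (exp (- (1 / 2) * s))) * (exp (- Re \<kappa> * r) / r + exp (- Re \<kappa> * r))))"
    by simp
  qed
 qed measurable
 from set_borel_integral_eq_integral(2)[OF this] I show ?thesis by (simp add: set_lebesgue_integral_def)
qed

lemma powr_mult_of_real:
 assumes "0 < r" "v \<noteq> 0"
 shows "(complex_of_real r * v) powr of_real a = of_real (r powr a) * v powr of_real a"
proof -
 have "complex_of_real (r powr a) = exp (of_real a * of_real (ln r))"
  using assms by (simp add: powr_def flip: exp_of_real of_real_mult)
 moreover have "(complex_of_real r * v) powr of_real a = exp (of_real a * of_real (ln r) + of_real a * Ln v)"
  using assms unfolding powr_def Ln_times_of_real[OF assms] by (simp add: distrib_left Ln_of_real)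
 ultimately show ?thesis using assms(2) by (simp only: exp_add powr_def if_False)
qed

lemma spec_primitive_scale:
 assumes S: "0 < S" and k: "0 < Re \<kappa>"
 shows "spec_primitive n \<kappa> S = of_real (S powr (real n - 1)) * (1 + 2 * \<kappa> / of_real S) powr of_real ((real n - 1) / 2)"
proof -
 let ?a = "complex_of_real ((real n - 1) / 2)" and ?w = "complex_of_real S" and ?v = "1 + 2 * \<kappa> / complex_of_real S"
 have v: "2 * \<kappa> + ?w = ?w * ?v" using S by (simp add: field_simps)
 have "Re ?v > 0" using S k by (simp add: Re_divide_of_real add_pos_nonneg)
 then have v0: "?v \<noteq> 0" by (metis less_irrefl zero_complex.sel(1))
 have "(?w * ?v) powr ?a = of_real (S powr ((real n - 1) / 2)) * ?v powr ?a"
  using S v0 by (rule powr_mult_of_real)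
 moreover have "?w powr ?a = of_real (S powr ((real n - 1) / 2))" using S by (simp only: powr_of_real less_imp_le)
 moreover have "S powr ((real n - 1) / 2) * S powr ((real n - 1) / 2) = S powr (real n - 1)"
  by (simp add: powr_add[symmetric])
 ultimately show ?thesis unfolding spec_primitive_def v
  by (metis (no_types, lifting) mult.assoc of_real_mult)
qed

text \<open>Substitute \<open>x = y / S\<close>. The exponent \<open>(n - 1)/2\<close> is the one for which all powers of \<open>S\<close> cancel.\<close>
lemma yukawa_concentrates:
 fixes \<psi> :: "real^'k::finite => complex"
 assumes n: "2 <= CARD('k)" and k: "0 < Re \<kappa>" and c: "continuous_on UNIV \<psi>" and M: "!!x. cmod (\<psi> x) <= M"
 shows "(%j. LINT x|lborel. \<psi> x * (spec_primitive CARD('k) \<kappa> (real (Suc j)) * exp (- (\<kappa> + of_real (real (Suc j))) * of_real (norm x)) / of_real (norm x)))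
  \<longlonglongrightarrow> \<psi> 0 * of_real (1 / kernel_const TYPE('k))"
proof -
 let ?n = "CARD('k)" and ?S = "%j. real (Suc j)"
 let ?a = "complex_of_real ((real ?n - 1) / 2)"
 let ?h = "%j. (1 + 2 * \<kappa> / of_real (?S j)) powr ?a"
 let ?G = "%j x. \<psi> (x /\<^sub>R ?S j) * exp (- \<kappa> * of_real (norm x / ?S j)) * of_real (exp (- norm x) / norm x)"
 have [measurable]: "\<psi> \<in> borel_measurable borel" using c by (rule borel_measurable_continuous_onI)
 have M0: "0 <= M" using M[of 0] norm_ge_zero order_trans by blast
 have iS: "(%j. inverse (?S j)) \<longlonglongrightarrow> 0" by (rule LIMSEQ_inverse_real_of_nat)
 have "(LINT x|lborel. \<psi> x * (spec_primitive ?n \<kappa> (?S j) * exp (- (\<kappa> + of_real (?S j)) * of_real (norm x)) / of_real (norm x)))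
   = ?h j * (LINT x|lborel. ?G j x)" for j
 proof -
  let ?F = "%x::real^'k. \<psi> x * (spec_primitive ?n \<kappa> (?S j) * exp (- (\<kappa> + of_real (?S j)) * of_real (norm x)) / of_real (norm x))"
  have "(LINT x|lborel. ?F x) = (\<bar>1 / ?S j\<bar> ^ DIM(real^'k)) *\<^sub>R (LINT x|lborel. ?F ((1 / ?S j) *\<^sub>R x))"
   by (rule integral_lborel_scale) auto
  also have "... = (LINT x|lborel. (\<bar>1 / ?S j\<bar> ^ DIM(real^'k)) *\<^sub>R ?F ((1 / ?S j) *\<^sub>R x))"
   by (rule integral_scaleR_right[symmetric])
  also have "... = (LINT x|lborel. ?h j * ?G j x)"
  proof (rule lint_cong[OF refl])
   fix x :: "real^'k"
   have S: "0 < ?S j" by simp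
   have pw: "\<bar>1 / S\<bar> ^ m * S powr (real m - 1) * S = 1" if "0 < S" for S :: real and m
    using that by (simp add: powr_diff powr_realpow field_simps)
   have nx: "norm ((1 / ?S j) *\<^sub>R x) = norm x / ?S j" by simp
   have ex: "exp (- (\<kappa> + of_real (?S j)) * of_real (norm x / ?S j)) = exp (- \<kappa> * of_real (norm x / ?S j)) * of_real (exp (- norm x))"
   proof -
    have "- (\<kappa> + of_real S) * of_real (N / S) = - \<kappa> * of_real (N / S) + of_real (- N)" if "0 < S" for S N :: real
     using that by (simp add: field_simps)
    then show ?thesis unfolding exp_of_real[symmetric] exp_add[symmetric] using S by metis
   qed
   have "w *\<^sub>R (p * ((of_real u * h) * (e * of_real y) / of_real (N / S))) = of_real (w * u * S) * (h * (p * e * of_real (y / N)))"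
    for w u S y N :: real and p h e :: complex
    by (simp add: scaleR_conv_of_real)
   then have "(\<bar>1 / ?S j\<bar> ^ DIM(real^'k)) *\<^sub>R ?F ((1 / ?S j) *\<^sub>R x)
    = of_real (\<bar>1 / ?S j\<bar> ^ DIM(real^'k) * ?S j powr (real ?n - 1) * ?S j) * (?h j * (\<psi> ((1 / ?S j) *\<^sub>R x) * exp (- \<kappa> * of_real (norm x / ?S j)) * of_real (exp (- norm x) / norm x)))"
    unfolding nx ex spec_primitive_scale[OF S k] .
   moreover have "\<bar>1 / ?S j\<bar> ^ DIM(real^'k) * ?S j powr (real ?n - 1) * ?S j = 1"
    using pw[OF S, of ?n] by simp
   moreover have "(1 / ?S j) *\<^sub>R x = x /\<^sub>R ?S j" by (simp add: divide_inverse)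
   ultimately show "(\<bar>1 / ?S j\<bar> ^ DIM(real^'k)) *\<^sub>R ?F ((1 / ?S j) *\<^sub>R x) = ?h j * ?G j x"
    by (simp only: of_real_1 mult_1_left)
  qed
  also have "... = ?h j * (LINT x|lborel. ?G j x)" by (rule integral_mult_right_zero)
  finally show ?thesis .
 qed
 moreover have "?h \<longlonglongrightarrow> 1"
 proof -
  have "(%j. 1 + 2 * \<kappa> * of_real (inverse (?S j))) \<longlonglongrightarrow> 1 + 2 * \<kappa> * of_real 0"
   by (intro tendsto_intros iS)
  then have "(%j. 1 + 2 * \<kappa> / of_real (?S j)) \<longlonglongrightarrow> 1" by (simp add: divide_inverse)
  then have "?h \<longlonglongrightarrow> 1 powr ?a" by (intro tendsto_powr_complex tendsto_const) auto
  then show ?thesis by simp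
 qed
 moreover have "(%j. LINT x|lborel. ?G j x) \<longlonglongrightarrow> (LINT x|lborel. \<psi> 0 * of_real (exp (- norm (x::real^'k)) / norm x))"
 proof (rule integral_dominated_convergence)
  show "integrable lborel (%x::real^'k. M * (exp (- norm x) / norm x))"
   using integrable_yukawa[where 'a="real^'k", of 1] n by (intro integrable_mult_right) simp
  show "AE x in lborel. (%j. ?G j x) \<longlonglongrightarrow> \<psi> 0 * of_real (exp (- norm x) / norm x)"
  proof (intro AE_I2)
   fix x :: "real^'k"
   have "(%j. x /\<^sub>R ?S j) \<longlonglongrightarrow> 0 *\<^sub>R x" by (intro tendsto_intros iS)
   then have "(%j. \<psi> (x /\<^sub>R ?S j)) \<longlonglongrightarrow> \<psi> 0"
    using continuous_on_tendsto_compose[OF c, of _ 0 sequentially] by simp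
   moreover have "(%j. exp (- \<kappa> * of_real (norm x * inverse (?S j)))) \<longlonglongrightarrow> exp (- \<kappa> * of_real (norm x * 0))"
    by (intro tendsto_intros iS)
   then have "(%j. exp (- \<kappa> * of_real (norm x / ?S j))) \<longlonglongrightarrow> 1" by (simp add: divide_inverse)
   ultimately have "(%j. ?G j x) \<longlonglongrightarrow> \<psi> 0 * 1 * of_real (exp (- norm x) / norm x)" by (intro tendsto_intros)
   then show "(%j. ?G j x) \<longlonglongrightarrow> \<psi> 0 * of_real (exp (- norm x) / norm x)" by simp
  qed
  fix j
  show "AE x in lborel. cmod (?G j x) <= M * (exp (- norm x) / norm x)"
  proof (intro AE_I2)
   fix x :: "real^'k"
   have "cmod (exp (- \<kappa> * of_real (norm x / ?S j))) <= 1" using k by (simp add: mult_nonneg_nonneg divide_nonneg_nonneg)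
   then have "cmod (\<psi> (x /\<^sub>R ?S j)) * cmod (exp (- \<kappa> * of_real (norm x / ?S j))) <= M * 1"
    using M[of "x /\<^sub>R ?S j"] M0 by (intro mult_mono) auto
   then show "cmod (?G j x) <= M * (exp (- norm x) / norm x)"
    unfolding norm_mult norm_of_real using M0 by (intro mult_mono) auto
  qed
 qed measurable
 moreover have "(LINT x|lborel. \<psi> 0 * of_real (exp (- norm (x::real^'k)) / norm x)) = \<psi> 0 * of_real (1 / kernel_const TYPE('k))"
  unfolding integral_mult_right_zero integral_complex_of_real kernel_const_def by simp
 ultimately show ?thesis using tendsto_mult[of ?h 1 sequentially] by (simp only: mult_1_left)
qed

text \<open>Truncate the superposition at \<open>S\<close>. By Green's identity and Fubini only the boundary term of the
 \<open>s\<close>-integral remains, and it tends to a point mass.\<close>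
lemma helmholtz_kernel_fundamental:
 fixes \<psi> :: "real^'k::finite => complex"
 assumes n: "2 <= CARD('k)" and k: "0 < Re \<kappa>" and C2: "bdd_C2 \<psi> D1 D2"
 shows "(LINT h|lborel. helmholtz_kernel \<kappa> h * (- (\<Sum>i\<in>UNIV. D2 i h) + \<kappa>\<^sup>2 * \<psi> h)) = \<psi> 0"
proof -
 let ?n = "CARD('k)" and ?S = "%j. real (Suc j)"
 let ?L = "%h. - (\<Sum>i\<in>UNIV. D2 i h) + \<kappa>\<^sup>2 * \<psi> h"
 note [measurable] = borel_measurable_spec_density[OF k] borel_measurable_spec_integrand[OF k]
 have c: "continuous_on UNIV \<psi>" "!!i. continuous_on UNIV (D2 i)" using C2 by (auto simp: bdd_C2_def)
 have [measurable]: "\<psi> \<in> borel_measurable borel" using c(1) by (rule borel_measurable_continuous_onI)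
 have Lm [measurable]: "?L \<in> borel_measurable borel" by (intro borel_measurable_continuous_onI continuous_intros c)
 obtain M where M: "!!x. cmod (\<psi> x) <= M" using C2 by (auto simp: bdd_C2_def bounded_iff)
 have "\<forall>i. \<exists>M. \<forall>x. cmod (D2 i x) <= M" using C2 by (auto simp: bdd_C2_def bounded_iff)
 then obtain M2 where M2: "!!i x. cmod (D2 i x) <= M2 i" by metis
 have LM: "cmod (?L h) <= (\<Sum>i\<in>UNIV. M2 i) + cmod (\<kappa>\<^sup>2) * M" for h
 proof -
  have "cmod (?L h) <= cmod (\<Sum>i\<in>UNIV. D2 i h) + cmod (\<kappa>\<^sup>2 * \<psi> h)"
   using norm_triangle_ineq[of "- (\<Sum>i\<in>UNIV. D2 i h)" "\<kappa>\<^sup>2 * \<psi> h"] by simp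
  also have "... <= (\<Sum>i\<in>UNIV. M2 i) + cmod (\<kappa>\<^sup>2) * M"
   using M2 M by (intro add_mono order_trans[OF norm_sum sum_mono]) (auto simp: norm_mult intro!: mult_left_mono)
  finally show ?thesis .
 qed
 let ?A = "%s. LINT h|lborel. decay (Re \<kappa> + s) (Im \<kappa>) h * ?L h"
 note P = helmholtz_kernel_pairing[OF n k Lm LM]
 let ?W = "%s x. spec_integrand ?n \<kappa> (norm x) s * \<psi> (x::real^'k)"
 have A: "spec_density ?n \<kappa> s * ?A s = (LINT x|lborel. ?W s x)" for s
 proof (cases "0 < s")
  case True
  let ?m = "\<kappa> + complex_of_real s"
  have m: "0 < Re ?m" using k True by simp
  let ?e = "%x::real^'k. exp (- ?m * of_real (norm x))"
  have dom: "cmod (?e x) <= exp (- Re ?m * norm x)" for x by simp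
  have em: "?e \<in> borel_measurable borel" by measurable
  have bnd: "cmod (?e x * F x) <= B * exp (- Re ?m * norm x)" if "!!x. cmod (F x) <= B" for F B x
   using mult_mono[OF dom[of x] that[of x]] by (simp add: norm_mult mult.commute)
  have i1: "integrable lborel (%x. ?e x * (\<Sum>i\<in>UNIV. D2 i x))"
   by (rule integrable_bounded_exp[OF n _ m bnd[of _ "\<Sum>i\<in>UNIV. M2 i"]])
    (use M2 in \<open>auto intro!: order_trans[OF norm_sum sum_mono] borel_measurable_continuous_onI continuous_intros c\<close>)
  have i2: "integrable lborel (%x. ?e x * \<psi> x)"
   by (rule integrable_bounded_exp[OF n _ m bnd[of _ M]]) (use M in auto)
  have i3: "integrable lborel (%x. \<psi> x * ((?m\<^sup>2 - ?m * of_real ((real ?n - 1) / norm x)) * ?e x))"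
  proof -
   have y: "integrable lborel (%x::real^'k. exp (- Re ?m * norm x) / norm x)"
    by (rule integrable_yukawa) (use n m in auto)
   have y2: "integrable lborel (%x::real^'k. exp (- Re ?m * norm x))"
    by (rule integrable_exp_norm) (use n m in auto)
   show ?thesis
   proof (rule integrable_dominated)
    show "integrable lborel (%x::real^'k. M * (cmod (?m\<^sup>2) * exp (- Re ?m * norm x) + cmod ?m * ((real ?n - 1) * (exp (- Re ?m * norm x) / norm x))))"
     by (intro integrable_mult_right Bochner_Integration.integrable_add y y2)
    have "cmod (\<psi> x * ((?m\<^sup>2 - ?m * of_real ((real ?n - 1) / norm x)) * ?e x)) <= M * (cmod (?m\<^sup>2) * exp (- Re ?m * norm x) + cmod ?m * ((real ?n - 1) * (exp (- Re ?m * norm x) / norm x)))" for x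
    proof -
     have n0: "0 <= (real ?n - 1) / norm x" using n by simp
     have "cmod (?m\<^sup>2 - ?m * of_real ((real ?n - 1) / norm x)) <= cmod (?m\<^sup>2) + cmod ?m * ((real ?n - 1) / norm x)"
      using norm_triangle_ineq4[of "?m\<^sup>2" "?m * of_real ((real ?n - 1) / norm x)"] unfolding norm_mult norm_of_real abs_of_nonneg[OF n0] .
     then have "cmod ((?m\<^sup>2 - ?m * of_real ((real ?n - 1) / norm x)) * ?e x) <= (cmod (?m\<^sup>2) + cmod ?m * ((real ?n - 1) / norm x)) * exp (- Re ?m * norm x)"
      unfolding norm_mult[of _ "?e x"] using n0 by (intro mult_mono dom) auto
     also have "... = cmod (?m\<^sup>2) * exp (- Re ?m * norm x) + cmod ?m * ((real ?n - 1) * (exp (- Re ?m * norm x) / norm x))"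
      by (simp only: distrib_right times_divide_eq_left times_divide_eq_right mult.assoc)
     finally show ?thesis unfolding norm_mult[of "\<psi> x"] using M[of x] by (intro mult_mono) (auto intro: order_trans[OF norm_ge_zero])
    qed
    then show "AE x in lborel. cmod (\<psi> x * ((?m\<^sup>2 - ?m * of_real ((real ?n - 1) / norm x)) * ?e x)) <= norm (M * (cmod (?m\<^sup>2) * exp (- Re ?m * norm x) + cmod ?m * ((real ?n - 1) * (exp (- Re ?m * norm x) / norm x))))"
     by (intro AE_I2) (auto intro: order_trans[OF _ abs_ge_self])
   qed measurable
  qed
  have "?A s = (LINT x|lborel. \<kappa>\<^sup>2 * (?e x * \<psi> x) - ?e x * (\<Sum>i\<in>UNIV. D2 i x))"
   unfolding decay_eq by (intro lint_cong refl) (simp add: algebra_simps)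
  also have "... = (LINT x|lborel. \<kappa>\<^sup>2 * (?e x * \<psi> x)) - (LINT x|lborel. ?e x * (\<Sum>i\<in>UNIV. D2 i x))"
   by (intro Bochner_Integration.integral_diff integrable_mult_right i1 i2)
  also have "... = (LINT x|lborel. \<kappa>\<^sup>2 * (?e x * \<psi> x)) - (LINT x|lborel. \<psi> x * ((?m\<^sup>2 - ?m * of_real ((real ?n - 1) / norm x)) * ?e x))"
   unfolding yukawa_green[OF n m C2] ..
  also have "... = (LINT x|lborel. \<kappa>\<^sup>2 * (?e x * \<psi> x) - \<psi> x * ((?m\<^sup>2 - ?m * of_real ((real ?n - 1) / norm x)) * ?e x))"
   by (intro Bochner_Integration.integral_diff[symmetric] integrable_mult_right i2 i3)
  finally have "spec_density ?n \<kappa> s * ?A s = (LINT x|lborel. spec_density ?n \<kappa> s * (\<kappa>\<^sup>2 * (?e x * \<psi> x) - \<psi> x * ((?m\<^sup>2 - ?m * of_real ((real ?n - 1) / norm x)) * ?e x)))"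
   by (simp only: integral_mult_right_zero)
  also have "... = (LINT x|lborel. ?W s x)"
  proof (rule lint_cong[OF refl])
   fix x :: "real^'k"
   have "d * (\<kappa>\<^sup>2 * (e * p) - p * (((\<kappa> + w)\<^sup>2 - (\<kappa> + w) * (N / \<rho>)) * e)) = d * ((N * (\<kappa> + w) / \<rho> - w * (2 * \<kappa> + w)) * e) * p"
    for d e p w N \<rho> :: complex by (simp add: power2_eq_square algebra_simps divide_inverse)
   then show "spec_density ?n \<kappa> s * (\<kappa>\<^sup>2 * (?e x * \<psi> x) - \<psi> x * ((?m\<^sup>2 - ?m * of_real ((real ?n - 1) / norm x)) * ?e x)) = ?W s x"
    unfolding spec_integrand_def of_real_divide .
  qed
  finally show ?thesis .
 qed (simp add: spec_density_neg spec_integrand_def)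
 have trunc: "(LINT s|lborel. indicator {0..S} s *\<^sub>R (spec_density ?n \<kappa> s * ?A s))
   = (LINT x|lborel. \<psi> x * (spec_primitive ?n \<kappa> S * exp (- (\<kappa> + of_real S) * of_real (norm x)) / of_real (norm x)))"
  if S: "0 <= S" for S
 proof -
  let ?C = "real ?n * (2 * cmod \<kappa> + S) * (1 + S) * exp (S / 2)"
  let ?g = "%x::real^'k. exp (- Re \<kappa> * norm x) / norm x + exp (- Re \<kappa> * norm x)"
  have C0: "0 <= ?C" using S by simp
  have AEx: "AE x in lborel. x \<noteq> (0::real^'k)" by (rule AE_lborel_singleton)
  have pi: "integrable lborel2 (%(s, x). indicator {0..S} s *\<^sub>R ?W s x)"
  proof (rule integrable_dominated)
   have g: "integrable lborel (%x::real^'k. complex_of_real (M * ?g x))"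
    by (intro integrable_of_real integrable_mult_right Bochner_Integration.integrable_add integrable_yukawa integrable_exp_norm) (use n k in auto)
   have "integrable lborel2 (%(s, x::real^'k). spec_density ?n \<kappa> s * of_real (exp (- (1 / 2) * s)) * complex_of_real (M * ?g x))"
    by (rule integrable_pair_mult[OF integrable_spec_density_exp[OF n k] g])
   then show "integrable lborel2 (%z. complex_of_real ?C * (case z of (s, x::real^'k) => spec_density ?n \<kappa> s * of_real (exp (- (1 / 2) * s)) * complex_of_real (M * ?g x)))"
    by (rule integrable_mult_right)
   have "AE s in (lborel :: real measure). AE x in lborel. x \<noteq> (0::real^'k)" using AEx by simp
   then have "AE z in (lborel :: real measure) \<Otimes>\<^sub>M (lborel :: (real^'k) measure). snd z \<noteq> 0"
   proof (intro lborel_pair.AE_pair_measure)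
    show "{z \<in> space ((lborel :: real measure) \<Otimes>\<^sub>M (lborel :: (real^'k) measure)). snd z \<noteq> 0} \<in> sets lborel2" by measurable
   qed simp
   then show "AE z in lborel \<Otimes>\<^sub>M lborel. norm (case z of (s, x) => indicator {0..S} s *\<^sub>R ?W s x) <= norm (complex_of_real ?C * (case z of (s, x::real^'k) => spec_density ?n \<kappa> s * of_real (exp (- (1 / 2) * s)) * complex_of_real (M * ?g x)))"
   proof eventually_elim
    case (elim z)
    obtain s x where z: "z = (s, x)" by (cases z)
    then have x: "0 < norm x" using elim by simp
    have g0: "0 <= ?g x" by simp
    have Mx: "cmod (\<psi> x) <= \<bar>M\<bar>" using M[of x] by simp
    show ?case unfolding z prod.case
    proof (cases "s \<in> {0..S}")
     case True
     have "cmod (?W s x) <= ?C * (cmod (spec_density ?n \<kappa> s * of_real (exp (- (1 / 2) * s))) * ?g x) * \<bar>M\<bar>"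
      unfolding norm_mult[of "spec_integrand _ _ _ _"] using spec_integrand_bound[OF n k x, of s S] True Mx C0 g0
      by (intro mult_mono mult_nonneg_nonneg) auto
     also have "... = norm (complex_of_real ?C * (spec_density ?n \<kappa> s * of_real (exp (- (1 / 2) * s)) * complex_of_real (M * ?g x)))"
      unfolding norm_mult[of "complex_of_real ?C"] norm_mult[of "spec_density ?n \<kappa> s * of_real (exp (- (1 / 2) * s))"] norm_of_real abs_mult[of M] abs_of_nonneg[OF C0] abs_of_nonneg[OF g0]
      by (simp only: mult_ac)
     finally show "norm (indicat_real {0..S} s *\<^sub>R ?W s x) <= norm (complex_of_real ?C * (spec_density ?n \<kappa> s * of_real (exp (- (1 / 2) * s)) * complex_of_real (M * ?g x)))"
      using True by simp
    next
     case False
     then show "norm (indicat_real {0..S} s *\<^sub>R ?W s x) <= norm (complex_of_real ?C * (spec_density ?n \<kappa> s * of_real (exp (- (1 / 2) * s)) * complex_of_real (M * ?g x)))"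
      by simp
    qed
   qed
  qed measurable
  have "(LINT s|lborel. indicator {0..S} s *\<^sub>R (spec_density ?n \<kappa> s * ?A s)) = (LINT s|lborel. LINT x|lborel. indicator {0..S} s *\<^sub>R ?W s x)"
   unfolding A integral_scaleR_right ..
  also have "... = (LINT x|lborel. LINT s|lborel. indicator {0..S} s *\<^sub>R ?W s x)"
   by (rule lborel_pair.Fubini_integral[OF pi, symmetric])
  also have "... = (LINT x|lborel. \<psi> x * (spec_primitive ?n \<kappa> S * exp (- (\<kappa> + of_real S) * of_real (norm x)) / of_real (norm x)))"
  proof (rule integral_cong_AE)
   show "AE x in lborel. (LINT s|lborel. indicator {0..S} s *\<^sub>R ?W s x) = \<psi> x * (spec_primitive ?n \<kappa> S * exp (- (\<kappa> + of_real S) * of_real (norm x)) / of_real (norm x))"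
    using AEx
   proof eventually_elim
    case (elim x)
    then have x: "0 < norm x" by simp
    have "(LINT s|lborel. indicator {0..S} s *\<^sub>R ?W s x) = (LINT s|lborel. (indicator {0..S} s *\<^sub>R spec_integrand ?n \<kappa> (norm x) s) * \<psi> x)"
     by simp
    also have "... = (LINT s|lborel. indicator {0..S} s *\<^sub>R spec_integrand ?n \<kappa> (norm x) s) * \<psi> x" by (rule integral_mult_left_zero)
    finally show ?case unfolding integral_spec_integrand[OF n k x S] by (simp only: mult.commute)
   qed
  qed measurable
  finally show ?thesis .
 qed
 have "(%j. LINT s|lborel. indicator {0..?S j} s *\<^sub>R (spec_density ?n \<kappa> s * ?A s)) \<longlonglongrightarrow> (LINT s|lborel. spec_density ?n \<kappa> s * ?A s)"
 proof (rule integral_dominated_convergence)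
  have [measurable]: "(%s. spec_density ?n \<kappa> s * ?A s) \<in> borel_measurable borel"
   using borel_measurable_integrable[OF P(2)] by simp
  show "(%s. spec_density ?n \<kappa> s * ?A s) \<in> borel_measurable lborel"
   "!!j. (%s. indicator {0..?S j} s *\<^sub>R (spec_density ?n \<kappa> s * ?A s)) \<in> borel_measurable lborel" by measurable
  show "integrable lborel (%s. cmod (spec_density ?n \<kappa> s * ?A s))" by (rule integrable_norm[OF P(2)])
  show "AE s in lborel. norm (indicat_real {0..?S j} s *\<^sub>R (spec_density ?n \<kappa> s * ?A s)) <= cmod (spec_density ?n \<kappa> s * ?A s)" for j
   by (intro AE_I2) (auto simp: indicator_def)
  show "AE s in lborel. (%j. indicat_real {0..?S j} s *\<^sub>R (spec_density ?n \<kappa> s * ?A s)) \<longlonglongrightarrow> spec_density ?n \<kappa> s * ?A s"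
  proof (intro AE_I2)
   fix s :: real
   have "eventually (%j. indicat_real {0..?S j} s *\<^sub>R (spec_density ?n \<kappa> s * ?A s) = spec_density ?n \<kappa> s * ?A s) sequentially"
   proof (cases "0 < s")
    case True
    obtain N :: nat where "s <= real N" using real_arch_simple by blast
    then have "indicat_real {0..?S j} s = 1" if "N <= j" for j using that True by (auto simp: indicator_def)
    then show ?thesis unfolding eventually_sequentially by (intro exI[of _ N]) simp
   qed (simp add: spec_density_neg)
   then show "(%j. indicat_real {0..?S j} s *\<^sub>R (spec_density ?n \<kappa> s * ?A s)) \<longlonglongrightarrow> spec_density ?n \<kappa> s * ?A s"
    by (rule tendsto_eventually)
  qed
 qed
 moreover have "(%j. LINT s|lborel. indicator {0..?S j} s *\<^sub>R (spec_density ?n \<kappa> s * ?A s)) \<longlonglongrightarrow> \<psi> 0 * of_real (1 / kernel_const TYPE('k))"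
  using yukawa_concentrates[OF n k c(1) M] by (simp only: trunc of_nat_0_le_iff)
 ultimately have "(LINT s|lborel. spec_density ?n \<kappa> s * ?A s) = \<psi> 0 * of_real (1 / kernel_const TYPE('k))"
  by (rule LIMSEQ_unique)
 moreover have "complex_of_real (kernel_const TYPE('k)) \<noteq> 0" using kernel_const_pos[OF n] by simp
 ultimately show ?thesis unfolding P(1) by simp
qed

section \<open>Convolution on Lebesgue spaces\<close>

text \<open>Borel representatives, so that product measurability and Tonelli apply directly to \<open>lborel\<close>.\<close>
definition borel_Lp :: "real => ('a::euclidean_space => complex) set" where
 "borel_Lp p = {f. f \<in> borel_measurable borel \<and> integrable lborel (%x. cmod (f x) powr p)}"

lemma borel_Lp_measurable [measurable_dest]: "f \<in> borel_Lp p ==> f \<in> borel_measurable borel"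
 by (simp add: borel_Lp_def)

lemma borel_Lp_integrable: "f \<in> borel_Lp p ==> integrable lborel (%x. cmod (f x) powr p)"
 by (simp add: borel_Lp_def)

lemma le_1_plus_powr: "1 <= p ==> 0 <= (t::real) ==> t <= 1 + t powr p"
 using powr_mono[of 1 p t] by (cases "t <= 1") (auto intro: order_trans[of _ 1])

lemma integrable_shift:
 fixes K :: "'a::euclidean_space => complex"
 assumes K: "integrable lborel K"
 shows "integrable lborel (%x. K (x - y))" "integrable lborel (%x. K (y - x))"
  and "(LINT x|lborel. cmod (K (x - y))) = (LINT x|lborel. cmod (K x))" "(LINT x|lborel. cmod (K (y - x))) = (LINT x|lborel. cmod (K x))"
proof -
 have [measurable]: "K \<in> borel_measurable borel" using borel_measurable_integrable[OF K] by simp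
 have f: "(\<integral>\<^sup>+x. ennreal (cmod (K x)) \<partial>lborel) < \<infinity>" using K by (simp add: integrable_iff_bounded)
 have 1: "(\<integral>\<^sup>+x. ennreal (cmod (K (x - y))) \<partial>lborel) = (\<integral>\<^sup>+x. ennreal (cmod (K x)) \<partial>lborel)"
  using nn_integral_lborel_shift[of "%x. ennreal (cmod (K x))" "- y"] by simp
 have 2: "(\<integral>\<^sup>+x. ennreal (cmod (K (y - x))) \<partial>lborel) = (\<integral>\<^sup>+x. ennreal (cmod (K x)) \<partial>lborel)"
  using nn_integral_lborel_uminus[of "%x. ennreal (cmod (K (y + x)))"] nn_integral_lborel_shift[of "%x. ennreal (cmod (K x))" y] by simp
 show "integrable lborel (%x. K (x - y))" "integrable lborel (%x. K (y - x))"
  using f by (auto intro!: integrableI_bounded simp: 1 2)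
 show "(LINT x|lborel. cmod (K (x - y))) = (LINT x|lborel. cmod (K x))" "(LINT x|lborel. cmod (K (y - x))) = (LINT x|lborel. cmod (K x))"
  by (simp_all add: integral_eq_nn_integral 1 2)
qed

lemma integrable_convolution_pair:
 fixes K a :: "'a::euclidean_space => complex"
 assumes K: "integrable lborel K" and a: "integrable lborel a"
 shows "integrable lborel2 (%(x, y). K (x - y) * a y)"
  and "integrable lborel2 (%(y, x). K (x - y) * a y)"
  and "integrable lborel2 (%(x, y). K (x - y) * a x)"
proof -
 have [measurable]: "K \<in> borel_measurable borel" "a \<in> borel_measurable borel"
  using borel_measurable_integrable[OF K] borel_measurable_integrable[OF a] by simp_all
 show 2: "integrable lborel2 (%(y, x). K (x - y) * a y)"
 proof (rule lborel_pair.Fubini_integrable)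
  show "integrable lborel (%y. LINT x|lborel. norm (case (y, x) of (y, x) => K (x - y) * a y))"
   unfolding prod.case norm_mult integral_mult_left_zero integrable_shift(3)[OF K] by (intro integrable_mult_right integrable_norm a)
  show "AE y in lborel. integrable lborel (%x. case (y, x) of (y, x) => K (x - y) * a y)"
   unfolding prod.case by (intro AE_I2 integrable_mult_left integrable_shift K)
 qed measurable
 show "integrable lborel2 (%(x, y). K (x - y) * a y)"
  using lborel_pair.integrable_product_swap[OF 2] by simp
 show "integrable lborel2 (%(x, y). K (x - y) * a x)"
 proof (rule lborel_pair.Fubini_integrable)
  show "integrable lborel (%x. LINT y|lborel. norm (case (x, y) of (x, y) => K (x - y) * a x))"
   unfolding prod.case norm_mult integral_mult_left_zero integrable_shift(4)[OF K] by (intro integrable_mult_right integrable_norm a)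
  show "AE x in lborel. integrable lborel (%y. case (x, y) of (x, y) => K (x - y) * a x)"
   unfolding prod.case by (intro AE_I2 integrable_mult_left integrable_shift K)
 qed measurable
qed

definition conv :: "('a::euclidean_space => complex) => ('a => complex) => 'a => complex" where
 "conv K f x = (LINT y|lborel. K (x - y) * f y)"

text \<open>From \<open>|f| \<le> 1 + |f|\<^bsup>p\<^esup>\<close>: each summand has a convolution with an integrable kernel that is finite almost
 everywhere.\<close>
lemma AE_convolution_integrable:
 assumes K: "integrable lborel K" and f: "f \<in> borel_Lp p" and p: "1 <= p"
 shows "AE x in lborel. integrable lborel (%y. K (x - y) * f y)"
proof -
 note [measurable] = borel_Lp_measurable[OF f]
 have [measurable]: "K \<in> borel_measurable borel" using borel_measurable_integrable[OF K] by simp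
 have "integrable lborel2 (%(x, y). K (x - y) * of_real (cmod (f y) powr p))"
  by (intro integrable_convolution_pair K integrable_of_real borel_Lp_integrable[OF f])
 from lborel_pair.AE_integrable_fst[OF this]
 show ?thesis
 proof eventually_elim
  case (elim x)
  show ?case
  proof (rule integrable_dominated)
   show "integrable lborel (%y. cmod (K (x - y)) + cmod (K (x - y) * of_real (cmod (f y) powr p)))"
    by (intro Bochner_Integration.integrable_add integrable_norm integrable_shift K elim)
   show "AE y in lborel. cmod (K (x - y) * f y) <= norm (cmod (K (x - y)) + cmod (K (x - y) * of_real (cmod (f y) powr p)))"
   proof (intro AE_I2)
    fix y
    have "cmod (K (x - y)) * cmod (f y) <= cmod (K (x - y)) * (1 + cmod (f y) powr p)"
     by (intro mult_left_mono le_1_plus_powr p) auto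
    then show "cmod (K (x - y) * f y) <= norm (cmod (K (x - y)) + cmod (K (x - y) * of_real (cmod (f y) powr p)))"
     by (simp add: norm_mult distrib_left)
   qed
  qed measurable
 qed
qed

lemma borel_measurable_conv:
 assumes [measurable]: "K \<in> borel_measurable borel" "f \<in> borel_measurable borel" shows "conv K f \<in> borel_measurable borel"
proof -
 have "(%x. LINT y|lborel. K (x - y) * f y) \<in> borel_measurable lborel"
  by (intro lborel.borel_measurable_lebesgue_integral) measurable
 then show ?thesis unfolding conv_def[abs_def] by simp
qed

lemma mult_powr_conjugate:
 assumes "0 <= I" "0 <= A" "1 < p" "1 / p + 1 / q = 1" "I <= A * I powr (1 / q)"
 shows "I <= A powr (p::real)"
proof (cases "I = 0")
 case False
 then have I: "0 < I" using assms by simp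
 have e: "1 / p = 1 - 1 / q" using assms by simp
 have "I powr (1 / p) = I / I powr (1 / q)" unfolding e using I by (simp add: powr_diff)
 also have "... <= A" using assms(5) I by (simp add: field_simps)
 finally have "(I powr (1 / p)) powr p <= A powr p" using assms by (intro powr_mono2) auto
 then show ?thesis using I assms by (simp add: powr_powr)
qed simp

text \<open>Duality with the extremal function \<open>cnj (sgn u) |u|\<^bsup>p-1\<^esup>\<close>, cut off to a ball so that it is admissible.\<close>
lemma conv_local_bound:
 fixes f :: "'a::euclidean_space => complex"
 assumes pq: "1 < p" "1 < q" "1 / p + 1 / q = 1" and K: "integrable lborel K" and f: "nice f" and B: "0 <= B"
  and form: "!!g. nice g ==> cmod (pairing (K) f g) <= B * (lp_norm p f * lp_norm q g)"
 shows "(\<integral>\<^sup>+x. ennreal (cmod (conv K f x) powr p * indicator (ball 0 R) x) \<partial>lborel) <= ennreal ((B * lp_norm p f) powr p)"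
proof -
 have Km [measurable]: "K \<in> borel_measurable borel" using borel_measurable_integrable[OF K] by simp
 note [measurable] = nice_measurable[OF f]
 define u where "u = conv K f"
 have um [measurable]: "u \<in> borel_measurable borel" unfolding u_def by (rule borel_measurable_conv) measurable
 have bR [measurable]: "ball (0::'a) R \<in> sets borel" by simp
 obtain M where M: "0 <= M" "!!x. cmod (f x) <= M" using niceE[OF f] by metis
 define U where "U = (LINT y|lborel. cmod (K y)) * M"
 have uU: "cmod (u x) <= U" for x
 proof -
  have "cmod (u x) <= (LINT y|lborel. cmod (K (x - y) * f y))" unfolding u_def conv_def by (rule integral_norm_bound)
  also have "... <= (LINT y|lborel. cmod (K (x - y)) * M)"
   by (intro integral_mono' integrable_mult_left integrable_norm integrable_shift K) (auto simp: norm_mult intro!: mult_left_mono mult_nonneg_nonneg M)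
  also have "... = U" unfolding U_def integral_mult_left_zero integrable_shift(4)[OF K] ..
  finally show ?thesis .
 qed
 define g where "g x = cnj (sgn (u x)) * of_real (cmod (u x) powr (p - 1) * indicator (ball 0 R) x)" for x
 have s: "(%x. cnj (sgn (u x))) \<in> borel_measurable borel"
  unfolding sgn_div_norm by (intro borel_measurable_continuous_on[OF continuous_on_cnj[OF continuous_on_id]]) measurable
 have g: "nice g"
 proof (rule niceI)
  show "g \<in> borel_measurable borel" unfolding g_def using s by measurable
  show "norm (g x) <= U powr (p - 1)" for x
  proof -
   have "norm (g x) <= 1 * (cmod (u x) powr (p - 1) * 1)"
    unfolding g_def norm_mult norm_of_real by (intro mult_mono) (auto simp: norm_sgn abs_mult indicator_def)
   also have "... <= U powr (p - 1)" using uU[of x] pq by (simp add: powr_mono2)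
   finally show ?thesis .
  qed
  show "g x = 0" if "R < norm x" for x using that by (simp add: g_def)
 qed
 note [measurable] = nice_measurable[OF g]
 let ?F = "%x. cmod (u x) powr p * indicator (ball 0 R) x"
 define I where "I = (LINT x|lborel. ?F x)"
 have ug: "u x * g x = of_real (?F x)" for x
 proof (cases "u x = 0")
  case False
  have "u x * cnj (sgn (u x)) = of_real (cmod (u x))"
   using False by (simp add: sgn_div_norm scaleR_conv_of_real complex_norm_square[symmetric] power2_eq_square field_simps)
  moreover have "cmod (u x) * cmod (u x) powr (p - 1) = cmod (u x) powr p" using False by (simp add: powr_diff)
  ultimately show ?thesis unfolding g_def by (metis (no_types, opaque_lifting) mult.assoc of_real_mult)
 qed (use pq in \<open>simp add: g_def\<close>)
 have gq: "cmod (g x) powr q = ?F x" for x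
 proof (cases "u x = 0")
  case False
  have "(p - 1) * q = p" using pq by (simp add: field_simps)
  then show ?thesis using False pq by (auto simp: g_def norm_mult norm_sgn powr_powr indicator_def)
 qed (use pq in \<open>simp add: g_def\<close>)
 have iF: "integrable lborel ?F" using integrable_lp_nice[OF g, of q] pq by (simp add: gq)
 have I0: "0 <= I" unfolding I_def by (intro lint_nonneg) simp
 have "(pairing (K) f g) = (LINT h|lborel. LINT x|lborel. K h * f (x - h) * g x)"
  unfolding corr_def by (simp only: integral_mult_right_zero mult.assoc)
 also have "... = (LINT x|lborel. LINT h|lborel. K h * f (x - h) * g x)"
 proof (rule lborel_pair.Fubini_integral[symmetric], rule integrable_dominated)
  show "integrable lborel2 (%z. of_real M * (case z of (h, x) => K h * g x))"
   by (intro integrable_mult_right integrable_pair_mult K nice_integrable g)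
  show "AE z in lborel \<Otimes>\<^sub>M lborel. norm (case z of (h, x) => K h * f (x - h) * g x) <= norm (of_real M * (case z of (h, x) => K h * g x))"
  proof (intro AE_I2)
   fix z :: "'a \<times> 'a"
   obtain h x where z: "z = (h, x)" by (cases z)
   have "cmod (K h * f (x - h) * g x) = cmod (f (x - h)) * cmod (K h * g x)" by (simp add: norm_mult)
   also have "... <= \<bar>M\<bar> * cmod (K h * g x)" using M by (intro mult_right_mono) auto
   finally show "norm (case z of (h, x) => K h * f (x - h) * g x) <= norm (of_real M * (case z of (h, x) => K h * g x))"
    by (simp only: z prod.case norm_mult[of "of_real M"] norm_of_real)
  qed
 qed measurable
 also have "... = (LINT x|lborel. of_real (?F x))"
 proof (rule lint_cong[OF refl])
  fix x
  have "(LINT h|lborel. K h * f (x - h)) = u x"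
   unfolding u_def conv_def
   using integral_lborel_uminus[of "%h. K (x + h) * f (- h)"] integral_lborel_shift[of "%h. K h * f (x - h)" x] by simp
  then show "(LINT h|lborel. K h * f (x - h) * g x) = of_real (?F x)"
   unfolding integral_mult_left_zero by (simp only: ug)
 qed
 also have "... = of_real I" unfolding I_def by (rule integral_complex_of_real)
 finally have "I <= B * (lp_norm p f * lp_norm q g)" using form[OF g] I0 by simp
 also have "lp_norm q g = I powr (1 / q)" by (simp add: lp_norm_def gq I_def)
 finally have "I <= (B * lp_norm p f) powr p"
  by (intro mult_powr_conjugate[OF I0 _ pq(1,3)]) (use B in \<open>auto simp: lp_norm_nonneg mult.assoc\<close>)
 then show ?thesis using nn_integral_eq_integral[OF iF] by (simp add: u_def I_def ennreal_leI)
qed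

text \<open>Truncate \<open>f\<close> and the domain simultaneously and apply Fatou's lemma.\<close>
lemma conv_Lp_bound:
 fixes f :: "'a::euclidean_space => complex"
 assumes pq: "1 < p" "1 < q" "1 / p + 1 / q = 1" and K: "integrable lborel K" and f: "f \<in> borel_Lp p" and B: "0 <= B"
  and form: "!!f g. nice f ==> nice g ==> cmod (pairing (K) f g) <= B * (lp_norm p f * lp_norm q g)"
 shows "conv K f \<in> borel_Lp p" "lp_norm p (conv K f) <= B * lp_norm p f"
proof -
 have Km [measurable]: "K \<in> borel_measurable borel" using borel_measurable_integrable[OF K] by simp
 note [measurable] = borel_Lp_measurable[OF f]
 have um [measurable]: "conv K f \<in> borel_measurable borel" by (rule borel_measurable_conv) measurable
 define fj where "fj j x = f x * indicator {x. norm x <= real j \<and> cmod (f x) <= real j} x" for j x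
 have nf: "nice (fj j)" for j
 proof (rule niceI)
  show "fj j \<in> borel_measurable borel" unfolding fj_def by measurable
  show "norm (fj j x) <= real j" for x by (simp add: fj_def indicator_def)
  show "fj j x = 0" if "real j < norm x" for x using that by (simp add: fj_def indicator_def)
 qed
 note [measurable] = nice_measurable[OF nf]
 have fle: "cmod (fj j x) <= cmod (f x)" for j x by (simp add: fj_def indicator_def)
 have lpf: "lp_norm p (fj j) <= lp_norm p f" for j
  unfolding lp_norm_def using pq fle
  by (intro powr_mono2 integral_mono' borel_Lp_integrable[OF f] lint_nonneg) auto
 let ?A = "B * lp_norm p f"
 have A0: "0 <= ?A" using B by (simp add: lp_norm_nonneg)
 have lim: "(%j. fj j x) \<longlonglongrightarrow> f x" for x
 proof -
  obtain N where N: "max (norm x) (cmod (f x)) <= real N" using real_arch_simple by blast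
  then have "fj j x = f x" if "N <= j" for j using that by (auto simp: fj_def indicator_def)
  then show ?thesis by (intro tendsto_eventually) (auto simp: eventually_sequentially)
 qed
 let ?H = "%j x. ennreal (cmod (conv K (fj j) x) powr p * indicator (ball 0 (real j)) x)"
 have "AE x in lborel. liminf (%j. ?H j x) = ennreal (cmod (conv K f x) powr p)"
  using AE_convolution_integrable[OF K f less_imp_le[OF pq(1)]]
 proof eventually_elim
  case (elim x)
  have "(%j. conv K (fj j) x) \<longlonglongrightarrow> conv K f x"
   unfolding conv_def
  proof (rule integral_dominated_convergence)
   show "integrable lborel (%y. cmod (K (x - y) * f y))" by (rule integrable_norm[OF elim])
   show "AE y in lborel. (%j. K (x - y) * fj j y) \<longlonglongrightarrow> K (x - y) * f y" by (intro AE_I2 tendsto_intros lim)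
   show "AE y in lborel. norm (K (x - y) * fj j y) <= cmod (K (x - y) * f y)" for j
    by (intro AE_I2) (auto simp: norm_mult intro!: mult_left_mono fle)
  qed measurable
  then have "(%j. cmod (conv K (fj j) x) powr p) \<longlonglongrightarrow> cmod (conv K f x) powr p"
   using pq by (intro tendsto_powr' tendsto_norm tendsto_const) auto
  moreover have "(%j. indicator (ball 0 (real j)) x) \<longlonglongrightarrow> (1::real)"
  proof -
   obtain N where N: "norm x < real N" using reals_Archimedean2 by blast
   then have "indicator (ball 0 (real j)) x = (1::real)" if "N <= j" for j using that by (auto simp: indicator_def)
   then show ?thesis by (intro tendsto_eventually) (auto simp: eventually_sequentially)
  qed
  ultimately have "(%j. cmod (conv K (fj j) x) powr p * indicator (ball 0 (real j)) x) \<longlonglongrightarrow> cmod (conv K f x) powr p * 1"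
   by (rule tendsto_mult)
  then have "(%j. ?H j x) \<longlonglongrightarrow> ennreal (cmod (conv K f x) powr p)" by (intro tendsto_ennrealI) simp
  then show ?case by (rule lim_imp_Liminf[OF sequentially_bot])
 qed
 then have "(\<integral>\<^sup>+x. ennreal (cmod (conv K f x) powr p) \<partial>lborel) = (\<integral>\<^sup>+x. liminf (%j. ?H j x) \<partial>lborel)"
  by (intro nn_integral_cong_AE) (auto elim: eventually_mono)
 also have "... <= liminf (%j. \<integral>\<^sup>+x. ?H j x \<partial>lborel)"
 proof (rule nn_integral_liminf)
  fix j
  have [measurable]: "conv K (fj j) \<in> borel_measurable borel" by (rule borel_measurable_conv) measurable
  have [measurable]: "ball (0::'a) (real j) \<in> sets borel" by simp
  show "?H j \<in> borel_measurable lborel" by measurable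
 qed
 also have "... <= limsup (%j. \<integral>\<^sup>+x. ?H j x \<partial>lborel)" by (rule Liminf_le_Limsup) simp
 also have "... <= ennreal (?A powr p)"
 proof (rule Limsup_bounded, rule always_eventually, rule allI)
  fix j
  have "(\<integral>\<^sup>+x. ?H j x \<partial>lborel) <= ennreal ((B * lp_norm p (fj j)) powr p)"
   by (rule conv_local_bound[OF pq K nf B form[OF nf]])
  also have "... <= ennreal (?A powr p)"
   using pq B lpf[of j] by (intro ennreal_leI powr_mono2 mult_left_mono) (auto simp: lp_norm_nonneg)
  finally show "(\<integral>\<^sup>+x. ?H j x \<partial>lborel) <= ennreal (?A powr p)" .
 qed
 finally have nn: "(\<integral>\<^sup>+x. ennreal (cmod (conv K f x) powr p) \<partial>lborel) <= ennreal (?A powr p)" .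
 then have i: "integrable lborel (%x. cmod (conv K f x) powr p)"
  by (intro integrableI_nonneg) (auto intro: le_less_trans)
 then show "conv K f \<in> borel_Lp p" by (simp add: borel_Lp_def)
 have "(LINT x|lborel. cmod (conv K f x) powr p) <= ?A powr p"
  using nn unfolding nn_integral_eq_integral[OF i AE_I2[OF powr_ge_zero]] by (subst (asm) ennreal_le_iff) auto
 then have "lp_norm p (conv K f) <= (?A powr p) powr (1 / p)"
  unfolding lp_norm_def using pq by (intro powr_mono2 lint_nonneg) auto
 then show "lp_norm p (conv K f) <= ?A" using pq A0 by (simp add: powr_powr)
qed

section \<open>Test functions\<close>

lemma smooth_on_UNIV_differentiable: "smooth_on f UNIV ==> (f has_derivative frechet_derivative f (at x)) (at x)"
 unfolding smooth_on_def by (rule Ck_on_Suc_has_derivative[of 0 f UNIV]) auto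

lemma smooth_on_partial_deriv:
 assumes "smooth_on f UNIV" shows "smooth_on (partial_deriv i f) UNIV"
proof -
 have "Ck_on (Suc k) f UNIV" for k using assms unfolding smooth_on_def by (rule spec)
 then show ?thesis unfolding smooth_on_def partial_deriv_def[abs_def] by (intro allI Ck_on_frechet_derivative)
qed

lemma notin_supp: "x \<notin> supp f ==> f x = 0"
 using closure_subset[of "{x. f x \<noteq> 0}"] unfolding supp_def by blast

lemma test_function_partial_deriv:
 fixes f :: "real^'k::finite => complex"
 assumes "test_function f" shows "test_function (partial_deriv i f)"
proof -
 have z: "partial_deriv i f x = 0" if x: "x \<notin> supp f" for x
 proof -
  have o: "open (- supp f)" unfolding supp_def by (intro open_Compl closed_closure)
  have "((%x. 0) has_derivative (%x. 0)) (at x)" by (rule has_derivative_const)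
  then have "(f has_derivative (%x. 0)) (at x)"
  proof (rule has_derivative_transform_within_open[OF _ o])
   show "x \<in> - supp f" using x by simp
   show "0 = f y" if "y \<in> - supp f" for y using notin_supp[of y f] that by simp
  qed
  then show ?thesis unfolding partial_deriv_def by (simp add: frechet_derivative_at[symmetric])
 qed
 then have "supp (partial_deriv i f) \<subseteq> supp f"
  unfolding supp_def[of "partial_deriv i f"] by (intro closure_minimal) (auto simp: supp_def)
 moreover have "closed (supp (partial_deriv i f))" by (simp add: supp_def)
 ultimately have "compact (supp (partial_deriv i f))"
  using assms by (metis compact_Int_closed inf.absorb2 test_function_def)
 then show ?thesis using assms by (simp add: test_function_def smooth_on_partial_deriv)
qed

lemma test_function_continuous: "test_function f ==> continuous_on UNIV f"
 by (simp add: test_function_def smooth_on_continuous_on)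

lemma test_function_nice:
 fixes f :: "real^'k::finite => complex"
 assumes t: "test_function f" shows "nice f"
proof -
 have c: "compact (supp f)" using t by (simp add: test_function_def)
 have "compact (f ` supp f)" using c continuous_on_subset[OF test_function_continuous[OF t]] by (intro compact_continuous_image) auto
 then obtain M where M: "!!x. x \<in> supp f ==> norm (f x) <= M" using compact_imp_bounded bounded_iff by (metis imageI)
 obtain R where R: "!!x. x \<in> supp f ==> norm x <= R" using compact_imp_bounded[OF c] bounded_iff by metis
 show ?thesis
 proof (rule niceI)
  show "f \<in> borel_measurable borel" by (intro borel_measurable_continuous_onI test_function_continuous t)
  show "norm (f x) <= max M 0" for x using M[of x] notin_supp[of x f] by (cases "x \<in> supp f") auto
  show "f x = 0" if "R < norm x" for x using R[of x] that notin_supp[of x f] by fastforce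
 qed
qed

lemma partial_deriv_line:
 fixes f :: "real^'k::finite => complex"
 assumes "smooth_on f UNIV"
 shows "((%t. f (x + t *\<^sub>R axis i 1)) has_vector_derivative partial_deriv i f (x + t *\<^sub>R axis i 1)) (at t)"
proof -
 let ?y = "x + t *\<^sub>R axis i 1" and ?D = "frechet_derivative f (at (x + t *\<^sub>R axis i 1))"
 have D: "(f has_derivative ?D) (at ?y)" by (rule smooth_on_UNIV_differentiable[OF assms])
 have "((%t. x + t *\<^sub>R axis i 1) has_derivative (%s. s *\<^sub>R axis i 1)) (at t)" by (auto intro!: derivative_eq_intros)
 from has_derivative_compose[OF this D] show ?thesis
  unfolding has_vector_derivative_def partial_deriv_def
  using has_derivative_linear[OF D] by (simp add: linear_scale)
qed

lemma test_function_bdd_C2: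
 fixes f :: "real^'k::finite => complex"
 assumes t: "test_function f"
 shows "bdd_C2 (%x. f (y + x)) (%i x. partial_deriv i f (y + x)) (%i x. partial_deriv i (partial_deriv i f) (y + x))"
proof -
 have b: "bounded (range (%x. g (y + x)))" "continuous_on UNIV (%x. g (y + x))"
  "((%t. g (y + (x + t *\<^sub>R axis i 1))) has_vector_derivative partial_deriv i g (y + (x + t *\<^sub>R axis i 1))) (at t)"
  if g: "test_function g" for g :: "real^'k => complex" and x t i
 proof -
  show "bounded (range (%x. g (y + x)))" using niceE[OF test_function_nice[OF g]] unfolding bounded_iff by (metis rangeE)
  show "continuous_on UNIV (%x. g (y + x))"
   by (rule continuous_on_compose2[OF test_function_continuous[OF g]]) (auto intro!: continuous_intros)
  show "((%t. g (y + (x + t *\<^sub>R axis i 1))) has_vector_derivative partial_deriv i g (y + (x + t *\<^sub>R axis i 1))) (at t)"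
   using partial_deriv_line[of g "y + x" i t] g by (simp add: test_function_def add.assoc)
 qed
 note t1 = test_function_partial_deriv[OF t]
 note t2 = test_function_partial_deriv[OF t1]
 show ?thesis unfolding bdd_C2_def by (intro conjI allI b t t1 t2)
qed

definition helmholtz_op :: "complex => (real^'k::finite => complex) => real^'k => complex" where
 "helmholtz_op z f x = - laplacian f x - z * f x"

lemma nice_add:
 fixes g h :: "'a::euclidean_space => complex"
 assumes g: "nice g" and h: "nice h" shows "nice (%x. g x + h x)"
proof -
 obtain M R where 1: "!!x. norm (g x) <= M" "!!x. R < norm x ==> g x = 0" using niceE[OF g] by metis
 obtain M' R' where 2: "!!x. norm (h x) <= M'" "!!x. R' < norm x ==> h x = 0" using niceE[OF h] by metis
 show ?thesis
 proof (rule niceI)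
  show "(%x. g x + h x) \<in> borel_measurable borel" using nice_measurable[OF g] nice_measurable[OF h] by measurable
  show "norm (g x + h x) <= M + M'" for x by (intro norm_triangle_mono 1 2)
  show "g x + h x = 0" if "max R R' < norm x" for x using that 1 2 by simp
 qed
qed

lemma nice_sum:
 fixes g :: "'i => 'a::euclidean_space => complex"
 assumes "finite I" "!!i. nice (g i)" shows "nice (%x. \<Sum>i\<in>I. g i x)"
 using assms
proof (induction I rule: finite_induct)
 case empty
 show ?case by (rule niceI[of _ 0 0]) auto
next
 case (insert i I)
 then show ?case using nice_add[of "g i" "%x. \<Sum>i\<in>I. g i x"] by simp
qed

lemma nice_helmholtz_op:
 fixes f :: "real^'k::finite => complex"
 assumes t: "test_function f" shows "nice (helmholtz_op z f)"
proof -
 have nl: "nice (laplacian f)"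
  unfolding laplacian_def[abs_def] by (intro nice_sum test_function_nice test_function_partial_deriv t) simp
 have "nice (%x. - laplacian f x)"
  by (intro nice_dominated[OF nl, of _ 1] borel_measurable_uminus nice_measurable[OF nl]) auto
 moreover have "nice (%x. - z * f x)"
  using nice_measurable[OF test_function_nice[OF t]]
  by (intro nice_dominated[OF test_function_nice[OF t], of _ "cmod z"]) (auto simp: norm_mult)
 ultimately show ?thesis using nice_add by (fastforce simp: helmholtz_op_def[abs_def])
qed

lemma helmholtz_kernel_inverts:
 fixes f :: "real^'k::finite => complex"
 assumes n: "2 <= CARD('k)" and k: "0 < Re \<kappa>" and t: "test_function f"
 shows "(LINT h|lborel. helmholtz_kernel \<kappa> h * helmholtz_op (- \<kappa>\<^sup>2) f (y + h)) = f y"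
 using helmholtz_kernel_fundamental[OF n k test_function_bdd_C2[OF t, of y]]
 by (simp add: helmholtz_op_def laplacian_def)

lemma helmholtz_kernel_uminus: "helmholtz_kernel \<kappa> (- h) = helmholtz_kernel \<kappa> h"
 by (simp add: helmholtz_kernel_def decay_def)

lemma Ck_on_translate:
 fixes f :: "'a::real_normed_vector => 'b::real_normed_vector"
 shows "Ck_on k f UNIV ==> Ck_on k (%x. f (x - h)) UNIV"
proof (induction k arbitrary: f)
 case 0
 then show ?case by (auto intro: continuous_on_compose2[of UNIV f] intro!: continuous_intros)
next
 case (Suc k)
 show ?case
 proof (rule Ck_on_SucI[OF open_UNIV])
  fix x
  show "((%x. f (x - h)) has_derivative frechet_derivative f (at (x - h))) (at x)"
   by (rule has_derivative_compose[of "%x. x - h" "%x. x", OF _ Ck_on_Suc_has_derivative[OF Suc.prems]]) (auto intro!: derivative_eq_intros)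
  show "Ck_on k (%x. frechet_derivative f (at (x - h)) v) UNIV" for v
   by (rule Suc.IH[OF Ck_on_frechet_derivative[OF Suc.prems]])
 qed
qed

lemma partial_deriv_translate:
 assumes "smooth_on f UNIV" shows "partial_deriv i (%x. f (x - h)) = (%x. partial_deriv i f (x - h))"
proof
 fix x
 have "((%x. f (x - h)) has_derivative frechet_derivative f (at (x - h))) (at x)"
  by (rule has_derivative_compose[of "%x. x - h" "%x. x", OF _ smooth_on_UNIV_differentiable[OF assms]]) (auto intro!: derivative_eq_intros)
 then show "partial_deriv i (%x. f (x - h)) x = partial_deriv i f (x - h)"
  unfolding partial_deriv_def by (simp add: frechet_derivative_at[symmetric])
qed

lemma test_function_translate:
 fixes f :: "real^'k::finite => complex"
 assumes t: "test_function f"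
 shows "test_function (%x. f (x - h))" "helmholtz_op z (%x. f (x - h)) x = helmholtz_op z f (x - h)"
proof -
 have s: "smooth_on f UNIV" "compact (supp f)" using t by (auto simp: test_function_def)
 have "supp (%x. f (x - h)) = (+) h ` supp f"
 proof -
  have "{x. f (x - h) \<noteq> 0} = (+) h ` {x. f x \<noteq> 0}" by (auto simp: image_iff intro!: exI[of _ "_ - h"])
  then show ?thesis unfolding supp_def by (simp add: closure_translation)
 qed
 then show "test_function (%x. f (x - h))"
  using s Ck_on_translate[of _ f h] by (auto simp: test_function_def smooth_on_def compact_translation)
 show "helmholtz_op z (%x. f (x - h)) x = helmholtz_op z f (x - h)"
  unfolding helmholtz_op_def laplacian_def by (simp add: partial_deriv_translate[OF s(1)] partial_deriv_translate[OF smooth_on_partial_deriv[OF s(1)]])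
qed

text \<open>Smooth functions that converge to the indicator of an open box and vanish outside it.\<close>
definition box_cutoff :: "real^'k::finite => real^'k => nat => real^'k => real" where
 "box_cutoff a b j x = (\<Prod>i\<in>UNIV. step (real j * (x $ i - a $ i)) * step (real j * (b $ i - x $ i)))"

lemma box_cutoff_bounds: "0 <= box_cutoff a b j x" "box_cutoff a b j x <= 1"
 unfolding box_cutoff_def by (auto intro!: prod_nonneg prod_le_1 mult_le_one mult_nonneg_nonneg step_nonneg step_le_1)

lemma box_cutoff_eq_0: "x \<notin> box a b ==> box_cutoff a b j x = 0"
proof -
 assume "x \<notin> box a b"
 then obtain i where "x $ i <= a $ i \<or> b $ i <= x $ i" by (auto simp: mem_box_cart not_less)
 then have "real j * (x $ i - a $ i) <= 0 \<or> real j * (b $ i - x $ i) <= 0" by (auto simp: mult_nonneg_nonpos)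
 then have "step (real j * (x $ i - a $ i)) * step (real j * (b $ i - x $ i)) = 0" by (auto simp: step_eq_0)
 then show ?thesis unfolding box_cutoff_def by (auto intro!: prod_zero)
qed

lemma box_cutoff_tendsto:
 fixes a b x :: "real^'k::finite"
 shows "(%j. box_cutoff a b j x) \<longlonglongrightarrow> (indicator (box a b) x :: real)"
proof (cases "x \<in> box a b")
 case True
 have s: "(%j. step (real j * t)) \<longlonglongrightarrow> 1" if t: "0 < t" for t
 proof -
  obtain N where N: "2 / t < real N" using reals_Archimedean2 by blast
  have "step (real j * t) = 1" if "N <= j" for j
  proof (rule step_eq_1)
   have "2 / t <= real j" using N that by simp
   then show "2 <= real j * t" using t by (simp add: field_simps)
  qed
  then show ?thesis by (intro tendsto_eventually) (auto simp: eventually_sequentially)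
 qed
 have "(%j. box_cutoff a b j x) \<longlonglongrightarrow> (\<Prod>i\<in>(UNIV::'k set). 1 * 1)"
  unfolding box_cutoff_def using True by (intro tendsto_prod tendsto_mult s) (auto simp: mem_box_cart)
 then show ?thesis using True by simp
qed (simp add: box_cutoff_eq_0)

lemma test_function_box_cutoff:
 fixes a b :: "real^'k::finite"
 shows "test_function (%x. complex_of_real (box_cutoff a b j x))"
proof -
 have lin: "smooth_on (%x::real^'k. c * (x $ i - d)) UNIV" "smooth_on (%x::real^'k. c * (d - x $ i)) UNIV" for c d and i :: 'k
  by (intro smooth_on_mult smooth_on_diff smooth_on_const open_UNIV smooth_on_bounded_linear bounded_linear_vec_nth)+
 have "smooth_on (%x. complex_of_real (box_cutoff a b j x)) UNIV"
  unfolding box_cutoff_def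
  by (intro smooth_on_bounded_linear_comp[OF open_UNIV bounded_linear_of_real] smooth_on_prod smooth_on_mult open_UNIV
    smooth_on_compose_real[OF open_UNIV smooth_on_step] lin) auto
 moreover have "compact (supp (%x. complex_of_real (box_cutoff a b j x)))"
 proof -
  have "{x. complex_of_real (box_cutoff a b j x) \<noteq> 0} \<subseteq> cbox a b"
   using box_cutoff_eq_0[of _ a b j] box_subset_cbox[of a b] by auto
  then have "supp (%x. complex_of_real (box_cutoff a b j x)) \<subseteq> cbox a b"
   unfolding supp_def by (intro closure_minimal) auto
  moreover have "closed (supp (%x. complex_of_real (box_cutoff a b j x)))" by (simp add: supp_def)
  ultimately show ?thesis by (metis compact_Int_closed compact_cbox inf.absorb2)
 qed
 ultimately show ?thesis by (simp add: test_function_def)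
qed

text \<open>Boxes form an intersection-stable generator, so all integrals over Borel sets in a fixed cube vanish.\<close>
lemma AE_zero_if_box_integrals_zero:
 fixes w :: "'a::euclidean_space => complex"
 assumes i: "!!a b. integrable lborel (%x. indicator (box a b) x *\<^sub>R w x)"
  and z: "!!a b. (LINT x|lborel. indicator (box a b) x *\<^sub>R w x) = 0"
 shows "AE x in lborel. w x = 0"
proof -
 have AEj: "AE x in lborel. indicator (box (- (real j *\<^sub>R One)) (real j *\<^sub>R One)) x *\<^sub>R w x = 0" for j :: nat
 proof -
  let ?B = "box (- (real j *\<^sub>R One)) (real j *\<^sub>R One) :: 'a set"
  let ?v = "%x. indicator ?B x *\<^sub>R w x"
  have iA: "set_integrable lborel A ?v" if "A \<in> sets borel" for A
   unfolding set_integrable_def by (rule integrable_mult_indicator[OF _ i]) (use that in simp)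
  have "(LINT x:A|lborel. ?v x) = 0" if "A \<in> sigma_sets UNIV (range (%(a, b). box a b))" for A
  proof (rule sigma_sets_induct_disjoint[OF _ _ that])
   show "Int_stable (range (%(a, b). box a b :: 'a set))" by (auto simp: Int_stable_def box_Int_box)
   show "range (%(a, b). box a b :: 'a set) \<subseteq> Pow UNIV" by simp
   show "(LINT x:A|lborel. ?v x) = 0" if A0: "A \<in> range (%(a, b). box a b)" for A
   proof -
    obtain a b where A: "A = box a b" using A0 by auto
    obtain c d where cd: "box a b \<inter> ?B = box c d" unfolding box_Int_box by blast
    have "(LINT x:A|lborel. ?v x) = (LINT x|lborel. indicator (box c d) x *\<^sub>R w x)"
     unfolding set_lebesgue_integral_def A cd[symmetric] by (intro lint_cong) (auto simp: indicator_def)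
    then show ?thesis using z by simp
   qed
   show "(LINT x:{}|lborel. ?v x) = 0" by (simp add: set_lebesgue_integral_def)
   have sb: "A \<in> sets borel" if "A \<in> sigma_sets UNIV (range (%(a, b). box a b :: 'a set))" for A :: "'a set"
    using that unfolding borel_eq_box by (simp add: sets_measure_of)
   show "(LINT x:UNIV - A|lborel. ?v x) = 0"
    if A: "A \<in> sigma_sets UNIV (range (%(a, b). box a b))" "(LINT x:A|lborel. ?v x) = 0" for A
   proof -
    have "(LINT x:A \<union> (UNIV - A)|lborel. ?v x) = (LINT x:A|lborel. ?v x) + (LINT x:UNIV - A|lborel. ?v x)"
     using sb[OF A(1)] by (intro set_integral_Un iA) auto
    moreover have "(LINT x:A \<union> (UNIV - A)|lborel. ?v x) = 0" using z by (simp add: set_lebesgue_integral_def)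
    ultimately show ?thesis using A by simp
   qed
   show "(LINT x:(\<Union>i. A i)|lborel. ?v x) = 0"
    if A: "disjoint_family A" "range A \<subseteq> sigma_sets UNIV (range (%(a, b). box a b))" "!!i. (LINT x:A i|lborel. ?v x) = 0" for A :: "nat => 'a set"
   proof -
    have m: "A i \<in> sets borel" for i using A(2) sb by blast
    have U: "(\<Union>i. A i) \<in> sets borel" using m by auto
    have "(LINT x:(\<Union>i. A i)|lborel. ?v x) = (\<Sum>i. LINT x:A i|lborel. ?v x)"
     by (rule lebesgue_integral_countable_add[OF _ _ iA[OF U]]) (use A(1) m in \<open>auto simp: disjoint_family_on_def\<close>)
    then show ?thesis using A(3) by simp
   qed
  qed
  then have "(LINT x:A|lborel. ?v x) = 0" if "A \<in> sets lborel" for A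
   using that unfolding sets_lborel borel_eq_box by (simp add: sets_measure_of)
  then show ?thesis using sigma_finite_measure.density_zero[OF lborel.sigma_finite_measure_axioms i] by blast
 qed
 have "AE x in lborel. \<forall>j. indicator (box (- (real j *\<^sub>R One)) (real j *\<^sub>R One)) x *\<^sub>R w x = 0"
  unfolding AE_all_countable using AEj by blast
 then show ?thesis
 proof eventually_elim
  case (elim x)
  obtain j :: nat where j: "norm x < real j" using reals_Archimedean2 by blast
  have "- real j < x \<bullet> i \<and> x \<bullet> i < real j" if "i \<in> Basis" for i
   using Basis_le_norm[OF that, of x] j by linarith
  then have "x \<in> box (- (real j *\<^sub>R One)) (real j *\<^sub>R One)"
   unfolding mem_box by (auto simp: inner_minus_left)
  then show ?case using spec[OF elim, of j] by simp
 qed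
qed

section \<open>Existence and uniqueness of the resolvent\<close>

lemma integrable_Lp_times_nice:
 assumes w: "w \<in> borel_Lp p" and p: "1 <= p" and F: "nice F" shows "integrable lborel (%y. w y * F y)"
proof -
 note [measurable] = borel_Lp_measurable[OF w] nice_measurable[OF F]
 obtain M where M: "0 <= M" "!!x. cmod (F x) <= M" using niceE[OF F] by metis
 show ?thesis
 proof (rule integrable_dominated)
  show "integrable lborel (%y. cmod (F y) + M * cmod (w y) powr p)"
   by (intro Bochner_Integration.integrable_add integrable_norm nice_integrable[OF F] integrable_mult_right borel_Lp_integrable[OF w])
  show "AE y in lborel. cmod (w y * F y) <= norm (cmod (F y) + M * cmod (w y) powr p)"
  proof (intro AE_I2)
   fix y
   have "cmod (w y) * cmod (F y) <= (1 + cmod (w y) powr p) * cmod (F y)" by (intro mult_right_mono le_1_plus_powr p) auto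
   also have "... <= cmod (F y) + M * cmod (w y) powr p" using mult_left_mono[OF M(2)[of y], of "cmod (w y) powr p"] by (simp add: algebra_simps)
   finally show "cmod (w y * F y) <= norm (cmod (F y) + M * cmod (w y) powr p)" by (simp add: norm_mult)
  qed
 qed measurable
qed

lemma conv_solves:
 fixes f :: "real^'k::finite => complex"
 assumes n: "2 <= CARD('k)" and k: "0 < Re \<kappa>" and f: "f \<in> borel_Lp p" and p: "1 <= p" and t: "test_function \<psi>"
 shows "(LINT x|lborel. conv (helmholtz_kernel \<kappa>) f x * helmholtz_op (- \<kappa>\<^sup>2) \<psi> x) = (LINT x|lborel. f x * \<psi> x)"
proof -
 let ?K = "helmholtz_kernel \<kappa> :: real^'k => complex" and ?c = "helmholtz_op (- \<kappa>\<^sup>2) \<psi>"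
 note K = integrable_helmholtz_kernel[OF n k]
 note c = nice_helmholtz_op[OF t, of "- \<kappa>\<^sup>2"]
 have Km [measurable]: "?K \<in> borel_measurable borel" using borel_measurable_integrable[OF K] by simp
 note [measurable] = borel_Lp_measurable[OF f] nice_measurable[OF c]
 obtain M where M: "0 <= M" "!!x. cmod (?c x) <= M" using niceE[OF c] by metis
 have "(LINT x|lborel. conv ?K f x * ?c x) = (LINT x|lborel. LINT y|lborel. ?K (x - y) * f y * ?c x)"
  unfolding conv_def by (simp only: integral_mult_left_zero)
 also have "... = (LINT y|lborel. LINT x|lborel. ?K (x - y) * f y * ?c x)"
 proof (rule lborel_pair.Fubini_integral[symmetric], rule integrable_dominated)
  let ?G = "%x y. cmod (?K (x - y) * ?c x) + M * cmod (?K (x - y) * of_real (cmod (f y) powr p))"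
  have "integrable lborel2 (%z. cmod (case z of (x, y) => ?K (x - y) * ?c x) + M * cmod (case z of (x, y) => ?K (x - y) * of_real (cmod (f y) powr p)))"
   by (intro Bochner_Integration.integrable_add integrable_mult_right integrable_norm integrable_convolution_pair K nice_integrable c integrable_of_real borel_Lp_integrable[OF f])
  then show "integrable lborel2 (%(x, y). ?G x y)" by (simp only: case_prod_unfold)
  show "AE z in lborel \<Otimes>\<^sub>M lborel. norm (case z of (x, y) => ?K (x - y) * f y * ?c x) <= norm (case z of (x, y) => ?G x y)"
  proof (intro AE_I2)
   fix z :: "(real^'k) \<times> (real^'k)"
   obtain x y where z: "z = (x, y)" by (cases z)
   have "cmod (?K (x - y)) * cmod (f y) * cmod (?c x) <= cmod (?K (x - y)) * (1 + cmod (f y) powr p) * cmod (?c x)"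
    by (intro mult_right_mono mult_left_mono le_1_plus_powr p) auto
   also have "... = cmod (?K (x - y)) * cmod (?c x) + cmod (?c x) * (cmod (?K (x - y)) * cmod (f y) powr p)" by (simp only: distrib_left distrib_right mult_1_right mult_ac)
   also have "... <= cmod (?K (x - y)) * cmod (?c x) + M * (cmod (?K (x - y)) * cmod (f y) powr p)"
    by (intro add_left_mono mult_right_mono M mult_nonneg_nonneg) auto
   finally have "cmod (?K (x - y) * f y * ?c x) <= ?G x y" unfolding norm_mult norm_of_real abs_of_nonneg[OF powr_ge_zero] .
   then show "norm (case z of (x, y) => ?K (x - y) * f y * ?c x) <= norm (case z of (x, y) => ?G x y)"
    unfolding z prod.case real_norm_def using abs_ge_self order_trans by blast
  qed
 qed measurable
 also have "... = (LINT y|lborel. f y * \<psi> y)"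
 proof (rule lint_cong[OF refl])
  fix y
  have "(LINT x|lborel. ?K (x - y) * f y * ?c x) = (LINT x|lborel. f y * (?K (x - y) * ?c x))"
   by (simp only: mult_ac)
  also have "... = f y * (LINT x|lborel. ?K (x - y) * ?c x)" by (rule integral_mult_right_zero)
  also have "(LINT x|lborel. ?K (x - y) * ?c x) = (LINT h|lborel. ?K h * ?c (y + h))"
   using integral_lborel_shift[of "%h. ?K h * ?c (y + h)" "- y"] by simp
  also have "... = \<psi> y" by (rule helmholtz_kernel_inverts[OF n k t])
  finally show "(LINT x|lborel. ?K (x - y) * f y * ?c x) = f y * \<psi> y" .
 qed
 finally show ?thesis .
qed

text \<open>Represent \<open>\<theta>\<close> through the fundamental solution. By Fubini the pairing becomes an average of pairings of \<open>w\<close>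
 with the equation applied to translates of \<open>\<theta>\<close>, and these vanish.\<close>
lemma homogeneous_solution_pairing:
 fixes w :: "real^'k::finite => complex"
 assumes n: "2 <= CARD('k)" and k: "0 < Re \<kappa>" and w: "w \<in> borel_Lp p" and p: "1 <= p" and t: "test_function \<theta>"
  and hom: "!!\<psi>. test_function \<psi> ==> (LINT x|lborel. w x * helmholtz_op (- \<kappa>\<^sup>2) \<psi> x) = 0"
 shows "(LINT x|lborel. w x * \<theta> x) = 0"
proof -
 let ?K = "helmholtz_kernel \<kappa> :: real^'k => complex" and ?c = "helmholtz_op (- \<kappa>\<^sup>2) \<theta>"
 note K = integrable_helmholtz_kernel[OF n k]
 note c = nice_helmholtz_op[OF t, of "- \<kappa>\<^sup>2"]
 have Km [measurable]: "?K \<in> borel_measurable borel" using borel_measurable_integrable[OF K] by simp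
 note [measurable] = borel_Lp_measurable[OF w] nice_measurable[OF c]
 obtain M where M: "0 <= M" "!!x. cmod (?c x) <= M" using niceE[OF c] by metis
 have "(LINT y|lborel. w y * \<theta> y) = (LINT y|lborel. LINT h|lborel. w y * (?K h * ?c (y - h)))"
 proof (rule lint_cong[OF refl])
  fix y
  have "(LINT h|lborel. ?K h * ?c (y - h)) = (LINT h|lborel. ?K h * ?c (y + h))"
   using integral_lborel_uminus[of "%h. ?K h * ?c (y + h)"] by (simp add: helmholtz_kernel_uminus)
  then show "w y * \<theta> y = (LINT h|lborel. w y * (?K h * ?c (y - h)))"
   unfolding integral_mult_right_zero helmholtz_kernel_inverts[OF n k t] by simp
 qed
 also have "... = (LINT h|lborel. LINT y|lborel. w y * (?K h * ?c (y - h)))"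
 proof (rule lborel_pair.Fubini_integral, rule integrable_dominated)
  let ?G = "%h y. cmod (?c (y - h) * ?K h) + M * cmod (?K h * of_real (cmod (w y) powr p))"
  have "integrable lborel2 (%z. cmod (case z of (h, y) => ?c (y - h) * ?K h) + M * cmod (case z of (h, y) => ?K h * of_real (cmod (w y) powr p)))"
   by (intro Bochner_Integration.integrable_add integrable_mult_right integrable_norm integrable_convolution_pair(2) integrable_pair_mult K nice_integrable c integrable_of_real borel_Lp_integrable[OF w])
  then show "integrable lborel2 (%(h, y). ?G h y)" by (simp only: case_prod_unfold)
  show "AE z in lborel \<Otimes>\<^sub>M lborel. norm (case z of (h, y) => w y * (?K h * ?c (y - h))) <= norm (case z of (h, y) => ?G h y)"
  proof (intro AE_I2)
   fix z :: "(real^'k) \<times> (real^'k)"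
   obtain h y where z: "z = (h, y)" by (cases z)
   have "cmod (w y) * (cmod (?K h) * cmod (?c (y - h))) <= (1 + cmod (w y) powr p) * (cmod (?K h) * cmod (?c (y - h)))"
    by (intro mult_right_mono le_1_plus_powr p) auto
   also have "... = cmod (?c (y - h)) * cmod (?K h) + cmod (?c (y - h)) * (cmod (?K h) * cmod (w y) powr p)" by (simp only: distrib_left distrib_right mult_1_left mult_ac)
   also have "... <= cmod (?c (y - h)) * cmod (?K h) + M * (cmod (?K h) * cmod (w y) powr p)"
    by (intro add_left_mono mult_right_mono M mult_nonneg_nonneg) auto
   finally have "cmod (w y * (?K h * ?c (y - h))) <= ?G h y" unfolding norm_mult norm_of_real abs_of_nonneg[OF powr_ge_zero] .
   then show "norm (case z of (h, y) => w y * (?K h * ?c (y - h))) <= norm (case z of (h, y) => ?G h y)"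
    unfolding z prod.case real_norm_def using abs_ge_self order_trans by blast
  qed
 qed measurable
 also have "... = (LINT h|(lborel :: (real^'k) measure). 0)"
 proof (rule lint_cong[OF refl])
  fix h :: "real^'k"
  have "(LINT y|lborel. w y * (?K h * ?c (y - h))) = (LINT y|lborel. ?K h * (w y * ?c (y - h)))" by (simp only: mult_ac)
  also have "... = ?K h * (LINT y|lborel. w y * ?c (y - h))" by (rule integral_mult_right_zero)
  also have "(LINT y|lborel. w y * ?c (y - h)) = 0"
   using hom[OF test_function_translate(1)[OF t, of h]] unfolding test_function_translate(2)[OF t] .
  finally show "(LINT y|lborel. w y * (?K h * ?c (y - h))) = 0" by simp
 qed
 finally show ?thesis by simp
qed

text \<open>Test with smooth approximations of indicators of boxes.\<close>
lemma homogeneous_solution_zero: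
 fixes w :: "real^'k::finite => complex"
 assumes n: "2 <= CARD('k)" and k: "0 < Re \<kappa>" and w: "w \<in> borel_Lp p" and p: "1 <= p"
  and hom: "!!\<psi>. test_function \<psi> ==> (LINT x|lborel. w x * helmholtz_op (- \<kappa>\<^sup>2) \<psi> x) = 0"
 shows "AE x in lborel. w x = 0"
proof (rule AE_zero_if_box_integrals_zero)
 note [measurable] = borel_Lp_measurable[OF w]
 fix a b :: "real^'k"
 have [measurable]: "box a b \<in> sets borel" by simp
 have nb: "nice (%x. indicator (box a b) x *\<^sub>R (1::complex))"
 proof -
  obtain R where R: "!!x. x \<in> box a b ==> norm x <= R" using bounded_box bounded_iff by metis
  show ?thesis
  proof (rule niceI)
   show "(%x. indicator (box a b) x *\<^sub>R (1::complex)) \<in> borel_measurable borel" by measurable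
   show "norm (indicator (box a b) x *\<^sub>R (1::complex)) <= 1" for x by (simp add: indicator_def)
   show "indicator (box a b) x *\<^sub>R (1::complex) = 0" if "R < norm x" for x using R[of x] that by (auto simp: indicator_def)
  qed
 qed
 have i: "integrable lborel (%x. w x * (indicator (box a b) x *\<^sub>R 1))" by (rule integrable_Lp_times_nice[OF w p nb])
 then show "integrable lborel (%x. indicator (box a b) x *\<^sub>R w x)" by (simp add: scaleR_conv_of_real mult.commute)
 note tb = test_function_box_cutoff[of a b]
 have "(%j. LINT x|lborel. w x * of_real (box_cutoff a b j x)) \<longlonglongrightarrow> (LINT x|lborel. indicator (box a b) x *\<^sub>R w x)"
 proof (rule integral_dominated_convergence)
  show "(%x. w x * of_real (box_cutoff a b j x)) \<in> borel_measurable lborel" for j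
   using nice_measurable[OF test_function_nice[OF tb[of j]]] by measurable
  show "integrable lborel (%x. cmod (w x * (indicator (box a b) x *\<^sub>R 1)))" by (rule integrable_norm[OF i])
  show "AE x in lborel. (%j. w x * of_real (box_cutoff a b j x)) \<longlonglongrightarrow> indicator (box a b) x *\<^sub>R w x"
  proof (intro AE_I2)
   fix x
   have "(%j. w x * of_real (box_cutoff a b j x)) \<longlonglongrightarrow> w x * of_real (indicator (box a b) x)"
    by (intro tendsto_intros box_cutoff_tendsto)
   then show "(%j. w x * of_real (box_cutoff a b j x)) \<longlonglongrightarrow> indicator (box a b) x *\<^sub>R w x"
    by (simp add: scaleR_conv_of_real mult.commute)
  qed
  show "AE x in lborel. norm (w x * of_real (box_cutoff a b j x)) <= cmod (w x * (indicator (box a b) x *\<^sub>R 1))" for j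
  proof (intro AE_I2)
   fix x
   show "norm (w x * of_real (box_cutoff a b j x)) <= cmod (w x * (indicator (box a b) x *\<^sub>R 1))"
    using box_cutoff_bounds[of a b j x] by (cases "x \<in> box a b") (auto simp: norm_mult box_cutoff_eq_0 intro!: mult_left_le)
  qed
 qed measurable
 moreover have "(LINT x|lborel. w x * of_real (box_cutoff a b j x)) = 0" for j
  by (rule homogeneous_solution_pairing[OF n k w p tb]) (rule hom)
 ultimately have "(%j. 0) \<longlonglongrightarrow> (LINT x|lborel. indicator (box a b) x *\<^sub>R w x)" by simp
 then show "(LINT x|lborel. indicator (box a b) x *\<^sub>R w x) = 0" using LIMSEQ_unique tendsto_const by blast
qed

lemma borel_Lp_imp_Lp:
 assumes "f \<in> borel_Lp p" shows "f \<in> Lp p UNIV" "Lp_norm p UNIV f = lp_norm p f"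
proof -
 note [measurable] = borel_Lp_measurable[OF assms]
 have m: "(%x. cmod (f x) powr p) \<in> borel_measurable lborel" by measurable
 have "integrable lebesgue (%x. cmod (f x) powr p)" using borel_Lp_integrable[OF assms] by (simp add: integrable_completion[OF m])
 moreover have "f \<in> borel_measurable lebesgue" by (rule measurable_completion) measurable
 ultimately show "f \<in> Lp p UNIV" by (simp add: Lp_def set_borel_measurable_def set_integrable_def)
 show "Lp_norm p UNIV f = lp_norm p f" by (simp add: Lp_norm_def lp_norm_def set_lebesgue_integral_def integral_completion[OF m])
qed

lemma Lp_representative:
 fixes f :: "'a::euclidean_space => complex"
 assumes "f \<in> Lp p UNIV"
 obtains g where "g \<in> borel_Lp p" "AE x in lebesgue. f x = g x" "lp_norm p g = Lp_norm p UNIV f"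
proof -
 have fm [measurable]: "f \<in> borel_measurable lebesgue" and fi: "integrable lebesgue (%x. cmod (f x) powr p)"
  using assms by (simp_all add: Lp_def set_borel_measurable_def set_integrable_def)
 have "(%x. Re (f x)) \<in> borel_measurable lebesgue" "(%x. Im (f x)) \<in> borel_measurable lebesgue" by measurable
 then obtain r s where [measurable]: "r \<in> borel_measurable lborel" "s \<in> borel_measurable lborel"
  and ae: "AE x in lborel. Re (f x) = r x" "AE x in lborel. Im (f x) = s x"
  using completion_ex_borel_measurable_real by metis
 define g where "g x = Complex (r x) (s x)" for x
 have gm [measurable]: "g \<in> borel_measurable borel" unfolding g_def[abs_def] borel_measurable_complex_iff by simp
 have "AE x in lborel. f x = g x" using ae by eventually_elim (simp add: g_def complex_eq_iff)
 then have AE: "AE x in lebesgue. f x = g x" by (rule AE_completion)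
 have gl: "(%x. cmod (g x) powr p) \<in> borel_measurable lborel" by measurable
 have glm [measurable]: "g \<in> borel_measurable lebesgue" by (rule measurable_completion) measurable
 have AEp: "AE x in lebesgue. cmod (f x) powr p = cmod (g x) powr p" using AE by eventually_elim simp
 have "integrable lebesgue (%x. cmod (g x) powr p)"
  by (rule integrable_cong_AE_imp[OF fi _ AEp]) measurable
 then have "integrable lborel (%x. cmod (g x) powr p)" by (simp add: integrable_completion[OF gl])
 then have gB: "g \<in> borel_Lp p" by (simp add: borel_Lp_def gm)
 have "(LINT x|lebesgue. cmod (f x) powr p) = (LINT x|lebesgue. cmod (g x) powr p)"
  by (rule integral_cong_AE[OF _ _ AEp]) measurable
 then have "lp_norm p g = Lp_norm p UNIV f"
  by (simp add: Lp_norm_def lp_norm_def set_lebesgue_integral_def integral_completion[OF gl])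
 then show ?thesis using that gB AE by blast
qed

lemma lebesgue_pairing:
 fixes f g c :: "'a::euclidean_space => complex"
 assumes "f \<in> borel_measurable lebesgue" "AE x in lebesgue. f x = g x" "g \<in> borel_measurable borel" "c \<in> borel_measurable borel"
 shows "(LINT x|lebesgue. f x * c x) = (LINT x|lborel. g x * c x)"
proof -
 note [measurable] = assms(1,3,4)
 have [measurable]: "g \<in> borel_measurable lebesgue" "c \<in> borel_measurable lebesgue" by (rule measurable_completion, measurable)+
 have "(LINT x|lebesgue. f x * c x) = (LINT x|lebesgue. g x * c x)"
  by (rule integral_cong_AE) (use assms(2) in \<open>auto elim!: eventually_mono\<close>)
 also have "... = (LINT x|lborel. g x * c x)" by (rule integral_completion) measurable
 finally show ?thesis .
qed

lemma helmholtz_solution_iff: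
 fixes f u f' u' :: "real^'k::finite => complex"
 assumes u: "u \<in> Lp p UNIV" "AE x in lebesgue. u x = u' x" "u' \<in> borel_Lp p"
  and f: "f \<in> Lp p UNIV" "AE x in lebesgue. f x = f' x" "f' \<in> borel_Lp p"
 shows "helmholtz_solution z f u \<longleftrightarrow> (\<forall>\<psi>. test_function \<psi> --> (LINT x|lborel. u' x * helmholtz_op z \<psi> x) = (LINT x|lborel. f' x * \<psi> x))"
proof -
 have m: "u \<in> borel_measurable lebesgue" "f \<in> borel_measurable lebesgue"
  using u(1) f(1) by (simp_all add: Lp_def set_borel_measurable_def)
 have "(LINT x|lebesgue. u x * (- laplacian \<psi> x - z * \<psi> x)) = (LINT x|lborel. u' x * helmholtz_op z \<psi> x)"
  "(LINT x|lebesgue. f x * \<psi> x) = (LINT x|lborel. f' x * \<psi> x)" if t: "test_function \<psi>" for \<psi>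
  using lebesgue_pairing[OF m(1) u(2) borel_Lp_measurable[OF u(3)] nice_measurable[OF nice_helmholtz_op[OF t, of z]]]
   lebesgue_pairing[OF m(2) f(2) borel_Lp_measurable[OF f(3)] nice_measurable[OF test_function_nice[OF t]]]
  by (simp_all only: helmholtz_op_def)
 then show ?thesis unfolding helmholtz_solution_def by auto
qed

text \<open>The operator norm concerns the chosen solution; by uniqueness it agrees almost everywhere with the
 convolution, for which the bound is known.\<close>
lemma resolvent_bound:
 assumes pq: "1 < p" "1 < q" "1 / p + 1 / q = 1" and n: "2 <= CARD('k::finite)" and k: "0 < Re \<kappa>" and B: "0 <= B"
  and form: "!!f g. nice f ==> nice g ==> cmod (LINT h|lborel. helmholtz_kernel \<kappa> h * corr f g (h :: real^'k)) <= B * (lp_norm p f * lp_norm q g)"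
 shows "resolvent_exists TYPE('k) p (- \<kappa>\<^sup>2)"
  and "Lp_operator_norm p (resolvent p (- \<kappa>\<^sup>2) :: (real^'k => complex) => _) <= ennreal B"
proof -
 let ?z = "- \<kappa>\<^sup>2" and ?K = "helmholtz_kernel \<kappa> :: real^'k => complex"
 note K = integrable_helmholtz_kernel[OF n k]
 note conv = conv_Lp_bound[OF pq K _ B form]
 have p1: "1 <= p" using pq by simp
 have sol: "\<exists>u. u \<in> borel_Lp p \<and> lp_norm p u <= B * Lp_norm p UNIV f \<and> helmholtz_solution ?z f u"
  if f: "f \<in> Lp p (UNIV :: (real^'k) set)" for f
 proof -
  obtain f' where f': "f' \<in> borel_Lp p" "AE x in lebesgue. f x = f' x" "lp_norm p f' = Lp_norm p UNIV f"
   using Lp_representative[OF f] by blast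
  note u = conv[OF f'(1)]
  have "helmholtz_solution ?z f (conv ?K f')"
   using conv_solves[OF n k f'(1) p1]
   by (subst helmholtz_solution_iff[OF borel_Lp_imp_Lp(1)[OF u(1)] _ u(1) f f'(2,1)]) auto
  then show ?thesis using u f'(3) by auto
 qed
 have uniq: "AE x in lebesgue. u x = v x"
  if f: "f \<in> Lp p (UNIV :: (real^'k) set)" and u: "u \<in> Lp p UNIV" and v: "v \<in> Lp p UNIV"
   and s: "helmholtz_solution ?z f u" "helmholtz_solution ?z f v" for f u v
 proof -
  obtain f' where f': "f' \<in> borel_Lp p" "AE x in lebesgue. f x = f' x" using Lp_representative[OF f] by blast
  obtain u' where u': "u' \<in> borel_Lp p" "AE x in lebesgue. u x = u' x" using Lp_representative[OF u] by blast
  obtain v' where v': "v' \<in> borel_Lp p" "AE x in lebesgue. v x = v' x" using Lp_representative[OF v] by blast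
  note [measurable] = borel_Lp_measurable[OF u'(1)] borel_Lp_measurable[OF v'(1)]
  have w: "(%x. u' x - v' x) \<in> borel_Lp p"
  proof -
   have "integrable lborel (%x. cmod (u' x - v' x) powr p)"
   proof (rule integrable_dominated)
    show "integrable lborel (%x. 2 powr p * (cmod (u' x) powr p + cmod (v' x) powr p))"
     by (intro integrable_mult_right Bochner_Integration.integrable_add borel_Lp_integrable u'(1) v'(1))
    show "AE x in lborel. norm (cmod (u' x - v' x) powr p) <= norm (2 powr p * (cmod (u' x) powr p + cmod (v' x) powr p))"
    proof (intro AE_I2)
     fix x
     have "cmod (u' x - v' x) <= 2 * max (cmod (u' x)) (cmod (v' x))" using norm_triangle_ineq4[of "u' x" "v' x"] by linarith
     then have "cmod (u' x - v' x) powr p <= (2 * max (cmod (u' x)) (cmod (v' x))) powr p" using p1 by (intro powr_mono2) auto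
     also have "... = 2 powr p * max (cmod (u' x)) (cmod (v' x)) powr p" by (simp add: powr_mult)
     also have "... <= 2 powr p * (cmod (u' x) powr p + cmod (v' x) powr p)" by (intro mult_left_mono) (auto simp: max_def)
     finally show "norm (cmod (u' x - v' x) powr p) <= norm (2 powr p * (cmod (u' x) powr p + cmod (v' x) powr p))" by simp
    qed
   qed measurable
   then show ?thesis by (simp add: borel_Lp_def)
  qed
  have "AE x in lborel. u' x - v' x = 0"
  proof (rule homogeneous_solution_zero[OF n k w p1])
   fix \<psi> :: "real^'k => complex" assume t: "test_function \<psi>"
   note c = nice_helmholtz_op[OF t, of ?z]
   have "(LINT x|lborel. (u' x - v' x) * helmholtz_op ?z \<psi> x) = (LINT x|lborel. u' x * helmholtz_op ?z \<psi> x) - (LINT x|lborel. v' x * helmholtz_op ?z \<psi> x)"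
    unfolding left_diff_distrib by (intro Bochner_Integration.integral_diff integrable_Lp_times_nice[OF _ p1 c] u'(1) v'(1))
   also have "... = 0"
    using s t unfolding helmholtz_solution_iff[OF u u'(2,1) f f'(2,1)] helmholtz_solution_iff[OF v v'(2,1) f f'(2,1)] by simp
   finally show "(LINT x|lborel. (u' x - v' x) * helmholtz_op ?z \<psi> x) = 0" .
  qed
  then have "AE x in lebesgue. u' x - v' x = 0" by (rule AE_completion)
  with u'(2) v'(2) show ?thesis by eventually_elim simp
 qed
 show "resolvent_exists TYPE('k) p ?z"
  unfolding resolvent_exists_def using sol borel_Lp_imp_Lp(1) uniq by blast
 show "Lp_operator_norm p (resolvent p ?z :: (real^'k => complex) => _) <= ennreal B"
  unfolding Lp_operator_norm_def
 proof (rule SUP_least)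
  fix f :: "real^'k => complex" assume "f \<in> {f \<in> Lp p UNIV. Lp_norm p UNIV f <= 1}"
  then have f: "f \<in> Lp p UNIV" "Lp_norm p UNIV f <= 1" by auto
  let ?u = "resolvent p ?z f"
  obtain v where v: "v \<in> borel_Lp p" "lp_norm p v <= B * Lp_norm p UNIV f" "helmholtz_solution ?z f v" using sol[OF f(1)] by blast
  note vL = borel_Lp_imp_Lp[OF v(1)]
  have u: "?u \<in> Lp p UNIV \<and> helmholtz_solution ?z f ?u"
   unfolding resolvent_def by (rule someI[of "%u. u \<in> Lp p UNIV \<and> helmholtz_solution ?z f u" v]) (simp add: vL v)
  have AE: "AE x in lebesgue. ?u x = v x" using uniq[OF f(1) _ vL(1)] u v(3) by blast
  have [measurable]: "?u \<in> borel_measurable lebesgue" "v \<in> borel_measurable lebesgue"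
   using u vL(1) by (simp_all add: Lp_def set_borel_measurable_def)
  have "(LINT x|lebesgue. cmod (?u x) powr p) = (LINT x|lebesgue. cmod (v x) powr p)"
   by (rule integral_cong_AE) (use AE in \<open>auto elim!: eventually_mono\<close>)
  then have "Lp_norm p UNIV ?u = lp_norm p v" unfolding vL(2)[symmetric] by (simp add: Lp_norm_def set_lebesgue_integral_def)
  also have "... <= B * 1" using v(2) mult_left_mono[OF f(2) B] by linarith
  finally show "ennreal (Lp_norm p UNIV ?u) <= ennreal B" by (simp add: ennreal_leI)
 qed
qed

section \<open>The resolvent estimate\<close>

lemma closed_nonneg_axis: "closed nonneg_axis"
proof -
 have "nonneg_axis = \<real>\<^sub>\<ge>\<^sub>0" by (auto simp: nonneg_axis_def nonneg_Reals_def)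
 then show ?thesis by simp
qed

text \<open>Compare with the point \<open>(Im \<kappa>)\<^sup>2\<close> of the half line.\<close>
lemma infdist_nonneg_axis_le: "infdist (- \<kappa>\<^sup>2) nonneg_axis <= 3 * (cmod \<kappa> * \<bar>Re \<kappa>\<bar>)"
proof -
 let ?a = "Re \<kappa>" and ?b = "Im \<kappa>"
 have "infdist (- \<kappa>\<^sup>2) nonneg_axis <= dist (- \<kappa>\<^sup>2) (of_real (?b\<^sup>2))"
  unfolding nonneg_axis_def by (intro infdist_le imageI) simp
 also have "... = cmod (of_real ?a * (- of_real ?a - 2 * \<i> * of_real ?b))"
  unfolding dist_norm by (rule arg_cong[of _ _ cmod]) (simp add: complex_eq_iff power2_eq_square algebra_simps)
 also have "... <= \<bar>?a\<bar> * (cmod \<kappa> + 2 * cmod \<kappa>)"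
 proof -
  have "cmod (- of_real ?a - 2 * \<i> * of_real ?b) <= \<bar>?a\<bar> + 2 * \<bar>?b\<bar>"
   using norm_triangle_ineq4[of "- of_real ?a" "2 * \<i> * of_real ?b"] by (simp add: norm_mult)
  also have "... <= cmod \<kappa> + 2 * cmod \<kappa>" by (intro add_mono mult_left_mono abs_Re_le_cmod abs_Im_le_cmod) simp
  finally show ?thesis unfolding norm_mult norm_of_real by (rule mult_left_mono) simp
 qed
 finally show ?thesis by (simp add: algebra_simps)
qed

lemma square_root_right_half_plane:
 assumes "z \<notin> nonneg_axis" obtains \<kappa> where "- \<kappa>\<^sup>2 = z" "0 < Re \<kappa>"
proof -
 define k where "k = csqrt (- z)"
 have k: "- k\<^sup>2 = z" by (simp add: k_def)
 have "Re k \<noteq> 0"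
 proof
  assume "Re k = 0"
  then have "z = of_real ((Im k)\<^sup>2)" unfolding k[symmetric] by (simp add: complex_eq_iff power2_eq_square)
  then show False using assms unfolding nonneg_axis_def by (metis atLeast_iff image_eqI zero_le_power2)
 qed
 then have "0 < Re k" using csqrt_principal[of "- z"] unfolding k_def by auto
 then show ?thesis using that k by blast
qed

text \<open>On the diagonal the maximum is attained by the third entry: it exceeds 1 exactly for \<open>p > 2n/(n - 1)\<close>.\<close>
lemma resolvent_exponent_diagonal:
 assumes n: "2 <= n" and p: "p > 2 * real n / (real n - 1)"
 shows "2 < p" and "1 < (real n + 1) / 2 - real n / p" and "resolvent_exponent n p p = (real n + 1) / 2 - real n / p"
proof -
 have n1: "0 < real n - 1" using n by simp
 have "2 <= 2 * real n / (real n - 1)" using n1 by (simp add: field_simps)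
 then show p2: "2 < p" using p by simp
 have "2 * real n < p * (real n - 1)" using p n1 by (simp add: pos_divide_less_eq)
 then have "real n / p < (real n - 1) / 2" using p2 by (simp add: field_simps)
 then show g: "1 < (real n + 1) / 2 - real n / p" by (simp add: field_simps)
 have M: "Max {0, 1, c, d} = c" if "1 <= c" "d <= c" for c d :: real
  using that by (intro Max_eqI) auto
 have le: "real n / p - (real n - 1) / 2 <= (real n + 1) / 2 - real n / p"
 proof -
  have "X - (N - 1) / 2 <= (N + 1) / 2 - X" if "1 < (N + 1) / 2 - X" for X N :: real
   using that by (simp add: field_simps)
  from this[OF g] show ?thesis .
 qed
 have "1 - (real n + 1) / 2 * (1 / p - 1 / p) = 1" by simp
 then show "resolvent_exponent n p p = (real n + 1) / 2 - real n / p"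
  unfolding resolvent_exponent_def by (simp only: M[OF less_imp_le[OF g] le])
qed

theorem theorem2p7:
  fixes n :: nat and p :: real
  assumes n_def: "n = CARD('m::finite option)"
    and n: "n \<ge> 2"
    and p: "p > 2 * real n / (real n - 1)"
    and hyp: "\<And>a \<phi> :: 'm phase_space \<Rightarrow> real.
      hormander_type a \<phi> \<Longrightarrow> convex_condition a \<phi> \<Longrightarrow> straight_condition \<phi> \<Longrightarrow>
      \<exists>C. \<forall>l \<ge> 1. \<forall>f \<in> Lp p (ball 0 1).
        T_op a \<phi> l f \<in> Lp p UNIV \<and>
        Lp_norm p UNIV (T_op a \<phi> l f) \<le> C * Lp_norm p (ball 0 1) f"
  shows "\<exists>C. \<forall>z. z \<notin> nonneg_axis \<longrightarrow>
    resolvent_exists TYPE('m option) p z \<and>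
    Lp_operator_norm p (resolvent p z :: (real ^ ('m option) \<Rightarrow> complex) \<Rightarrow> _)
      \<le> ennreal (C * cmod z powr (- 1 + resolvent_exponent n p p)
                   * infdist z nonneg_axis powr (- resolvent_exponent n p p))"
proof -
 let ?\<gamma> = "(real n + 1) / 2 - real n / p" and ?\<beta> = "real n / p"
 note ex = resolvent_exponent_diagonal[OF n p]
 define q where "q = p / (p - 1)"
 have pq: "1 < p" "1 < q" "1 / p + 1 / q = 1" using ex(1) by (auto simp: q_def field_simps)
 \<comment> \<open>small enough for the support of the amplitude to fit into the unit balls\<close>
 define e where "e = 1 / (9 * real n)"
 have e: "0 < e" "e * (9 * real CARD('m option)) <= 1" using n unfolding n_def[symmetric] e_def by auto
 \<comment> \<open>\<open>N = n + 1\<close> is admissible in \<open>damped_kernel_bound\<close> because \<open>n/p + 1 \<le> n + 1\<close>\<close>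
 note amp = amplitude_amp[OF e, of "n + 1"]
 obtain C0 where C0: "\<forall>l \<ge> 1. \<forall>f \<in> Lp p (ball 0 1).
    T_op (amp e (n + 1)) (phase e) l f \<in> Lp p (UNIV :: (real^('m option)) set) \<and>
    Lp_norm p UNIV (T_op (amp e (n + 1)) (phase e) l f) <= C0 * Lp_norm p (ball 0 1) f"
  using hyp[OF hormander_phase[OF e(1) amp] straight_condition_phase[OF e(1)]] by blast
 have \<beta>: "0 <= ?\<beta>" "?\<beta> + 1 <= real (n + 1)" using ex(1) n by (auto simp: field_simps)
 have b: "- real CARD('m option) / p = - ?\<beta>" unfolding n_def by (rule minus_divide_left[symmetric])
 have "\<exists>C\<ge>0. \<forall>\<omega> f g. nice f --> nice g -->
  cmod (LINT h|lborel. osc_kernel (n + 1) \<omega> h * corr f g (h :: real^('m option)))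
   <= C * (1 + \<bar>\<omega>\<bar>) powr (- ?\<beta>) * (lp_norm p f * lp_norm q g)"
  unfolding b[symmetric] by (rule osc_kernel_bound[OF e(1) pq]) (use C0 in blast)
 then obtain C1 where C1: "0 <= C1" "!!\<omega> f g. nice f ==> nice g ==>
  cmod (LINT h|lborel. osc_kernel (n + 1) \<omega> h * corr f g (h :: real^('m option)))
   <= C1 * (1 + \<bar>\<omega>\<bar>) powr (- ?\<beta>) * (lp_norm p f * lp_norm q g)" by blast
 obtain D where D: "0 <= D" "!!\<sigma> \<omega> f g. 0 <= \<sigma> ==> nice f ==> nice g ==>
  cmod (LINT h|lborel. damped_kernel \<sigma> \<omega> h * corr f g (h :: real^('m option)))
   <= D * exp (- \<sigma> / 2) * (1 + \<bar>\<omega>\<bar>) powr (- ?\<beta>) * (lp_norm p f * lp_norm q g)"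
  using damped_kernel_bound[OF pq \<beta> C1] by blast
 have n2: "2 <= CARD('m option)" using n n_def by (simp only:)
 have g: "?\<gamma> = 2 + kernel_order CARD('m option) - ?\<beta>" unfolding n_def[symmetric] kernel_order_def by (simp add: field_simps)
 obtain C where C: "0 <= C" "!!\<kappa> f g. 0 < Re \<kappa> ==> nice f ==> nice g ==>
  cmod (LINT h|lborel. helmholtz_kernel \<kappa> h * corr f g (h :: real^('m option)))
   <= C * ((cmod \<kappa>) powr (-2) * (cmod \<kappa> / Re \<kappa>) powr ?\<gamma>) * (lp_norm p f * lp_norm q g)"
  using helmholtz_form_bound[OF pq D(1) \<beta>(1) n2 g ex(2) D(2)] by blast
 have "resolvent_exists TYPE('m option) p z \<and>
  Lp_operator_norm p (resolvent p z :: (real ^ ('m option) => complex) => _)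
   <= ennreal (C * 3 powr ?\<gamma> * cmod z powr (- 1 + ?\<gamma>) * infdist z nonneg_axis powr (- ?\<gamma>))"
  if z: "z \<notin> nonneg_axis" for z
 proof -
  obtain \<kappa> where k: "- \<kappa>\<^sup>2 = z" "0 < Re \<kappa>" by (rule square_root_right_half_plane[OF z])
  let ?d = "infdist z nonneg_axis"
  have nk: "0 < cmod \<kappa>" using k(2) by auto
  have d: "0 < ?d"
   by (rule infdist_pos_not_in_closed[OF closed_nonneg_axis _ z]) (auto simp: nonneg_axis_def)
  have d3: "?d <= 3 * (cmod \<kappa> * Re \<kappa>)" using infdist_nonneg_axis_le[of \<kappa>] k by simp
  have cz: "cmod z = (cmod \<kappa>)\<^sup>2" unfolding k(1)[symmetric] by (simp add: norm_power)
  have "cmod \<kappa> / Re \<kappa> <= 3 * cmod z / ?d"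
  proof -
   have "cmod \<kappa> * ?d <= cmod \<kappa> * (3 * (cmod \<kappa> * Re \<kappa>))" by (intro mult_left_mono d3) simp
   then show ?thesis using d k(2) by (simp add: cz power2_eq_square field_simps)
  qed
  then have "(cmod \<kappa> / Re \<kappa>) powr ?\<gamma> <= (3 * cmod z / ?d) powr ?\<gamma>"
   by (rule powr_mono2[rotated 2]) (use ex(2) k(2) in linarith, use k(2) in simp)
  also have "... = 3 powr ?\<gamma> * cmod z powr ?\<gamma> * ?d powr (- ?\<gamma>)"
  proof -
   have "(3 * x / y) powr c = 3 powr c * x powr c * y powr (- c)" if "0 < y" "0 <= x" for x y c :: real
    using that by (simp add: powr_divide powr_mult powr_minus_divide)
   from this[OF d norm_ge_zero] show ?thesis .
  qed
  finally have r: "(cmod \<kappa> / Re \<kappa>) powr ?\<gamma> <= 3 powr ?\<gamma> * cmod z powr ?\<gamma> * ?d powr (- ?\<gamma>)" .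
  have m: "(cmod \<kappa>) powr (-2) = cmod z powr (-1)"
   unfolding cz using nk by (simp add: powr_minus powr_numeral)
  let ?B = "C * ((cmod \<kappa>) powr (-2) * (cmod \<kappa> / Re \<kappa>) powr ?\<gamma>)"
  have B: "0 <= ?B" using C(1) by simp
  have "?B <= C * (cmod z powr (-1) * (3 powr ?\<gamma> * cmod z powr ?\<gamma> * ?d powr (- ?\<gamma>)))"
   unfolding m by (intro mult_left_mono r C(1)) simp
  also have "... = C * 3 powr ?\<gamma> * cmod z powr (- 1 + ?\<gamma>) * ?d powr (- ?\<gamma>)"
   unfolding powr_add by (simp only: mult_ac)
  finally have le: "?B <= C * 3 powr ?\<gamma> * cmod z powr (- 1 + ?\<gamma>) * ?d powr (- ?\<gamma>)" .
  note R = resolvent_bound[OF pq n2 k(2) B C(2)[OF k(2)]]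
  show ?thesis using R order_trans[OF R(2) ennreal_leI[OF le]] unfolding k(1) by blast
 qed
 then show ?thesis unfolding ex(3) by blast
qed

end
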